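(* Let $T>0$ and $u_0\in H^\gamma(\mathbb{T})$, $u_0\not\equiv0$. Let $u$ be the solution on $[0,T]$ of $$ i\partial_t u+\partial_{xx}u-|u|^2u=0,\quad x\in\mathbb{T},\qquad u(0,\cdot)=u_0, $$ and let $U^n$ be defined by $U^0=u_0$ and $U^{n+1}=\Psi(U^n)+G_1(U^n)+G_2(U^n)$, $n=0,1,\dots,\frac T\tau-1$, with $\Psi,G_1,G_2$ as defined below; $t_n=n\tau$. (a) If $\gamma>\frac32$, there exist $\tau_0,C>0$ depending only on $T$ and $\|u\|_{L^\infty((0,T);H^\gamma)}$ such that for all $0<\tau\le\tau_0$ and $n=0,1,\dots,\frac T\tau$, $$\|u(t_n,\cdot)-U^n\|_{H^\gamma}\le C\tau\qquad\text{and}\qquad |M(U^n)-M(u_0)|\le C\tau^5 .$$ (b) If $\gamma=1$, then for every $\epsilon>0$ there exist $\tau_0,C>0$ depending only on $\epsilon$, $T$ and $\|u\|_{L^\infty((0,T);H^1)}$ such that for all $0<\tau\le\tau_0$ and $n=0,1,\dots,\frac T\tau$, $$\|u(t_n,\cdot)-U^n\|_{H^1}\le C\tau^{\frac12-\epsilon}.$$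
   Context: $\mathbb{T}=\mathbb{R}/2\pi\mathbb{Z}$. Fourier coefficients: $\hat f_k=\frac1{2\pi}\int_{\mathbb{T}}e^{-ikx}f(x)\,dx$; $\|f\|_{H^s}^2=2\pi\sum_k(1+k^2)^s|\hat f_k|^2$. $\partial_x^{-1}$ is the Fourier multiplier $(ik)^{-1}$ for $k\ne0$ and $0$ for $k=0$; $\partial_x^{-2}=(\partial_x^{-1})^2$. $e^{it\partial_x^2}$ is the Fourier multiplier $e^{-itk^2}$. $\Pi_0(f)=\frac1{2\pi}\int_{\mathbb{T}}f\,dx$. Mass: $M(f)=\Pi_0(|f|^2)$. $M_0=M(u_0)$, $P_0=\Pi_0(u_0\,\partial_x\overline{u_0})$. The operator $e^{i\tau(-2M_0-2P_0\partial_x^{-1}+\partial_x^2)}$ is the Fourier multiplier $\exp(i\tau(-2M_0-2P_0 m_k-k^2))$ with $m_k=(ik)^{-1}$ for $k\ne0$, $m_0=0$. The map $\Psi$ is $$\Psi(u)=e^{i\tau(-2M_0-2P_0\partial_x^{-1}+\partial_x^2)}u-i\tau\,\Pi_0(|u|^2u)+2i\tau M_0\,\Pi_0(u)-\tfrac12\partial_x^{-2}\Big[\big(e^{-i\tau\partial_x^2}\bar u\big)\cdot e^{i\tau\partial_x^2}(u^2)\Big]+\tfrac12 e^{i\tau\partial_x^2}\partial_x^{-2}\big[|u|^2u\big]$$ $$\qquad+\partial_x^{-1}\Big[\big(e^{i\tau\partial_x^2}u\big)\cdot\partial_x^{-1}\big(|e^{i\tau\partial_x^2}u|^2\big)\Big]-e^{i\tau\partial_x^2}\partial_x^{-1}\Big[u\cdot\partial_x^{-1}\big(|u|^2\big)\Big].$$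 Further, $F(U)=\Psi(U)-e^{i\tau\partial_x^2}U$, $$H(U)=-M_0^{-1}\Big[\mathrm{Re}\,\Pi_0\big(F(U)\,\overline{e^{i\tau\partial_x^2}U}\big)+\tfrac12\Pi_0\big(|F(U)|^2\big)\Big],$$ $G_1(U)=H(U)\,e^{i\tau\partial_x^2}U$, and $$G_2(U)=-\tfrac12 H(U)^2e^{i\tau\partial_x^2}U-M_0^{-1}H(U)\,\mathrm{Re}\,\Pi_0\big(F(U)\,\overline{e^{i\tau\partial_x^2}U}\big)\,e^{i\tau\partial_x^2}U.$$ *)

theory Defs
  imports "HOL-Analysis.Analysis"
begin

text \<open>Functions on the torus T = R/2piZ are represented as 2pi-periodic functions
  real \<Rightarrow> complex.\<close>

definition periodic2pi :: "(real \<Rightarrow> complex) \<Rightarrow> bool" where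
  "periodic2pi f \<longleftrightarrow> (\<forall>x. f (x + 2 * pi) = f x)"

definition L2T :: "(real \<Rightarrow> complex) \<Rightarrow> bool" where
  "L2T f \<longleftrightarrow> periodic2pi f \<and> f absolutely_integrable_on {0..2*pi}
      \<and> (\<lambda>x. (cmod (f x))^2) integrable_on {0..2*pi}"

definition fc :: "(real \<Rightarrow> complex) \<Rightarrow> int \<Rightarrow> complex" where
  "fc f k = integral {0..2*pi} (\<lambda>x. cis (- (of_int k * x)) * f x) / of_real (2 * pi)"

definition Hs :: "real \<Rightarrow> (real \<Rightarrow> complex) \<Rightarrow> bool" where
  "Hs s f \<longleftrightarrow> L2T f \<and> (\<lambda>k::int. (1 + (of_int k)^2) powr s * (cmod (fc f k))^2) summable_on UNIV"

definition Hnorm :: "real \<Rightarrow> (real \<Rightarrow> complex) \<Rightarrow> real" where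
  "Hnorm s f = sqrt (2 * pi * infsum (\<lambda>k::int. (1 + (of_int k)^2) powr s * (cmod (fc f k))^2) UNIV)"

definition fmult :: "(int \<Rightarrow> complex) \<Rightarrow> (real \<Rightarrow> complex) \<Rightarrow> (real \<Rightarrow> complex)" where
  "fmult m f = (SOME g. L2T g \<and> (\<forall>k. fc g k = m k * fc f k))"

definition dinv_m :: "int \<Rightarrow> complex" where
  "dinv_m k = (if k = 0 then 0 else 1 / (\<i> * of_int k))"

definition dx :: "(real \<Rightarrow> complex) \<Rightarrow> (real \<Rightarrow> complex)" where
  "dx f = fmult (\<lambda>k. \<i> * of_int k) f"

definition dx_inv :: "(real \<Rightarrow> complex) \<Rightarrow> (real \<Rightarrow> complex)" where
  "dx_inv f = fmult dinv_m f"

definition dx_inv2 :: "(real \<Rightarrow> complex) \<Rightarrow> (real \<Rightarrow> complex)" where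
  "dx_inv2 f = dx_inv (dx_inv f)"

definition schr :: "real \<Rightarrow> (real \<Rightarrow> complex) \<Rightarrow> (real \<Rightarrow> complex)" where
  "schr t f = fmult (\<lambda>k. exp (- \<i> * of_real t * (of_int k)^2)) f"

definition Pi0 :: "(real \<Rightarrow> complex) \<Rightarrow> complex" where
  "Pi0 f = fc f 0"

definition cnjf :: "(real \<Rightarrow> complex) \<Rightarrow> (real \<Rightarrow> complex)" where
  "cnjf f = (\<lambda>x. cnj (f x))"

definition abs2 :: "(real \<Rightarrow> complex) \<Rightarrow> (real \<Rightarrow> complex)" where
  "abs2 f = (\<lambda>x. of_real ((cmod (f x))^2))"

definition mass :: "(real \<Rightarrow> complex) \<Rightarrow> real" where
  "mass f = Re (Pi0 (abs2 f))"

definition P0 :: "(real \<Rightarrow> complex) \<Rightarrow> complex" where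
  "P0 u0 = Pi0 (\<lambda>x. u0 x * dx (cnjf u0) x)"

definition Emain :: "(real \<Rightarrow> complex) \<Rightarrow> real \<Rightarrow> (real \<Rightarrow> complex) \<Rightarrow> (real \<Rightarrow> complex)" where
  "Emain u0 \<tau> f = fmult (\<lambda>k. exp (\<i> * of_real \<tau> *
       (- 2 * of_real (mass u0) - 2 * P0 u0 * dinv_m k - (of_int k)^2))) f"

definition Psi :: "(real \<Rightarrow> complex) \<Rightarrow> real \<Rightarrow> (real \<Rightarrow> complex) \<Rightarrow> (real \<Rightarrow> complex)" where
  "Psi u0 \<tau> u = (\<lambda>x.
       Emain u0 \<tau> u x
     - \<i> * of_real \<tau> * Pi0 (\<lambda>y. abs2 u y * u y)
     + 2 * \<i> * of_real \<tau> * of_real (mass u0) * Pi0 u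
     - 1/2 * dx_inv2 (\<lambda>y. schr (- \<tau>) (cnjf u) y * schr \<tau> (\<lambda>z. (u z)^2) y) x
     + 1/2 * schr \<tau> (dx_inv2 (\<lambda>y. abs2 u y * u y)) x
     + dx_inv (\<lambda>y. schr \<tau> u y * dx_inv (abs2 (schr \<tau> u)) y) x
     - schr \<tau> (dx_inv (\<lambda>y. u y * dx_inv (abs2 u) y)) x)"

definition Fop :: "(real \<Rightarrow> complex) \<Rightarrow> real \<Rightarrow> (real \<Rightarrow> complex) \<Rightarrow> (real \<Rightarrow> complex)" where
  "Fop u0 \<tau> U = (\<lambda>x. Psi u0 \<tau> U x - schr \<tau> U x)"

definition Hop :: "(real \<Rightarrow> complex) \<Rightarrow> real \<Rightarrow> (real \<Rightarrow> complex) \<Rightarrow> real" where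
  "Hop u0 \<tau> U = - (1 / mass u0) *
     (Re (Pi0 (\<lambda>x. Fop u0 \<tau> U x * cnj (schr \<tau> U x))) + 1/2 * Re (Pi0 (abs2 (Fop u0 \<tau> U))))"

definition G1 :: "(real \<Rightarrow> complex) \<Rightarrow> real \<Rightarrow> (real \<Rightarrow> complex) \<Rightarrow> (real \<Rightarrow> complex)" where
  "G1 u0 \<tau> U = (\<lambda>x. of_real (Hop u0 \<tau> U) * schr \<tau> U x)"

definition G2 :: "(real \<Rightarrow> complex) \<Rightarrow> real \<Rightarrow> (real \<Rightarrow> complex) \<Rightarrow> (real \<Rightarrow> complex)" where
  "G2 u0 \<tau> U = (\<lambda>x.
       - 1/2 * of_real ((Hop u0 \<tau> U)^2) * schr \<tau> U x
     - of_real ((1 / mass u0) * Hop u0 \<tau> U *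
          Re (Pi0 (\<lambda>y. Fop u0 \<tau> U y * cnj (schr \<tau> U y)))) * schr \<tau> U x)"

definition scheme :: "(real \<Rightarrow> complex) \<Rightarrow> real \<Rightarrow> nat \<Rightarrow> (real \<Rightarrow> complex)" where
  "scheme u0 \<tau> n = ((\<lambda>U x. Psi u0 \<tau> U x + G1 u0 \<tau> U x + G2 u0 \<tau> U x) ^^ n) u0"

text \<open>u : [0,T] \<rightarrow> H^gamma is a solution of i u_t + u_xx - |u|^2 u = 0 with u(0) = u0:
  u in C([0,T]; H^gamma), u(0) = u0 (as elements of L2, i.e. same Fourier coefficients),
  and the equation holds Fourier-mode-wise: i d/dt hat u_k - k^2 hat u_k - (|u|^2u)^_k = 0.\<close>
definition nls_sol :: "real \<Rightarrow> real \<Rightarrow> (real \<Rightarrow> complex) \<Rightarrow> (real \<Rightarrow> real \<Rightarrow> complex) \<Rightarrow> bool" where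
  "nls_sol \<gamma> T u0 u \<longleftrightarrow>
     (\<forall>t\<in>{0..T}. Hs \<gamma> (u t))
   \<and> (\<forall>k. fc (u 0) k = fc u0 k)
   \<and> (\<forall>t\<in>{0..T}. ((\<lambda>s. Hnorm \<gamma> (\<lambda>x. u s x - u t x)) \<longlongrightarrow> 0) (at t within {0..T}))
   \<and> (\<forall>k::int. \<forall>t\<in>{0..T}. \<exists>D.
        ((\<lambda>s. fc (u s) k) has_vector_derivative D) (at t within {0..T})
        \<and> \<i> * D - (of_int k)^2 * fc (u t) k - fc (\<lambda>x. abs2 (u t) x * u t x) k = 0)"

end

theory Submission
  imports Defs
begin

text \<open>
  Everything is done for the twisted Fourier coefficients \<open>v t k = cis (t k\<^sup>2) * fc (u t) k\<close>, for which the
  equation is a cubic convolution with phase \<open>phi = k\<^sup>2 + k\<^sub>1\<^sup>2 - k\<^sub>2\<^sup>2 - k\<^sub>3\<^sup>2 = 2 k k\<^sub>1 + 2 k\<^sub>2 k\<^sub>3\<close> and mass and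
  momentum are conserved. Symmetrising in \<open>k\<^sub>2, k\<^sub>3\<close> shows that one step of \<open>\<Psi>\<close> is the exact flow up to a
  cubic term with multiplier of size \<open>\<tau> (\<bar>k\<^sub>1\<bar> / \<bar>k\<bar>) min 1 (\<tau> \<bar>k\<^sub>2 k\<^sub>3\<bar>)\<close>. In \<open>H\<^sup>\<gamma>\<close> this is \<open>O(\<tau>\<^bsup>1 + \<theta>\<^esup>)\<close> pointwise
  in time, with \<open>\<theta> = 1\<close> for \<open>\<gamma> > 3/2\<close> and any \<open>\<theta> < 1/2\<close> for \<open>\<gamma> = 1\<close>.

  The correction \<open>G\<^sub>1 + G\<^sub>2\<close> contains \<open>M\<^sub>0\<^sup>-\<^sup>1\<close>, so uniform constants require \<open>L\<^sup>2\<close> bounds proportional to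
  \<open>sqrt M\<^sub>0\<close>. For \<open>\<bar>k\<^sub>1\<bar> \<le> 4 \<bar>k\<bar>\<close> they hold stepwise; for \<open>\<bar>k\<^sub>1\<bar> > 4 \<bar>k\<bar>\<close> they hold only after summation over the time
  steps, by summation by parts and a bilinear estimate for the exponential sums in \<open>j \<tau> phi\<close>. A discrete Gronwall
  argument then gives the error bound. For the mass, \<open>H\<close> cancels the defect of \<open>\<Psi>\<close> to first order and
  \<open>G\<^sub>2\<close> to second order; since \<open>H = O(\<tau>\<^sup>2)\<close>, the defect per step is \<open>O(\<tau>\<^sup>6)\<close>.
\<close>

section \<open>Weighted sequence norms\<close>

text \<open>Only an \<open>H^\<gamma>\<close> bound is given, so the mass may be arbitrarily small.
  In \<open>Ht\<close> a pairing of the local error with the solution is divided by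
  \<open>\<mu>\<^sup>2\<close>, and the solution supplies only one factor \<open>\<mu>\<close>; the
  error has to supply the other. An absolute trilinear estimate in \<open>L^2\<close> bounds one of
  the functions in a summable norm, which the mass does not control, and where
  \<open>4 * |k| < |k1|\<close> the other functions cannot in general absorb all derivatives while
  one of them stays in \<open>L^2\<close>. There the decay of the geometric sum in time pays for the
  summation over one frequency. Errors are therefore accumulated along the exact solution, which
  moves by \<open>O(\<tau>)\<close> per step, before they are estimated.

  The mass law gets its uniformity in another way, since it uses \<open>Ht\<close> at single times:
  interpolation gives \<open>|Ht| \<le> C * \<tau>\<^sup>2 / hh\<close> with
  \<open>hh\<^sup>3 = \<mu>\<^sup>2\<close>. The defect of one step is \<open>\<mu>\<^sup>2\<close>
  times a product of three quantities of that size, and the powers of the mass cancel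
  exactly.\<close>

definition jb :: "int \<Rightarrow> real" where
  "jb k = sqrt (1 + (real_of_int k)^2)"

lemma jb_ge1: "1 \<le> jb k"
  by (simp add: jb_def)

lemma jb_pos [simp]: "0 < jb k"
  using jb_ge1[of k] by linarith

lemma jb_nonneg [simp]: "0 \<le> jb k"
  using jb_pos[of k] by linarith

lemma jb_neq0 [simp]: "jb k \<noteq> 0"
  using jb_pos[of k] by linarith

lemma jb_minus [simp]: "jb (- k) = jb k"
  by (simp add: jb_def)

lemma jb_sq: "(jb k)^2 = 1 + (real_of_int k)^2"
  by (simp add: jb_def)

lemma abs_le_jb: "\<bar>real_of_int k\<bar> \<le> jb k"
  unfolding jb_def by (rule real_le_rsqrt) simp

lemma jb_le_abs: "k \<noteq> 0 \<Longrightarrow> jb k \<le> 2 * \<bar>real_of_int k\<bar>"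
proof -
  assume "k \<noteq> 0"
  then have "1 \<le> \<bar>real_of_int k\<bar>" by linarith
  then have "1 \<le> (real_of_int k)^2" by (metis one_le_power power2_abs)
  then show ?thesis unfolding jb_def
    by (intro real_le_lsqrt) (auto simp: power_mult_distrib)
qed

lemma jb_triangle: "jb (a + b) \<le> jb a + jb b"
proof -
  have "real_of_int a * real_of_int b \<le> jb a * jb b"
    using mult_mono[OF abs_le_jb[of a] abs_le_jb[of b]]
    by (simp add: abs_mult[symmetric])
  then have "(jb (a+b))^2 \<le> (jb a + jb b)^2"
    unfolding jb_sq power2_sum by (simp add: power2_sum)
  then show ?thesis by (rule power2_le_imp_le) simp
qed

lemma jb_triangle3: "jb k \<le> jb k1 + jb k2 + jb (k - k1 - k2)"
  using jb_triangle[of k1 "k - k1"] jb_triangle[of k2 "k - k1 - k2"] by simp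

lemma jb_powr_triangle3:
  assumes "0 \<le> s"
  shows "jb k powr s \<le> 3 powr s * (jb k1 powr s + jb k2 powr s + jb (k - k1 - k2) powr s)"
proof -
  define M where "M = max (jb k1) (max (jb k2) (jb (k - k1 - k2)))"
  have "jb k \<le> 3 * M" using jb_triangle3[of k k1 k2] by (auto simp: M_def)
  then have "jb k powr s \<le> (3 * M) powr s" using assms by (intro powr_mono2) auto
  also have "\<dots> = 3 powr s * M powr s" by (rule powr_mult)
  also have "M powr s \<le> jb k1 powr s + jb k2 powr s + jb (k - k1 - k2) powr s"
    by (auto simp: M_def max_def)
  finally show ?thesis by simp
qed

text \<open>Bounds on finite partial sums replace \<open>infsum\<close>: they assert summability
  together with its size, and no convergence side conditions arise. \<open>0 \<le> C\<close> is
  demanded because otherwise only \<open>C\<^sup>2\<close> would matter; for \<open>l1\<close> the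
  empty sum gives it.\<close>

definition l2 :: "('i \<Rightarrow> real) \<Rightarrow> real \<Rightarrow> bool" where
  "l2 f C \<longleftrightarrow> 0 \<le> C \<and> (\<forall>F. finite F \<longrightarrow> (\<Sum>x\<in>F. (f x)^2) \<le> C^2)"

definition l1 :: "('i \<Rightarrow> real) \<Rightarrow> real \<Rightarrow> bool" where
  "l1 f C \<longleftrightarrow> (\<forall>F. finite F \<longrightarrow> (\<Sum>x\<in>F. f x) \<le> C)"

lemma l1D: "l1 f C \<Longrightarrow> finite F \<Longrightarrow> sum f F \<le> C"
  by (simp add: l1_def)

lemma l2D: "l2 f C \<Longrightarrow> finite F \<Longrightarrow> (\<Sum>x\<in>F. (f x)^2) \<le> C^2"
  by (simp add: l2_def)

lemma l2_nonneg: "l2 f C \<Longrightarrow> 0 \<le> C"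
  by (simp add: l2_def)

lemma l1_nonneg: "l1 f C \<Longrightarrow> 0 \<le> C"
  using l1D[of f C "{}"] by simp

lemma l1_mono: "l1 f C \<Longrightarrow> (\<And>x. g x \<le> f x) \<Longrightarrow> C \<le> D \<Longrightarrow> l1 g D"
  unfolding l1_def by (meson order_trans sum_mono)

lemma l2_iff_L2_set: "l2 f C \<longleftrightarrow> (\<forall>F. finite F \<longrightarrow> L2_set f F \<le> C)"
proof
  assume l: "l2 f C"
  show "\<forall>F. finite F \<longrightarrow> L2_set f F \<le> C"
    using l unfolding l2_def L2_set_def by (auto intro: real_le_lsqrt sum_nonneg)
next
  assume l: "\<forall>F. finite F \<longrightarrow> L2_set f F \<le> C"
  then have "L2_set f {} \<le> C" by blast
  then have C: "0 \<le> C" by simp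
  show "l2 f C" unfolding l2_def
    using l C unfolding L2_set_def by (auto simp: sqrt_le_D)
qed

lemma l2_mono:
  assumes "l2 f C" "\<And>x. \<bar>g x\<bar> \<le> \<bar>f x\<bar>" "C \<le> D"
  shows "l2 g D"
proof -
  have C: "0 \<le> C" using assms(1) by (rule l2_nonneg)
  have "(\<Sum>x\<in>F. (g x)^2) \<le> D^2" if "finite F" for F
  proof -
    have "(\<Sum>x\<in>F. (g x)^2) \<le> (\<Sum>x\<in>F. (f x)^2)"
      using assms(2) by (intro sum_mono) (simp add: abs_le_square_iff)
    also have "\<dots> \<le> C^2" using l2D[OF assms(1) that] .
    also have "\<dots> \<le> D^2" using C assms(3) by (simp add: power_mono)
    finally show ?thesis .
  qed
  then show ?thesis using C assms(3) by (simp add: l2_def)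
qed

lemma l2_add:
  fixes f g :: "'a \<Rightarrow> real"
  assumes "l2 f C" "l2 g D"
  shows "l2 (\<lambda>x. f x + g x) (C + D)"
  unfolding l2_iff_L2_set
proof (intro allI impI)
  fix F :: "'a set" assume "finite F"
  then have "L2_set f F \<le> C" "L2_set g F \<le> D" using assms by (auto simp: l2_iff_L2_set)
  then show "L2_set (\<lambda>x. f x + g x) F \<le> C + D" using L2_set_triangle_ineq[of f g F] by linarith
qed

lemma l2_cmult:
  assumes "l2 f C"
  shows "l2 (\<lambda>x. c * f x) (\<bar>c\<bar> * C)"
proof -
  have "(\<Sum>x\<in>F. (c * f x)^2) \<le> (\<bar>c\<bar> * C)^2" if "finite F" for F
    using mult_left_mono[OF l2D[OF assms that], of "c^2"]
    by (simp add: power_mult_distrib sum_distrib_left)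
  then show ?thesis using l2_nonneg[OF assms] by (simp add: l2_def)
qed

lemma l2_indicator: "l2 (\<lambda>k. if k = j then 1 else (0::real)) 1"
proof -
  have "(\<Sum>x\<in>F. (if x = j then 1 else (0::real))^2) \<le> 1" if "finite F" for F
  proof -
    have "(\<Sum>x\<in>F. (if x = j then 1 else (0::real))^2) = (\<Sum>x\<in>F. (if x = j then 1 else (0::real)))"
      by (rule sum.cong) auto
    also have "\<dots> \<le> 1" using that by (simp add: sum.delta)
    finally show ?thesis .
  qed
  then show ?thesis by (simp add: l2_def)
qed

lemma sum_mult_le_l2:
  assumes "l2 f C" "l2 g D" "finite F"
  shows "(\<Sum>x\<in>F. \<bar>f x\<bar> * \<bar>g x\<bar>) \<le> C * D"
proof -
  have "(\<Sum>x\<in>F. \<bar>f x\<bar> * \<bar>g x\<bar>) \<le> L2_set f F * L2_set g F" by (rule L2_set_mult_ineq)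
  also have "\<dots> \<le> C * D"
    using assms by (intro mult_mono) (auto simp: l2_iff_L2_set L2_set_nonneg l2_nonneg[OF assms(1)])
  finally show ?thesis .
qed

lemma l1_mult_l2:
  assumes "l2 f C" "l2 g D"
  shows "l1 (\<lambda>x. \<bar>f x\<bar> * \<bar>g x\<bar>) (C * D)"
  using sum_mult_le_l2[OF assms] by (simp add: l1_def)

text \<open>The three coordinates determine the index, so \<open>F\<close> embeds in the product of
  its three projections; enlarging it to that product is harmless for nonnegative terms.\<close>

lemma sum_triple_le:
  fixes a b c :: "int \<Rightarrow> real"
  assumes F: "finite F" and inj: "inj_on (\<lambda>x. (p x, q x, r x)) F"
    and a: "l1 a P" and b: "l1 b Q" and c: "l1 c R"
    and nn: "\<And>x. 0 \<le> a x" "\<And>x. 0 \<le> b x" "\<And>x. 0 \<le> c x"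
  shows "(\<Sum>x\<in>F. a (p x) * (b (q x) * c (r x))) \<le> P * (Q * R)"
proof -
  have "(\<Sum>x\<in>F. a (p x) * (b (q x) * c (r x)))
      = (\<Sum>(x,y,z)\<in>(\<lambda>x. (p x, q x, r x)) ` F. a x * (b y * c z))"
    by (subst sum.reindex[OF inj]) simp
  also have "\<dots> \<le> (\<Sum>(x,y,z)\<in>p ` F \<times> q ` F \<times> r ` F. a x * (b y * c z))"
    using F nn by (intro sum_mono2) auto
  also have "\<dots> = sum a (p ` F) * (sum b (q ` F) * sum c (r ` F))"
    by (simp add: sum_product sum.cartesian_product split_def)
  also have "\<dots> \<le> P * (Q * R)"
    using F nn l1_nonneg[OF a] l1_nonneg[OF b]
    by (intro mult_mono l1D[OF a] l1D[OF b] l1D[OF c]) (auto intro!: sum_nonneg mult_nonneg_nonneg)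
  finally show ?thesis .
qed

lemma l2_imp_l1_sq: "l2 f C \<Longrightarrow> l1 (\<lambda>x. (f x)^2) (C^2)"
  by (simp add: l1_def l2_def)

text \<open>Young's convolution inequality in dual form. Cauchy-Schwarz is applied with the weight
  \<open>C * D\<close> shared by both factors; each squared factor is then a triple sum over
  coordinates that determine the index. For frequencies subject to one linear relation any three of
  the four determine the fourth.\<close>

lemma sum_quad_le:
  fixes A B C D :: "int \<Rightarrow> real"
  assumes F: "finite F"
    and i1: "inj_on (\<lambda>x. (p1 x, p3 x, p4 x)) F" and i2: "inj_on (\<lambda>x. (p2 x, p3 x, p4 x)) F"
    and A: "l2 A P" and B: "l2 B Q" and C: "l1 C R" and D: "l1 D S"
    and nn: "\<And>x. 0 \<le> A x" "\<And>x. 0 \<le> B x" "\<And>x. 0 \<le> C x" "\<And>x. 0 \<le> D x"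
  shows "(\<Sum>x\<in>F. A (p1 x) * B (p2 x) * C (p3 x) * D (p4 x)) \<le> P * Q * R * S"
proof -
  have RS: "0 \<le> R * S" "0 \<le> P" "0 \<le> Q" "0 \<le> R" "0 \<le> S"
    using l1_nonneg[OF C] l1_nonneg[OF D] l2_nonneg[OF A] l2_nonneg[OF B] by auto
  let ?f = "\<lambda>x. A (p1 x) * sqrt (C (p3 x) * D (p4 x))"
  let ?g = "\<lambda>x. B (p2 x) * sqrt (C (p3 x) * D (p4 x))"
  have "(\<Sum>x\<in>F. A (p1 x) * B (p2 x) * C (p3 x) * D (p4 x)) = (\<Sum>x\<in>F. \<bar>?f x\<bar> * \<bar>?g x\<bar>)"
  proof (rule sum.cong[OF refl])
    fix x
    have "sqrt (C (p3 x) * D (p4 x)) * sqrt (C (p3 x) * D (p4 x)) = C (p3 x) * D (p4 x)"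
      using nn by simp
    then show "A (p1 x) * B (p2 x) * C (p3 x) * D (p4 x) = \<bar>?f x\<bar> * \<bar>?g x\<bar>"
      using nn by (simp add: abs_mult algebra_simps del: real_sqrt_mult_self)
  qed
  also have "\<dots> \<le> L2_set ?f F * L2_set ?g F" by (rule L2_set_mult_ineq)
  also have "\<dots> \<le> sqrt (P^2 * (R * S)) * sqrt (Q^2 * (R * S))"
  proof (rule mult_mono)
    have "(\<Sum>x\<in>F. (?f x)^2) = (\<Sum>x\<in>F. (A (p1 x))^2 * (C (p3 x) * D (p4 x)))"
      using nn by (simp add: power_mult_distrib)
    also have "\<dots> \<le> P^2 * (R * S)"
      using sum_triple_le[OF F i1 l2_imp_l1_sq[OF A] C D] nn by simp
    finally show "L2_set ?f F \<le> sqrt (P^2 * (R * S))" by (simp add: L2_set_def)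
    have "(\<Sum>x\<in>F. (?g x)^2) = (\<Sum>x\<in>F. (B (p2 x))^2 * (C (p3 x) * D (p4 x)))"
      using nn by (simp add: power_mult_distrib)
    also have "\<dots> \<le> Q^2 * (R * S)"
      using sum_triple_le[OF F i2 l2_imp_l1_sq[OF B] C D] nn by simp
    finally show "L2_set ?g F \<le> sqrt (Q^2 * (R * S))" by (simp add: L2_set_def)
  qed (use RS in auto)
  also have "\<dots> = P * Q * (sqrt (R * S) * sqrt (R * S))"
    using RS by (simp add: real_sqrt_mult)
  also have "\<dots> = P * Q * R * S" using RS by simp
  finally show ?thesis .
qed

section \<open>Sobolev bounds for coefficient sequences and their embeddings\<close>

definition hb :: "real \<Rightarrow> (int \<Rightarrow> complex) \<Rightarrow> real \<Rightarrow> bool" where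
  "hb s a C \<longleftrightarrow> l2 (\<lambda>k. jb k powr s * cmod (a k)) C"

lemma hb_nonneg: "hb s a C \<Longrightarrow> 0 \<le> C"
  unfolding hb_def by (rule l2_nonneg)

lemma hb_mono: "hb s a C \<Longrightarrow> C \<le> D \<Longrightarrow> hb s a D"
  unfolding hb_def by (erule l2_mono) auto

lemma hb_dom:
  assumes "hb s a C" "\<And>k. cmod (b k) \<le> c * cmod (a k)" "0 \<le> c"
  shows "hb s b (c * C)"
  unfolding hb_def
proof (rule l2_mono)
  show "l2 (\<lambda>k. c * (jb k powr s * cmod (a k))) (\<bar>c\<bar> * C)"
    using assms(1) unfolding hb_def by (rule l2_cmult)
  show "\<bar>jb k powr s * cmod (b k)\<bar> \<le> \<bar>c * (jb k powr s * cmod (a k))\<bar>" for k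
    using mult_left_mono[OF assms(2)[of k], of "jb k powr s"] assms(3)
    by (simp add: abs_mult algebra_simps)
qed (use assms in auto)

lemma hb_cong_norm: "hb s a C \<Longrightarrow> (\<And>k. cmod (b k) = cmod (a k)) \<Longrightarrow> hb s b C"
  unfolding hb_def by simp

lemma hb_add: "hb s a C \<Longrightarrow> hb s b D \<Longrightarrow> hb s (\<lambda>k. a k + b k) (C + D)"
  unfolding hb_def
  by (rule l2_mono[OF l2_add[of "\<lambda>k. jb k powr s * cmod (a k)" C "\<lambda>k. jb k powr s * cmod (b k)" D]])
     (auto simp flip: distrib_left intro!: mult_left_mono norm_triangle_ineq)

lemma hb_minus: "hb s a C \<Longrightarrow> hb s (\<lambda>k. - a k) C"
  by (erule hb_cong_norm) simp

lemma hb_diff: "hb s a C \<Longrightarrow> hb s b D \<Longrightarrow> hb s (\<lambda>k. a k - b k) (C + D)"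
  using hb_add[OF _ hb_minus, of s a C b D] by simp

lemma hb_scale: "hb s a C \<Longrightarrow> hb s (\<lambda>k. c * a k) (cmod c * C)"
  by (erule hb_dom) (auto simp: norm_mult)

lemma hb_zero: "0 \<le> C \<Longrightarrow> hb s (\<lambda>k. 0) C"
  by (simp add: hb_def l2_def)

lemma hb_sum: "(\<And>j. j \<in> J \<Longrightarrow> hb s (a j) (C j)) \<Longrightarrow> hb s (\<lambda>k. \<Sum>j\<in>J. a j k) (\<Sum>j\<in>J. C j)"
proof (induction J rule: infinite_finite_induct)
  case (insert x F)
  then show ?case using hb_add[of s "a x" "C x" "\<lambda>k. \<Sum>j\<in>F. a j k" "sum C F"] by simp
qed (auto intro: hb_zero)

lemma hb_weaken:
  assumes "hb s a C" "r \<le> s"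
  shows "hb r a C"
  using assms(1) unfolding hb_def
proof (rule l2_mono)
  show "\<bar>jb k powr r * cmod (a k)\<bar> \<le> \<bar>jb k powr s * cmod (a k)\<bar>" for k
    using powr_mono[OF assms(2) jb_ge1[of k]] by (simp add: abs_mult mult_right_mono)
qed simp

lemma summable_jb_powr:
  assumes "\<delta> > 1/2"
  shows "(\<lambda>k. jb k powr (- 2 * \<delta>)) summable_on UNIV"
proof -
  have s: "summable (\<lambda>n. real n powr (- 2 * \<delta>))"
    using assms by (subst summable_real_powr_iff) auto
  have nat: "(\<lambda>n::nat. jb (int n) powr (- 2 * \<delta>)) summable_on UNIV"
  proof (subst summable_on_UNIV_nonneg_real_iff)
    show "summable (\<lambda>n::nat. jb (int n) powr (- 2 * \<delta>))"
    proof (rule summable_comparison_test_ev[OF _ s])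
      have "jb (int n) powr (- 2 * \<delta>) \<le> real n powr (- 2 * \<delta>)" if "n \<ge> 1" for n
        using abs_le_jb[of "int n"] that assms by (intro powr_mono2') auto
      then show "\<forall>\<^sub>F n in sequentially. norm (jb (int n) powr (- 2 * \<delta>)) \<le> real n powr (- 2 * \<delta>)"
        unfolding eventually_sequentially by auto
    qed
  qed auto
  have 1: "(\<lambda>k. jb k powr (- 2 * \<delta>)) summable_on (range int)"
    using nat by (subst summable_on_reindex) (auto simp: o_def)
  have 2: "(\<lambda>k. jb k powr (- 2 * \<delta>)) summable_on (range (\<lambda>n. - int n))"
    using nat by (subst summable_on_reindex) (auto simp: o_def inj_def)
  have "UNIV = range int \<union> range (\<lambda>n. - int n)"
  proof (intro equalityI subsetI)
    fix x :: int show "x \<in> range int \<union> range (\<lambda>n. - int n)"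
      by (cases x rule: int_cases2) auto
  qed auto
  then show ?thesis using summable_on_union[OF 1 2] by simp
qed

text \<open>The Cauchy-Schwarz constant of the embedding of \<open>H^\<delta>\<close> into
  absolutely convergent series. For \<open>\<delta> \<le> 1/2\<close> the series diverges and
  \<open>infsum\<close> returns \<open>0\<close>; this occurs in \<open>kap\<close> with
  \<open>emb_const (\<gamma> - 1)\<close> for \<open>\<gamma> = 1\<close>.\<close>

definition emb_const :: "real \<Rightarrow> real" where
  "emb_const \<delta> = sqrt (\<Sum>\<^sub>\<infinity>k. jb k powr (- 2 * \<delta>))"

lemma l2_jb_powr: "\<delta> > 1/2 \<Longrightarrow> l2 (\<lambda>k. jb k powr (- \<delta>)) (emb_const \<delta>)"
proof -
  assume d: "\<delta> > 1/2"
  have nn: "0 \<le> (\<Sum>\<^sub>\<infinity>k. jb k powr (- 2 * \<delta>))" by (rule infsum_nonneg) simp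
  have "(\<Sum>k\<in>F. (jb k powr (- \<delta>))^2) \<le> (emb_const \<delta>)^2" if "finite F" for F
  proof -
    have "(\<Sum>k\<in>F. (jb k powr (- \<delta>))^2) = (\<Sum>k\<in>F. jb k powr (- 2 * \<delta>))"
      by (intro sum.cong) (auto simp: power2_eq_square simp flip: powr_add)
    also have "\<dots> \<le> (\<Sum>\<^sub>\<infinity>k. jb k powr (- 2 * \<delta>))"
      using summable_jb_powr[OF d] that by (intro finite_sum_le_infsum) auto
    finally show ?thesis using nn by (simp add: emb_const_def)
  qed
  then show ?thesis using nn by (simp add: l2_def emb_const_def)
qed

lemma hb_imp_l1:
  assumes "hb s a C" "s - r > 1/2"
  shows "l1 (\<lambda>k. jb k powr r * cmod (a k)) (emb_const (s - r) * C)"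
proof -
  have "l1 (\<lambda>k. \<bar>jb k powr (- (s - r))\<bar> * \<bar>jb k powr s * cmod (a k)\<bar>) (emb_const (s - r) * C)"
    using l2_jb_powr[OF assms(2)] assms(1) unfolding hb_def by (rule l1_mult_l2)
  moreover have eq: "\<bar>jb k powr (- (s - r))\<bar> * \<bar>jb k powr s * cmod (a k)\<bar> = jb k powr r * cmod (a k)" for k
    by (simp add: abs_mult mult.assoc[symmetric] flip: powr_add)
  ultimately show ?thesis by (simp only: eq)
qed

lemma l1_div_jb:
  assumes "l2 w P" "\<And>k. 0 \<le> w k"
  shows "l1 (\<lambda>k. w k / jb k) (emb_const 1 * P)"
proof -
  have "l1 (\<lambda>k. \<bar>jb k powr (- 1)\<bar> * \<bar>w k\<bar>) (emb_const 1 * P)"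
    using l2_jb_powr[of 1] assms(1) by (intro l1_mult_l2) auto
  moreover have eq: "\<bar>jb k powr (- 1)\<bar> * \<bar>w k\<bar> = w k / jb k" for k
    using assms(2)[of k] by (simp add: powr_minus field_simps)
  ultimately show ?thesis by (simp only: eq)
qed

text \<open>These are the coefficients of the complex conjugate of a function with coefficients
  \<open>a\<close>, see \<open>fc_cnjf\<close>.\<close>

definition rv :: "(int \<Rightarrow> complex) \<Rightarrow> int \<Rightarrow> complex" where
  "rv a k = cnj (a (- k))"

lemma hb_rv:
  assumes "hb s a C"
  shows "hb s (rv a) C"
proof -
  have "(\<Sum>k\<in>F. (jb k powr s * cmod (rv a k))^2) \<le> C^2" if "finite F" for F
  proof -
    have "(\<Sum>k\<in>F. (jb k powr s * cmod (rv a k))^2) = (\<Sum>k\<in>uminus ` F. (jb k powr s * cmod (a k))^2)"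
      by (subst sum.reindex) (auto simp: rv_def)
    also have "\<dots> \<le> C^2" using assms that unfolding hb_def by (intro l2D) auto
    finally show ?thesis .
  qed
  then show ?thesis using hb_nonneg[OF assms] by (simp add: hb_def l2_def)
qed

section \<open>Trilinear Fourier multipliers\<close>

text \<open>The frequencies of the three factors are \<open>k1\<close>, \<open>k2\<close> and
  \<open>k - k1 - k2\<close>. Summation over pairs at once, instead of two iterated series, makes
  bijections of the frequency lattice available for reindexing.\<close>

definition trt :: "(int \<Rightarrow> int \<Rightarrow> int \<Rightarrow> complex) \<Rightarrow> (int \<Rightarrow> complex) \<Rightarrow> (int \<Rightarrow> complex) \<Rightarrow>
    (int \<Rightarrow> complex) \<Rightarrow> int \<Rightarrow> int \<times> int \<Rightarrow> complex" where
  "trt m a b c k = (\<lambda>(k1, k2). m k k1 k2 * a k1 * b k2 * c (k - k1 - k2))"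

definition tri :: "(int \<Rightarrow> int \<Rightarrow> int \<Rightarrow> complex) \<Rightarrow> (int \<Rightarrow> complex) \<Rightarrow> (int \<Rightarrow> complex) \<Rightarrow>
    (int \<Rightarrow> complex) \<Rightarrow> int \<Rightarrow> complex" where
  "tri m a b c k = infsum (trt m a b c k) UNIV"

lemma l1_imp_abs_summable:
  assumes "l1 (\<lambda>x. cmod (f x)) C"
  shows "(\<lambda>x. cmod (f x)) summable_on UNIV" "f summable_on UNIV" "cmod (infsum f UNIV) \<le> C"
proof -
  show s: "(\<lambda>x. cmod (f x)) summable_on UNIV"
    using assms unfolding l1_def
    by (intro nonneg_bdd_above_summable_on) (auto simp: bdd_above_def)
  then show "f summable_on UNIV" by (rule abs_summable_summable)
  have "cmod (infsum f UNIV) \<le> infsum (\<lambda>x. cmod (f x)) UNIV" by (rule norm_infsum_bound[OF s])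
  also have "\<dots> \<le> C" using s assms by (intro infsum_le_finite_sums) (auto simp: l1_def)
  finally show "cmod (infsum f UNIV) \<le> C" .
qed

lemma has_sum_sum:
  fixes f :: "'j \<Rightarrow> 'i \<Rightarrow> 'a :: topological_comm_monoid_add"
  assumes "\<And>j. j \<in> J \<Longrightarrow> (f j has_sum s j) A"
  shows "((\<lambda>x. \<Sum>j\<in>J. f j x) has_sum (\<Sum>j\<in>J. s j)) A"
  using assms by (induction J rule: infinite_finite_induct) (auto intro: has_sum_add)

text \<open>Duality with absolute values inside: the hypothesis tests the form against nonnegative
  \<open>w\<close> in the unit ball of \<open>l2\<close>, over finite sets of triples only. The
  indicator of one frequency yields absolute convergence at that frequency, and \<open>w\<close>
  proportional to the output on a finite set \<open>K\<close> yields the norm bound.\<close>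

lemma tri_bound:
  assumes C: "0 \<le> C"
    and H: "\<And>F w. finite F \<Longrightarrow> (\<And>k. 0 \<le> w k) \<Longrightarrow> l2 w 1 \<Longrightarrow>
      (\<Sum>(k,p)\<in>F. w k * (jb k powr s * cmod (trt m a b c k p))) \<le> C"
  shows tri_bound_summable: "(\<lambda>p. cmod (trt m a b c k p)) summable_on UNIV"
    and tri_bound_hb: "hb s (tri m a b c) C"
proof -
  have l1: "l1 (\<lambda>p. cmod (trt m a b c k p)) (C / jb k powr s)" for k
    unfolding l1_def
  proof (intro allI impI)
    fix G :: "(int \<times> int) set" assume G: "finite G"
    have "jb k powr s * (\<Sum>p\<in>G. cmod (trt m a b c k p))
       = (\<Sum>(j,p)\<in>{k} \<times> G. (if j = k then 1 else 0) * (jb j powr s * cmod (trt m a b c j p)))"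
      using G by (subst sum.cartesian_product[symmetric]) (simp add: sum_distrib_left)
    also have "\<dots> \<le> C" using G by (intro H l2_indicator) auto
    finally show "(\<Sum>p\<in>G. cmod (trt m a b c k p)) \<le> C / jb k powr s"
      by (subst pos_le_divide_eq) (auto simp: mult.commute)
  qed
  show s: "(\<lambda>p. cmod (trt m a b c k p)) summable_on UNIV" for k using l1_imp_abs_summable(1)[OF l1] .
  have main: "L2_set (\<lambda>k. jb k powr s * cmod (tri m a b c k)) K \<le> C" if K: "finite K" for K
  proof (cases "L2_set (\<lambda>k. jb k powr s * cmod (tri m a b c k)) K = 0")
    case True then show ?thesis using C by simp
  next
    case False
    define L where "L = L2_set (\<lambda>k. jb k powr s * cmod (tri m a b c k)) K"
    have L: "L > 0" using False L2_set_nonneg[of "\<lambda>k. jb k powr s * cmod (tri m a b c k)" K]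
      unfolding L_def by linarith
    have LL: "L^2 = (\<Sum>k\<in>K. (jb k powr s * cmod (tri m a b c k))^2)"
      unfolding L_def L2_set_def by (simp add: sum_nonneg)
    define w where "w k = (if k \<in> K then jb k powr s * cmod (tri m a b c k) / L else 0)" for k
    have w0: "0 \<le> w k" for k using L by (simp add: w_def)
    have "(\<Sum>k\<in>F. (w k)^2) \<le> 1" if F: "finite F" for F
    proof -
      have "(\<Sum>k\<in>F. (w k)^2) = (\<Sum>k\<in>F \<inter> K. (w k)^2)"
        using F by (intro sum.mono_neutral_right) (auto simp: w_def)
      also have "\<dots> \<le> (\<Sum>k\<in>K. (w k)^2)" using K by (intro sum_mono2) auto
      also have "\<dots> = (\<Sum>k\<in>K. (jb k powr s * cmod (tri m a b c k))^2) / L^2"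
        by (simp add: w_def sum_divide_distrib power_divide)
      also have "\<dots> = 1" unfolding LL[symmetric] using L by simp
      finally show ?thesis .
    qed
    then have w1: "l2 w 1" by (simp add: l2_def)
    define g where "g p = (\<Sum>k\<in>K. w k * (jb k powr s * cmod (trt m a b c k p)))" for p
    have gs: "(\<lambda>p. w k * (jb k powr s * cmod (trt m a b c k p))) summable_on UNIV" for k
      using s[of k] by (intro summable_on_cmult_right) auto
    have "L = (\<Sum>k\<in>K. w k * (jb k powr s * cmod (tri m a b c k)))"
    proof -
      have "(\<Sum>k\<in>K. w k * (jb k powr s * cmod (tri m a b c k))) = L^2 / L"
        unfolding LL by (simp add: w_def sum_divide_distrib power2_eq_square)
      then show ?thesis using L by (simp add: power2_eq_square)
    qed
    also have "\<dots> \<le> (\<Sum>k\<in>K. infsum (\<lambda>p. w k * (jb k powr s * cmod (trt m a b c k p))) UNIV)"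
    proof (rule sum_mono)
      fix k
      have "cmod (tri m a b c k) \<le> infsum (\<lambda>p. cmod (trt m a b c k p)) UNIV"
        unfolding tri_def by (rule norm_infsum_bound[OF s])
      then have "w k * (jb k powr s * cmod (tri m a b c k))
          \<le> w k * (jb k powr s * infsum (\<lambda>p. cmod (trt m a b c k p)) UNIV)"
        using w0 by (intro mult_left_mono) auto
      also have "\<dots> = infsum (\<lambda>p. w k * (jb k powr s * cmod (trt m a b c k p))) UNIV"
        by (simp add: infsum_cmult_right')
      finally show "w k * (jb k powr s * cmod (tri m a b c k))
          \<le> infsum (\<lambda>p. w k * (jb k powr s * cmod (trt m a b c k p))) UNIV" .
    qed
    also have "\<dots> = infsum g UNIV"
      unfolding g_def by (rule infsumI[symmetric], rule has_sum_sum) (use gs in auto)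
    also have "\<dots> \<le> C"
    proof (rule infsum_le_finite_sums)
      show "g summable_on UNIV"
        unfolding g_def by (rule has_sum_imp_summable, rule has_sum_sum, rule has_sum_infsum) (rule gs)
      fix G :: "(int \<times> int) set" assume G: "finite G"
      have "sum g G = (\<Sum>(k,p)\<in>K \<times> G. w k * (jb k powr s * cmod (trt m a b c k p)))"
        unfolding g_def by (subst sum.swap) (simp add: sum.cartesian_product)
      also have "\<dots> \<le> C" using G K w0 w1 by (intro H) auto
      finally show "sum g G \<le> C" .
    qed
    finally show ?thesis by (simp add: L_def)
  qed
  then show "hb s (tri m a b c) C" unfolding hb_def l2_iff_L2_set by blast
qed

lemma emb_const_nonneg: "0 \<le> emb_const \<delta>"
  unfolding emb_const_def by (intro real_sqrt_ge_zero infsum_nonneg) simp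

text \<open>\<open>\<theta>\<close> is the order of convergence. In both cases
  \<open>\<gamma> - \<theta> > 1/2\<close>, so coefficients with weight
  \<open>jb k powr \<theta>\<close> are absolutely summable (\<open>embt\<close>); the case
  \<open>\<gamma> > 3/2\<close> allows a full derivative in that norm (\<open>emb1\<close>).\<close>

locale adm =
  fixes \<gamma> \<theta> :: real
  assumes adm: "(\<gamma> = 1 \<and> 0 < \<theta> \<and> \<theta> < 1/2) \<or> (\<gamma> > 3/2 \<and> \<theta> = 1)"
begin

definition kap :: real where
  "kap = 1 + emb_const \<gamma> + emb_const (\<gamma> - \<theta>) + emb_const 1 + emb_const (\<gamma> - 1) + 3 powr \<gamma>"

lemma kap_ge: "1 \<le> kap" "emb_const \<gamma> \<le> kap" "emb_const (\<gamma> - \<theta>) \<le> kap" "emb_const 1 \<le> kap"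
    "emb_const (\<gamma> - 1) \<le> kap" "3 powr \<gamma> \<le> kap"
  unfolding kap_def
  using emb_const_nonneg[of \<gamma>] emb_const_nonneg[of "\<gamma> - \<theta>"] emb_const_nonneg[of 1]
    emb_const_nonneg[of "\<gamma> - 1"] powr_ge_zero[of 3 \<gamma>]
  by linarith+

lemma gamma_ge1: "1 \<le> \<gamma>" and theta_pos: "0 < \<theta>" and theta_le1: "\<theta> \<le> 1"
  using adm by auto

lemma kap_pos: "0 < kap"
  using kap_ge(1) by linarith

lemma emb0: "hb \<gamma> a C \<Longrightarrow> l1 (\<lambda>k. cmod (a k)) (kap * C)"
  using hb_imp_l1[of \<gamma> a C 0] gamma_ge1 mult_right_mono[OF kap_ge(2) hb_nonneg]
  by (auto intro: l1_mono)

lemma embt: "hb \<gamma> a C \<Longrightarrow> l1 (\<lambda>k. jb k powr \<theta> * cmod (a k)) (kap * C)"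
proof -
  assume a: "hb \<gamma> a C"
  have "\<gamma> - \<theta> > 1/2" using adm by auto
  then show ?thesis using hb_imp_l1[OF a, of \<theta>] mult_right_mono[OF kap_ge(3) hb_nonneg[OF a]]
    by (auto intro: l1_mono)
qed

lemma emb1: "\<gamma> > 3/2 \<Longrightarrow> hb \<gamma> a C \<Longrightarrow> l1 (\<lambda>k. jb k * cmod (a k)) (kap * C)"
  using hb_imp_l1[of \<gamma> a C 1] mult_right_mono[OF kap_ge(5) hb_nonneg]
  by (auto intro: l1_mono)

lemma hb_l2_gamma: "hb \<gamma> a C \<Longrightarrow> l2 (\<lambda>k. jb k powr \<gamma> * cmod (a k)) C"
  by (simp add: hb_def)

lemma hb_l2_one: "hb 1 a C \<Longrightarrow> l2 (\<lambda>k. jb k * cmod (a k)) C"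
  by (simp add: hb_def)

lemma hb_gamma_one: "hb \<gamma> a C \<Longrightarrow> hb 1 a C"
  by (rule hb_weaken[OF _ gamma_ge1])

lemma hb_l2_zero: "hb 0 a C \<Longrightarrow> l2 (\<lambda>k. cmod (a k)) C"
  by (simp add: hb_def)

lemma w_div_jb: "l2 w 1 \<Longrightarrow> (\<And>k. 0 \<le> w k) \<Longrightarrow> l1 (\<lambda>k. w k / jb k) kap"
  using l1_div_jb[of w 1] kap_ge(4) by (auto intro: l1_mono)

text \<open>Dual form of an \<open>H^\<gamma>\<close> bound in which one derivative on the output
  pays for one on the first factor, with \<open>\<theta>\<close> derivatives on each of the others.
  For \<open>\<gamma> = 1\<close> the factor \<open>jb powr (\<gamma> - 1)\<close> is
  \<open>1\<close> and \<open>sum_quad_le\<close> applies. For \<open>\<gamma> > 3/2\<close> the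
  remaining \<open>\<gamma> - 1\<close> derivatives of the output are moved to one of the three
  factors, which then sits in \<open>H^\<gamma>\<close>, while the other two are summable with one
  derivative.\<close>

lemma gamma_form:
  assumes F: "finite F" and rel: "\<And>x. x \<in> F \<Longrightarrow> p0 x = p1 x + p2 x + p3 x"
    and inj: "inj_on (\<lambda>x. (p1 x, p2 x, p3 x)) F"
    and w: "\<And>k. 0 \<le> w k" "l2 w 1" and abc: "hb \<gamma> a P" "hb \<gamma> b Q" "hb \<gamma> c R"
  shows "(\<Sum>x\<in>F. w (p0 x) * (jb (p0 x) powr (\<gamma> - 1) * (jb (p1 x) * cmod (a (p1 x)))
      * (jb (p2 x) powr \<theta> * cmod (b (p2 x))) * (jb (p3 x) powr \<theta> * cmod (c (p3 x))))) \<le> 3 * kap^3 * (P * Q * R)"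
proof -
  have nn: "0 \<le> P" "0 \<le> Q" "0 \<le> R" using abc hb_nonneg by auto
  have k: "1 \<le> kap" by (rule kap_ge)
  have i: "inj_on (\<lambda>x. (p0 x, p2 x, p3 x)) F" "inj_on (\<lambda>x. (p1 x, p2 x, p3 x)) F"
    "inj_on (\<lambda>x. (p0 x, p1 x, p3 x)) F" "inj_on (\<lambda>x. (p2 x, p1 x, p3 x)) F"
    "inj_on (\<lambda>x. (p0 x, p1 x, p2 x)) F" "inj_on (\<lambda>x. (p3 x, p1 x, p2 x)) F"
    using inj rel by (auto simp: inj_on_def)
  consider (1) "\<gamma> = 1" | (2) "\<gamma> > 3/2" "\<theta> = 1" using adm by auto
  then show ?thesis
  proof cases
    case 1
    have "(\<Sum>x\<in>F. w (p0 x) * (jb (p0 x) powr (\<gamma> - 1) * (jb (p1 x) * cmod (a (p1 x)))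
      * (jb (p2 x) powr \<theta> * cmod (b (p2 x))) * (jb (p3 x) powr \<theta> * cmod (c (p3 x)))))
      = (\<Sum>x\<in>F. w (p0 x) * (jb (p1 x) * cmod (a (p1 x)))
      * (jb (p2 x) powr \<theta> * cmod (b (p2 x))) * (jb (p3 x) powr \<theta> * cmod (c (p3 x))))"
      using 1 by (intro sum.cong) (auto simp: mult.assoc)
    also have "\<dots> \<le> 1 * P * (kap * Q) * (kap * R)"
      using w abc by (intro sum_quad_le[OF F i(1,2)] embt hb_l2_one hb_gamma_one) auto
    also have "\<dots> = kap^2 * (P * Q * R)" by (simp add: power2_eq_square)
    also have "\<dots> \<le> 3 * kap^3 * (P * Q * R)"
    proof (rule mult_right_mono)
      show "kap^2 \<le> 3 * kap^3" using k power_increasing[of 2 3 kap] zero_le_power[of kap 3] by linarith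
    qed (use nn in auto)
    finally show ?thesis .
  next
    case 2
    let ?A = "\<lambda>x. jb (p1 x) * cmod (a (p1 x))" and ?B = "\<lambda>x. jb (p2 x) * cmod (b (p2 x))"
      and ?C = "\<lambda>x. jb (p3 x) * cmod (c (p3 x))"
    let ?A' = "\<lambda>x. jb (p1 x) powr \<gamma> * cmod (a (p1 x))" and ?B' = "\<lambda>x. jb (p2 x) powr \<gamma> * cmod (b (p2 x))"
      and ?C' = "\<lambda>x. jb (p3 x) powr \<gamma> * cmod (c (p3 x))"
    have pw: "jb j powr (\<gamma> - 1) * jb j = jb j powr \<gamma>" for j
      by (simp add: powr_diff)
    have "(\<Sum>x\<in>F. w (p0 x) * (jb (p0 x) powr (\<gamma> - 1) * (jb (p1 x) * cmod (a (p1 x)))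
      * (jb (p2 x) powr \<theta> * cmod (b (p2 x))) * (jb (p3 x) powr \<theta> * cmod (c (p3 x)))))
      \<le> (\<Sum>x\<in>F. kap * (w (p0 x) * ?A' x * ?B x * ?C x + w (p0 x) * ?B' x * ?A x * ?C x + w (p0 x) * ?C' x * ?A x * ?B x))"
    proof (rule sum_mono)
      fix x assume x: "x \<in> F"
      have "jb (p0 x) powr (\<gamma> - 1) \<le> 3 powr (\<gamma> - 1) * (jb (p1 x) powr (\<gamma> - 1) + jb (p2 x) powr (\<gamma> - 1) + jb (p3 x) powr (\<gamma> - 1))"
        using jb_powr_triangle3[of "\<gamma> - 1" "p0 x" "p1 x" "p2 x"] rel[OF x] gamma_ge1 by simp
      also have "\<dots> \<le> kap * (jb (p1 x) powr (\<gamma> - 1) + jb (p2 x) powr (\<gamma> - 1) + jb (p3 x) powr (\<gamma> - 1))"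
      proof (rule mult_right_mono)
        have "3 powr (\<gamma> - 1) \<le> 3 powr \<gamma>" by (intro powr_mono) auto
        then show "3 powr (\<gamma> - 1) \<le> kap" using kap_ge(6) by linarith
      qed auto
      finally have "jb (p0 x) powr (\<gamma> - 1) * (w (p0 x) * ?A x * ?B x * ?C x) \<le>
         kap * (jb (p1 x) powr (\<gamma> - 1) + jb (p2 x) powr (\<gamma> - 1) + jb (p3 x) powr (\<gamma> - 1)) * (w (p0 x) * ?A x * ?B x * ?C x)"
        using w by (intro mult_right_mono) auto
      also have "\<dots> = kap * (w (p0 x) * ?A' x * ?B x * ?C x + w (p0 x) * ?B' x * ?A x * ?C x + w (p0 x) * ?C' x * ?A x * ?B x)"
        unfolding pw[symmetric] by (simp add: algebra_simps)
      finally show "w (p0 x) * (jb (p0 x) powr (\<gamma> - 1) * (jb (p1 x) * cmod (a (p1 x)))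
        * (jb (p2 x) powr \<theta> * cmod (b (p2 x))) * (jb (p3 x) powr \<theta> * cmod (c (p3 x)))) \<le>
        kap * (w (p0 x) * ?A' x * ?B x * ?C x + w (p0 x) * ?B' x * ?A x * ?C x + w (p0 x) * ?C' x * ?A x * ?B x)"
        using 2 by (simp add: algebra_simps)
    qed
    also have "\<dots> = kap * ((\<Sum>x\<in>F. w (p0 x) * ?A' x * ?B x * ?C x) + (\<Sum>x\<in>F. w (p0 x) * ?B' x * ?A x * ?C x)
       + (\<Sum>x\<in>F. w (p0 x) * ?C' x * ?A x * ?B x))"
      by (simp only: sum.distrib sum_distrib_left distrib_left)
    also have "\<dots> \<le> kap * (1 * P * (kap * Q) * (kap * R) + 1 * Q * (kap * P) * (kap * R) + 1 * R * (kap * P) * (kap * Q))"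
      using w abc k 2
      by (intro mult_left_mono add_mono sum_quad_le[OF F i(1,2)] sum_quad_le[OF F i(3,4)] sum_quad_le[OF F i(5,6)] emb1 hb_l2_gamma) auto
    also have "\<dots> = 3 * kap^3 * (P * Q * R)" by (simp add: power3_eq_cube algebra_simps)
    finally show ?thesis .
  qed
qed

text \<open>Division by \<open>jb\<close> makes the test function summable, so it takes one of the
  two \<open>l1\<close> places, and only one of the three factors must be summable.\<close>

lemma zero_form:
  assumes F: "finite F" and rel: "\<And>x. x \<in> F \<Longrightarrow> p0 x = p1 x + p2 x + p3 x"
    and inj: "inj_on (\<lambda>x. (p1 x, p2 x, p3 x)) F"
    and w: "\<And>k. 0 \<le> w k" "l2 w 1" and A: "l2 A P" "\<And>k. 0 \<le> A k" and B: "l2 B Q" "\<And>k. 0 \<le> B k"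
    and C: "l1 C R" "\<And>k. 0 \<le> C k"
  shows "(\<Sum>x\<in>F. w (p0 x) / jb (p0 x) * A (p1 x) * B (p2 x) * C (p3 x)) \<le> kap * (P * Q * R)"
proof -
  have i: "inj_on (\<lambda>x. (p1 x, p0 x, p3 x)) F" "inj_on (\<lambda>x. (p2 x, p0 x, p3 x)) F"
    using inj rel by (auto simp: inj_on_def)
  have "(\<Sum>x\<in>F. A (p1 x) * B (p2 x) * (w (p0 x) / jb (p0 x)) * C (p3 x)) \<le> P * Q * kap * R"
    using w A B C by (intro sum_quad_le[OF F i, where C = "\<lambda>k. w k / jb k"] w_div_jb) auto
  then show ?thesis by (simp add: algebra_simps)
qed

lemma triple_inj: "inj_on (\<lambda>x. (fst (snd x), snd (snd x), fst x - fst (snd x) - snd (snd x))) (F :: (int \<times> int \<times> int) set)"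
  by (auto simp: inj_on_def)

lemma triple_inj':
  "inj_on (\<lambda>x. (snd (snd x), fst (snd x), fst x - fst (snd x) - snd (snd x))) (F :: (int \<times> int \<times> int) set)"
  "inj_on (\<lambda>x. (fst x - fst (snd x) - snd (snd x), snd (snd x), fst (snd x))) (F :: (int \<times> int \<times> int) set)"
  "inj_on (\<lambda>x. (fst x, snd (snd x), fst x - fst (snd x) - snd (snd x))) (F :: (int \<times> int \<times> int) set)"
  by (auto simp: inj_on_def)

abbreviation "q1 \<equiv> \<lambda>x::int \<times> int \<times> int. fst (snd x)"
abbreviation "q2 \<equiv> \<lambda>x::int \<times> int \<times> int. snd (snd x)"
abbreviation "q3 \<equiv> \<lambda>x::int \<times> int \<times> int. fst x - fst (snd x) - snd (snd x)"

lemma tri_hard: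
  assumes m: "\<And>k k1 k2. cmod (m k k1 k2) * jb k \<le> A * (jb k1 * jb k2 powr \<theta> * jb (k - k1 - k2) powr \<theta>)"
    and A: "0 \<le> A" and abc: "hb \<gamma> a P" "hb \<gamma> b Q" "hb \<gamma> c R"
  shows "hb \<gamma> (tri m a b c) (A * (3 * kap^3 * (P * Q * R)))"
    and "(\<lambda>p. cmod (trt m a b c k p)) summable_on UNIV"
proof -
  have nn: "0 \<le> P" "0 \<le> Q" "0 \<le> R" using abc hb_nonneg by auto
  have C: "0 \<le> A * (3 * kap^3 * (P * Q * R))" using nn kap_pos A by simp
  have H: "(\<Sum>(k,p)\<in>F. w k * (jb k powr \<gamma> * cmod (trt m a b c k p))) \<le> A * (3 * kap^3 * (P * Q * R))"
    if F: "finite F" and w: "\<And>k. 0 \<le> w k" "l2 w 1" for F w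
  proof -
    have "(\<Sum>(k,p)\<in>F. w k * (jb k powr \<gamma> * cmod (trt m a b c k p)))
      \<le> (\<Sum>x\<in>F. A * (w (fst x) * (jb (fst x) powr (\<gamma> - 1) * (jb (q1 x) * cmod (a (q1 x)))
      * (jb (q2 x) powr \<theta> * cmod (b (q2 x))) * (jb (q3 x) powr \<theta> * cmod (c (q3 x))))))"
    proof (rule sum_mono, clarify)
      fix k k1 k2
      have pw: "jb k powr \<gamma> = jb k powr (\<gamma> - 1) * jb k"
        by (simp add: powr_diff)
      show "w k * (jb k powr \<gamma> * cmod (trt m a b c k (k1, k2))) \<le> A * (w (fst (k,k1,k2)) * (jb (fst (k,k1,k2)) powr (\<gamma> - 1) * (jb (q1 (k,k1,k2)) * cmod (a (q1 (k,k1,k2))))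
      * (jb (q2 (k,k1,k2)) powr \<theta> * cmod (b (q2 (k,k1,k2)))) * (jb (q3 (k,k1,k2)) powr \<theta> * cmod (c (q3 (k,k1,k2))))))"
        using mult_left_mono[OF m[of k k1 k2], of "w k * jb k powr (\<gamma> - 1) * cmod (a k1) * cmod (b k2) * cmod (c (k - k1 - k2))"] w(1)
        unfolding pw by (simp add: trt_def norm_mult algebra_simps)
    qed
    also have "\<dots> \<le> A * (3 * kap^3 * (P * Q * R))"
      using mult_left_mono[OF gamma_form[where ?p0.0 = fst and ?p1.0 = q1 and ?p2.0 = q2 and ?p3.0 = q3, OF F _ triple_inj w abc] A]
      by (simp add: sum_distrib_left)
    finally show ?thesis .
  qed
  show "hb \<gamma> (tri m a b c) (A * (3 * kap^3 * (P * Q * R)))"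
    by (rule tri_bound_hb[OF C], rule H)
  show "(\<lambda>p. cmod (trt m a b c k p)) summable_on UNIV"
    by (rule tri_bound_summable[OF C], rule H)
qed

text \<open>The second bound is relative to \<open>\<mu>\<close>, the square root of the mass. It absorbs the factor
  \<open>M\<^sub>0\<^sup>-\<^sup>1\<close> in \<open>H\<close>, so that no constant degenerates as the mass tends to \<open>0\<close>.\<close>
definition yb :: "real \<Rightarrow> (int \<Rightarrow> complex) \<Rightarrow> real \<Rightarrow> bool" where
  "yb \<mu> a C \<longleftrightarrow> hb \<gamma> a C \<and> hb 0 a (C * \<mu>)"

lemma yb_gamma: "yb \<mu> a C \<Longrightarrow> hb \<gamma> a C" and yb_zero: "yb \<mu> a C \<Longrightarrow> hb 0 a (C * \<mu>)"
  by (auto simp: yb_def)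

lemma yb_nonneg: "yb \<mu> a C \<Longrightarrow> 0 \<le> C"
  using yb_gamma hb_nonneg by blast

lemma jb_powr_ge1: "0 \<le> s \<Longrightarrow> 1 \<le> jb k powr s"
  using jb_ge1[of k] by (simp add: ge_one_powr_ge_zero)

text \<open>For the \<open>L^2\<close> part, one factor carries the lost derivative in
  \<open>l2\<close>, a second one is taken in \<open>L^2\<close> and contributes
  \<open>\<mu>\<close>, and the third is summable. The bound is thus linear in \<open>\<mu>\<close>,
  which makes \<open>yb\<close> stable under cubic expressions.\<close>

lemma tri_yb:
  assumes m: "\<And>k k1 k2. cmod (m k k1 k2) * jb k \<le> A * (jb k1 + jb k2 + jb (k - k1 - k2))"
    and A: "0 \<le> A" and abc: "yb \<mu> a P" "yb \<mu> b Q" "yb \<mu> c R" and mu: "0 \<le> \<mu>"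
  shows "yb \<mu> (tri m a b c) (9 * kap^3 * A * (P * Q * R))"
    and "(\<lambda>p. cmod (trt m a b c k p)) summable_on UNIV"
proof -
  have nn: "0 \<le> P" "0 \<le> Q" "0 \<le> R" using abc yb_nonneg by auto
  have g: "hb \<gamma> a P" "hb \<gamma> b Q" "hb \<gamma> c R" using abc yb_gamma by auto
  have z: "hb 0 a (P * \<mu>)" "hb 0 b (Q * \<mu>)" "hb 0 c (R * \<mu>)" using abc yb_zero by auto
  have k: "1 \<le> kap" by (rule kap_ge)
  define G where "G p1 p2 p3 a b c w x = w (fst x) * (jb (fst x) powr (\<gamma> - 1) * (jb (p1 x) * cmod (a (p1 x)))
      * (jb (p2 x) powr \<theta> * cmod (b (p2 x))) * (jb (p3 x) powr \<theta> * cmod (c (p3 x))))"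
    for p1 p2 p3 :: "int \<times> int \<times> int \<Rightarrow> int" and a b c :: "int \<Rightarrow> complex" and w :: "int \<Rightarrow> real" and x
  have C1: "0 \<le> 9 * kap^3 * A * (P * Q * R)" using nn k A by simp
  have H1: "(\<Sum>(k,p)\<in>F. w k * (jb k powr \<gamma> * cmod (trt m a b c k p))) \<le> 9 * kap^3 * A * (P * Q * R)"
    if F: "finite F" and w: "\<And>k. 0 \<le> w k" "l2 w 1" for F w
  proof -
    have "(\<Sum>(k,p)\<in>F. w k * (jb k powr \<gamma> * cmod (trt m a b c k p)))
      \<le> (\<Sum>x\<in>F. A * (G q1 q2 q3 a b c w x + G q2 q1 q3 b a c w x + G q3 q2 q1 c b a w x))"
    proof (rule sum_mono, clarify)
      fix k k1 k2
      have pw: "jb k powr \<gamma> = jb k powr (\<gamma> - 1) * jb k"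
        by (simp add: powr_diff)
      let ?N = "w k * jb k powr (\<gamma> - 1) * cmod (a k1) * cmod (b k2) * cmod (c (k - k1 - k2))"
      have N: "0 \<le> ?N" using w(1) by simp
      have up: "x * ?N \<le> x * ?N * (jb i powr \<theta> * jb j powr \<theta>)" if "0 \<le> x" for x i j
      proof -
        have "1 * 1 \<le> jb i powr \<theta> * jb j powr \<theta>"
          using theta_pos by (intro mult_mono jb_powr_ge1) auto
        then show ?thesis using mult_left_mono[of 1 "jb i powr \<theta> * jb j powr \<theta>" "x * ?N"] N that by simp
      qed
      have "w k * (jb k powr \<gamma> * cmod (trt m a b c k (k1, k2))) \<le> A * (jb k1 + jb k2 + jb (k - k1 - k2)) * ?N"
        using mult_right_mono[OF m[of k k1 k2] N] unfolding pw by (simp add: trt_def norm_mult algebra_simps)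
      also have "\<dots> = A * (jb k1 * ?N + jb k2 * ?N + jb (k - k1 - k2) * ?N)" by (simp add: algebra_simps)
      also have "\<dots> \<le> A * (jb k1 * ?N * (jb k2 powr \<theta> * jb (k - k1 - k2) powr \<theta>)
        + jb k2 * ?N * (jb k1 powr \<theta> * jb (k - k1 - k2) powr \<theta>)
        + jb (k - k1 - k2) * ?N * (jb k2 powr \<theta> * jb k1 powr \<theta>))"
        using A by (intro mult_left_mono add_mono up) auto
      finally show "w k * (jb k powr \<gamma> * cmod (trt m a b c k (k1, k2)))
        \<le> A * (G q1 q2 q3 a b c w (k,k1,k2) + G q2 q1 q3 b a c w (k,k1,k2) + G q3 q2 q1 c b a w (k,k1,k2))"
        unfolding G_def by (simp add: algebra_simps)
    qed
    also have "\<dots> = A * ((\<Sum>x\<in>F. G q1 q2 q3 a b c w x) + (\<Sum>x\<in>F. G q2 q1 q3 b a c w x) + (\<Sum>x\<in>F. G q3 q2 q1 c b a w x))"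
      by (simp only: sum.distrib sum_distrib_left distrib_left)
    also have "\<dots> \<le> A * (3 * kap^3 * (P * Q * R) + 3 * kap^3 * (Q * P * R) + 3 * kap^3 * (R * Q * P))"
      unfolding G_def using w g A F
      by (intro mult_left_mono add_mono gamma_form triple_inj triple_inj') auto
    also have "\<dots> = 9 * kap^3 * A * (P * Q * R)" by (simp add: algebra_simps)
    finally show ?thesis .
  qed
  define Z where "Z p1 p2 p3 a b c w x = w (fst x) / jb (fst x) * (jb (p1 x) * cmod (a (p1 x)))
      * cmod (b (p2 x)) * cmod (c (p3 x))"
    for p1 p2 p3 :: "int \<times> int \<times> int \<Rightarrow> int" and a b c :: "int \<Rightarrow> complex" and w :: "int \<Rightarrow> real" and x
  have C2: "0 \<le> 9 * kap^3 * A * (P * Q * R) * \<mu>" using C1 mu by simp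
  have H2: "(\<Sum>(k,p)\<in>F. w k * (jb k powr 0 * cmod (trt m a b c k p))) \<le> 9 * kap^3 * A * (P * Q * R) * \<mu>"
    if F: "finite F" and w: "\<And>k. 0 \<le> w k" "l2 w 1" for F w
  proof -
    have "(\<Sum>(k,p)\<in>F. w k * (jb k powr 0 * cmod (trt m a b c k p)))
      \<le> (\<Sum>x\<in>F. A * (Z q1 q2 q3 a b c w x + Z q2 q1 q3 b a c w x + Z q3 q2 q1 c b a w x))"
    proof (rule sum_mono, clarify)
      fix k k1 k2
      let ?N = "w k / jb k * cmod (a k1) * cmod (b k2) * cmod (c (k - k1 - k2))"
      have N: "0 \<le> ?N" using w(1) by simp
      have "w k * (jb k powr 0 * cmod (trt m a b c k (k1, k2))) = cmod (m k k1 k2) * jb k * ?N"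
        by (simp add: trt_def norm_mult)
      also have "\<dots> \<le> A * (jb k1 + jb k2 + jb (k - k1 - k2)) * ?N"
        by (rule mult_right_mono[OF m N])
      finally show "w k * (jb k powr 0 * cmod (trt m a b c k (k1, k2)))
        \<le> A * (Z q1 q2 q3 a b c w (k,k1,k2) + Z q2 q1 q3 b a c w (k,k1,k2) + Z q3 q2 q1 c b a w (k,k1,k2))"
        unfolding Z_def by (simp add: algebra_simps add_divide_distrib)
    qed
    also have "\<dots> = A * ((\<Sum>x\<in>F. Z q1 q2 q3 a b c w x) + (\<Sum>x\<in>F. Z q2 q1 q3 b a c w x) + (\<Sum>x\<in>F. Z q3 q2 q1 c b a w x))"
      by (simp only: sum.distrib sum_distrib_left distrib_left)
    also have "\<dots> \<le> A * (kap * (P * (Q * \<mu>) * (kap * R)) + kap * (Q * (P * \<mu>) * (kap * R)) + kap * (R * (Q * \<mu>) * (kap * P)))"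
      unfolding Z_def using w g z A F
      by (intro mult_left_mono add_mono zero_form triple_inj triple_inj' hb_l2_one hb_gamma_one hb_l2_zero emb0) auto
    also have "\<dots> = 3 * kap^2 * (A * (P * Q * R) * \<mu>)" by (simp add: algebra_simps power2_eq_square)
    also have "\<dots> \<le> 9 * kap^3 * (A * (P * Q * R) * \<mu>)"
    proof (rule mult_right_mono)
      have "kap^2 \<le> kap^3" using k by (intro power_increasing) auto
      then show "3 * kap^2 \<le> 9 * kap^3" using zero_le_power[of kap 3] k by linarith
    qed (use nn A mu in auto)
    finally show ?thesis by (simp add: algebra_simps)
  qed
  have "hb \<gamma> (tri m a b c) (9 * kap^3 * A * (P * Q * R))"
    by (rule tri_bound_hb[OF C1], rule H1)
  moreover have "hb 0 (tri m a b c) (9 * kap^3 * A * (P * Q * R) * \<mu>)"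
    by (rule tri_bound_hb[OF C2], rule H2)
  ultimately show "yb \<mu> (tri m a b c) (9 * kap^3 * A * (P * Q * R))" by (simp add: yb_def)
  show "(\<lambda>p. cmod (trt m a b c k p)) summable_on UNIV"
    by (rule tri_bound_summable[OF C1], rule H1)
qed

text \<open>No derivative falls on \<open>a\<close>, so \<open>a\<close> may be measured in
  \<open>L^2\<close> alone, whereas \<open>b\<close> and \<open>c\<close> are summable with their
  weights. With \<open>a\<close> bounded by a multiple of \<open>\<mu>\<close> this gives a bound
  proportional to \<open>\<mu>\<close>.\<close>

lemma tri_easy:
  assumes m: "\<And>k k1 k2. cmod (m k k1 k2) \<le> A * (jb k2 powr \<theta> * jb (k - k1 - k2) powr \<theta>)"
    and A: "0 \<le> A" and abc: "hb 0 a P" "hb \<gamma> b Q" "hb \<gamma> c R"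
  shows "hb 0 (tri m a b c) (A * kap^2 * (P * Q * R))"
proof -
  have nn: "0 \<le> P" "0 \<le> Q" "0 \<le> R" using abc hb_nonneg by auto
  have C: "0 \<le> A * kap^2 * (P * Q * R)" using nn kap_pos A by simp
  have H: "(\<Sum>(k,p)\<in>F. w k * (jb k powr 0 * cmod (trt m a b c k p))) \<le> A * kap^2 * (P * Q * R)"
    if F: "finite F" and w: "\<And>k. 0 \<le> w k" "l2 w 1" for F w
  proof -
    have "(\<Sum>(k,p)\<in>F. w k * (jb k powr 0 * cmod (trt m a b c k p)))
      \<le> (\<Sum>x\<in>F. A * (w (fst x) * cmod (a (q1 x)) * (jb (q2 x) powr \<theta> * cmod (b (q2 x))) * (jb (q3 x) powr \<theta> * cmod (c (q3 x)))))"
    proof (rule sum_mono, clarify)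
      fix k k1 k2
      show "w k * (jb k powr 0 * cmod (trt m a b c k (k1, k2))) \<le> A * (w (fst (k,k1,k2)) * cmod (a (q1 (k,k1,k2)))
      * (jb (q2 (k,k1,k2)) powr \<theta> * cmod (b (q2 (k,k1,k2)))) * (jb (q3 (k,k1,k2)) powr \<theta> * cmod (c (q3 (k,k1,k2)))))"
        using mult_left_mono[OF m[of k k1 k2], of "w k * cmod (a k1) * cmod (b k2) * cmod (c (k - k1 - k2))"] w(1)
        by (simp add: trt_def norm_mult algebra_simps)
    qed
    also have "\<dots> \<le> A * (1 * P * (kap * Q) * (kap * R))"
    proof -
      have "(\<Sum>x\<in>F. w (fst x) * cmod (a (q1 x)) * (jb (q2 x) powr \<theta> * cmod (b (q2 x))) * (jb (q3 x) powr \<theta> * cmod (c (q3 x))))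
        \<le> 1 * P * (kap * Q) * (kap * R)"
        by (rule sum_quad_le[where ?p1.0 = fst and ?p2.0 = q1 and ?p3.0 = q2 and ?p4.0 = q3, OF F triple_inj'(3) triple_inj w(2) hb_l2_zero[OF abc(1)] embt[OF abc(2)] embt[OF abc(3)] w(1)]) auto
      from mult_left_mono[OF this A] show ?thesis by (simp only: sum_distrib_left)
    qed
    finally show ?thesis by (simp add: algebra_simps power2_eq_square)
  qed
  show ?thesis by (rule tri_bound_hb[OF C], rule H)
qed

text \<open>Two factors enter only through \<open>H^1\<close>. With the interpolated norms of
  \<open>v_interpolation\<close>, each proportional to \<open>sqrt hh\<close>, this yields the
  factor \<open>hh\<close> in \<open>H_v_small\<close>.\<close>

lemma tri_hard_zero:
  assumes g: "\<gamma> > 3/2" and m: "\<And>k k1 k2. cmod (m k k1 k2) * jb k \<le> A * (jb k1 * jb k2 * jb (k - k1 - k2))"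
    and A: "0 \<le> A" and abc: "hb 1 a P" "hb 1 b Q" "hb \<gamma> c R"
  shows "hb 0 (tri m a b c) (A * kap^2 * (P * Q * R))"
proof -
  have nn: "0 \<le> P" "0 \<le> Q" "0 \<le> R" using abc hb_nonneg by auto
  have C: "0 \<le> A * kap^2 * (P * Q * R)" using nn kap_pos A by simp
  have H: "(\<Sum>(k,p)\<in>F. w k * (jb k powr 0 * cmod (trt m a b c k p))) \<le> A * kap^2 * (P * Q * R)"
    if F: "finite F" and w: "\<And>k. 0 \<le> w k" "l2 w 1" for F w
  proof -
    have "(\<Sum>(k,p)\<in>F. w k * (jb k powr 0 * cmod (trt m a b c k p)))
      \<le> (\<Sum>x\<in>F. A * (w (fst x) / jb (fst x) * (jb (q1 x) * cmod (a (q1 x))) * (jb (q2 x) * cmod (b (q2 x))) * (jb (q3 x) * cmod (c (q3 x)))))"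
    proof (rule sum_mono, clarify)
      fix k k1 k2
      have "w k * (jb k powr 0 * cmod (trt m a b c k (k1, k2))) = cmod (m k k1 k2) * jb k * (w k / jb k * cmod (a k1) * cmod (b k2) * cmod (c (k - k1 - k2)))"
        by (simp add: trt_def norm_mult)
      also have "\<dots> \<le> A * (jb k1 * jb k2 * jb (k - k1 - k2)) * (w k / jb k * cmod (a k1) * cmod (b k2) * cmod (c (k - k1 - k2)))"
        using w by (intro mult_right_mono m) auto
      finally show "w k * (jb k powr 0 * cmod (trt m a b c k (k1, k2))) \<le> A * (w (fst (k,k1,k2)) / jb (fst (k,k1,k2)) * (jb (q1 (k,k1,k2)) * cmod (a (q1 (k,k1,k2))))
      * (jb (q2 (k,k1,k2)) * cmod (b (q2 (k,k1,k2)))) * (jb (q3 (k,k1,k2)) * cmod (c (q3 (k,k1,k2)))))"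
        by (simp add: algebra_simps)
    qed
    also have "\<dots> \<le> A * (kap * (P * Q * (kap * R)))"
      using mult_left_mono[OF zero_form[where ?p0.0 = fst and ?p1.0 = q1 and ?p2.0 = q2 and ?p3.0 = q3, OF F _ triple_inj w hb_l2_one[OF abc(1)] _ hb_l2_one[OF abc(2)] _ emb1[OF g abc(3)]] A]
      by (simp add: sum_distrib_left)
    finally show ?thesis by (simp add: algebra_simps power2_eq_square)
  qed
  show ?thesis by (rule tri_bound_hb[OF C], rule H)
qed

end

section \<open>Differences, mean values and derivatives of infinite families\<close>

lemma has_sum_diff:
  fixes f g :: "'i \<Rightarrow> complex"
  assumes "(f has_sum a) A" "(g has_sum b) A"
  shows "((\<lambda>x. f x - g x) has_sum (a - b)) A"
  using has_sum_add[OF assms(1) has_sum_cmult_right[OF assms(2), of "-1"]] by simp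

lemma summable_on_diff:
  fixes f g :: "'i \<Rightarrow> complex"
  shows "f summable_on A \<Longrightarrow> g summable_on A \<Longrightarrow> (\<lambda>x. f x - g x) summable_on A"
  using has_sum_diff has_sum_infsum has_sum_imp_summable by metis

lemma infsum_diff:
  fixes f g :: "'i \<Rightarrow> complex"
  shows "f summable_on A \<Longrightarrow> g summable_on A \<Longrightarrow> (\<Sum>\<^sub>\<infinity>x\<in>A. f x - g x) = infsum f A - infsum g A"
  using has_sum_diff has_sum_infsum infsumI by metis

lemma Re_cnj_mult_self: "Re (cnj z * z) = (cmod z)^2"
  unfolding cmod_power2 by (simp add: power2_eq_square)

text \<open>On a finite set of frequencies the scalar mean value theorem is applied to the weighted
  real pairing of \<open>f s\<close> with the fixed increment \<open>D\<close>. The increment of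
  this pairing is the square of the norm of \<open>D\<close>, and Cauchy-Schwarz allows division by
  that norm. Integrals of sequence-valued functions are thereby avoided.\<close>

lemma hb_mvt:
  assumes ab: "a \<le> b"
    and der: "\<And>k s. a \<le> s \<Longrightarrow> s \<le> b \<Longrightarrow> ((\<lambda>s. f s k) has_vector_derivative g s k) (at s within {a..b})"
    and g: "\<And>s. a \<le> s \<Longrightarrow> s \<le> b \<Longrightarrow> hb r (g s) C"
  shows "hb r (\<lambda>k. f b k - f a k) ((b - a) * C)"
proof -
  have C: "0 \<le> C" using g[OF order_refl ab] hb_nonneg by blast
  let ?n = "\<lambda>k. jb k powr r * cmod (f b k - f a k)"
  have "L2_set ?n F \<le> (b - a) * C" if F: "finite F" for F
  proof -
    define L where "L = L2_set ?n F"
    have L0: "0 \<le> L" by (simp add: L_def L2_set_nonneg)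
    define D where "D k = f b k - f a k" for k
    define \<psi> where "\<psi> s = (\<Sum>k\<in>F. (jb k powr r)^2 * Re (cnj (D k) * f s k))" for s
    define \<psi>' where "\<psi>' s = (\<Sum>k\<in>F. (jb k powr r)^2 * Re (cnj (D k) * g s k))" for s
    have d: "(\<psi> has_derivative (\<lambda>h. h * \<psi>' s)) (at s within {a..b})" if "a \<le> s" "s \<le> b" for s
      unfolding \<psi>_def \<psi>'_def
      using der[OF that] unfolding has_vector_derivative_def
      by (auto intro!: derivative_eq_intros simp: sum_distrib_left algebra_simps scaleR_conv_of_real)
    obtain x where x: "a \<le> x" "x \<le> b" "\<psi> b - \<psi> a = (b - a) * \<psi>' x"
      using mvt_very_simple[OF ab d] by auto
    have "L^2 = (\<Sum>k\<in>F. (jb k powr r)^2 * Re (cnj (D k) * D k))"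
      unfolding L_def L2_set_def
      unfolding Re_cnj_mult_self by (simp add: sum_nonneg power_mult_distrib D_def)
    also have "\<dots> = \<psi> b - \<psi> a"
      unfolding \<psi>_def sum_subtractf[symmetric]
      by (intro sum.cong refl) (simp add: D_def right_diff_distrib)
    also have "\<dots> = (b - a) * \<psi>' x" by (rule x)
    finally have LL: "L^2 = (b - a) * \<psi>' x" .
    have "\<psi>' x \<le> (\<Sum>k\<in>F. \<bar>?n k\<bar> * \<bar>jb k powr r * cmod (g x k)\<bar>)"
      unfolding \<psi>'_def
    proof (rule sum_mono)
      fix k
      have "Re (cnj (D k) * g x k) \<le> cmod (D k) * cmod (g x k)"
        by (metis complex_Re_le_cmod complex_mod_cnj norm_mult)
      then have "(jb k powr r)^2 * Re (cnj (D k) * g x k) \<le> (jb k powr r)^2 * (cmod (D k) * cmod (g x k))"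
        by (intro mult_left_mono) auto
      then show "(jb k powr r)^2 * Re (cnj (D k) * g x k) \<le> \<bar>?n k\<bar> * \<bar>jb k powr r * cmod (g x k)\<bar>"
        by (simp add: D_def power2_eq_square abs_mult algebra_simps)
    qed
    also have "\<dots> \<le> L2_set ?n F * L2_set (\<lambda>k. jb k powr r * cmod (g x k)) F"
      by (rule L2_set_mult_ineq)
    also have "\<dots> \<le> L * C"
      unfolding L_def[symmetric] using g[OF x(1,2)] F L0 unfolding hb_def l2_iff_L2_set by (intro mult_left_mono) auto
    finally have "(b - a) * \<psi>' x \<le> (b - a) * (L * C)" using ab by (intro mult_left_mono) auto
    then have "L * L \<le> L * ((b - a) * C)" using LL by (simp add: power2_eq_square algebra_simps)
    then have "L \<le> (b - a) * C"
      using L0 C ab by (cases "L = 0") (auto simp: mult_le_cancel_left)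
    then show ?thesis by (simp add: L_def)
  qed
  then show ?thesis unfolding hb_def l2_iff_L2_set by blast
qed

text \<open>Domination by the summable \<open>M\<close> makes each term Lipschitz with constant
  \<open>M i\<close>. A finite set \<open>I\<close> is chosen with tail at most
  \<open>e / 4\<close>; the tail of the difference quotients then costs \<open>2 * (e / 4)\<close>
  and the finite sum \<open>e / 2\<close>.\<close>

lemma has_vector_derivative_infsum:
  fixes f :: "'i \<Rightarrow> real \<Rightarrow> complex"
  assumes S: "s0 \<in> {a..b}"
    and der: "\<And>i s. s \<in> {a..b} \<Longrightarrow> (f i has_vector_derivative f' i s) (at s within {a..b})"
    and bd: "\<And>i s. s \<in> {a..b} \<Longrightarrow> cmod (f' i s) \<le> M i" and M: "M summable_on UNIV"
    and sm: "\<And>s. s \<in> {a..b} \<Longrightarrow> (\<lambda>i. f i s) summable_on UNIV"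
  shows "((\<lambda>s. infsum (\<lambda>i. f i s) UNIV) has_vector_derivative infsum (\<lambda>i. f' i s0) UNIV) (at s0 within {a..b})"
  unfolding has_vector_derivative_def has_derivative_within_alt
proof (intro conjI allI impI)
  show "bounded_linear (\<lambda>x. x *\<^sub>R infsum (\<lambda>i. f' i s0) UNIV)" by (rule bounded_linear_scaleR_left)
  fix e :: real assume e: "0 < e"
  have M0: "0 \<le> M i" for i using bd[OF S, of i] norm_ge_zero order_trans by blast
  have sf': "(\<lambda>i. f' i s0) summable_on UNIV"
    by (rule abs_summable_summable, rule summable_on_comparison_test[OF M]) (use bd[OF S] in auto)
  obtain I where I: "finite I" "dist (sum M I) (infsum M UNIV) \<le> e / 4"
    using infsum_finite_approximation[OF M, of "e/4"] e by auto
  have tail: "(\<Sum>\<^sub>\<infinity>i\<in>-I. M i) \<le> e / 4"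
  proof -
    have "infsum M UNIV = infsum M I + (\<Sum>\<^sub>\<infinity>i\<in>-I. M i)"
      using infsum_Un_disjoint[of M I "-I"] M I(1) summable_on_subset_banach[OF M]
      by (simp add: Compl_partition)
    then show ?thesis using I by (simp add: dist_real_def abs_le_iff)
  qed
  have lip: "cmod (f i y - f i s0) \<le> M i * norm (y - s0)" if "y \<in> {a..b}" for i y
  proof (rule differentiable_bound[where S = "{a..b}" and f' = "\<lambda>s h. h *\<^sub>R f' i s"])
    show "(f i has_derivative (\<lambda>h. h *\<^sub>R f' i s)) (at s within {a..b})" if "s \<in> {a..b}" for s
      using der[OF that] by (simp add: has_vector_derivative_def)
    show "onorm (\<lambda>h. h *\<^sub>R f' i s) \<le> M i" if "s \<in> {a..b}" for s
      using bd[OF that, of i] by (intro onorm_le) (simp add: mult.commute mult_left_mono)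
  qed (use S that in auto)
  have "((\<lambda>s. \<Sum>i\<in>I. f i s) has_vector_derivative (\<Sum>i\<in>I. f' i s0)) (at s0 within {a..b})"
    by (rule has_vector_derivative_sum) (rule der[OF S])
  then obtain d where d: "d > 0" "\<And>y. y \<in> {a..b} \<Longrightarrow> norm (y - s0) < d \<Longrightarrow>
      norm ((\<Sum>i\<in>I. f i y) - (\<Sum>i\<in>I. f i s0) - (y - s0) *\<^sub>R (\<Sum>i\<in>I. f' i s0)) \<le> e / 2 * norm (y - s0)"
    using e unfolding has_vector_derivative_def has_derivative_within_alt by (metis half_gt_zero)
  show "\<exists>d>0. \<forall>y\<in>{a..b}. norm (y - s0) < d \<longrightarrow>
      norm (infsum (\<lambda>i. f i y) UNIV - infsum (\<lambda>i. f i s0) UNIV - (y - s0) *\<^sub>R infsum (\<lambda>i. f' i s0) UNIV) \<le> e * norm (y - s0)"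
  proof (intro exI[of _ d] conjI ballI impI d(1))
    fix y assume y: "y \<in> {a..b}" "norm (y - s0) < d"
    define h where "h i = f i y - f i s0 - (y - s0) *\<^sub>R f' i s0" for i
    have hs: "h summable_on UNIV"
      unfolding h_def using sm[OF y(1)] sm[OF S] sf'
      by (intro summable_on_diff summable_on_scaleR_right) auto
    have hb: "cmod (h i) \<le> 2 * norm (y - s0) * M i" for i
    proof -
      have "cmod (h i) \<le> cmod (f i y - f i s0) + norm (y - s0) * cmod (f' i s0)"
        unfolding h_def by (metis norm_scaleR norm_triangle_ineq4 real_norm_def)
      also have "\<dots> \<le> M i * norm (y - s0) + norm (y - s0) * M i"
        using lip[OF y(1)] bd[OF S, of i] by (intro add_mono mult_left_mono) auto
      finally show ?thesis by (simp add: algebra_simps)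
    qed
    have Mc: "M summable_on -I" by (rule summable_on_subset_banach[OF M]) auto
    have "infsum (\<lambda>i. f i y) UNIV - infsum (\<lambda>i. f i s0) UNIV - (y - s0) *\<^sub>R infsum (\<lambda>i. f' i s0) UNIV = infsum h UNIV"
      unfolding h_def using sm[OF y(1)] sm[OF S] sf'
      by (subst infsum_diff, (intro summable_on_diff summable_on_scaleR_right; simp)+,
          subst infsum_diff) (auto simp: infsum_scaleR_right)
    also have "infsum h UNIV = sum h I + infsum h (-I)"
      using infsum_Un_disjoint[of h I "-I"] hs I(1) summable_on_subset_banach[OF hs]
      by (simp add: Compl_partition)
    also have "cmod \<dots> \<le> cmod (sum h I) + cmod (infsum h (-I))" by (rule norm_triangle_ineq)
    also have "sum h I = (\<Sum>i\<in>I. f i y) - (\<Sum>i\<in>I. f i s0) - (y - s0) *\<^sub>R (\<Sum>i\<in>I. f' i s0)"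
      unfolding h_def by (simp add: sum_subtractf scaleR_sum_right)
    also have "cmod \<dots> \<le> e / 2 * norm (y - s0)" by (rule d(2)[OF y])
    also have "cmod (infsum h (-I)) \<le> infsum (\<lambda>i. 2 * norm (y - s0) * M i) (-I)"
      by (rule norm_infsum_le[OF has_sum_infsum has_sum_infsum])
         (use hs hb Mc in \<open>auto intro!: summable_on_cmult_right summable_on_subset_banach[OF hs]\<close>)
    also have "\<dots> = 2 * norm (y - s0) * infsum M (-I)" by (rule infsum_cmult_right')
    also have "\<dots> \<le> 2 * norm (y - s0) * (e / 4)" by (rule mult_left_mono[OF tail]) simp
    finally show "norm (infsum (\<lambda>i. f i y) UNIV - infsum (\<lambda>i. f i s0) UNIV - (y - s0) *\<^sub>R infsum (\<lambda>i. f' i s0) UNIV) \<le> e * norm (y - s0)"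
      by (simp add: algebra_simps)
  qed
qed

section \<open>Cubic multipliers, the resonance phase and the inner product of coefficients\<close>

context adm
begin

lemma yb_mono: "yb \<mu> a C \<Longrightarrow> C \<le> D \<Longrightarrow> 0 \<le> \<mu> \<Longrightarrow> yb \<mu> a D"
  unfolding yb_def by (auto intro: hb_mono mult_right_mono)

lemma yb_add: "yb \<mu> a C \<Longrightarrow> yb \<mu> b D \<Longrightarrow> yb \<mu> (\<lambda>k. a k + b k) (C + D)"
  unfolding yb_def by (auto simp: distrib_right intro: hb_add)

lemma yb_diff: "yb \<mu> a C \<Longrightarrow> yb \<mu> b D \<Longrightarrow> yb \<mu> (\<lambda>k. a k - b k) (C + D)"
  unfolding yb_def by (auto simp: distrib_right intro: hb_diff)

lemma yb_dom: "yb \<mu> a C \<Longrightarrow> (\<And>k. cmod (b k) \<le> c * cmod (a k)) \<Longrightarrow> 0 \<le> c \<Longrightarrow> yb \<mu> b (c * C)"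
  unfolding yb_def by (auto simp: mult.assoc intro: hb_dom)

lemma yb_cong_norm: "yb \<mu> a C \<Longrightarrow> (\<And>k. cmod (b k) = cmod (a k)) \<Longrightarrow> yb \<mu> b C"
  unfolding yb_def by (auto intro: hb_cong_norm)

lemma yb_scale: "yb \<mu> a C \<Longrightarrow> yb \<mu> (\<lambda>k. c * a k) (cmod c * C)"
  by (erule yb_dom) (auto simp: norm_mult)

lemma yb_sum: "(\<And>j. j \<in> J \<Longrightarrow> yb \<mu> (a j) (C j)) \<Longrightarrow> yb \<mu> (\<lambda>k. \<Sum>j\<in>J. a j k) (\<Sum>j\<in>J. C j)"
  unfolding yb_def by (auto simp: sum_distrib_right intro: hb_sum)

lemma yb_rv: "yb \<mu> a C \<Longrightarrow> yb \<mu> (rv a) C"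
  unfolding yb_def by (auto intro: hb_rv)

lemma yb_zero_seq: "0 \<le> C \<Longrightarrow> 0 \<le> \<mu> \<Longrightarrow> yb \<mu> (\<lambda>k. 0) C"
  unfolding yb_def by (auto intro: hb_zero)

lemma yb_one: "hb \<gamma> a C \<Longrightarrow> yb 1 a C"
  unfolding yb_def using gamma_ge1 by (auto intro: hb_weaken)

lemma yb_mvt:
  assumes ab: "a \<le> b"
    and der: "\<And>k s. a \<le> s \<Longrightarrow> s \<le> b \<Longrightarrow> ((\<lambda>s. f s k) has_vector_derivative g s k) (at s within {a..b})"
    and g: "\<And>s. a \<le> s \<Longrightarrow> s \<le> b \<Longrightarrow> yb \<mu> (g s) C"
  shows "yb \<mu> (\<lambda>k. f b k - f a k) ((b - a) * C)"
  using hb_mvt[OF ab der, where r = \<gamma> and C = C] hb_mvt[OF ab der, where r = 0 and C = "C * \<mu>"] g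
  unfolding yb_def by (auto simp: mult.assoc)

text \<open>The working class of multipliers: one derivative gained on the output against one lost
  on any single factor. It contains the bounded multipliers, by the triangle inequality for
  \<open>jb\<close>, and those of the scheme, is closed under sums, and is unaffected by unimodular
  modulation, so every cubic series below converges absolutely on \<open>H^\<gamma>\<close>.\<close>

definition mb :: "(int \<Rightarrow> int \<Rightarrow> int \<Rightarrow> complex) \<Rightarrow> real \<Rightarrow> bool" where
  "mb m A \<longleftrightarrow> 0 \<le> A \<and> (\<forall>k k1 k2. cmod (m k k1 k2) * jb k \<le> A * (jb k1 + jb k2 + jb (k - k1 - k2)))"

lemma mb_tri_yb:
  "mb m A \<Longrightarrow> 0 \<le> \<mu> \<Longrightarrow> yb \<mu> a P \<Longrightarrow> yb \<mu> b Q \<Longrightarrow> yb \<mu> c R \<Longrightarrow> yb \<mu> (tri m a b c) (9 * kap^3 * A * (P * Q * R))"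
  using tri_yb(1)[of m A \<mu> a P b Q c R] unfolding mb_def by blast

lemma mb_abs_summable:
  "mb m A \<Longrightarrow> hb \<gamma> a P \<Longrightarrow> hb \<gamma> b Q \<Longrightarrow> hb \<gamma> c R \<Longrightarrow> (\<lambda>p. cmod (trt m a b c k p)) summable_on UNIV"
  using tri_yb(2)[of m A 1 a P b Q c R k] yb_one unfolding mb_def by auto

lemma mb_summable:
  "mb m A \<Longrightarrow> hb \<gamma> a P \<Longrightarrow> hb \<gamma> b Q \<Longrightarrow> hb \<gamma> c R \<Longrightarrow> trt m a b c k summable_on UNIV"
  by (rule abs_summable_summable, rule mb_abs_summable)

lemma mb_bounded:
  assumes "0 \<le> A" "\<And>k k1 k2. cmod (m k k1 k2) \<le> A"
  shows "mb m A"
  unfolding mb_def using assms by (auto intro!: mult_mono jb_triangle3)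

lemma mb_cmult: "mb m A \<Longrightarrow> mb (\<lambda>k k1 k2. c * m k k1 k2) (cmod c * A)"
  unfolding mb_def by (auto simp: norm_mult mult.assoc intro!: mult_left_mono)

lemma mb_dom: "mb m A \<Longrightarrow> (\<And>k k1 k2. cmod (m' k k1 k2) \<le> c * cmod (m k k1 k2)) \<Longrightarrow> 0 \<le> c \<Longrightarrow> mb m' (c * A)"
  unfolding mb_def
proof (intro conjI allI)
  assume m: "0 \<le> A \<and> (\<forall>k k1 k2. cmod (m k k1 k2) * jb k \<le> A * (jb k1 + jb k2 + jb (k - k1 - k2)))"
    and d: "\<And>k k1 k2. cmod (m' k k1 k2) \<le> c * cmod (m k k1 k2)" and c: "0 \<le> c"
  fix k k1 k2
  have "cmod (m' k k1 k2) * jb k \<le> c * cmod (m k k1 k2) * jb k" using d by (intro mult_right_mono) auto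
  also have "\<dots> = c * (cmod (m k k1 k2) * jb k)" by simp
  also have "\<dots> \<le> c * (A * (jb k1 + jb k2 + jb (k - k1 - k2)))" using m c by (intro mult_left_mono) auto
  finally show "cmod (m' k k1 k2) * jb k \<le> c * A * (jb k1 + jb k2 + jb (k - k1 - k2))" by simp
qed auto

lemma mb_add: "mb m A \<Longrightarrow> mb m' B \<Longrightarrow> mb (\<lambda>k k1 k2. m k k1 k2 + m' k k1 k2) (A + B)"
  unfolding mb_def
proof (intro conjI allI)
  fix k k1 k2
  assume m: "0 \<le> A \<and> (\<forall>k k1 k2. cmod (m k k1 k2) * jb k \<le> A * (jb k1 + jb k2 + jb (k - k1 - k2)))"
    "0 \<le> B \<and> (\<forall>k k1 k2. cmod (m' k k1 k2) * jb k \<le> B * (jb k1 + jb k2 + jb (k - k1 - k2)))"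
  have "cmod (m k k1 k2 + m' k k1 k2) * jb k \<le> (cmod (m k k1 k2) + cmod (m' k k1 k2)) * jb k"
    by (intro mult_right_mono norm_triangle_ineq) auto
  also have "\<dots> = cmod (m k k1 k2) * jb k + cmod (m' k k1 k2) * jb k" by (simp add: distrib_right)
  also have "\<dots> \<le> A * (jb k1 + jb k2 + jb (k - k1 - k2)) + B * (jb k1 + jb k2 + jb (k - k1 - k2))"
    using m by (intro add_mono) auto
  finally show "cmod (m k k1 k2 + m' k k1 k2) * jb k \<le> (A + B) * (jb k1 + jb k2 + jb (k - k1 - k2))"
    by (simp add: distrib_right)
qed auto

text \<open>The conjugated factor stands first. For the constant multiplier \<open>1\<close> this is
  the coefficient sequence of \<open>|u|^2 u\<close>, see \<open>fc_cubic\<close>.\<close>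

definition cub :: "(int \<Rightarrow> int \<Rightarrow> int \<Rightarrow> complex) \<Rightarrow> (int \<Rightarrow> complex) \<Rightarrow> int \<Rightarrow> complex" where
  "cub m x = tri m (rv x) x x"

lemma cub_has_sum: "mb m A \<Longrightarrow> hb \<gamma> x P \<Longrightarrow> (trt m (rv x) x x k has_sum cub m x k) UNIV"
  unfolding cub_def tri_def by (intro has_sum_infsum mb_summable hb_rv)

lemma cub_yb: "mb m A \<Longrightarrow> 0 \<le> \<mu> \<Longrightarrow> yb \<mu> x P \<Longrightarrow> yb \<mu> (cub m x) (9 * kap^3 * A * P^3)"
  unfolding cub_def using mb_tri_yb[of m A \<mu> "rv x" P x P x P] yb_rv[of \<mu> x P]
  by (simp add: power3_eq_cube)

lemma cub_add_m: "mb m A \<Longrightarrow> mb m' B \<Longrightarrow> hb \<gamma> x P \<Longrightarrow> cub (\<lambda>k k1 k2. m k k1 k2 + m' k k1 k2) x k = cub m x k + cub m' x k"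
proof -
  assume "mb m A" "mb m' B" "hb \<gamma> x P"
  then have "((\<lambda>p. trt m (rv x) x x k p + trt m' (rv x) x x k p) has_sum (cub m x k + cub m' x k)) UNIV"
    by (intro has_sum_add cub_has_sum)
  moreover have "(\<lambda>p. trt m (rv x) x x k p + trt m' (rv x) x x k p) = trt (\<lambda>k k1 k2. m k k1 k2 + m' k k1 k2) (rv x) x x k"
    by (auto simp: trt_def algebra_simps)
  ultimately show ?thesis unfolding cub_def tri_def by (simp add: infsumI)
qed

lemma cub_cmult_m: "cub (\<lambda>k k1 k2. c k * m k k1 k2) x k = c k * cub m x k"
  unfolding cub_def tri_def infsum_cmult_right'[symmetric]
  by (intro infsum_cong) (auto simp: trt_def)

lemma cub_sum_m:
  assumes "\<And>j. j \<in> J \<Longrightarrow> mb (m j) (A j)" "hb \<gamma> x P"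
  shows "cub (\<lambda>k k1 k2. \<Sum>j\<in>J. m j k k1 k2) x k = (\<Sum>j\<in>J. cub (m j) x k)"
proof -
  have "((\<lambda>p. \<Sum>j\<in>J. trt (m j) (rv x) x x k p) has_sum (\<Sum>j\<in>J. cub (m j) x k)) UNIV"
    using assms by (intro has_sum_sum cub_has_sum)
  moreover have "(\<lambda>p. \<Sum>j\<in>J. trt (m j) (rv x) x x k p) = trt (\<lambda>k k1 k2. \<Sum>j\<in>J. m j k k1 k2) (rv x) x x k"
    by (auto simp: trt_def sum_distrib_right)
  ultimately show ?thesis unfolding cub_def tri_def by (simp add: infsumI)
qed

lemma cub_diff:
  assumes m: "mb m A" and xy: "hb \<gamma> x P" "hb \<gamma> y Q"
  shows "cub m x k - cub m y k = tri m (rv (\<lambda>k. x k - y k)) x x k + tri m (rv y) (\<lambda>k. x k - y k) x k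
     + tri m (rv y) y (\<lambda>k. x k - y k) k"
proof -
  let ?d = "\<lambda>k. x k - y k"
  have d: "hb \<gamma> ?d (P + Q)" by (rule hb_diff[OF xy])
  have "((\<lambda>p. trt m (rv ?d) x x k p + trt m (rv y) ?d x k p + trt m (rv y) y ?d k p) has_sum
     (tri m (rv ?d) x x k + tri m (rv y) ?d x k + tri m (rv y) y ?d k)) UNIV"
    unfolding tri_def using xy d by (intro has_sum_add has_sum_infsum mb_summable[OF m] hb_rv)
  moreover have "((\<lambda>p. trt m (rv x) x x k p - trt m (rv y) y y k p) has_sum (cub m x k - cub m y k)) UNIV"
    by (rule has_sum_diff[OF cub_has_sum[OF m xy(1)] cub_has_sum[OF m xy(2)]])
  moreover have "(\<lambda>p. trt m (rv x) x x k p - trt m (rv y) y y k p)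
     = (\<lambda>p. trt m (rv ?d) x x k p + trt m (rv y) ?d x k p + trt m (rv y) y ?d k p)"
    by (auto simp: trt_def rv_def algebra_simps)
  ultimately show ?thesis by (simp only: has_sum_unique)
qed

lemma cub_lip:
  assumes m: "mb m A" and mu: "0 \<le> \<mu>" and xy: "yb \<mu> x P" "yb \<mu> y P" and d: "yb \<mu> (\<lambda>k. x k - y k) D"
  shows "yb \<mu> (\<lambda>k. cub m x k - cub m y k) (27 * kap^3 * A * P^2 * D)"
proof -
  have "yb \<mu> (\<lambda>k. tri m (rv (\<lambda>k. x k - y k)) x x k + tri m (rv y) (\<lambda>k. x k - y k) x k
     + tri m (rv y) y (\<lambda>k. x k - y k) k)
     (9 * kap^3 * A * (D * P * P) + 9 * kap^3 * A * (P * D * P) + 9 * kap^3 * A * (P * P * D))"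
    by (intro yb_add mb_tri_yb[OF m mu] yb_rv xy d)
  moreover have "9 * kap^3 * A * (D * P * P) + 9 * kap^3 * A * (P * D * P) + 9 * kap^3 * A * (P * P * D) = 27 * kap^3 * A * P^2 * D"
    by (simp add: power2_eq_square algebra_simps)
  ultimately show ?thesis
    by (simp only: cub_diff[OF m yb_gamma[OF xy(1)] yb_gamma[OF xy(2)]])
qed

definition phi :: "int \<Rightarrow> int \<Rightarrow> int \<Rightarrow> int" where
  "phi k k1 k2 = k^2 + k1^2 - k2^2 - (k - k1 - k2)^2"

text \<open>The two factorisations have different uses. This one exhibits the resonances and cancels
  against \<open>k1 + k2\<close> in the denominator of \<open>mm\<close>; \<open>phi_split\<close>
  separates \<open>2 * k * k1\<close>, which replaces the phase in one part of the scheme, from the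
  product of the two remaining frequencies, which measures the error.\<close>

lemma phi_factor: "phi k k1 k2 = 2 * (k1 + k2) * (k - k2)"
  unfolding phi_def by (simp add: power2_eq_square algebra_simps)

lemma phi_split: "phi k k1 k2 = 2 * k * k1 + 2 * k2 * (k - k1 - k2)"
  unfolding phi_def by (simp add: power2_eq_square algebra_simps)

lemma cub_twist:
  "cis (t * (real_of_int k)^2) * cub m (\<lambda>j. cis (- (t * (real_of_int j)^2)) * v j) k
     = cub (\<lambda>k k1 k2. cis (t * real_of_int (phi k k1 k2)) * m k k1 k2) v k"
  unfolding cub_def tri_def infsum_cmult_right'[symmetric]
proof (intro infsum_cong, clarify)
  fix k1 k2
  have "cis (t * real_of_int (phi k k1 k2)) = cis (t * (real_of_int k)^2) * cis (t * (real_of_int k1)^2)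
     * cis (- (t * (real_of_int k2)^2)) * cis (- (t * (real_of_int (k - k1 - k2))^2))"
    by (simp add: cis_mult phi_def algebra_simps)
  then show "cis (t * (real_of_int k)^2) * trt m (rv (\<lambda>j. cis (- (t * (real_of_int j)^2)) * v j))
      (\<lambda>j. cis (- (t * (real_of_int j)^2)) * v j) (\<lambda>j. cis (- (t * (real_of_int j)^2)) * v j) k (k1, k2) =
      trt (\<lambda>k k1 k2. cis (t * real_of_int (phi k k1 k2)) * m k k1 k2) (rv v) v v k (k1, k2)"
    by (simp add: trt_def rv_def cis_cnj)
qed

text \<open>By Parseval this is \<open>Pi0 (\<lambda>x. f x * cnj (g x))\<close> for functions with
  coefficients \<open>a\<close> and \<open>b\<close>, see \<open>Pi0_mult_cnj\<close>.\<close>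

definition ip :: "(int \<Rightarrow> complex) \<Rightarrow> (int \<Rightarrow> complex) \<Rightarrow> complex" where
  "ip a b = (\<Sum>\<^sub>\<infinity>k. a k * cnj (b k))"

lemma ip_l1: "hb 0 a C \<Longrightarrow> hb 0 b D \<Longrightarrow> l1 (\<lambda>k. cmod (a k * cnj (b k))) (C * D)"
  using l1_mult_l2[OF hb_l2_zero hb_l2_zero, of a C b D] by (simp add: norm_mult)

lemma ip_has_sum: "hb 0 a C \<Longrightarrow> hb 0 b D \<Longrightarrow> ((\<lambda>k. a k * cnj (b k)) has_sum ip a b) UNIV"
  unfolding ip_def by (intro has_sum_infsum l1_imp_abs_summable(2)[OF ip_l1])

lemma ip_bound: "hb 0 a C \<Longrightarrow> hb 0 b D \<Longrightarrow> cmod (ip a b) \<le> C * D"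
  unfolding ip_def by (intro l1_imp_abs_summable(3)[OF ip_l1])

lemma ip_add_left: "hb 0 a C \<Longrightarrow> hb 0 a' C' \<Longrightarrow> hb 0 b D \<Longrightarrow> ip (\<lambda>k. a k + a' k) b = ip a b + ip a' b"
  using has_sum_add[OF ip_has_sum[of a C b D] ip_has_sum[of a' C' b D]]
  unfolding ip_def by (simp add: distrib_right infsumI)

lemma ip_diff_left: "hb 0 a C \<Longrightarrow> hb 0 a' C' \<Longrightarrow> hb 0 b D \<Longrightarrow> ip (\<lambda>k. a k - a' k) b = ip a b - ip a' b"
  using has_sum_diff[OF ip_has_sum[of a C b D] ip_has_sum[of a' C' b D]]
  unfolding ip_def by (simp add: left_diff_distrib infsumI)

lemma ip_cnj: "ip b a = cnj (ip a b)"
  unfolding ip_def infsum_cnj[symmetric] by (intro infsum_cong) (simp add: mult.commute)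

lemma ip_diff_right: "hb 0 a C \<Longrightarrow> hb 0 b D \<Longrightarrow> hb 0 b' D' \<Longrightarrow> ip a (\<lambda>k. b k - b' k) = ip a b - ip a b'"
  using ip_diff_left[of b D b' D' a C] by (metis complex_cnj_diff ip_cnj)

lemma ip_scale_left: "ip (\<lambda>k. c * a k) b = c * ip a b"
  unfolding ip_def infsum_cmult_right'[symmetric] by (intro infsum_cong) (simp add: mult.assoc)

lemma ip_sum_left: "(\<And>j. j \<in> J \<Longrightarrow> hb 0 (a j) (C j)) \<Longrightarrow> hb 0 b D \<Longrightarrow> ip (\<lambda>k. \<Sum>j\<in>J. a j k) b = (\<Sum>j\<in>J. ip (a j) b)"
proof -
  assume "\<And>j. j \<in> J \<Longrightarrow> hb 0 (a j) (C j)" "hb 0 b D"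
  then have "((\<lambda>k. \<Sum>j\<in>J. a j k * cnj (b k)) has_sum (\<Sum>j\<in>J. ip (a j) b)) UNIV"
    by (intro has_sum_sum ip_has_sum)
  then show ?thesis unfolding ip_def[of "\<lambda>k. \<Sum>j\<in>J. a j k"] sum_distrib_right by (rule infsumI)
qed

lemma ip_unimodular: "(\<And>k. cmod (c k) = 1) \<Longrightarrow> ip (\<lambda>k. c k * a k) (\<lambda>k. c k * b k) = ip a b"
  unfolding ip_def
proof (intro infsum_cong)
  fix k assume "\<And>k. cmod (c k) = 1"
  then have "c k * cnj (c k) = 1" by (simp add: complex_norm_square[symmetric])
  then show "c k * a k * cnj (c k * b k) = a k * cnj (b k)"
    by (metis (no_types, lifting) complex_cnj_mult mult.assoc mult.commute mult_1)
qed

end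

section \<open>A discrete-time bilinear estimate\<close>

lemma cmod_cis_minus_one: "cmod (cis z - 1) = 2 * \<bar>sin (z / 2)\<bar>"
proof -
  have c: "cos z = 1 - 2 * (sin (z/2))^2" using cos_double_sin[of "z/2"] by simp
  have "(cmod (cis z - 1))^2 = (cos z - 1)^2 + (sin z)^2" by (simp add: cmod_power2)
  also have "\<dots> = 2 - 2 * cos z" using sin_cos_squared_add[of z] by (simp add: power2_eq_square algebra_simps)
  also have "\<dots> = (2 * \<bar>sin (z / 2)\<bar>)^2" by (simp add: c power_mult_distrib)
  finally show ?thesis by (rule power2_eq_imp_eq) auto
qed

text \<open>Multiplication by \<open>cis x - 1\<close> telescopes the sum to a difference of size at
  most \<open>2\<close>. The modulus of \<open>cis x - 1\<close> is \<open>2 * |sin (z / 2)|\<close>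
  with \<open>z = x - 2 * pi * p\<close>, and Jordan's inequality bounds it below by
  \<open>2 * |z| / pi\<close>. The result does not depend on the number of terms.\<close>

lemma geometric_cis_bound:
  fixes x :: real
  assumes y: "\<bar>x - 2 * pi * of_int p\<bar> \<le> pi"
  shows "cmod (\<Sum>j\<in>{i..<n}. cis (real j * x)) * \<bar>x - 2 * pi * of_int p\<bar> \<le> pi"
proof (cases "i \<le> n")
  case False then show ?thesis by simp
next
  case True
  define z where "z = x - 2 * pi * of_int p"
  have tele: "(\<Sum>j\<in>{i..<n}. cis (real j * x)) * (cis x - 1) = cis (real n * x) - cis (real i * x)"
    using True
  proof (induction n rule: dec_induct)
    case base then show ?case by simp
  next
    case (step n)
    have "cis (real (Suc n) * x) = cis (real n * x) * cis x" by (simp add: cis_mult algebra_simps)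
    then show ?case using step by (simp add: algebra_simps)
  qed
  have "cmod (cis x - 1) = 2 * \<bar>sin (z / 2)\<bar>"
  proof -
    have "cis x = cis z" unfolding z_def by (simp add: cis_divide[symmetric] cis_multiple_2pi)
    then show ?thesis by (simp add: cmod_cis_minus_one)
  qed
  moreover have "\<bar>z\<bar> / pi \<le> \<bar>sin (z / 2)\<bar>"
  proof -
    \<comment> \<open>Jordan's inequality, from concavity of the sine on
      \<open>{0..pi}\<close>.\<close>
    have jordan: "u * (2 / pi) \<le> sin u" if "0 \<le> u" "u \<le> pi / 2" for u
    proof -
      have "concave_on {0..pi} sin"
        by (rule f''_le0_imp_concave[where f' = cos and f'' = "\<lambda>x. - sin x"])
           (auto intro!: derivative_eq_intros sin_ge_zero)
      then have "(1 - u * (2/pi)) * sin 0 + (u * (2/pi)) * sin (pi/2) \<le> sin ((1 - u * (2/pi)) *\<^sub>R 0 + (u * (2/pi)) *\<^sub>R (pi/2))"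
        using that by (intro concave_onD) (auto simp: field_simps)
      then show ?thesis using pi_gt_zero by simp
    qed
    have "\<bar>z\<bar> / 2 * (2 / pi) \<le> sin (\<bar>z\<bar> / 2)" using y by (intro jordan) (auto simp: z_def)
    also have "\<dots> \<le> \<bar>sin (z / 2)\<bar>" by (cases "z \<ge> 0") auto
    finally show ?thesis by simp
  qed
  ultimately have "2 * \<bar>z\<bar> / pi \<le> cmod (cis x - 1)" by simp
  then have "cmod (\<Sum>j\<in>{i..<n}. cis (real j * x)) * (2 * \<bar>z\<bar> / pi) \<le> cmod (\<Sum>j\<in>{i..<n}. cis (real j * x)) * cmod (cis x - 1)"
    by (intro mult_left_mono) auto
  also have "\<dots> = cmod (cis (real n * x) - cis (real i * x))" by (metis norm_mult tele)
  also have "\<dots> \<le> 2" using norm_triangle_ineq4[of "cis (real n * x)" "cis (real i * x)"] by simp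
  finally show ?thesis using pi_gt_zero by (simp add: z_def field_simps)
qed

text \<open>Since \<open>|A - Z^2| \<ge> (|Z| - a)^2\<close> with \<open>a\<close> the root of the
  positive part of \<open>A\<close>, the terms decay like inverse squares of the distance from
  \<open>|Z|\<close> to the integer \<open>n\<close>, uniformly in the real \<open>A\<close>.
  Rounding \<open>a\<close> to \<open>n\<close> costs the factor \<open>3\<close>, the two signs of
  \<open>Z\<close> the factor \<open>2\<close>.\<close>

lemma sum_inverse_quadratic:
  fixes A :: real
  assumes F: "finite F"
  shows "(\<Sum>Z\<in>F. 1 / (1 + \<bar>A - (real_of_int Z)^2\<bar>)) \<le> 6 * (emb_const 1)^2"
proof -
  define a where "a = sqrt (max A 0)"
  define n where "n = \<lfloor>a\<rfloor>"
  have a0: "0 \<le> a" and a2: "a^2 = max A 0" by (auto simp: a_def)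
  have pt: "1 / (1 + \<bar>A - (real_of_int Z)^2\<bar>) \<le> 3 * (jb (\<bar>Z\<bar> - n) powr (-1))^2" for Z
  proof -
    define m where "m = real_of_int (\<bar>Z\<bar> - n)"
    define f where "f = a - real_of_int n"
    have f: "0 \<le> f" "f \<le> 1" unfolding f_def n_def by linarith+
    have mf: "\<bar>real_of_int Z\<bar> - a = m - f" by (simp add: m_def f_def)
    have "(\<bar>real_of_int Z\<bar> - a)^2 \<le> \<bar>A - (real_of_int Z)^2\<bar>"
    proof (cases "A \<ge> 0")
      case True
      have "\<bar>A - (real_of_int Z)^2\<bar> = \<bar>(\<bar>real_of_int Z\<bar> - a) * (\<bar>real_of_int Z\<bar> + a)\<bar>"
        using a2 True by (simp add: algebra_simps power2_eq_square[symmetric] abs_minus_commute)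
      also have "\<dots> = \<bar>\<bar>real_of_int Z\<bar> - a\<bar> * (\<bar>real_of_int Z\<bar> + a)" using a0 by (simp add: abs_mult)
      also have "\<dots> \<ge> \<bar>\<bar>real_of_int Z\<bar> - a\<bar> * \<bar>\<bar>real_of_int Z\<bar> - a\<bar>"
        using a0 by (intro mult_left_mono) auto
      finally show ?thesis by (simp add: power2_eq_square)
    next
      case False
      then have "a = 0" using a2 by simp
      then show ?thesis using False by simp
    qed
    moreover have "1 + m^2 \<le> 3 * (1 + (m - f)^2)"
    proof -
      have "3 * (1 + (m - f)^2) = 1 + m^2 + (2 * (m - 3/2 * f)^2 + (2 - 3/2 * f^2))"
        by (simp add: power2_eq_square field_simps)
      moreover have "f^2 \<le> 1" using f by (simp add: power_le_one)
      ultimately show ?thesis using zero_le_power2[of "m - 3/2 * f"] by linarith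
    qed
    ultimately have "1 + m^2 \<le> 3 * (1 + \<bar>A - (real_of_int Z)^2\<bar>)" unfolding mf
      by (meson add_left_mono mult_left_mono order_trans zero_le_numeral)
    moreover have "(jb (\<bar>Z\<bar> - n) powr (-1))^2 = 1 / (1 + m^2)"
      using jb_sq[of "\<bar>Z\<bar> - n"] by (simp add: powr_minus m_def power_inverse power_one_over divide_inverse)
    moreover have "0 < 1 + m^2" by (smt (verit) zero_le_power2)
    ultimately show ?thesis by (simp add: field_simps)
  qed
  have half: "(\<Sum>Z\<in>G. (jb (\<bar>Z\<bar> - n) powr (-1))^2) \<le> (emb_const 1)^2"
    if "finite G" "inj_on (\<lambda>Z. \<bar>Z\<bar> - n) G" for G
  proof -
    have "(\<Sum>Z\<in>G. (jb (\<bar>Z\<bar> - n) powr (-1))^2) = (\<Sum>Y\<in>(\<lambda>Z. \<bar>Z\<bar> - n) ` G. (jb Y powr (-1))^2)"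
      by (subst sum.reindex[OF that(2)]) simp
    also have "\<dots> \<le> (emb_const 1)^2" using l2D[OF l2_jb_powr[of 1], of "(\<lambda>Z. \<bar>Z\<bar> - n) ` G"] that(1) by simp
    finally show ?thesis .
  qed
  have "(\<Sum>Z\<in>F. 1 / (1 + \<bar>A - (real_of_int Z)^2\<bar>)) \<le> (\<Sum>Z\<in>F. 3 * (jb (\<bar>Z\<bar> - n) powr (-1))^2)"
    by (rule sum_mono) (rule pt)
  also have "\<dots> = 3 * (\<Sum>Z\<in>F. (jb (\<bar>Z\<bar> - n) powr (-1))^2)" by (simp only: sum_distrib_left)
  also have "(\<Sum>Z\<in>F. (jb (\<bar>Z\<bar> - n) powr (-1))^2)
      = (\<Sum>Z\<in>F \<inter> {0..}. (jb (\<bar>Z\<bar> - n) powr (-1))^2) + (\<Sum>Z\<in>F - {0..}. (jb (\<bar>Z\<bar> - n) powr (-1))^2)"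
    by (rule sum.Int_Diff[OF F])
  also have "3 * ((\<Sum>Z\<in>F \<inter> {0..}. (jb (\<bar>Z\<bar> - n) powr (-1))^2) + (\<Sum>Z\<in>F - {0..}. (jb (\<bar>Z\<bar> - n) powr (-1))^2))
      \<le> 3 * ((emb_const 1)^2 + (emb_const 1)^2)"
    using F by (intro mult_left_mono add_mono half) (auto simp: inj_on_def)
  finally show ?thesis by simp
qed

text \<open>The phase \<open>\<tau>(X\<^sup>2 - Z\<^sup>2)/2\<close> may be close to a multiple of \<open>2\<pi>\<close> also away from
  \<open>Z = \<plusminus>X\<close>; the weight \<open>1 + \<tau> powr (1 - 2\<eta>) Z\<^sup>2\<close> pays for these aliased resonances, which are
  indexed by \<open>q\<close>.\<close>
lemma row_sum_bound:
  fixes X :: int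
  assumes tau: "0 < \<tau>" "\<tau> \<le> 1" and eta: "0 < \<eta>" "\<eta> \<le> 1/2" and D: "0 \<le> D" and T: "0 \<le> T"
    and F: "finite F" and W0: "\<And>Z. 0 \<le> W Z" and WT: "\<And>Z. W Z \<le> T"
    and WD: "\<And>Z. \<exists>p::int. \<bar>(real_of_int X)^2 - (real_of_int Z)^2 - 4 * pi * p / \<tau>\<bar> \<le> 2 * pi / \<tau> \<and>
      W Z \<le> D / (1 + \<bar>(real_of_int X)^2 - (real_of_int Z)^2 - 4 * pi * p / \<tau>\<bar>)"
  shows "(\<Sum>Z\<in>F. W Z / (1 + \<tau> powr (1 - 2 * \<eta>) * (real_of_int Z)^2))
    \<le> D * (6 * (emb_const 1)^2) * (3 + 1 / (2 * \<eta>)) + T * (4 * (emb_const (1/2 + \<eta>))^2)"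
proof -
  let ?om = "\<lambda>Z. 1 + \<tau> powr (1 - 2 * \<eta>) * (real_of_int Z)^2"
  define q0 where "q0 = \<lfloor>\<tau> * (real_of_int X)^2 / (4 * pi)\<rfloor>"
  define N where "N = \<lfloor>1 / \<tau>\<rfloor>"
  \<comment> \<open>\<open>cc q\<close> bounds the inverse weight on the shell \<open>q\<close>: for
    \<open>q \<ge> 1\<close> there \<open>\<tau> * Z\<^sup>2\<close> is at least \<open>q\<close>,
    so the weight is at least \<open>\<tau> powr (- (2 * \<eta>)) * q\<close>. On the shells
    \<open>q \<le> 0\<close> the trivial bound \<open>1\<close> is taken.\<close>
  define cc where "cc q = (if q \<le> 0 then 1 else \<tau> powr (2 * \<eta>) / real_of_int q)" for q :: int
  define A where "A q = (real_of_int X)^2 - 4 * pi * (q0 - q) / \<tau>" for q :: int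
  have N1: "1 \<le> N" using tau by (simp add: N_def)
  have cc0: "0 \<le> cc q" for q using tau by (simp add: cc_def)
  have om: "0 < ?om Z" for Z by (smt (verit) mult_nonneg_nonneg powr_ge_zero zero_le_power2)
  \<comment> \<open>Up to \<open>1 / \<tau>\<close> there are only about \<open>1 / \<tau>\<close>
    shells. Beyond that, resonances are not located at all: the weight alone exceeds
    \<open>|Z| powr (1 + 2 * \<eta>)\<close>, whose inverse is summable, and
    \<open>W Z \<le> T\<close> suffices.\<close>
  define F1 where "F1 = {Z\<in>F. \<bar>real_of_int Z\<bar> \<le> 1 / \<tau>}"
  define F2 where "F2 = {Z\<in>F. \<bar>real_of_int Z\<bar> > 1 / \<tau>}"
  have split: "F = F1 \<union> F2" "F1 \<inter> F2 = {}" "finite F1" "finite F2" using F by (auto simp: F1_def F2_def)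
  have small: "W Z / ?om Z \<le> (\<Sum>q\<in>{-1..N}. D * cc q * (1 / (1 + \<bar>A q - (real_of_int Z)^2\<bar>)))" if Z: "Z \<in> F1" for Z
  proof -
    obtain p :: int where p: "\<bar>(real_of_int X)^2 - (real_of_int Z)^2 - 4 * pi * p / \<tau>\<bar> \<le> 2 * pi / \<tau>"
      "W Z \<le> D / (1 + \<bar>(real_of_int X)^2 - (real_of_int Z)^2 - 4 * pi * p / \<tau>\<bar>)" using WD by blast
    \<comment> \<open>Counting from \<open>q0\<close> makes \<open>q\<close> agree with
      \<open>\<tau> * Z\<^sup>2 / (4 * pi)\<close> up to an error of at most \<open>3/2\<close>, so
      it runs from \<open>-1\<close> to \<open>N\<close> whatever \<open>X\<close> is.\<close>
    define q where "q = q0 - p"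
    have Aq: "A q - (real_of_int Z)^2 = (real_of_int X)^2 - (real_of_int Z)^2 - 4 * pi * p / \<tau>"
      by (simp add: A_def q_def)
    define x where "x = \<tau> * (real_of_int X)^2 / (4 * pi)"
    define z where "z = \<tau> * (real_of_int Z)^2 / (4 * pi)"
    have "\<bar>x - z - p\<bar> \<le> 1/2"
    proof -
      have "\<bar>x - z - p\<bar> = \<bar>(real_of_int X)^2 - (real_of_int Z)^2 - 4 * pi * p / \<tau>\<bar> * (\<tau> / (4 * pi))"
      proof -
        have "x - z - p = ((real_of_int X)^2 - (real_of_int Z)^2 - 4 * pi * p / \<tau>) * (\<tau> / (4 * pi))"
          using tau pi_gt_zero by (simp add: x_def z_def field_simps)
        moreover have "\<bar>\<tau> / (4 * pi)\<bar> = \<tau> / (4 * pi)" using tau by simp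
        ultimately show ?thesis by (simp only: abs_mult)
      qed
      also have "\<dots> \<le> 2 * pi / \<tau> * (\<tau> / (4 * pi))" using p(1) tau by (intro mult_right_mono) auto
      finally show ?thesis using tau by simp
    qed
    moreover have "real_of_int q0 \<le> x" "x < real_of_int q0 + 1" unfolding q0_def x_def by linarith+
    moreover have q: "real_of_int q = real_of_int q0 - real_of_int p" by (simp add: q_def)
    ultimately have zq: "real_of_int q - 1/2 \<le> z" "z \<le> real_of_int q + 3/2"
      unfolding q_def of_int_diff abs_le_iff by linarith+
    have z0: "0 \<le> z" using tau by (simp add: z_def)
    have "real_of_int q > -2" using zq(2) z0 by linarith
    then have q1: "-1 \<le> q" by linarith
    have "z \<le> 1 / (4 * pi * \<tau>)"
    proof -
      have "(real_of_int Z)^2 \<le> (1/\<tau>)^2" using Z tau unfolding F1_def by (auto simp: abs_le_square_iff[symmetric])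
      then have "\<tau> * (real_of_int Z)^2 \<le> \<tau> * (1/\<tau>)^2" using tau by (intro mult_left_mono) auto
      then have "\<tau> * (real_of_int Z)^2 \<le> 1/\<tau>" using tau by (simp add: power2_eq_square)
      then have "z \<le> (1/\<tau>) / (4 * pi)" unfolding z_def by (intro divide_right_mono) auto
      then show ?thesis by (simp add: mult.commute)
    qed
    also have "\<dots> \<le> 1 / (2 * \<tau>)" using tau pi_gt3 by (intro divide_left_mono) auto
    finally have "z \<le> 1 / (2 * \<tau>)" .
    moreover have "1/2 \<le> 1 / (2 * \<tau>)" using tau by simp
    ultimately have "real_of_int q \<le> 1 / (2 * \<tau>) + 1 / (2 * \<tau>)" using zq(1) by linarith
    then have "real_of_int q \<le> 1 / \<tau>" by simp
    then have qN: "q \<le> N" unfolding N_def by linarith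
    have "1 / ?om Z \<le> cc q"
    proof (cases "q \<le> 0")
      case True
      then show ?thesis using om[of Z] tau by (simp add: cc_def)
    next
      case False
      then have q: "1 \<le> real_of_int q" by simp
      have t1: "\<tau> powr (1 - 2 * \<eta>) = \<tau> powr (- (2 * \<eta>)) * \<tau>"
        using tau by (simp add: powr_diff powr_minus field_simps)
      have "real_of_int q \<le> 4 * pi * z"
      proof -
        have "real_of_int q \<le> 2 * z" using zq(1) q by linarith
        also have "\<dots> \<le> 4 * pi * z" using z0 pi_gt3 by (intro mult_right_mono) auto
        finally show ?thesis .
      qed
      also have "4 * pi * z = \<tau> * (real_of_int Z)^2" using pi_gt_zero by (simp add: z_def)
      finally have "\<tau> powr (- (2 * \<eta>)) * real_of_int q \<le> \<tau> powr (- (2 * \<eta>)) * (\<tau> * (real_of_int Z)^2)"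
        by (intro mult_left_mono) auto
      also have "\<dots> \<le> ?om Z" unfolding t1 by simp
      finally have le: "\<tau> powr (- (2 * \<eta>)) * real_of_int q \<le> ?om Z" .
      have "1 / ?om Z \<le> 1 / (\<tau> powr (- (2 * \<eta>)) * real_of_int q)"
        using le q tau om[of Z] by (intro divide_left_mono mult_pos_pos) auto
      also have "\<dots> = cc q" using False tau by (simp add: cc_def powr_minus field_simps)
      finally show ?thesis .
    qed
    then have "W Z * (1 / ?om Z) \<le> D / (1 + \<bar>A q - (real_of_int Z)^2\<bar>) * cc q"
      using p(2) W0[of Z] om[of Z] D unfolding Aq[symmetric]
      by (intro mult_mono) auto
    also have "\<dots> = D * cc q * (1 / (1 + \<bar>A q - (real_of_int Z)^2\<bar>))" by simp
    also have "\<dots> \<le> (\<Sum>q\<in>{-1..N}. D * cc q * (1 / (1 + \<bar>A q - (real_of_int Z)^2\<bar>)))"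
      using q1 qN D cc0 by (intro member_le_sum) auto
    finally show ?thesis by simp
  qed
  have "(\<Sum>Z\<in>F1. W Z / ?om Z) \<le> (\<Sum>Z\<in>F1. \<Sum>q\<in>{-1..N}. D * cc q * (1 / (1 + \<bar>A q - (real_of_int Z)^2\<bar>)))"
    by (rule sum_mono) (rule small)
  also have "\<dots> = (\<Sum>q\<in>{-1..N}. D * cc q * (\<Sum>Z\<in>F1. 1 / (1 + \<bar>A q - (real_of_int Z)^2\<bar>)))"
    by (subst sum.swap) (simp only: sum_distrib_left)
  also have "\<dots> \<le> (\<Sum>q\<in>{-1..N}. D * cc q * (6 * (emb_const 1)^2))"
    using D cc0 split by (intro sum_mono mult_left_mono sum_inverse_quadratic) auto
  also have "\<dots> = D * (6 * (emb_const 1)^2) * (\<Sum>q\<in>{-1..N}. cc q)"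
    unfolding sum_distrib_left by (intro sum.cong refl) simp
  also have "(\<Sum>q\<in>{-1..N}. cc q) \<le> 3 + 1 / (2 * \<eta>)"
  proof -
    have "{-1..N} = {-1, 0} \<union> {1..N}" using N1 by auto
    then have "(\<Sum>q\<in>{-1..N}. cc q) = (\<Sum>q\<in>{-1,0}. cc q) + (\<Sum>q\<in>{1..N}. cc q)"
      by (simp add: sum.union_disjoint)
    also have "\<dots> = 2 + \<tau> powr (2 * \<eta>) * (\<Sum>q\<in>{1..N}. 1 / real_of_int q)"
      by (simp add: cc_def sum_distrib_left)
    also have "(\<Sum>q\<in>{1..N}. 1 / real_of_int q) = harm (nat N)"
    proof -
      have "{1..N} = int ` {1..nat N}" using N1 image_int_atLeastAtMost[of 1 "nat N"] by simp
      then have "(\<Sum>q\<in>{1..N}. 1 / real_of_int q) = (\<Sum>q\<in>int ` {1..nat N}. 1 / real_of_int q)" by simp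
      also have "\<dots> = harm (nat N)" by (subst sum.reindex) (auto simp: harm_def inverse_eq_divide)
      finally show ?thesis .
    qed
    \<comment> \<open>The sum over the shells is only logarithmic in \<open>1 / \<tau>\<close>; the
      factor \<open>\<tau> powr (2 * \<eta>)\<close> absorbs it at the price
      \<open>1 / (2 * \<eta>)\<close>.\<close>
    also have "\<tau> powr (2 * \<eta>) * harm (nat N) \<le> \<tau> powr (2 * \<eta>) * (1 + ln (1 / \<tau>))"
    proof (rule mult_left_mono)
      have "harm (nat N) \<le> ln (real (nat N)) + (1::real)"
      proof -
        obtain l where l: "nat N = Suc l" using N1 by (cases "nat N") auto
        show ?thesis using decseqD[OF decseq_harm_diff_ln, of 0 l] unfolding l by (simp add: harm_def)
      qed
      also have "ln (real (nat N)) \<le> ln (1 / \<tau>)" using N1 tau unfolding N_def by (intro ln_mono) auto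
      finally show "harm (nat N) \<le> 1 + ln (1 / \<tau>)" by simp
    qed simp
    also have "\<tau> powr (2 * \<eta>) * (1 + ln (1 / \<tau>)) \<le> 1 + 1 / (2 * \<eta>)"
    proof -
      have "ln (1 / \<tau>) \<le> (1 / \<tau>) powr (2 * \<eta>) / (2 * \<eta>)"
        using tau eta by (intro ln_powr_bound) auto
      then have "\<tau> powr (2 * \<eta>) * ln (1 / \<tau>) \<le> \<tau> powr (2 * \<eta>) * ((1 / \<tau>) powr (2 * \<eta>) / (2 * \<eta>))"
        by (intro mult_left_mono) auto
      also have "\<dots> = 1 / (2 * \<eta>)" using tau by (simp add: powr_divide)
      finally have "\<tau> powr (2 * \<eta>) * ln (1 / \<tau>) \<le> 1 / (2 * \<eta>)" .
      moreover have "\<tau> powr (2 * \<eta>) \<le> 1" using tau eta by (intro powr_le1) auto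
      ultimately show ?thesis by (simp add: algebra_simps)
    qed
    finally show ?thesis by simp
  qed
  finally have S1: "(\<Sum>Z\<in>F1. W Z / ?om Z) \<le> D * (6 * (emb_const 1)^2) * (3 + 1 / (2 * \<eta>))"
    using D by (simp add: mult_left_mono)
  have "(\<Sum>Z\<in>F2. W Z / ?om Z) \<le> (\<Sum>Z\<in>F2. T * (4 * (jb Z powr (- (1/2 + \<eta>)))^2))"
  proof (rule sum_mono)
    fix Z assume "Z \<in> F2"
    then have Z: "1 / \<tau> < \<bar>real_of_int Z\<bar>" by (simp add: F2_def)
    have a1: "1 \<le> 1 / \<tau>" using tau by simp
    have Z0: "0 < \<bar>real_of_int Z\<bar>" using Z a1 by linarith
    have t: "\<bar>real_of_int Z\<bar> powr (1 + 2 * \<eta>) \<le> ?om Z"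
    proof -
      have "(1 / \<tau>) powr (1 - 2 * \<eta>) \<le> \<bar>real_of_int Z\<bar> powr (1 - 2 * \<eta>)"
        using Z a1 eta tau by (intro powr_mono2) auto
      then have "1 \<le> \<tau> powr (1 - 2 * \<eta>) * \<bar>real_of_int Z\<bar> powr (1 - 2 * \<eta>)"
        using tau by (simp add: powr_divide field_simps)
      then have "\<bar>real_of_int Z\<bar> powr (1 + 2 * \<eta>) * 1
         \<le> \<bar>real_of_int Z\<bar> powr (1 + 2 * \<eta>) * (\<tau> powr (1 - 2 * \<eta>) * \<bar>real_of_int Z\<bar> powr (1 - 2 * \<eta>))"
        by (intro mult_left_mono) auto
      also have "\<dots> = \<tau> powr (1 - 2 * \<eta>) * (\<bar>real_of_int Z\<bar> powr (1 + 2 * \<eta>) * \<bar>real_of_int Z\<bar> powr (1 - 2 * \<eta>))"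
        by simp
      also have "\<bar>real_of_int Z\<bar> powr (1 + 2 * \<eta>) * \<bar>real_of_int Z\<bar> powr (1 - 2 * \<eta>) = (real_of_int Z)^2"
        using Z0 by (simp flip: powr_add add: powr_numeral)
      finally show ?thesis by simp
    qed
    have "W Z / ?om Z \<le> T / \<bar>real_of_int Z\<bar> powr (1 + 2 * \<eta>)"
      using t Z0 WT[of Z] W0[of Z] T by (intro frac_le) auto
    also have "\<dots> = T * \<bar>real_of_int Z\<bar> powr (- (1 + 2 * \<eta>))" by (simp only: powr_minus divide_inverse)
    also have "\<dots> \<le> T * (4 * (jb Z powr (- (1/2 + \<eta>)))^2)"
    proof (rule mult_left_mono)
      have "jb Z \<le> 2 * \<bar>real_of_int Z\<bar>" using Z0 by (intro jb_le_abs) auto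
      then have "(2 * \<bar>real_of_int Z\<bar>) powr (- (1 + 2 * \<eta>)) \<le> jb Z powr (- (1 + 2 * \<eta>))"
        using eta by (intro powr_mono2') auto
      then have "2 powr (- (1 + 2 * \<eta>)) * \<bar>real_of_int Z\<bar> powr (- (1 + 2 * \<eta>)) \<le> jb Z powr (- (1 + 2 * \<eta>))"
        by (simp add: powr_mult)
      moreover have "1/4 \<le> (2::real) powr (- (1 + 2 * \<eta>))"
      proof -
        have "(2::real) powr (-2) \<le> 2 powr (- (1 + 2 * \<eta>))" using eta by (intro powr_mono) auto
        then show ?thesis by (simp add: powr_minus powr_numeral)
      qed
      then have "1/4 * \<bar>real_of_int Z\<bar> powr (- (1 + 2 * \<eta>)) \<le> 2 powr (- (1 + 2 * \<eta>)) * \<bar>real_of_int Z\<bar> powr (- (1 + 2 * \<eta>))"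
        by (intro mult_right_mono) auto
      ultimately have "\<bar>real_of_int Z\<bar> powr (- (1 + 2 * \<eta>)) \<le> 4 * jb Z powr (- (1 + 2 * \<eta>))" by linarith
      also have "jb Z powr (- (1 + 2 * \<eta>)) = (jb Z powr (- (1/2 + \<eta>)))^2"
        by (simp add: power2_eq_square flip: powr_add)
      finally show "\<bar>real_of_int Z\<bar> powr (- (1 + 2 * \<eta>)) \<le> 4 * (jb Z powr (- (1/2 + \<eta>)))^2" .
    qed (rule T)
    finally show "W Z / ?om Z \<le> T * (4 * (jb Z powr (- (1/2 + \<eta>)))^2)" .
  qed
  also have "\<dots> = T * (4 * (\<Sum>Z\<in>F2. (jb Z powr (- (1/2 + \<eta>)))^2))" by (simp only: sum_distrib_left)
  also have "\<dots> \<le> T * (4 * (emb_const (1/2 + \<eta>))^2)"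
    using T eta split by (intro mult_left_mono l2D l2_jb_powr) auto
  finally have S2: "(\<Sum>Z\<in>F2. W Z / ?om Z) \<le> T * (4 * (emb_const (1/2 + \<eta>))^2)" .
  have "(\<Sum>Z\<in>F. W Z / ?om Z) = (\<Sum>Z\<in>F1. W Z / ?om Z) + (\<Sum>Z\<in>F2. W Z / ?om Z)"
    unfolding split(1) using split by (intro sum.union_disjoint) auto
  then show ?thesis using S1 S2 by simp
qed


context adm
begin

text \<open>A weighted Schur test. The kernel \<open>W / sqrt om\<close> is split into
  \<open>sqrt (W / om)\<close> and \<open>sqrt W\<close>. The square of the first is summed over
  \<open>k2\<close> by the row bound at fixed \<open>k\<close>, \<open>k1\<close>; in the second,
  \<open>W\<close> is bounded by \<open>T\<close> and the summation over \<open>k\<close> is paid by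
  \<open>1 / jb k\<close>. Thus all three functions need only be square summable.\<close>

lemma schur_form:
  assumes F: "finite F" and W0: "\<And>x. 0 \<le> W x" and WT: "\<And>x. W x \<le> T" and om: "\<And>x. 0 < om x"
    and R: "0 \<le> R" and row: "\<And>k k1 G. finite G \<Longrightarrow> (\<Sum>k2\<in>G. W (k, k1, k2) / om (k, k1, k2)) \<le> R"
    and w: "\<And>k. 0 \<le> w k" "l2 w 1" and A: "l2 A P" "\<And>k. 0 \<le> A k" and B: "l2 B Q" "\<And>k. 0 \<le> B k"
    and C: "l2 C S" "\<And>k. 0 \<le> C k"
  shows "(\<Sum>x\<in>F. w (fst x) / jb (fst x) * (W x / sqrt (om x)) * A (q1 x) * B (q2 x) * C (q3 x))
     \<le> sqrt R * sqrt T * emb_const 1 * (P * Q * S)"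
proof -
  have nn: "0 \<le> P" "0 \<le> Q" "0 \<le> S"
    using l2_nonneg[OF A(1)] l2_nonneg[OF B(1)] l2_nonneg[OF C(1)] by auto
  have T0: "0 \<le> T" using W0 WT order_trans by blast
  let ?f = "\<lambda>x. w (fst x) * A (q1 x) * sqrt (W x / om x)"
  let ?g = "\<lambda>x. jb (fst x) powr (-1) * sqrt (W x) * (B (q2 x) * C (q3 x))"
  have "(\<Sum>x\<in>F. w (fst x) / jb (fst x) * (W x / sqrt (om x)) * A (q1 x) * B (q2 x) * C (q3 x)) = (\<Sum>x\<in>F. \<bar>?f x\<bar> * \<bar>?g x\<bar>)"
  proof (rule sum.cong[OF refl])
    fix x
    have s: "sqrt (W x / om x) * sqrt (W x) = W x / sqrt (om x)"
      using W0[of x] by (simp add: real_sqrt_divide)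
    have "\<bar>?f x\<bar> * \<bar>?g x\<bar> = ?f x * ?g x" using w A B C W0[of x] om[of x] by (simp add: abs_mult)
    also have "\<dots> = w (fst x) / jb (fst x) * (sqrt (W x / om x) * sqrt (W x)) * A (q1 x) * B (q2 x) * C (q3 x)"
      by (simp add: powr_minus divide_inverse)
    finally show "w (fst x) / jb (fst x) * (W x / sqrt (om x)) * A (q1 x) * B (q2 x) * C (q3 x) = \<bar>?f x\<bar> * \<bar>?g x\<bar>"
      unfolding s by simp
  qed
  also have "\<dots> \<le> L2_set ?f F * L2_set ?g F" by (rule L2_set_mult_ineq)
  also have "\<dots> \<le> sqrt (R * P^2) * sqrt (T * ((emb_const 1)^2 * (Q^2 * S^2)))"
  proof (rule mult_mono)
    have "(\<Sum>x\<in>F. (?f x)^2) = (\<Sum>x\<in>F. (w (fst x))^2 * (A (q1 x))^2 * (W x / om x))"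
      using W0 om by (simp add: power_mult_distrib less_imp_le)
    also have "\<dots> \<le> (\<Sum>x\<in>fst ` F \<times> q1 ` F \<times> q2 ` F. (w (fst x))^2 * (A (q1 x))^2 * (W x / om x))"
    proof (rule sum_mono2)
      show "F \<subseteq> fst ` F \<times> q1 ` F \<times> q2 ` F" by (auto simp: image_iff) force+
    qed (use F W0 om in \<open>auto simp: less_imp_le\<close>)
    also have "\<dots> = (\<Sum>k\<in>fst ` F. \<Sum>k1\<in>q1 ` F. (w k)^2 * (A k1)^2 * (\<Sum>k2\<in>q2 ` F. W (k, k1, k2) / om (k, k1, k2)))"
      by (simp add: sum.cartesian_product' sum_distrib_left split_def)
    also have "\<dots> \<le> (\<Sum>k\<in>fst ` F. \<Sum>k1\<in>q1 ` F. (w k)^2 * (A k1)^2 * R)"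
      using F by (intro sum_mono mult_left_mono row) auto
    also have "\<dots> = R * ((\<Sum>k\<in>fst ` F. (w k)^2) * (\<Sum>k1\<in>q1 ` F. (A k1)^2))"
      unfolding sum_product by (simp add: sum_distrib_left algebra_simps)
    also have "\<dots> \<le> R * (1^2 * P^2)"
      using F R by (intro mult_left_mono mult_mono l2D[OF w(2)] l2D[OF A(1)]) (auto intro: sum_nonneg)
    finally show "L2_set ?f F \<le> sqrt (R * P^2)" by (simp add: L2_set_def)
    have "(\<Sum>x\<in>F. (?g x)^2) = (\<Sum>x\<in>F. W x * ((jb (fst x) powr (-1))^2 * ((B (q2 x))^2 * (C (q3 x))^2)))"
      using W0 by (intro sum.cong refl) (simp add: power_mult_distrib power_divide)
    also have "\<dots> \<le> (\<Sum>x\<in>F. T * ((jb (fst x) powr (-1))^2 * ((B (q2 x))^2 * (C (q3 x))^2)))"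
      by (intro sum_mono mult_right_mono WT) auto
    also have "\<dots> = T * (\<Sum>x\<in>F. (jb (fst x) powr (-1))^2 * ((B (q2 x))^2 * (C (q3 x))^2))"
      by (simp only: sum_distrib_left)
    also have "\<dots> \<le> T * ((emb_const 1)^2 * (Q^2 * S^2))"
      using sum_triple_le[OF F triple_inj'(3) l2_imp_l1_sq[OF l2_jb_powr[of 1]] l2_imp_l1_sq[OF B(1)] l2_imp_l1_sq[OF C(1)]] T0
      by (intro mult_left_mono) auto
    finally show "L2_set ?g F \<le> sqrt (T * ((emb_const 1)^2 * (Q^2 * S^2)))" by (simp add: L2_set_def)
  qed (use R T0 in \<open>auto intro!: mult_nonneg_nonneg L2_set_nonneg\<close>)
  also have "\<dots> = sqrt R * sqrt T * emb_const 1 * (P * Q * S)"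
    using nn emb_const_nonneg[of 1] by (simp add: real_sqrt_mult)
  finally show ?thesis .
qed

text \<open>The regularity left over for summing the aliased shells. It is chosen so that
  \<open>\<theta> + eta + 1/2 \<le> \<gamma>\<close>, the number of derivatives that
  \<open>hard_weight\<close> puts on each of two factors; for \<open>\<gamma> = 1\<close> equality
  holds.\<close>

definition eta :: real where
  "eta = (if \<gamma> = 1 then 1/2 - \<theta> else min (1/2) (\<gamma> - 3/2))"

lemma eta: "0 < eta" "eta \<le> 1/2" "1/2 \<le> \<theta> + eta" "\<theta> + eta \<le> 3/2" "\<theta> + eta + 1/2 \<le> \<gamma>"
  using adm by (auto simp: eta_def min_def)

text \<open>The frequencies where \<open>\<bar>k\<^sub>1\<bar> / \<bar>k\<bar>\<close> in the local error is unbounded: there the \<open>L\<^sup>2\<close> bound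
  comes only from oscillation in the time step index.\<close>
definition hard :: "int \<Rightarrow> int \<Rightarrow> bool" where
  "hard k k1 \<longleftrightarrow> k \<noteq> 0 \<and> 4 * \<bar>k\<bar> < \<bar>k1\<bar>"

lemma min_le_powr: "0 \<le> x \<Longrightarrow> 0 \<le> s \<Longrightarrow> s \<le> 1 \<Longrightarrow> min 1 x \<le> x powr (s::real)"
proof -
  assume a: "0 \<le> x" "0 \<le> s" "s \<le> 1"
  consider "x = 0" | "0 < x" "x \<le> 1" | "1 < x" using a by linarith
  then show ?thesis
  proof cases
    case 2
    then have "x powr 1 \<le> x powr s" using a by (intro powr_mono') auto
    then show ?thesis using 2 by simp
  next
    case 3
    then show ?thesis using ge_one_powr_ge_zero[of x s] a by simp
  qed auto
qed

text \<open>As \<open>|k|\<close> is small against \<open>|k1|\<close>, at least two of the three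
  frequencies are comparable to or larger than \<open>N\<close>, the larger of \<open>|k2|\<close>
  and \<open>|k3|\<close>. The whole loss is a power \<open>N powr (2 * g)\<close> and is shared
  equally by two such factors. The third carries no derivative and may be measured in
  \<open>L^2\<close>.\<close>

lemma hard_weight:
  fixes k k1 k2 :: int and \<tau> :: real
  assumes h: "hard k k1" and tau: "0 < \<tau>" "\<tau> \<le> 1"
  defines "k3 \<equiv> k - k1 - k2" and "g \<equiv> \<theta> + eta + 1/2"
  shows "\<bar>real_of_int k1\<bar> * min 1 (\<tau> * \<bar>real_of_int k2 * real_of_int k3\<bar>)
      * sqrt (1 + \<tau> powr (1 - 2 * eta) * (real_of_int (k2 - k3))^2)
    \<le> 9 * 3 powr \<gamma> * \<tau> powr \<theta> *
      (jb k1 powr g * jb k2 powr g + jb k1 powr g * jb k3 powr g + jb k2 powr g * jb k3 powr g)"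
proof (cases "k2 = 0 \<or> k3 = 0")
  case True
  then have *: "\<bar>real_of_int k1\<bar> * min 1 (\<tau> * \<bar>real_of_int k2 * real_of_int k3\<bar>) = 0" by auto
  show ?thesis unfolding * by simp
next
  case False
  define N where "N = max \<bar>real_of_int k2\<bar> \<bar>real_of_int k3\<bar>"
  have N1: "1 \<le> N" using False by (auto simp: N_def max_def)
  have kk: "k = k1 + k2 + k3" by (simp add: k3_def)
  have k1k: "4 * \<bar>real_of_int k\<bar> < \<bar>real_of_int k1\<bar>" 
  proof -
    have "real_of_int (4 * \<bar>k\<bar>) < real_of_int \<bar>k1\<bar>"
      using h unfolding hard_def of_int_less_iff by blast
    then show ?thesis by simp
  qed
  have rk: "real_of_int k = real_of_int k1 + real_of_int k2 + real_of_int k3" using kk by simp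
  have k1N: "\<bar>real_of_int k1\<bar> \<le> 3 * N" using k1k rk unfolding N_def by linarith
  have Z: "\<bar>real_of_int (k2 - k3)\<bar> \<le> 2 * N" unfolding N_def by simp
  define \<kappa> where "\<kappa> = \<tau> * N^2"
  have kp: "0 < \<kappa>" using tau N1 by (simp add: \<kappa>_def)
  have mk: "min 1 (\<tau> * \<bar>real_of_int k2 * real_of_int k3\<bar>) \<le> min 1 \<kappa>"
  proof -
    have "\<bar>real_of_int k2 * real_of_int k3\<bar> \<le> N^2"
      unfolding power2_eq_square abs_mult by (intro mult_mono) (auto simp: N_def)
    then have "\<tau> * \<bar>real_of_int k2 * real_of_int k3\<bar> \<le> \<kappa>" unfolding \<kappa>_def using tau by (intro mult_left_mono) auto
    then show ?thesis by (rule min.mono[OF order_refl])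
  qed
  have t2: "\<tau> powr (1 - 2 * eta) = (\<tau> powr (1/2 - eta))^2"
    by (simp add: power2_eq_square flip: powr_add)
  have so: "sqrt (1 + \<tau> powr (1 - 2 * eta) * (real_of_int (k2 - k3))^2) \<le> 1 + \<tau> powr (1/2 - eta) * (2 * N)"
  proof (rule real_le_lsqrt)
    have p: "0 \<le> \<tau> powr (1/2 - eta) * N" using N1 by simp
    have "(real_of_int (k2 - k3))^2 \<le> (2 * N)^2" using power_mono[OF Z, of 2] by simp
    then have "\<tau> powr (1 - 2 * eta) * (real_of_int (k2 - k3))^2 \<le> \<tau> powr (1 - 2 * eta) * (2 * N)^2"
      by (intro mult_left_mono) auto
    then show "1 + \<tau> powr (1 - 2 * eta) * (real_of_int (k2 - k3))^2 \<le> (1 + \<tau> powr (1/2 - eta) * (2 * N))^2"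
      unfolding t2 using N1 by (simp add: power2_sum power_mult_distrib) (use p in linarith)
  qed (use N1 in auto)
  have p1: "min 1 \<kappa> \<le> \<tau> powr \<theta> * N powr (2 * (\<theta> + eta))"
  proof -
    have "min 1 \<kappa> \<le> \<kappa> powr \<theta>" using kp theta_pos theta_le1 by (intro min_le_powr) auto
    also have "\<dots> = \<tau> powr \<theta> * N powr (2 * \<theta>)"
      using N1 tau by (simp add: \<kappa>_def powr_mult powr_powr flip: powr_numeral)
    also have "\<dots> \<le> \<tau> powr \<theta> * N powr (2 * (\<theta> + eta))"
      using N1 eta(1) by (intro mult_left_mono powr_mono) auto
    finally show ?thesis .
  qed
  have p2: "min 1 \<kappa> * (\<tau> powr (1/2 - eta) * N) \<le> \<tau> powr \<theta> * N powr (2 * (\<theta> + eta))"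
  proof -
    have e1: "\<tau> powr (1/2 - eta) * N = \<kappa> powr (1/2) * \<tau> powr (- eta)"
    proof -
      have "\<kappa> powr (1/2) = \<tau> powr (1/2) * N"
        using N1 tau by (simp add: \<kappa>_def powr_mult powr_powr flip: powr_numeral)
      moreover have "\<tau> powr (1/2 - eta) = \<tau> powr (1/2) * \<tau> powr (- eta)"
        by (simp flip: powr_add)
      ultimately show ?thesis by simp
    qed
    \<comment> \<open>The exponent lies between \<open>0\<close> and \<open>1\<close> by the bounds
      on \<open>eta\<close>; the root of the weight contributes the missing
      \<open>\<kappa> powr (1/2)\<close>, up to \<open>\<tau> powr (- eta)\<close>.\<close>
    have "min 1 \<kappa> \<le> \<kappa> powr (\<theta> + eta - 1/2)" using kp eta by (intro min_le_powr) auto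
    then have "min 1 \<kappa> * (\<tau> powr (1/2 - eta) * N) \<le> \<kappa> powr (\<theta> + eta - 1/2) * (\<kappa> powr (1/2) * \<tau> powr (- eta))"
      unfolding e1 by (intro mult_right_mono) auto
    also have "\<dots> = \<kappa> powr (\<theta> + eta) * \<tau> powr (- eta)"
      by (simp add: mult.assoc[symmetric] flip: powr_add)
    also have "\<dots> = \<tau> powr (\<theta> + eta) * \<tau> powr (- eta) * N powr (2 * (\<theta> + eta))"
      using N1 tau by (simp add: \<kappa>_def powr_mult powr_powr algebra_simps flip: powr_numeral)
    also have "\<tau> powr (\<theta> + eta) * \<tau> powr (- eta) = \<tau> powr \<theta>" by (simp flip: powr_add)
    finally show ?thesis .
  qed
  have g: "N powr (2 * g) = N * N powr (2 * (\<theta> + eta))"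
    using N1 by (simp add: g_def powr_add distrib_left)
  have "\<bar>real_of_int k1\<bar> * min 1 (\<tau> * \<bar>real_of_int k2 * real_of_int k3\<bar>)
      * sqrt (1 + \<tau> powr (1 - 2 * eta) * (real_of_int (k2 - k3))^2)
    \<le> (3 * N) * min 1 \<kappa> * (1 + \<tau> powr (1/2 - eta) * (2 * N))"
    using k1N mk so N1 tau kp by (intro mult_mono) auto
  also have "\<dots> = (3 * N) * (min 1 \<kappa> + 2 * (min 1 \<kappa> * (\<tau> powr (1/2 - eta) * N)))" by (simp add: algebra_simps)
  also have "\<dots> \<le> (3 * N) * (\<tau> powr \<theta> * N powr (2 * (\<theta> + eta)) + 2 * (\<tau> powr \<theta> * N powr (2 * (\<theta> + eta))))"
    using p1 p2 N1 by (intro mult_left_mono add_mono) auto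
  also have "\<dots> = 9 * \<tau> powr \<theta> * N powr (2 * g)" unfolding g by simp
  also have "N powr (2 * g) \<le> 3 powr \<gamma> * (jb k1 powr g * jb k2 powr g + jb k1 powr g * jb k3 powr g + jb k2 powr g * jb k3 powr g)"
  proof -
    have g0: "0 \<le> g" "g \<le> \<gamma>" using eta theta_pos by (auto simp: g_def)
    have key: "N powr (2 * g) \<le> 3 powr \<gamma> * (jb i powr g * jb j powr g)"
      if "N \<le> \<bar>real_of_int i\<bar>" "N \<le> 3 * \<bar>real_of_int j\<bar>" for i j
    proof -
      have "N powr g \<le> jb i powr g" using that(1) abs_le_jb[of i] N1 g0 by (intro powr_mono2) auto
      moreover have "N powr g \<le> (3 * jb j) powr g" using that(2) abs_le_jb[of j] N1 g0 by (intro powr_mono2) auto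
      moreover have "(3 * jb j) powr g \<le> 3 powr \<gamma> * jb j powr g"
        unfolding powr_mult using g0 by (intro mult_right_mono powr_mono) auto
      ultimately have "N powr g * N powr g \<le> jb i powr g * (3 powr \<gamma> * jb j powr g)"
        by (intro mult_mono) auto
      then show ?thesis by (simp add: algebra_simps flip: powr_add)
    qed
    define K where "K i j = 3 powr \<gamma> * (jb i powr g * jb j powr g)" for i j
    have K: "0 \<le> K i j" "K i j = K j i" for i j by (simp_all add: K_def)
    have "N powr (2 * g) \<le> K k1 k2 + K k1 k3 + K k2 k3"
    proof -
      consider "N \<le> \<bar>real_of_int k2\<bar>" "N \<le> 3 * \<bar>real_of_int k1\<bar>" | "N \<le> \<bar>real_of_int k2\<bar>" "N \<le> 3 * \<bar>real_of_int k3\<bar>"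
        | "N \<le> \<bar>real_of_int k3\<bar>" "N \<le> 3 * \<bar>real_of_int k1\<bar>" | "N \<le> \<bar>real_of_int k3\<bar>" "N \<le> 3 * \<bar>real_of_int k2\<bar>"
        using k1k rk unfolding N_def by linarith
      then have "N powr (2 * g) \<le> K k1 k2 \<or> N powr (2 * g) \<le> K k1 k3 \<or> N powr (2 * g) \<le> K k2 k3"
        using key unfolding K_def[symmetric] by cases (metis K(2))+
      then show ?thesis using K(1)[of k1 k2] K(1)[of k1 k3] K(1)[of k2 k3] by linarith
    qed
    then show ?thesis unfolding K_def by (simp add: distrib_left)
  qed
  finally show ?thesis using tau by (simp add: mult_left_mono algebra_simps)
qed

text \<open>With \<open>X = k + k1\<close> and \<open>Z\<close> the difference of the two
  unconjugated frequencies, twice the phase is \<open>X\<^sup>2 - Z\<^sup>2\<close>. For fixed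
  \<open>k\<close>, \<open>k1\<close> only \<open>Z\<close> varies, which is the situation of
  \<open>row_sum_bound\<close>.\<close>

lemma double_phi: "2 * phi k k1 k2 = (k + k1)^2 - (k2 - (k - k1 - k2))^2"
  unfolding phi_factor by (simp add: power2_eq_square algebra_simps)

text \<open>\<open>2 * pi * p\<close> is a multiple of \<open>2 * pi\<close> nearest to
  \<open>\<tau> * phi k k1 k2\<close>. The trivial bound by the number of terms and the bound by the
  distance are added, which gives a single quotient that is valid both at and away from
  resonance.\<close>

lemma geometric_phi_bound:
  fixes k k1 k2 :: int and i n :: nat and \<tau> T :: real
  assumes tau: "0 < \<tau>" and n: "real n * \<tau> \<le> T"
  defines "G \<equiv> cmod (\<Sum>j\<in>{i..<n}. cis (real j * \<tau> * real_of_int (phi k k1 k2)))"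
  shows "\<tau> * G \<le> T"
    and "\<exists>p::int. \<bar>(real_of_int (k + k1))^2 - (real_of_int (k2 - (k - k1 - k2)))^2 - 4 * pi * p / \<tau>\<bar> \<le> 2 * pi / \<tau> \<and>
      \<tau> * G \<le> 2 * (T + pi) / (1 + \<bar>(real_of_int (k + k1))^2 - (real_of_int (k2 - (k - k1 - k2)))^2 - 4 * pi * p / \<tau>\<bar>)"
proof -
  have "G \<le> (\<Sum>j\<in>{i..<n}. cmod (cis (real j * \<tau> * real_of_int (phi k k1 k2))))" unfolding G_def by (rule norm_sum)
  also have "\<dots> \<le> real n" by simp
  finally have "\<tau> * G \<le> \<tau> * real n" using tau by (intro mult_left_mono) auto
  then show GT: "\<tau> * G \<le> T" using n by (simp add: mult.commute)
  define x where "x = \<tau> * real_of_int (phi k k1 k2)"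
  define p where "p = round (x / (2 * pi))"
  have G0: "0 \<le> G" by (simp add: G_def)
  have xp: "\<bar>x - 2 * pi * p\<bar> \<le> pi"
  proof -
    have "\<bar>of_int p - x / (2 * pi)\<bar> \<le> 1/2" unfolding p_def by (rule of_int_round_abs_le)
    then have "\<bar>of_int p - x / (2 * pi)\<bar> * (2 * pi) \<le> 1/2 * (2 * pi)" by (intro mult_right_mono) auto
    also have "\<bar>of_int p - x / (2 * pi)\<bar> * (2 * pi) = \<bar>(of_int p - x / (2 * pi)) * (2 * pi)\<bar>" by (simp add: abs_mult)
    also have "(of_int p - x / (2 * pi)) * (2 * pi) = - (x - 2 * pi * p)" by (simp add: field_simps)
    finally show ?thesis by simp
  qed
  have "G = cmod (\<Sum>j\<in>{i..<n}. cis (real j * x))" unfolding G_def x_def by (simp add: mult.assoc)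
  then have Gx: "G * \<bar>x - 2 * pi * p\<bar> \<le> pi" using geometric_cis_bound[OF xp] by simp
  define Y where "Y = (real_of_int (k + k1))^2 - (real_of_int (k2 - (k - k1 - k2)))^2 - 4 * pi * p / \<tau>"
  have "2 * real_of_int (phi k k1 k2) = (real_of_int (k + k1))^2 - (real_of_int (k2 - (k - k1 - k2)))^2"
    using arg_cong[OF double_phi[of k k1 k2], of real_of_int] by simp
  then have "Y = 2 * real_of_int (phi k k1 k2) - 4 * pi * p / \<tau>" unfolding Y_def by simp
  then have Y: "Y * \<tau> = 2 * (x - 2 * pi * p)" unfolding x_def using tau by (simp add: field_simps)
  have Yx: "\<bar>Y\<bar> * \<tau> = 2 * \<bar>x - 2 * pi * p\<bar>"
  proof -
    have "\<bar>Y\<bar> * \<tau> = \<bar>Y * \<tau>\<bar>" using tau by (simp add: abs_mult)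
    also have "\<dots> = 2 * \<bar>x - 2 * pi * p\<bar>" unfolding Y abs_mult by simp
    finally show ?thesis .
  qed
  have "\<bar>Y\<bar> * \<tau> \<le> 2 * pi" using xp Yx by simp
  then have 1: "\<bar>Y\<bar> \<le> 2 * pi / \<tau>" using tau by (simp add: field_simps)
  have "\<tau> * G * (1 + \<bar>Y\<bar>) = \<tau> * G + G * (\<bar>Y\<bar> * \<tau>)" by (simp add: algebra_simps)
  also have "\<dots> \<le> T + 2 * pi" using GT Gx unfolding Yx by linarith
  also have "\<dots> \<le> 2 * (T + pi)" using order_trans[OF mult_nonneg_nonneg[OF less_imp_le[OF tau] G0] GT] by simp
  finally have "\<tau> * G \<le> 2 * (T + pi) / (1 + \<bar>Y\<bar>)" by (simp add: pos_le_divide_eq)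
  with 1 show "\<exists>p::int. \<bar>(real_of_int (k + k1))^2 - (real_of_int (k2 - (k - k1 - k2)))^2 - 4 * pi * p / \<tau>\<bar> \<le> 2 * pi / \<tau> \<and>
      \<tau> * G \<le> 2 * (T + pi) / (1 + \<bar>(real_of_int (k + k1))^2 - (real_of_int (k2 - (k - k1 - k2)))^2 - 4 * pi * p / \<tau>\<bar>)"
    unfolding Y_def by blast
qed

definition rconst :: "real \<Rightarrow> real" where
  "rconst T = 2 * (T + pi) * (6 * (emb_const 1)^2) * (3 + 1 / (2 * eta)) + T * (4 * (emb_const (1/2 + eta))^2)"

definition sconst :: "real \<Rightarrow> real" where
  "sconst T = 36 * 3 powr \<gamma> * (3 * (sqrt (rconst T) * sqrt T * emb_const 1))"

lemma sconst_nonneg: "0 \<le> T \<Longrightarrow> 0 \<le> sconst T"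
  unfolding sconst_def rconst_def using eta(1) emb_const_nonneg
  by (intro mult_nonneg_nonneg) auto

text \<open>Since the sequences are the same at all times, the time sum acts on the multiplier alone
  and becomes a geometric sum. The factor \<tau> of \<open>m\<close> turns it into \<open>W\<close>,
  and the rest of \<open>m\<close> times the root of the weight is bounded by
  \<open>hard_weight\<close>. Its three products assign \<open>\<mu>\<close> to each of the factors
  in turn.\<close>

lemma hard_time_sum:
  assumes tau: "0 < \<tau>" "\<tau> \<le> 1" and n: "real n * \<tau> \<le> T" and mu: "0 \<le> \<mu>"
    and m: "\<And>k k1 k2. \<not> hard k k1 \<Longrightarrow> m k k1 k2 = 0"
      "\<And>k k1 k2. cmod (m k k1 k2) \<le> 2 * \<tau> * (\<bar>real_of_int k1\<bar> / \<bar>real_of_int k\<bar>) * min 1 (\<tau> * \<bar>real_of_int k2 * real_of_int (k - k1 - k2)\<bar>)"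
    and abc: "yb \<mu> a P" "yb \<mu> b Q" "yb \<mu> c R"
  shows "hb 0 (tri (\<lambda>k k1 k2. (\<Sum>j\<in>{i..<n}. cis (real j * \<tau> * real_of_int (phi k k1 k2))) * m k k1 k2) a b c)
     (sconst T * \<tau> powr \<theta> * (P * Q * R) * \<mu>)"
proof -
  have nn: "0 \<le> P" "0 \<le> Q" "0 \<le> R" using abc yb_nonneg by auto
  have T0: "0 \<le> T" using n tau by (meson mult_nonneg_nonneg of_nat_0_le_iff order_trans less_imp_le)
  define g where "g = \<theta> + eta + 1/2"
  have gg: "g \<le> \<gamma>" using eta by (simp add: g_def)
  let ?S = "\<lambda>k k1 k2. \<Sum>j\<in>{i..<n}. cis (real j * \<tau> * real_of_int (phi k k1 k2))"
  let ?m = "\<lambda>k k1 k2. ?S k k1 k2 * m k k1 k2"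
  define W where "W x = \<tau> * cmod (?S (fst x) (q1 x) (q2 x))" for x
  define om where "om x = 1 + \<tau> powr (1 - 2 * eta) * (real_of_int (q2 x - q3 x))^2" for x
  have W0: "0 \<le> W x" for x using tau by (simp add: W_def)
  have WT: "W x \<le> T" for x unfolding W_def by (rule geometric_phi_bound(1)[OF tau(1) n])
  have om: "0 < om x" for x unfolding om_def by (smt (verit) mult_nonneg_nonneg powr_ge_zero zero_le_power2)
  have R0: "0 \<le> rconst T" unfolding rconst_def using T0 eta(1) by (intro add_nonneg_nonneg mult_nonneg_nonneg) auto
  have row: "(\<Sum>k2\<in>G. W (k, k1, k2) / om (k, k1, k2)) \<le> rconst T" if G: "finite G" for k k1 G
  proof -
    define Z where "Z k2 = k2 - (k - k1 - k2)" for k2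
    have inj: "inj Z" by (auto simp: inj_def Z_def)
    \<comment> \<open>\<open>Z\<close> takes values in one parity class only; extension by zero
      makes \<open>W'\<close> a function of all integers, as the row bound expects.\<close>
    define W' where "W' z = (if z \<in> range Z then W (k, k1, inv Z z) else 0)" for z
    have WZ: "W' (Z k2) = W (k, k1, k2)" for k2 using inj by (simp add: W'_def)
    have "(\<Sum>k2\<in>G. W (k, k1, k2) / om (k, k1, k2)) = (\<Sum>z\<in>Z ` G. W' z / (1 + \<tau> powr (1 - 2 * eta) * (real_of_int z)^2))"
    proof (subst sum.reindex)
      show "inj_on Z G" using inj by (rule inj_on_subset) simp
      show "(\<Sum>k2\<in>G. W (k, k1, k2) / om (k, k1, k2)) = sum ((\<lambda>z. W' z / (1 + \<tau> powr (1 - 2 * eta) * (real_of_int z)^2)) \<circ> Z) G"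
        by (simp add: WZ om_def) (simp add: Z_def)
    qed
    also have "\<dots> \<le> rconst T" unfolding rconst_def
    proof (rule row_sum_bound[where X = "k + k1"])
      show "0 \<le> W' z" "W' z \<le> T" for z using W0 WT T0 by (auto simp: W'_def)
      show "\<exists>p::int. \<bar>(real_of_int (k + k1))^2 - (real_of_int z)^2 - 4 * pi * p / \<tau>\<bar> \<le> 2 * pi / \<tau> \<and>
        W' z \<le> 2 * (T + pi) / (1 + \<bar>(real_of_int (k + k1))^2 - (real_of_int z)^2 - 4 * pi * p / \<tau>\<bar>)" for z
      proof (cases "z \<in> range Z")
        case True
        then obtain k2 where z: "z = Z k2" by auto
        show ?thesis using geometric_phi_bound(2)[OF tau(1) n, of k k1 k2 i] unfolding z WZ
          by (simp add: W_def Z_def)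
      next
        case False
        define x where "x = ((real_of_int (k + k1))^2 - (real_of_int z)^2) * \<tau> / (4 * pi)"
        have "\<bar>of_int (round x) - x\<bar> \<le> 1/2" by (rule of_int_round_abs_le)
        then have "\<bar>of_int (round x) - x\<bar> * (4 * pi / \<tau>) \<le> 1/2 * (4 * pi / \<tau>)" using tau by (intro mult_right_mono) auto
        moreover have "\<bar>of_int (round x) - x\<bar> * (4 * pi / \<tau>) = \<bar>(of_int (round x) - x) * (4 * pi / \<tau>)\<bar>"
          using tau by (simp add: abs_mult)
        moreover have "(of_int (round x) - x) * (4 * pi / \<tau>) = - ((real_of_int (k + k1))^2 - (real_of_int z)^2 - 4 * pi * round x / \<tau>)"
          using tau by (simp add: x_def field_simps)
        ultimately have "\<bar>(real_of_int (k + k1))^2 - (real_of_int z)^2 - 4 * pi * round x / \<tau>\<bar> \<le> 2 * pi / \<tau>"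
          by (simp only: abs_minus_cancel)
        then show ?thesis using False T0 by (intro exI[of _ "round x"]) (auto simp: W'_def intro!: divide_nonneg_nonneg)
      qed
    qed (use tau eta T0 G in auto)
    finally show ?thesis .
  qed
  let ?E = "sqrt (rconst T) * sqrt T * emb_const 1"
  have C: "0 \<le> sconst T * \<tau> powr \<theta> * (P * Q * R) * \<mu>" using nn mu sconst_nonneg[OF T0] by simp
  have H: "(\<Sum>(k,p)\<in>F. w k * (jb k powr 0 * cmod (trt ?m a b c k p))) \<le> sconst T * \<tau> powr \<theta> * (P * Q * R) * \<mu>"
    if F: "finite F" and w: "\<And>k. 0 \<le> w k" "l2 w 1" for F w
  proof -
    define S where "S A B C x = w (fst x) / jb (fst x) * (W x / sqrt (om x)) * A (q1 x) * B (q2 x) * C (q3 x)"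
      for A B C :: "int \<Rightarrow> real" and x
    let ?g = "\<lambda>f k. jb k powr g * cmod (f k)" and ?z = "\<lambda>f k. cmod (f k)"
    have "(\<Sum>(k,p)\<in>F. w k * (jb k powr 0 * cmod (trt ?m a b c k p)))
      \<le> (\<Sum>x\<in>F. (36 * 3 powr \<gamma> * \<tau> powr \<theta>) * (S (?g a) (?g b) (?z c) x + S (?g a) (?z b) (?g c) x + S (?z a) (?g b) (?g c) x))"
    proof (rule sum_mono, clarify)
      fix k k1 k2 :: int
      let ?x = "(k, k1, k2)" and ?k3 = "k - k1 - k2"
      let ?n = "cmod (a k1) * cmod (b k2) * cmod (c ?k3)"
      show "w k * (jb k powr 0 * cmod (trt ?m a b c k (k1, k2))) \<le> (36 * 3 powr \<gamma> * \<tau> powr \<theta>) *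
         (S (?g a) (?g b) (?z c) ?x + S (?g a) (?z b) (?g c) ?x + S (?z a) (?g b) (?g c) ?x)"
      proof (cases "hard k k1")
        case False
        have "0 \<le> S A B C x" if "\<And>k. 0 \<le> A k" "\<And>k. 0 \<le> B k" "\<And>k. 0 \<le> C k" for A B C x
          unfolding S_def using that w W0[of x] om[of x] by (intro mult_nonneg_nonneg divide_nonneg_nonneg) (auto simp: less_imp_le)
        then show ?thesis using m(1)[OF False] by (auto simp: trt_def intro!: add_nonneg_nonneg)
      next
        case True
        then have k0: "k \<noteq> 0" by (simp add: hard_def)
        let ?d = "min 1 (\<tau> * \<bar>real_of_int k2 * real_of_int ?k3\<bar>)"
        have d0: "0 \<le> ?d" using tau by simp
        have "\<bar>real_of_int k1\<bar> / \<bar>real_of_int k\<bar> \<le> \<bar>real_of_int k1\<bar> * (2 / jb k)"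
          using mult_right_mono[OF jb_le_abs[OF k0], of "\<bar>real_of_int k1\<bar>"] k0 jb_pos[of k]
          by (simp add: field_simps)
        then have "cmod (m k k1 k2) \<le> 2 * \<tau> * (\<bar>real_of_int k1\<bar> * (2 / jb k)) * ?d"
          using tau d0 by (intro order_trans[OF m(2)] mult_right_mono mult_left_mono) auto
        then have "cmod (?S k k1 k2) * cmod (m k k1 k2) \<le> cmod (?S k k1 k2) * (2 * \<tau> * (\<bar>real_of_int k1\<bar> * (2 / jb k)) * ?d)"
          by (intro mult_left_mono) auto
        also have "\<dots> = 4 * (W ?x / sqrt (om ?x)) / jb k * (\<bar>real_of_int k1\<bar> * ?d * sqrt (om ?x))"
          using om[of ?x] by (simp add: W_def)
        also have "\<dots> \<le> 4 * (W ?x / sqrt (om ?x)) / jb k * (9 * 3 powr \<gamma> * \<tau> powr \<theta> *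
          (jb k1 powr g * jb k2 powr g + jb k1 powr g * jb ?k3 powr g + jb k2 powr g * jb ?k3 powr g))"
          using hard_weight[OF True tau, of k2] W0[of ?x] om[of ?x]
          by (intro mult_left_mono) (auto simp: om_def g_def)
        finally have "w k * ?n * (cmod (?S k k1 k2) * cmod (m k k1 k2)) \<le> w k * ?n * (4 * (W ?x / sqrt (om ?x)) / jb k * (9 * 3 powr \<gamma> * \<tau> powr \<theta> *
          (jb k1 powr g * jb k2 powr g + jb k1 powr g * jb ?k3 powr g + jb k2 powr g * jb ?k3 powr g)))"
          using w by (intro mult_left_mono) auto
        also have "\<dots> = (36 * 3 powr \<gamma> * \<tau> powr \<theta>) *
         (S (?g a) (?g b) (?z c) ?x + S (?g a) (?z b) (?g c) ?x + S (?z a) (?g b) (?g c) ?x)"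
          unfolding S_def by (simp add: algebra_simps add_divide_distrib)
        also have "w k * ?n * (cmod (?S k k1 k2) * cmod (m k k1 k2)) = w k * (jb k powr 0 * cmod (trt ?m a b c k (k1, k2)))"
          by (simp add: trt_def norm_mult)
        finally show ?thesis .
      qed
    qed
    also have "\<dots> = (36 * 3 powr \<gamma> * \<tau> powr \<theta>) * ((\<Sum>x\<in>F. S (?g a) (?g b) (?z c) x) + (\<Sum>x\<in>F. S (?g a) (?z b) (?g c) x) + (\<Sum>x\<in>F. S (?z a) (?g b) (?g c) x))"
      by (simp only: sum.distrib sum_distrib_left distrib_left)
    also have "\<dots> \<le> (36 * 3 powr \<gamma> * \<tau> powr \<theta>) * (?E * (P * Q * (R * \<mu>)) + ?E * (P * (Q * \<mu>) * R) + ?E * ((P * \<mu>) * Q * R))"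
    proof (rule mult_left_mono)
      have g: "l2 (?g a) P" "l2 (?g b) Q" "l2 (?g c) R"
        using hb_weaken[OF yb_gamma[OF abc(1)] gg] hb_weaken[OF yb_gamma[OF abc(2)] gg] hb_weaken[OF yb_gamma[OF abc(3)] gg]
        by (auto simp: hb_def)
      have z: "l2 (?z a) (P * \<mu>)" "l2 (?z b) (Q * \<mu>)" "l2 (?z c) (R * \<mu>)"
        using abc yb_zero hb_l2_zero by auto
      show "(\<Sum>x\<in>F. S (?g a) (?g b) (?z c) x) + (\<Sum>x\<in>F. S (?g a) (?z b) (?g c) x) + (\<Sum>x\<in>F. S (?z a) (?g b) (?g c) x)
        \<le> ?E * (P * Q * (R * \<mu>)) + ?E * (P * (Q * \<mu>) * R) + ?E * ((P * \<mu>) * Q * R)"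
        unfolding S_def
        by (intro add_mono schur_form[OF F W0 WT om R0 row w g(1) _ g(2) _ z(3)]
            schur_form[OF F W0 WT om R0 row w g(1) _ z(2) _ g(3)] schur_form[OF F W0 WT om R0 row w z(1) _ g(2) _ g(3)]) auto
    qed simp
    also have "\<dots> = sconst T * \<tau> powr \<theta> * (P * Q * R) * \<mu>"
      unfolding sconst_def by (simp add: algebra_simps)
    finally show ?thesis .
  qed
  show ?thesis by (rule tri_bound_hb[OF C], rule H)
qed

end

section \<open>Conservation laws on the Fourier side\<close>

lemma tail_bound:
  fixes f :: "int \<Rightarrow> real"
  assumes l: "l1 (\<lambda>k. jb k * \<bar>f k\<bar>) D" and N: "0 < N"
  shows "\<bar>\<Sum>\<^sub>\<infinity>k\<in>- {- int N..int N}. f k\<bar> \<le> D / real N"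
proof -
  let ?S = "- {- int N..int N}"
  have NJ: "real N * \<bar>f k\<bar> \<le> jb k * \<bar>f k\<bar>" if "k \<in> ?S" for k
    using that abs_le_jb[of k] by (intro mult_right_mono) auto
  have fin: "(\<Sum>k\<in>F. \<bar>f k\<bar>) \<le> D / real N" if "finite F" "F \<subseteq> ?S" for F
  proof -
    have "real N * (\<Sum>k\<in>F. \<bar>f k\<bar>) \<le> (\<Sum>k\<in>F. jb k * \<bar>f k\<bar>)"
      unfolding sum_distrib_left using that NJ by (intro sum_mono) auto
    also have "\<dots> \<le> D" by (rule l1D[OF l that(1)])
    finally show ?thesis using N by (simp add: field_simps)
  qed
  then have s: "(\<lambda>k. norm (f k)) summable_on ?S"
    by (intro nonneg_bdd_above_summable_on) (auto simp: bdd_above_def)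
  have "\<bar>\<Sum>\<^sub>\<infinity>k\<in>?S. f k\<bar> \<le> (\<Sum>\<^sub>\<infinity>k\<in>?S. norm (f k))" using norm_infsum_bound[OF s] by simp
  also have "\<dots> \<le> D / real N" using s fin by (intro infsum_le_finite_sums) auto
  finally show ?thesis .
qed

lemma l1_real_summable: "l1 (\<lambda>k. \<bar>f k\<bar>) D \<Longrightarrow> (f :: 'i \<Rightarrow> real) summable_on UNIV"
  by (rule abs_summable_summable, rule nonneg_bdd_above_summable_on) (auto simp: bdd_above_def l1_def)

lemma infsum_cut:
  fixes f :: "int \<Rightarrow> real"
  assumes "f summable_on UNIV"
  shows "infsum f UNIV = sum f {- int N..int N} + (\<Sum>\<^sub>\<infinity>k\<in>- {- int N..int N}. f k)"
  using infsum_Un_disjoint[of f "{- int N..int N}" "- {- int N..int N}"] summable_on_subset_banach[OF assms]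
  by simp

text \<open>For a finite cutoff the derivative of the quadratic sum is twice a partial sum of a
  series with total \<open>0\<close>, that is, minus twice its tail. With \<open>v\<close> and
  \<open>g\<close> in \<open>H^1\<close> and \<open>|q k| \<le> jb k\<close> all tails are
  \<open>O(1 / N)\<close>, uniformly in time.\<close>

lemma conserved_quadratic:
  fixes v g :: "real \<Rightarrow> int \<Rightarrow> complex" and q :: "int \<Rightarrow> real"
  assumes der: "\<And>k s. 0 \<le> s \<Longrightarrow> s \<le> T \<Longrightarrow> ((\<lambda>s. v s k) has_vector_derivative g s k) (at s within {0..T})"
    and v: "\<And>s. 0 \<le> s \<Longrightarrow> s \<le> T \<Longrightarrow> hb 1 (v s) B" and g: "\<And>s. 0 \<le> s \<Longrightarrow> s \<le> T \<Longrightarrow> hb 1 (g s) C"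
    and q: "\<And>k. \<bar>q k\<bar> \<le> jb k"
    and z: "\<And>s. 0 \<le> s \<Longrightarrow> s \<le> T \<Longrightarrow> (\<Sum>\<^sub>\<infinity>k. q k * Re (cnj (v s k) * g s k)) = 0"
    and t: "0 \<le> t" "t \<le> T"
  shows "(\<Sum>\<^sub>\<infinity>k. q k * (cmod (v t k))^2) = (\<Sum>\<^sub>\<infinity>k. q k * (cmod (v 0 k))^2)"
proof -
  have T: "0 \<le> T" using t by linarith
  have lin: "l1 (\<lambda>k. jb k * \<bar>q k * Re (cnj (a k) * b k)\<bar>) (P * Q)" if "hb 1 a P" "hb 1 b Q" for a b P Q
  proof (rule l1_mono[OF l1_mult_l2])
    show "l2 (\<lambda>k. jb k powr 1 * cmod (a k)) P" "l2 (\<lambda>k. jb k powr 1 * cmod (b k)) Q" using that by (auto simp: hb_def)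
    fix k
    have "\<bar>Re (cnj (a k) * b k)\<bar> \<le> cmod (a k) * cmod (b k)"
      by (metis abs_Re_le_cmod complex_mod_cnj norm_mult)
    then have "\<bar>q k * Re (cnj (a k) * b k)\<bar> \<le> jb k * (cmod (a k) * cmod (b k))"
      unfolding abs_mult by (intro mult_mono q) auto
    then have "jb k * \<bar>q k * Re (cnj (a k) * b k)\<bar> \<le> jb k * (jb k * (cmod (a k) * cmod (b k)))"
      by (intro mult_left_mono) auto
    then show "jb k * \<bar>q k * Re (cnj (a k) * b k)\<bar> \<le> \<bar>jb k powr 1 * cmod (a k)\<bar> * \<bar>jb k powr 1 * cmod (b k)\<bar>"
      by (simp add: algebra_simps)
  qed simp
  have lin': "(\<lambda>k. q k * Re (cnj (a k) * b k)) summable_on UNIV" if "hb 1 a P" "hb 1 b Q" for a b P Q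
  proof (rule l1_real_summable, rule l1_mono[OF lin[OF that] _ order_refl])
    show "\<bar>q k * Re (cnj (a k) * b k)\<bar> \<le> jb k * \<bar>q k * Re (cnj (a k) * b k)\<bar>" for k
      using mult_right_mono[OF jb_ge1[of k], of "\<bar>q k * Re (cnj (a k) * b k)\<bar>"] by simp
  qed
  have C0: "0 \<le> B * C" using hb_nonneg v[OF order_refl T] g[OF order_refl T] by (metis mult_nonneg_nonneg)
  define h where "h s = (\<Sum>\<^sub>\<infinity>k. q k * (cmod (v s k))^2)" for s
  have est: "\<bar>h t - h 0\<bar> \<le> (2 * B * B + 2 * T * (B * C)) / real N" if N: "0 < N" for N
  proof -
    let ?I = "{- int N..int N}"
    define hN where "hN s = (\<Sum>k\<in>?I. q k * Re (cnj (v s k) * v s k))" for s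
    define dN where "dN s = (\<Sum>k\<in>?I. q k * Re (cnj (v s k) * g s k))" for s
    have tail: "\<bar>h s - hN s\<bar> \<le> B * B / real N" if "0 \<le> s" "s \<le> T" for s
    proof -
      have "h s - hN s = (\<Sum>\<^sub>\<infinity>k\<in>-?I. q k * Re (cnj (v s k) * v s k))"
        unfolding h_def hN_def using infsum_cut[OF lin'[OF v[OF that] v[OF that]], of N]
        unfolding Re_cnj_mult_self by simp
      then show ?thesis using tail_bound[OF lin[OF v[OF that] v[OF that]] N] by simp
    qed
    have d: "\<bar>2 * dN s\<bar> \<le> 2 * (B * C / real N)" if "0 \<le> s" "s \<le> T" for s
    proof -
      have "dN s = - (\<Sum>\<^sub>\<infinity>k\<in>-?I. q k * Re (cnj (v s k) * g s k))"
        unfolding dN_def using infsum_cut[OF lin'[OF v[OF that] g[OF that]], of N] z[OF that] by simp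
      then show ?thesis using tail_bound[OF lin[OF v[OF that] g[OF that]] N] by simp
    qed
    have der': "(hN has_derivative (\<lambda>h. h * (2 * dN s))) (at s within {0..T})" if "0 \<le> s" "s \<le> T" for s
      unfolding hN_def dN_def using der[OF that] unfolding has_vector_derivative_def
      by (auto intro!: derivative_eq_intros sum.cong simp: sum_distrib_left algebra_simps scaleR_conv_of_real)
    have "\<exists>x\<in>{0..t}. hN t - hN 0 = (t - 0) * (2 * dN x)"
      using t by (intro mvt_very_simple has_derivative_subset[OF der']) auto
    then obtain x where x: "0 \<le> x" "x \<le> t" "hN t - hN 0 = t * (2 * dN x)" by auto
    have "\<bar>hN t - hN 0\<bar> = t * \<bar>2 * dN x\<bar>" using t unfolding x(3) abs_mult by simp
    also have "\<dots> \<le> T * (2 * (B * C / real N))" using d[of x] x t by (intro mult_mono) auto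
    finally have "\<bar>hN t - hN 0\<bar> \<le> T * (2 * (B * C / real N))" .
    then have "\<bar>h t - h 0\<bar> \<le> B * B / real N + B * B / real N + T * (2 * (B * C / real N))"
      using tail[OF t] tail[OF order_refl T] unfolding abs_le_iff by linarith
    then show ?thesis by (simp add: algebra_simps add_divide_distrib)
  qed
  have "\<bar>h t - h 0\<bar> \<le> 0"
  proof (rule LIMSEQ_le_const)
    show "(\<lambda>N. (2 * B * B + 2 * T * (B * C)) / real N) \<longlonglongrightarrow> 0" by (rule lim_const_over_n)
    show "\<exists>N. \<forall>n\<ge>N. \<bar>h t - h 0\<bar> \<le> (2 * B * B + 2 * T * (B * C)) / real n"
      using est by (intro exI[of _ 1]) auto
  qed
  then show ?thesis by (simp add: h_def)
qed

text \<open>Summed over all triples this is the mean of \<open>|f|^4\<close> for a function with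
  coefficients \<open>y\<close>; \<open>k\<close> and \<open>- k1\<close> are the frequencies of the
  two conjugated factors.\<close>

definition quar :: "(int \<Rightarrow> complex) \<Rightarrow> int \<times> int \<times> int \<Rightarrow> complex" where
  "quar y = (\<lambda>(k, k1, k2). cnj (y k) * cnj (y (- k1)) * y k2 * y (k - k1 - k2))"

context adm
begin

lemma quar_l1:
  assumes y: "hb \<gamma> y B"
  shows "l1 (\<lambda>x. cmod (of_int (fst x) * quar y x)) (B * B * (kap * B) * (kap * B))"
    and "l1 (\<lambda>x. cmod (quar y x)) (B * B * (kap * B) * (kap * B))"
proof -
  have l: "l1 (\<lambda>x. jb (fst x) * cmod (quar y x)) (B * B * (kap * B) * (kap * B))"
    unfolding l1_def
  proof (intro allI impI)
    fix F :: "(int \<times> int \<times> int) set" assume F: "finite F"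
    have "(\<Sum>x\<in>F. jb (fst x) * cmod (quar y x)) = (\<Sum>x\<in>F. (jb (fst x) * cmod (y (fst x))) * cmod (rv y (q1 x)) * cmod (y (q2 x)) * cmod (y (q3 x)))"
      by (intro sum.cong refl) (auto simp: quar_def norm_mult rv_def)
    also have "\<dots> \<le> B * B * (kap * B) * (kap * B)"
      using y hb_weaken[OF hb_rv[OF y], of 0] gamma_ge1
      by (intro sum_quad_le[where A = "\<lambda>k. jb k * cmod (y k)" and B = "\<lambda>k. cmod (rv y k)" and C = "\<lambda>k. cmod (y k)" and D = "\<lambda>k. cmod (y k)", OF F triple_inj'(3) triple_inj]
          hb_l2_one hb_l2_zero hb_gamma_one emb0) auto
    finally show "(\<Sum>x\<in>F. jb (fst x) * cmod (quar y x)) \<le> B * B * (kap * B) * (kap * B)" .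
  qed
  show "l1 (\<lambda>x. cmod (of_int (fst x) * quar y x)) (B * B * (kap * B) * (kap * B))"
    by (rule l1_mono[OF l]) (auto simp: norm_mult abs_le_jb intro!: mult_right_mono)
  show "l1 (\<lambda>x. cmod (quar y x)) (B * B * (kap * B) * (kap * B))"
    by (rule l1_mono[OF l]) (auto simp: jb_ge1 mult_le_cancel_right1)
qed

lemma infsum_triple:
  assumes "l1 (\<lambda>x. cmod (f x)) D"
  shows "(\<Sum>\<^sub>\<infinity>k. \<Sum>\<^sub>\<infinity>p. f (k, p)) = infsum f UNIV"
  using infsum_Sigma'_banach[of "\<lambda>k p. f (k, p)" UNIV "\<lambda>_. UNIV"] l1_imp_abs_summable(2)[OF assms] by simp

text \<open>Exchanging the conjugated pair \<open>k\<close>, \<open>- k1\<close> with the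
  unconjugated pair \<open>k2\<close>, \<open>k - k1 - k2\<close> conjugates the summand, so the sum
  is real; this yields conservation of mass. With the weight \<open>k\<close> and sum
  \<open>S\<close>, symmetry within each pair shows that the weight \<open>k - k1\<close> gives
  \<open>2 * S\<close> and the weight \<open>k2 + (k - k1 - k2)\<close> gives
  \<open>2 * cnj S\<close>. The two weights are equal, whence conservation of momentum.\<close>

lemma quartic_real:
  assumes y: "hb \<gamma> y B"
  shows "Im (\<Sum>\<^sub>\<infinity>k. cnj (y k) * cub (\<lambda>_ _ _. 1) y k) = 0"
    and "Im (\<Sum>\<^sub>\<infinity>k. of_int k * (cnj (y k) * cub (\<lambda>_ _ _. 1) y k)) = 0"
proof -
  have c: "c * (cnj (y k) * cub (\<lambda>_ _ _. 1) y k) = (\<Sum>\<^sub>\<infinity>p. c * quar y (k, p))" for c k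
    unfolding cub_def tri_def infsum_cmult_right'[symmetric]
    by (intro infsum_cong) (auto simp: trt_def quar_def rv_def)
  note s1 = l1_imp_abs_summable(2)[OF quar_l1(1)[OF y]] and s0 = l1_imp_abs_summable(2)[OF quar_l1(2)[OF y]]
  have bij: "bij (\<lambda>(k, k1, k2). (- k1, - k, k2) :: int \<times> int \<times> int)"
     "bij (\<lambda>(k, k1, k2). (k2, - (k - k1 - k2), k) :: int \<times> int \<times> int)"
     "bij (\<lambda>(k, k1, k2). (k, k1, k - k1 - k2) :: int \<times> int \<times> int)"
    by (rule o_bij[of "\<lambda>(k, k1, k2). (- k1, - k, k2)"], auto simp: fun_eq_iff,
        rule o_bij[of "\<lambda>(k, k1, k2). (k2, - (k - k1 - k2), k)"], auto simp: fun_eq_iff,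
        rule o_bij[of "\<lambda>(k, k1, k2). (k, k1, k - k1 - k2)"], auto simp: fun_eq_iff)
  have "(\<Sum>\<^sub>\<infinity>k. cnj (y k) * cub (\<lambda>_ _ _. 1) y k) = infsum (quar y) UNIV"
    using c[of 1] infsum_triple[OF quar_l1(2)[OF y]] by simp
  moreover have "cnj (infsum (quar y) UNIV) = infsum (quar y) UNIV"
  proof -
    have "cnj (infsum (quar y) UNIV) = (\<Sum>\<^sub>\<infinity>x. cnj (quar y x))" by simp
    also have "\<dots> = (\<Sum>\<^sub>\<infinity>x. cnj (quar y ((\<lambda>(k, k1, k2). (k2, - (k - k1 - k2), k)) x)))"
      by (rule infsum_reindex_bij_betw[OF bij(2), symmetric])
    also have "\<dots> = infsum (quar y) UNIV" by (rule infsum_cong) (auto simp: quar_def)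
    finally show ?thesis .
  qed
  ultimately show "Im (\<Sum>\<^sub>\<infinity>k. cnj (y k) * cub (\<lambda>_ _ _. 1) y k) = 0"
    by (metis complex_cnj_cancel_iff complex_In_mult_cnj_zero Reals_cnj_iff complex_is_Real_iff)
  define S where "S = infsum (\<lambda>x. of_int (fst x) * quar y x) UNIV"
  have S: "((\<lambda>x. of_int (fst x) * quar y x) has_sum S) UNIV" unfolding S_def using s1 by (rule has_sum_infsum)
  have Sb: "((\<lambda>x. of_int (- q1 x) * quar y x) has_sum S) UNIV"
    using S unfolding has_sum_reindex_bij_betw[OF bij(1), of "\<lambda>x. of_int (fst x) * quar y x" S, symmetric]
    by (rule has_sum_cong[THEN iffD1, rotated]) (auto simp: quar_def)
  have cS: "((\<lambda>x. of_int (fst x) * cnj (quar y x)) has_sum cnj S) UNIV"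
    using S[THEN has_sum_cnj_iff[THEN iffD2]] by simp
  have Sc: "((\<lambda>x. of_int (q2 x) * quar y x) has_sum cnj S) UNIV"
    using cS unfolding has_sum_reindex_bij_betw[OF bij(2), of "\<lambda>x. of_int (fst x) * cnj (quar y x)" "cnj S", symmetric]
    by (rule has_sum_cong[THEN iffD1, rotated]) (auto simp: quar_def)
  have Sd: "((\<lambda>x. of_int (q3 x) * quar y x) has_sum cnj S) UNIV"
    using Sc unfolding has_sum_reindex_bij_betw[OF bij(3), of "\<lambda>x. of_int (q2 x) * quar y x" "cnj S", symmetric]
    by (rule has_sum_cong[THEN iffD1, rotated]) (auto simp: quar_def)
  have "S + S = cnj S + cnj S"
  proof (rule has_sum_unique)
    show "((\<lambda>x. of_int (fst x) * quar y x + of_int (- q1 x) * quar y x) has_sum (S + S)) UNIV"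
      by (rule has_sum_add[OF S Sb])
    have "((\<lambda>x. of_int (q2 x) * quar y x + of_int (q3 x) * quar y x) has_sum (cnj S + cnj S)) UNIV"
      by (rule has_sum_add[OF Sc Sd])
    then show "((\<lambda>x. of_int (fst x) * quar y x + of_int (- q1 x) * quar y x) has_sum (cnj S + cnj S)) UNIV"
      by (rule has_sum_cong[THEN iffD1, rotated]) (simp add: algebra_simps)
  qed
  then have "Im S = 0" by (simp add: complex_eq_iff)
  moreover have "(\<Sum>\<^sub>\<infinity>k. of_int k * (cnj (y k) * cub (\<lambda>_ _ _. 1) y k)) = S"
    unfolding c S_def using infsum_triple[OF quar_l1(1)[OF y]] by simp
  ultimately show "Im (\<Sum>\<^sub>\<infinity>k. of_int k * (cnj (y k) * cub (\<lambda>_ _ _. 1) y k)) = 0" by simp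
qed

end

section \<open>The multipliers of the scheme\<close>

lemma cmod_cis_minus_one_le: "cmod (cis x - 1) \<le> \<bar>x\<bar>"
  using abs_sin_x_le_abs_x[of "x/2"] by (simp add: cmod_cis_minus_one)

lemma cmod_cis_diff_le: "cmod (cis x - cis y) \<le> \<bar>x - y\<bar>"
proof -
  have "cis x - cis y = cis y * (cis (x - y) - 1)" by (simp add: algebra_simps cis_mult)
  then show ?thesis using cmod_cis_minus_one_le[of "x - y"] by (simp add: norm_mult)
qed

lemma has_vector_derivative_cis:
  "((\<lambda>s. cis (c * s)) has_vector_derivative (\<i> * c * cis (c * s))) (at s within S)"
proof -
  have "((\<lambda>s. exp (\<i> * (c * s))) has_vector_derivative (\<i> * c * exp (\<i> * (c * s)))) (at s within S)"
    by (auto intro!: derivative_eq_intros has_vector_derivative_real_field simp: )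
  then show ?thesis by (simp add: cis_conv_exp)
qed

text \<open>This is the integral of \<open>cis (r * of_int f)\<close> for \<open>r\<close> from
  \<open>0\<close> to \<open>s\<close>, that is, the exact contribution of one interaction over a
  time \<open>s\<close> when its coefficients are frozen.\<close>

definition phf :: "int \<Rightarrow> real \<Rightarrow> complex" where
  "phf f s = (if f = 0 then of_real s else (cis (s * of_int f) - 1) / (\<i> * of_int f))"

lemma phf_mult: "\<i> * of_int f * phf f s = cis (s * of_int f) - 1"
  by (simp add: phf_def)

lemma phf_deriv: "((\<lambda>s. phf f s) has_vector_derivative cis (s * of_int f)) (at s within S)"
proof (cases "f = 0")
  case True
  then show ?thesis by (auto simp: phf_def intro!: derivative_eq_intros)
next
  case False
  have "((\<lambda>s. (cis (of_int f * s) - 1) / (\<i> * of_int f)) has_vector_derivative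
     ((\<i> * of_int f * cis (of_int f * s) - 0) / (\<i> * of_int f))) (at s within S)"
    using has_vector_derivative_cis[of "of_int f" s S]
    by (intro has_vector_derivative_divide has_vector_derivative_diff) (auto intro: has_vector_derivative_const)
  then show ?thesis using False by (simp add: phf_def mult.commute)
qed

lemma cmod_increment_le:
  fixes f :: "real \<Rightarrow> complex"
  assumes "0 \<le> t" "f 0 = 0" "\<And>s. 0 \<le> s \<Longrightarrow> s \<le> t \<Longrightarrow> (f has_vector_derivative f' s) (at s within {0..t})"
    "\<And>s. 0 \<le> s \<Longrightarrow> s \<le> t \<Longrightarrow> cmod (f' s) \<le> M"
  shows "cmod (f t) \<le> M * t"
proof -
  have "cmod (f t - f 0) \<le> M * norm (t - 0)"
  proof (rule differentiable_bound[where S = "{0..t}" and f' = "\<lambda>s h. h *\<^sub>R f' s"])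
    show "(f has_derivative (\<lambda>h. h *\<^sub>R f' s)) (at s within {0..t})" if "s \<in> {0..t}" for s
      using assms(3)[of s] that by (simp add: has_vector_derivative_def)
    show "onorm (\<lambda>h. h *\<^sub>R f' s) \<le> M" if "s \<in> {0..t}" for s
      using assms(4)[of s] that by (intro onorm_le) (auto simp: mult.commute[of M] mult_left_mono)
  qed (use assms in auto)
  then show ?thesis using assms by simp
qed

lemma phf_0 [simp]: "phf f 0 = 0"
  by (simp add: phf_def)

lemma phf_bound: "0 \<le> t \<Longrightarrow> cmod (phf f t) \<le> t"
  using cmod_increment_le[of t "phf f" "\<lambda>s. cis (s * of_int f)" 1] phf_deriv by auto

text \<open>The derivative of the difference is bounded both by \<open>2\<close> and by the
  discarded phase; keeping the minimum allows any power between \<open>0\<close> and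
  \<open>1\<close> later.\<close>

lemma phf_diff_bound:
  assumes "0 \<le> t"
  shows "cmod (phf (f + 2 * g) t - phf f t) \<le> 2 * t * min 1 (t * \<bar>real_of_int g\<bar>)"
proof -
  have "cmod (phf (f + 2 * g) t - phf f t) \<le> (2 * min 1 (t * \<bar>real_of_int g\<bar>)) * t"
  proof (rule cmod_increment_le[where f' = "\<lambda>s. cis (s * of_int (f + 2 * g)) - cis (s * of_int f)"])
    show "((\<lambda>t. phf (f + 2 * g) t - phf f t) has_vector_derivative cis (s * of_int (f + 2 * g)) - cis (s * of_int f)) (at s within {0..t})" for s
      by (intro has_vector_derivative_diff phf_deriv)
    fix s assume s: "0 \<le> s" "s \<le> t"
    have "cmod (cis (s * of_int (f + 2 * g)) - cis (s * of_int f)) \<le> \<bar>s * of_int (f + 2 * g) - s * of_int f\<bar>"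
      by (rule cmod_cis_diff_le)
    also have "\<dots> = 2 * (s * \<bar>real_of_int g\<bar>)" using s by (simp add: algebra_simps abs_mult)
    also have "\<dots> \<le> 2 * (t * \<bar>real_of_int g\<bar>)" using s by (simp add: mult_right_mono)
    finally have 1: "cmod (cis (s * of_int (f + 2 * g)) - cis (s * of_int f)) \<le> 2 * (t * \<bar>real_of_int g\<bar>)" .
    have "cmod (cis (s * of_int (f + 2 * g)) - cis (s * of_int f)) \<le> 2"
      using norm_triangle_ineq4[of "cis (s * of_int (f + 2 * g))" "cis (s * of_int f)"] by simp
    then show "cmod (cis (s * of_int (f + 2 * g)) - cis (s * of_int f)) \<le> 2 * min 1 (t * \<bar>real_of_int g\<bar>)"
      using 1 by simp
  qed (use assms in auto)
  then show ?thesis by (simp add: algebra_simps)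
qed

lemma cis_second_order: "cmod (cis (- x) - 1 + \<i> * of_real x) \<le> x^2"
proof -
  have main: "cmod (cis (- (c * 1)) - 1 + \<i> * of_real (c * 1)) \<le> (c * c) * 1" for c
  proof (rule cmod_increment_le[where f' = "\<lambda>s. \<i> * of_real (-c) * cis ((-c) * s) + \<i> * of_real c" and f = "\<lambda>s. cis (- (c * s)) - 1 + \<i> * of_real (c * s)"])
    show "((\<lambda>s. cis (- (c * s)) - 1 + \<i> * complex_of_real (c * s)) has_vector_derivative
          \<i> * complex_of_real (-c) * cis (- c * s) + \<i> * complex_of_real c) (at s within {0..1})" for s
    proof -
      have "((\<lambda>s. cis ((-c) * s) - 1 + \<i> * complex_of_real (c * s)) has_vector_derivative
          (\<i> * complex_of_real (-c) * cis ((- c) * s) - 0) + \<i> * complex_of_real c) (at s within {0..1})"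
        by (intro has_vector_derivative_add has_vector_derivative_diff has_vector_derivative_cis has_vector_derivative_const)
           (auto intro!: derivative_eq_intros simp: has_vector_derivative_def scaleR_conv_of_real fun_eq_iff)
      then show ?thesis by simp
    qed
    fix s :: real assume s: "0 \<le> s" "s \<le> 1"
    have "\<i> * complex_of_real (-c) * cis (- c * s) + \<i> * complex_of_real c = - (\<i> * of_real c * (cis (- c * s) - 1))"
      by (simp add: algebra_simps)
    then have "cmod (\<i> * complex_of_real (-c) * cis (- c * s) + \<i> * complex_of_real c) = \<bar>c\<bar> * cmod (cis (- c * s) - 1)"
      by (simp add: norm_mult)
    also have "\<dots> \<le> \<bar>c\<bar> * (\<bar>c\<bar> * 1)"
    proof (rule mult_left_mono)
      have "cmod (cis (- c * s) - 1) \<le> \<bar>c\<bar> * s" using cmod_cis_minus_one_le[of "- c * s"] s by (simp add: abs_mult)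
      also have "\<dots> \<le> \<bar>c\<bar> * 1" using s by (intro mult_left_mono) auto
      finally show "cmod (cis (- c * s) - 1) \<le> \<bar>c\<bar> * 1" .
    qed simp
    finally show "cmod (\<i> * complex_of_real (-c) * cis (- c * s) + \<i> * complex_of_real c) \<le> c * c" by simp
  qed auto
  show ?thesis using main[of x] by (simp add: power2_eq_square)
qed

text \<open>\<open>\<mu>\<close> and \<open>p0\<close> stand for the root of the mass and for the
  sum of \<open>k * |fc u0 k|^2\<close>, with \<open>P0 u0 = - \<i> * p0\<close>. As parameters they
  let the multipliers be studied without reference to \<open>u0\<close>.\<close>

locale sch = adm +
  fixes \<tau> \<mu> p0 :: real
  assumes tau: "0 < \<tau>" "\<tau> \<le> 1" and mu: "0 < \<mu>"
begin

text \<open>Up to sign, the phase of \<open>Emain\<close> beyond the free flow. The two imaginary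
  units in \<open>P0 u0 * dinv_m k\<close> cancel to the real number
  \<open>- p0 / k\<close>.\<close>

definition xk :: "int \<Rightarrow> real" where
  "xk k = 2 * \<tau> * (\<mu>^2 + (if k = 0 then 0 else - p0 / of_int k))"

text \<open>The linear terms of \<Psi> with the free flow removed. At \<open>k = 0\<close> there is
  no resonant cubic term to compensate, and the added term removes the first-order part of
  \<open>cis (- xk 0)\<close>.\<close>

definition eps :: "int \<Rightarrow> complex" where
  "eps k = cis (- xk k) + (if k = 0 then \<i> * of_real (2 * \<tau> * \<mu>^2) else 0)"

text \<open>\<open>fc (Psi u0 \<tau> u) k = e\<^sup>-\<^sup>i\<^sup>\<tau>\<^sup>k\<^sup>2 (eps k * X k + cub mm X k)\<close> for \<open>X = fc u\<close>; \<open>k1\<close> is the frequency of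
  the conjugated factor.\<close>
definition mm :: "int \<Rightarrow> int \<Rightarrow> int \<Rightarrow> complex" where
  "mm k k1 k2 = (if k = 0 then - \<i> * of_real \<tau> else
     (cis (\<tau> * of_int (2 * k * k1)) - 1) / (2 * (of_int k)^2)
     - (if k1 + k2 = 0 then 0 else (cis (\<tau> * of_int (phi k k1 k2)) - 1) / (of_int k * of_int (k1 + k2))))"

text \<open>The multiplier of the local error. In one part of the cubic increment the scheme
  exchanges the phase \<open>phi\<close> for \<open>2 * k * k1\<close>, and the two differ by
  \<open>2 * k2 * (k - k1 - k2)\<close>. The quotient \<open>k1 / k\<close> is left over from the
  symmetrisation in \<open>mm_identity\<close>.\<close>

definition bb :: "int \<Rightarrow> int \<Rightarrow> int \<Rightarrow> complex" where
  "bb k k1 k2 = (if k = 0 then - \<i> * (phf (phi k k1 k2) \<tau> - phf (2 * k * k1) \<tau>)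
     else \<i> * (of_int k1 / of_int k) * (phf (phi k k1 k2) \<tau> - phf (2 * k * k1) \<tau>))"

definition twm :: "real \<Rightarrow> (int \<Rightarrow> int \<Rightarrow> int \<Rightarrow> complex) \<Rightarrow> int \<Rightarrow> int \<Rightarrow> int \<Rightarrow> complex" where
  "twm t m k k1 k2 = cis (t * of_int (phi k k1 k2)) * m k k1 k2"

lemma mb_twm: "mb m A \<Longrightarrow> mb (twm t m) A"
  by (simp add: mb_def twm_def norm_mult)

lemma jb_frac: "k \<noteq> 0 \<Longrightarrow> 0 \<le> x \<Longrightarrow> x / \<bar>real_of_int k\<bar> * jb k \<le> 2 * x"
  using mult_left_mono[OF jb_le_abs[of k], of x] by (simp add: field_simps)

text \<open>Each \<open>cis - 1\<close> is bounded by its phase, and the phases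
  \<open>2 * k * k1\<close> and \<open>phi\<close> contain the factors \<open>k\<close> and
  \<open>k1 + k2\<close> of the denominators. What remains is one power of \<open>1 / |k|\<close>
  against a numerator of first order.\<close>

lemma mm_mb: "mb mm (6 * \<tau>)"
  unfolding mb_def
proof (intro conjI allI)
  fix k k1 k2 :: int
  let ?k3 = "k - k1 - k2"
  show "cmod (mm k k1 k2) * jb k \<le> 6 * \<tau> * (jb k1 + jb k2 + jb ?k3)"
  proof (cases "k = 0")
    case True
    have "\<tau> * 1 \<le> 6 * \<tau> * (jb k1 + jb k2 + jb ?k3)"
      using tau jb_ge1[of k1] jb_ge1[of k2] jb_ge1[of ?k3] by (intro mult_mono) auto
    then show ?thesis using True tau by (simp add: mm_def norm_mult jb_def[of 0])
  next
    case False
    then have ka: "0 < \<bar>real_of_int k\<bar>" by simp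
    have 1: "cmod ((cis (\<tau> * of_int (2 * k * k1)) - 1) / (2 * (of_int k)^2)) \<le> \<tau> * \<bar>real_of_int k1\<bar> / \<bar>real_of_int k\<bar>"
    proof -
      have "cmod (cis (\<tau> * of_int (2 * k * k1)) - 1) \<le> 2 * \<tau> * \<bar>real_of_int k\<bar> * \<bar>real_of_int k1\<bar>"
        using cmod_cis_minus_one_le[of "\<tau> * of_int (2 * k * k1)"] tau by (simp add: abs_mult)
      then have "cmod (cis (\<tau> * of_int (2 * k * k1)) - 1) / (2 * \<bar>real_of_int k\<bar>^2) \<le> 2 * \<tau> * \<bar>real_of_int k\<bar> * \<bar>real_of_int k1\<bar> / (2 * \<bar>real_of_int k\<bar>^2)"
        by (intro divide_right_mono) auto
      also have "\<dots> = \<tau> * \<bar>real_of_int k1\<bar> / \<bar>real_of_int k\<bar>"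
      proof -
        have "2 * \<tau> * K * L / (2 * K^2) = \<tau> * L / K" if "0 < K" for K L :: real
          using that by (simp add: power2_eq_square)
        then show ?thesis using ka by blast
      qed
      finally show ?thesis by (simp add: norm_divide norm_mult norm_power)
    qed
    have 2: "cmod (if k1 + k2 = 0 then 0 else (cis (\<tau> * of_int (phi k k1 k2)) - 1) / (of_int k * of_int (k1 + k2)))
       \<le> 2 * \<tau> * (\<bar>real_of_int k1\<bar> + \<bar>real_of_int ?k3\<bar>) / \<bar>real_of_int k\<bar>"
    proof (cases "k1 + k2 = 0")
      case True then show ?thesis using tau by simp
    next
      case F: False
      have a: "0 < \<bar>real_of_int (k1 + k2)\<bar>" using F by linarith
      have "cmod (cis (\<tau> * of_int (phi k k1 k2)) - 1) \<le> 2 * \<tau> * \<bar>real_of_int (k1 + k2)\<bar> * \<bar>real_of_int (k - k2)\<bar>"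
      proof -
        have "real_of_int (phi k k1 k2) = 2 * real_of_int (k1 + k2) * real_of_int (k - k2)"
          by (simp only: phi_factor of_int_mult of_int_numeral)
        then have "\<bar>\<tau> * real_of_int (phi k k1 k2)\<bar> = 2 * \<tau> * \<bar>real_of_int (k1 + k2)\<bar> * \<bar>real_of_int (k - k2)\<bar>"
          using tau by (simp add: abs_mult del: of_int_add of_int_diff)
        then show ?thesis using cmod_cis_minus_one_le[of "\<tau> * of_int (phi k k1 k2)"] by simp
      qed
      also have "\<dots> \<le> 2 * \<tau> * \<bar>real_of_int (k1 + k2)\<bar> * (\<bar>real_of_int k1\<bar> + \<bar>real_of_int ?k3\<bar>)"
        using tau by (intro mult_left_mono) auto
      finally have "cmod (cis (\<tau> * of_int (phi k k1 k2)) - 1) / (\<bar>real_of_int k\<bar> * \<bar>real_of_int (k1 + k2)\<bar>)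
        \<le> 2 * \<tau> * \<bar>real_of_int (k1 + k2)\<bar> * (\<bar>real_of_int k1\<bar> + \<bar>real_of_int ?k3\<bar>) / (\<bar>real_of_int k\<bar> * \<bar>real_of_int (k1 + k2)\<bar>)"
        by (intro divide_right_mono) auto
      also have "\<dots> = 2 * \<tau> * (\<bar>real_of_int k1\<bar> + \<bar>real_of_int ?k3\<bar>) / \<bar>real_of_int k\<bar>"
        using a ka by (simp add: field_simps)
      finally show ?thesis using F by (simp add: norm_divide norm_mult flip: of_int_add)
    qed
    have "cmod (mm k k1 k2) \<le> \<tau> * \<bar>real_of_int k1\<bar> / \<bar>real_of_int k\<bar> + 2 * \<tau> * (\<bar>real_of_int k1\<bar> + \<bar>real_of_int ?k3\<bar>) / \<bar>real_of_int k\<bar>"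
      using False 1 2 norm_triangle_ineq4[of "(cis (\<tau> * of_int (2 * k * k1)) - 1) / (2 * (of_int k)^2)"
        "if k1 + k2 = 0 then 0 else (cis (\<tau> * of_int (phi k k1 k2)) - 1) / (of_int k * of_int (k1 + k2))"]
      unfolding mm_def by simp
    also have "\<dots> = (\<tau> * (3 * \<bar>real_of_int k1\<bar> + 2 * \<bar>real_of_int ?k3\<bar>)) / \<bar>real_of_int k\<bar>"
      by (simp add: add_divide_distrib[symmetric] algebra_simps)
    finally have "cmod (mm k k1 k2) * jb k \<le> (\<tau> * (3 * \<bar>real_of_int k1\<bar> + 2 * \<bar>real_of_int ?k3\<bar>)) / \<bar>real_of_int k\<bar> * jb k"
      by (intro mult_right_mono) auto
    also have "\<dots> \<le> 2 * (\<tau> * (3 * \<bar>real_of_int k1\<bar> + 2 * \<bar>real_of_int ?k3\<bar>))" using tau False by (intro jb_frac) auto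
    finally have le: "cmod (mm k k1 k2) * jb k \<le> 2 * (\<tau> * (3 * \<bar>real_of_int k1\<bar> + 2 * \<bar>real_of_int ?k3\<bar>))" .
    have "3 * \<bar>real_of_int k1\<bar> + 2 * \<bar>real_of_int ?k3\<bar> \<le> 3 * (jb k1 + jb k2 + jb ?k3)"
    proof -
      have r: "3 * a + 2 * b \<le> 3 * (x + y + z)" if "a \<le> x" "b \<le> z" "0 \<le> y" "0 \<le> z" for a b x y z :: real
        using that by simp
      show ?thesis by (rule r[OF abs_le_jb abs_le_jb jb_nonneg jb_nonneg])
    qed
    then have "2 * (\<tau> * (3 * \<bar>real_of_int k1\<bar> + 2 * \<bar>real_of_int ?k3\<bar>)) \<le> 2 * (\<tau> * (3 * (jb k1 + jb k2 + jb ?k3)))"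
      using tau by (intro mult_left_mono) auto
    from order_trans[OF le this] show ?thesis by (simp add: algebra_simps)
  qed
qed (use tau in auto)

lemma bb_bound:
  "cmod (bb k k1 k2) \<le> 2 * \<tau> * (if k = 0 then 1 else \<bar>real_of_int k1\<bar> / \<bar>real_of_int k\<bar>) * min 1 (\<tau> * \<bar>real_of_int k2 * real_of_int (k - k1 - k2)\<bar>)"
proof -
  have "phi k k1 k2 = 2 * k * k1 + 2 * (k2 * (k - k1 - k2))" using phi_split[of k k1 k2] by simp
  then have d: "cmod (phf (phi k k1 k2) \<tau> - phf (2 * k * k1) \<tau>) \<le> 2 * \<tau> * min 1 (\<tau> * \<bar>real_of_int k2 * real_of_int (k - k1 - k2)\<bar>)"
    using phf_diff_bound[of \<tau> "2 * k * k1" "k2 * (k - k1 - k2)"] tau by simp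
  show ?thesis
  proof (cases "k = 0")
    case True then show ?thesis using d by (simp add: bb_def norm_mult)
  next
    case False
    have "\<bar>real_of_int k1\<bar> / \<bar>real_of_int k\<bar> * cmod (phf (phi k k1 k2) \<tau> - phf (2 * k * k1) \<tau>)
      \<le> \<bar>real_of_int k1\<bar> / \<bar>real_of_int k\<bar> * (2 * \<tau> * min 1 (\<tau> * \<bar>real_of_int k2 * real_of_int (k - k1 - k2)\<bar>))"
      by (intro mult_left_mono d) auto
    then show ?thesis using False by (simp add: bb_def norm_mult norm_divide mult_ac)
  qed
qed

lemma min_theta: "min 1 (\<tau> * \<bar>real_of_int k2 * real_of_int k3\<bar>) \<le> \<tau> powr \<theta> * (jb k2 powr \<theta> * jb k3 powr \<theta>)"
proof -
  have "min 1 (\<tau> * \<bar>real_of_int k2 * real_of_int k3\<bar>) \<le> (\<tau> * \<bar>real_of_int k2 * real_of_int k3\<bar>) powr \<theta>"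
    using tau theta_pos theta_le1 by (intro min_le_powr) auto
  also have "\<dots> = \<tau> powr \<theta> * (\<bar>real_of_int k2\<bar> powr \<theta> * \<bar>real_of_int k3\<bar> powr \<theta>)"
    using tau by (simp add: powr_mult abs_mult)
  also have "\<dots> \<le> \<tau> powr \<theta> * (jb k2 powr \<theta> * jb k3 powr \<theta>)"
    using theta_pos by (intro mult_left_mono mult_mono powr_mono2 abs_le_jb) auto
  finally show ?thesis .
qed

lemma bb_frac:
  assumes "0 \<le> D"
  shows "2 * \<tau> * (if k = 0 then 1 else \<bar>real_of_int k1\<bar> / \<bar>real_of_int k\<bar>) * D * jb k \<le> 4 * \<tau> * jb k1 * D"
proof (cases "k = 0")
  case True
  have "2 * \<tau> * 1 * D \<le> 4 * \<tau> * jb k1 * D" using assms tau jb_ge1[of k1] by (intro mult_right_mono mult_mono) auto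
  then show ?thesis using True by (simp add: jb_def[of 0])
next
  case False
  have "\<bar>real_of_int k1\<bar> / \<bar>real_of_int k\<bar> * jb k \<le> 2 * jb k1"
    using jb_frac[OF False, of "\<bar>real_of_int k1\<bar>"] abs_le_jb[of k1] by simp
  then have "2 * \<tau> * D * (\<bar>real_of_int k1\<bar> / \<bar>real_of_int k\<bar> * jb k) \<le> 2 * \<tau> * D * (2 * jb k1)"
    using assms tau by (intro mult_left_mono) auto
  then show ?thesis using False by (simp add: algebra_simps)
qed

lemma bb_hard: "cmod (bb k k1 k2) * jb k \<le> 4 * \<tau> * \<tau> powr \<theta> * (jb k1 * jb k2 powr \<theta> * jb (k - k1 - k2) powr \<theta>)"
proof -
  let ?D = "min 1 (\<tau> * \<bar>real_of_int k2 * real_of_int (k - k1 - k2)\<bar>)"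
  have "cmod (bb k k1 k2) * jb k \<le> 2 * \<tau> * (if k = 0 then 1 else \<bar>real_of_int k1\<bar> / \<bar>real_of_int k\<bar>) * ?D * jb k"
    by (intro mult_right_mono bb_bound) auto
  also have "\<dots> \<le> 4 * \<tau> * jb k1 * ?D" using tau by (intro bb_frac) auto
  also have "\<dots> \<le> 4 * \<tau> * jb k1 * (\<tau> powr \<theta> * (jb k2 powr \<theta> * jb (k - k1 - k2) powr \<theta>))"
    using tau by (intro mult_left_mono min_theta) auto
  finally show ?thesis by (simp add: algebra_simps)
qed

lemma bb_mb: "mb bb (4 * \<tau>)"
  unfolding mb_def
proof (intro conjI allI)
  fix k k1 k2
  let ?D = "min 1 (\<tau> * \<bar>real_of_int k2 * real_of_int (k - k1 - k2)\<bar>)"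
  have "cmod (bb k k1 k2) * jb k \<le> 2 * \<tau> * (if k = 0 then 1 else \<bar>real_of_int k1\<bar> / \<bar>real_of_int k\<bar>) * ?D * jb k"
    by (intro mult_right_mono bb_bound) auto
  also have "\<dots> \<le> 4 * \<tau> * jb k1 * ?D" using tau by (intro bb_frac) auto
  also have "\<dots> \<le> 4 * \<tau> * jb k1 * 1" using tau by (intro mult_left_mono) auto
  also have "\<dots> \<le> 4 * \<tau> * (jb k1 + jb k2 + jb (k - k1 - k2))" using tau by (simp add: mult_left_mono)
  finally show "cmod (bb k k1 k2) * jb k \<le> 4 * \<tau> * (jb k1 + jb k2 + jb (k - k1 - k2))" .
qed (use tau in auto)

definition bbe :: "int \<Rightarrow> int \<Rightarrow> int \<Rightarrow> complex" where
  "bbe k k1 k2 = (if hard k k1 then 0 else bb k k1 k2)"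

definition bbh :: "int \<Rightarrow> int \<Rightarrow> int \<Rightarrow> complex" where
  "bbh k k1 k2 = (if hard k k1 then bb k k1 k2 else 0)"

lemma bbe_mb: "mb bbe (4 * \<tau>)" and bbh_mb: "mb bbh (4 * \<tau>)"
  using mb_dom[OF bb_mb, of bbe 1] mb_dom[OF bb_mb, of bbh 1] by (auto simp: bbe_def bbh_def)

lemma bbe_bound: "cmod (bbe k k1 k2) \<le> 8 * \<tau> * \<tau> powr \<theta> * (jb k2 powr \<theta> * jb (k - k1 - k2) powr \<theta>)"
proof (cases "hard k k1")
  case True then show ?thesis using tau by (simp add: bbe_def)
next
  case False
  let ?D = "min 1 (\<tau> * \<bar>real_of_int k2 * real_of_int (k - k1 - k2)\<bar>)"
  have f: "(if k = 0 then 1 else \<bar>real_of_int k1\<bar> / \<bar>real_of_int k\<bar>) \<le> 4"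
  proof (cases "k = 0")
    case F: False
    then have "\<bar>k1\<bar> \<le> 4 * \<bar>k\<bar>" using False by (auto simp: hard_def)
    then have "real_of_int \<bar>k1\<bar> \<le> real_of_int (4 * \<bar>k\<bar>)" unfolding of_int_le_iff .
    then show ?thesis using F by (simp add: field_simps)
  qed simp
  have "cmod (bbe k k1 k2) \<le> 2 * \<tau> * (if k = 0 then 1 else \<bar>real_of_int k1\<bar> / \<bar>real_of_int k\<bar>) * ?D"
    using bb_bound[of k k1 k2] False by (simp add: bbe_def)
  also have "\<dots> \<le> 2 * \<tau> * 4 * (\<tau> powr \<theta> * (jb k2 powr \<theta> * jb (k - k1 - k2) powr \<theta>))"
    using tau f min_theta[of k2 "k - k1 - k2"] by (intro mult_mono) auto
  finally show ?thesis by simp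
qed

lemma bbh_bound:
  "cmod (bbh k k1 k2) \<le> 2 * \<tau> * (\<bar>real_of_int k1\<bar> / \<bar>real_of_int k\<bar>) * min 1 (\<tau> * \<bar>real_of_int k2 * real_of_int (k - k1 - k2)\<bar>)"
  using bb_bound[of k k1 k2] tau by (auto simp: bbh_def hard_def)

lemma cub_swap: "cub (\<lambda>k k1 k2. m k k1 (k - k1 - k2)) x k = cub m x k"
proof -
  have bij: "bij (\<lambda>(k1, k2). (k1, k - k1 - k2) :: int \<times> int)"
    by (rule o_bij[of "\<lambda>(k1, k2). (k1, k - k1 - k2)"]) (auto simp: fun_eq_iff)
  show ?thesis unfolding cub_def tri_def
    by (subst infsum_reindex_bij_betw[OF bij, symmetric]) (auto intro!: infsum_cong simp: trt_def)
qed

text \<open>Where \<open>k1 + k2 = 0\<close> the operator \<open>dinv_m\<close> annihilates the term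
  in \<open>mm\<close>, while the continuous extension of the quotient would give this multiplier.
  Its sum separates into mass and momentum times \<open>v k\<close>; this is the origin of the
  linear phase in \<open>Emain\<close>.\<close>

lemma resonant_sum:
  assumes v: "hb \<gamma> v B" and mass: "(\<Sum>\<^sub>\<infinity>k. (cmod (v k))^2) = \<mu>^2" and mom: "(\<Sum>\<^sub>\<infinity>k. of_int k * (cmod (v k))^2) = p0"
    and k: "k \<noteq> 0"
  shows "cub (\<lambda>k k1 k2. if k1 + k2 = 0 then 2 * \<i> * of_real \<tau> * of_int (k - k2) / of_int k else 0) v k = \<i> * of_real (xk k) * v k"
proof -
  have v1: "hb 1 v B" by (rule hb_gamma_one[OF v])
  have lq: "l1 (\<lambda>j. \<bar>q j * (cmod (v j))^2\<bar>) (B * B)" if q: "\<And>j. \<bar>q j\<bar> \<le> jb j" for q :: "int \<Rightarrow> real"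
  proof (rule l1_mono[OF l1_mult_l2[OF hb_l2_one[OF v1] hb_l2_one[OF v1]]])
    fix j
    have "\<bar>q j * (cmod (v j))^2\<bar> \<le> jb j * (cmod (v j))^2" unfolding abs_mult using q by (intro mult_mono) auto
    also have "\<dots> \<le> jb j * jb j * (cmod (v j))^2" using jb_ge1[of j] by (intro mult_right_mono) auto
    finally show "\<bar>q j * (cmod (v j))^2\<bar> \<le> \<bar>jb j * cmod (v j)\<bar> * \<bar>jb j * cmod (v j)\<bar>"
      by (simp add: power2_eq_square mult_ac)
  qed simp
  have s0: "((\<lambda>j. of_real ((cmod (v j))^2)) has_sum complex_of_real (\<mu>^2)) UNIV"
    using l1_real_summable[OF lq[of "\<lambda>_. 1"]] mass jb_ge1 by (intro has_sum_of_real) (auto simp: has_sum_iff)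
  have s1: "((\<lambda>j. of_real (of_int j * (cmod (v j))^2)) has_sum complex_of_real p0) UNIV"
    using l1_real_summable[OF lq[of of_int]] mom abs_le_jb by (intro has_sum_of_real) (auto simp: has_sum_iff)
  let ?c = "2 * \<i> * of_real \<tau> * v k"
  have "((\<lambda>j. ?c * of_real ((cmod (v j))^2) - ?c / of_int k * of_real (of_int j * (cmod (v j))^2)) has_sum
      (?c * of_real (\<mu>^2) - ?c / of_int k * of_real p0)) UNIV"
    by (intro has_sum_diff has_sum_cmult_right s0 s1)
  moreover have "?c * of_real (\<mu>^2) - ?c / of_int k * of_real p0 = \<i> * of_real (xk k) * v k"
    using k by (simp add: xk_def algebra_simps)
  ultimately have S: "((\<lambda>j. ?c * of_real ((cmod (v j))^2) - ?c / of_int k * of_real (of_int j * (cmod (v j))^2)) has_sum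
      \<i> * of_real (xk k) * v k) UNIV" by simp
  let ?m = "\<lambda>k k1 k2. if k1 + k2 = 0 then 2 * \<i> * of_real \<tau> * of_int (k - k2) / of_int k else (0::complex)"
  have "infsum (trt ?m (rv v) v v k) UNIV = infsum (trt ?m (rv v) v v k) (range (\<lambda>j. (- j, j)))"
    by (rule infsum_cong_neutral) (auto simp: trt_def image_iff eq_neg_iff_add_eq_0)
  also have "\<dots> = infsum (trt ?m (rv v) v v k \<circ> (\<lambda>j. (- j, j))) UNIV"
    by (rule infsum_reindex) (auto simp: inj_def)
  also have "\<dots> = (\<Sum>\<^sub>\<infinity>j. ?c * of_real ((cmod (v j))^2) - ?c / of_int k * of_real (of_int j * (cmod (v j))^2))"
  proof (rule infsum_cong)
    fix j
    have "(trt ?m (rv v) v v k \<circ> (\<lambda>j. (- j, j))) j = 2 * \<i> * of_real \<tau> * of_int (k - j) / of_int k * (v j * cnj (v j)) * v k"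
      by (simp add: trt_def rv_def)
    also have "v j * cnj (v j) = of_real ((cmod (v j))^2)" by (simp only: complex_norm_square)
    finally show "(trt ?m (rv v) v v k \<circ> (\<lambda>j. (- j, j))) j = ?c * of_real ((cmod (v j))^2) - ?c / of_int k * of_real (of_int j * (cmod (v j))^2)"
      using k by (simp add: field_simps)
  qed
  also have "\<dots> = \<i> * of_real (xk k) * v k" by (rule infsumI[OF S])
  finally show ?thesis by (simp add: cub_def tri_def)
qed

lemma cub_mult_const: "cub (\<lambda>k k1 k2. c * m k k1 k2) x k = c * cub m x k"
  using cub_cmult_m[of "\<lambda>_. c"] .

text \<open>Both unconjugated factors are \<open>v\<close>, so the multiplier may be averaged over
  the exchange of \<open>k2\<close> and \<open>k3 = k - k1 - k2\<close>. Then
  \<open>(k - k2) + (k - k3) = k + k1\<close> turns the quotient \<open>2 * (k - k2) / k\<close>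
  into \<open>1 + k1 / k\<close>: the \<open>1\<close> is the exact increment with frozen
  coefficients, and the rest combines with the term of phase \<open>2 * k * k1\<close> to
  \<open>bb\<close>.\<close>

lemma mm_identity:
  assumes v: "hb \<gamma> v B" and mass: "(\<Sum>\<^sub>\<infinity>k. (cmod (v k))^2) = \<mu>^2" and mom: "(\<Sum>\<^sub>\<infinity>k. of_int k * (cmod (v k))^2) = p0"
  shows "cub (twm t mm) v k = cub (twm t (\<lambda>k k1 k2. - \<i> * phf (phi k k1 k2) \<tau>)) v k - cub (twm t bb) v k
     + (if k = 0 then 0 else \<i> * of_real (xk k) * v k)"
proof -
  define ph where "ph = twm t (\<lambda>k k1 k2. - \<i> * phf (phi k k1 k2) \<tau>)"
  have ph: "mb ph \<tau>" unfolding ph_def using tau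
    by (intro mb_twm mb_bounded) (auto simp: norm_mult phf_bound)
  have nb: "mb (\<lambda>k k1 k2. - twm t bb k k1 k2) (4 * \<tau>)"
    using mb_cmult[OF mb_twm[OF bb_mb], of "-1" t] by simp
  have cnb: "cub (\<lambda>k k1 k2. - twm t bb k k1 k2) v k = - cub (twm t bb) v k"
    using cub_mult_const[of "-1" "twm t bb" v k] by simp
  have sum: "cub (\<lambda>k k1 k2. ph k k1 k2 + - twm t bb k k1 k2) v k = cub ph v k - cub (twm t bb) v k"
    using cub_add_m[OF ph nb v] cnb by simp
  show ?thesis
  proof (cases "k = 0")
    case True
    have "cub (twm t mm) v k = cub (\<lambda>k k1 k2. ph k k1 k2 + - twm t bb k k1 k2) v k"
      unfolding cub_def tri_def using True
      by (intro infsum_cong) (auto simp: trt_def twm_def ph_def mm_def bb_def phf_def[of 0] algebra_simps)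
    then show ?thesis using sum True by (simp add: ph_def)
  next
    case False
    define res where "res = (\<lambda>k k1 k2. if k1 + k2 = 0 then 2 * \<i> * of_real \<tau> * of_int (k - k2) / of_int k else (0::complex))"
    \<comment> \<open>The twisted \<open>mm\<close> with its quotient continued across the
      resonance; this gives a formula in \<open>phf\<close> without case distinction.\<close>
    define n1 where "n1 k k1 k2 = twm t mm k k1 k2 - res k k1 k2" for k k1 k2
    have phi0: "phi k k1 k2 = 0" if "k1 + k2 = 0" for k k1 k2 using that by (simp add: phi_factor)
    have phis: "phi k k1 (k - k1 - k2) = phi k k1 k2" for k k1 k2 by (simp add: phi_def)
    have e: "n1 k k1 k2 = cis (t * of_int (phi k k1 k2)) *
       (\<i> * (of_int k1 / of_int k) * phf (2 * k * k1) \<tau> - 2 * \<i> * (of_int (k - k2) / of_int k) * phf (phi k k1 k2) \<tau>)" for k1 k2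
    proof -
      have a: "(cis (\<tau> * of_int (2 * k * k1)) - 1) / (2 * (of_int k)^2) = \<i> * (of_int k1 / of_int k) * phf (2 * k * k1) \<tau>"
        unfolding phf_mult[symmetric] using False by (simp add: field_simps power2_eq_square)
      have b: "(cis (\<tau> * of_int (phi k k1 k2)) - 1) / (of_int k * of_int (k1 + k2)) = 2 * \<i> * (of_int (k - k2) / of_int k) * phf (phi k k1 k2) \<tau>"
        if "k1 + k2 \<noteq> 0"
      proof -
        have "complex_of_int (k1 + k2) \<noteq> 0" using that by (metis of_int_eq_0_iff)
        moreover have "complex_of_int (phi k k1 k2) = 2 * of_int (k1 + k2) * of_int (k - k2)"
          by (simp only: phi_factor of_int_mult of_int_numeral)
        ultimately show ?thesis unfolding phf_mult[symmetric] using False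
          by (simp add: field_simps del: of_int_add of_int_diff)
      qed
      show ?thesis
      proof (cases "k1 + k2 = 0")
        case True
        then show ?thesis using False a phi0[OF True, of k] by (simp add: n1_def twm_def mm_def res_def phf_def[of 0] del: of_int_diff)
      next
        case F: False
        then show ?thesis using False a b[OF F] by (simp add: n1_def twm_def mm_def res_def)
      qed
    qed
    have rmb: "mb res (4 * \<tau>)"
      unfolding mb_def
    proof (intro conjI allI)
      fix k k1 k2 :: int
      show "cmod (res k k1 k2) * jb k \<le> 4 * \<tau> * (jb k1 + jb k2 + jb (k - k1 - k2))"
      proof (cases "k \<noteq> 0 \<and> k1 + k2 = 0")
        case True
        have "cmod (res k k1 k2) * jb k = 2 * \<tau> * (\<bar>real_of_int (k - k2)\<bar> / \<bar>real_of_int k\<bar> * jb k)"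
          using True tau by (simp add: res_def norm_mult norm_divide del: of_int_diff)
        also have "\<dots> \<le> 2 * \<tau> * (2 * \<bar>real_of_int (k - k2)\<bar>)" using True tau by (intro mult_left_mono jb_frac) auto
        also have "\<bar>real_of_int (k - k2)\<bar> \<le> jb k1 + jb k2 + jb (k - k1 - k2)"
          using abs_le_jb[of k1] abs_le_jb[of "k - k1 - k2"] jb_nonneg[of k2] unfolding of_int_diff by linarith
        finally show ?thesis using tau by (simp add: mult_left_mono algebra_simps)
      next
        case False
        then have "res k k1 k2 = 0" by (auto simp: res_def)
        then show ?thesis using tau by simp
      qed
    qed (use tau in auto)
    have nmb: "mb n1 (6 * \<tau> + 4 * \<tau>)"
      using mb_add[OF mb_twm[OF mm_mb] mb_cmult[OF rmb, of "-1"], of t] unfolding n1_def[abs_def] by simp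
    have smb: "mb (\<lambda>k k1 k2. n1 k k1 (k - k1 - k2)) (6 * \<tau> + 4 * \<tau>)"
      using nmb unfolding mb_def by (smt (verit) diff_diff_eq2 add_diff_cancel_left' diff_add_cancel add.commute diff_diff_add)
    have "2 * cub n1 v k = cub n1 v k + cub (\<lambda>k k1 k2. n1 k k1 (k - k1 - k2)) v k"
      by (simp add: cub_swap)
    also have "\<dots> = cub (\<lambda>k k1 k2. n1 k k1 k2 + n1 k k1 (k - k1 - k2)) v k"
      by (rule cub_add_m[OF nmb smb v, symmetric])
    also have "\<dots> = cub (\<lambda>k k1 k2. 2 * (ph k k1 k2 + - twm t bb k k1 k2)) v k"
      unfolding cub_def tri_def
    proof (intro infsum_cong, clarify)
      fix k1 k2
      have "n1 k k1 k2 + n1 k k1 (k - k1 - k2) = 2 * (ph k k1 k2 + - twm t bb k k1 k2)"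
        unfolding e phis using False by (simp add: ph_def twm_def bb_def field_simps)
      then show "trt (\<lambda>k k1 k2. n1 k k1 k2 + n1 k k1 (k - k1 - k2)) (rv v) v v k (k1, k2) = trt (\<lambda>k k1 k2. 2 * (ph k k1 k2 + - twm t bb k k1 k2)) (rv v) v v k (k1, k2)"
        by (simp add: trt_def)
    qed
    also have "\<dots> = 2 * cub (\<lambda>k k1 k2. ph k k1 k2 + - twm t bb k k1 k2) v k" by (rule cub_mult_const)
    finally have n: "cub n1 v k = cub ph v k - cub (twm t bb) v k" using sum by simp
    have "cub (twm t mm) v k = cub n1 v k + cub res v k"
      using cub_add_m[OF nmb rmb v, of k] by (simp add: n1_def)
    moreover have "cub res v k = \<i> * of_real (xk k) * v k" unfolding res_def by (rule resonant_sum[OF v mass mom False])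
    ultimately show ?thesis using n False by (simp add: ph_def)
  qed
qed

end

section \<open>Local and global error\<close>

text \<open>Summation by parts for \<open>f j\<close> that need not be linear in its second
  argument: the argument is frozen at \<open>x 0\<close>, and each later change of it is paired with
  all remaining indices \<open>j \<ge> i\<close>.\<close>

lemma sum_abel:
  fixes f :: "nat \<Rightarrow> 'x \<Rightarrow> complex"
  shows "(\<Sum>j<n. f j (x j)) = (\<Sum>j<n. f j (x 0)) + (\<Sum>i\<in>{1..<n}. \<Sum>j\<in>{i..<n}. f j (x i) - f j (x (i - 1)))"
proof (induction n)
  case (Suc n)
  have tele: "f n (x m) = f n (x 0) + (\<Sum>i\<in>{1..<Suc m}. f n (x i) - f n (x (i - 1)))" for m
    by (induction m) auto
  have "(\<Sum>i\<in>{1..<Suc n}. \<Sum>j\<in>{i..<Suc n}. f j (x i) - f j (x (i - 1)))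
      = (\<Sum>i\<in>{1..<Suc n}. (\<Sum>j\<in>{i..<n}. f j (x i) - f j (x (i - 1))) + (f n (x i) - f n (x (i - 1))))"
    by (intro sum.cong) auto
  also have "\<dots> = (\<Sum>i\<in>{1..<Suc n}. \<Sum>j\<in>{i..<n}. f j (x i) - f j (x (i - 1))) + (f n (x n) - f n (x 0))"
  proof -
    have "(\<Sum>i\<in>{1..<Suc n}. f n (x i) - f n (x (i - 1))) = f n (x n) - f n (x 0)"
      by (subst (2) tele) (simp only: add_diff_cancel_left')
    then show ?thesis by (simp only: sum.distrib)
  qed
  also have "(\<Sum>i\<in>{1..<Suc n}. \<Sum>j\<in>{i..<n}. f j (x i) - f j (x (i - 1))) = (\<Sum>i\<in>{1..<n}. \<Sum>j\<in>{i..<n}. f j (x i) - f j (x (i - 1)))"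
    by (cases n) auto
  finally show ?case using Suc by simp
qed simp


context sch
begin

text \<open>The increment of one step of \<Psi> taken at time \<open>t\<close>, written in twisted
  coefficients; the time enters only through the modulation \<open>twm\<close>.\<close>

definition Ft :: "real \<Rightarrow> (int \<Rightarrow> complex) \<Rightarrow> int \<Rightarrow> complex" where
  "Ft t X k = (eps k - 1) * X k + cub (twm t mm) X k"

end

text \<open>The constants of the final bounds, \<open>Ke\<close> and \<open>KM\<close>, involve only
  \<open>\<gamma>\<close>, \<open>\<theta>\<close>, \<open>T\<close> and \<open>B\<close>, not
  \<open>\<tau>\<close>, \<open>\<mu>\<close>, \<open>p0\<close> or \<open>v\<close>. Exported, they
  are functions of these four arguments, which expresses the uniformity required at the end.\<close>

locale sol = sch +
  fixes T B :: real and v :: "real \<Rightarrow> int \<Rightarrow> complex"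
  assumes T: "0 < T" and B: "1 \<le> B"
    and v_hb: "\<And>t. 0 \<le> t \<Longrightarrow> t \<le> T \<Longrightarrow> hb \<gamma> (v t) B"
    and v_der: "\<And>k t. 0 \<le> t \<Longrightarrow> t \<le> T \<Longrightarrow>
      ((\<lambda>s. v s k) has_vector_derivative (- \<i> * cub (twm t (\<lambda>_ _ _. 1)) (v t) k)) (at t within {0..T})"
    and mass0: "(\<Sum>\<^sub>\<infinity>k. (cmod (v 0 k))^2) = \<mu>^2"
    and mom0: "(\<Sum>\<^sub>\<infinity>k. of_int k * (cmod (v 0 k))^2) = p0"
begin

lemma one_mb: "mb (twm t (\<lambda>_ _ _. 1)) 1"
  by (intro mb_twm mb_bounded) auto

text \<open>Undoing the twist at the fixed time \<open>t\<close> removes the modulation without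
  changing the products with conjugates, so \<open>quartic_real\<close> applies.\<close>

lemma vg_real:
  assumes t: "0 \<le> t" "t \<le> T" and q: "q = (\<lambda>_. 1) \<or> q = real_of_int"
  shows "(\<Sum>\<^sub>\<infinity>k. q k * Re (cnj (v t k) * (- \<i> * cub (twm t (\<lambda>_ _ _. 1)) (v t) k))) = 0"
proof -
  define y where "y j = cis (- (t * (real_of_int j)^2)) * v t j" for j
  define w where "w k = cnj (y k) * cub (\<lambda>_ _ _. 1) y k" for k
  have yh: "hb \<gamma> y B" by (rule hb_cong_norm[OF v_hb[OF t]]) (simp add: y_def norm_mult)
  have "cnj (v t k) * cub (twm t (\<lambda>_ _ _. 1)) (v t) k = w k" for k
  proof -
    have "cub (twm t (\<lambda>_ _ _. 1)) (v t) k = cis (t * (real_of_int k)^2) * cub (\<lambda>_ _ _. 1) y k"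
      unfolding y_def cub_twist twm_def ..
    then show ?thesis by (simp add: w_def y_def cis_cnj)
  qed
  then have "Re (cnj (v t k) * (- \<i> * cub (twm t (\<lambda>_ _ _. 1)) (v t) k)) = Im (w k)" for k
    by (metis (no_types, lifting) Re_i_times add.inverse_inverse complex_minus mult.left_commute mult_minus_left uminus_complex.sel(1))
  then have eq: "(\<Sum>\<^sub>\<infinity>k. q k * Re (cnj (v t k) * (- \<i> * cub (twm t (\<lambda>_ _ _. 1)) (v t) k))) = (\<Sum>\<^sub>\<infinity>k. Im (of_real (q k) * w k))"
    by simp
  have qj: "\<bar>q k\<bar> \<le> jb k" for k using q jb_ge1[of k] abs_le_jb[of k] by auto
  have "hb \<gamma> (cub (\<lambda>_ _ _. 1) y) (9 * kap^3 * 1 * B^3)"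
    using cub_yb[OF mb_bounded[of 1 "\<lambda>_ _ _. 1"] _ yb_one[OF yh]] by (auto simp: yb_def)
  then have c0: "hb 0 (cub (\<lambda>_ _ _. 1) y) (9 * kap^3 * 1 * B^3)" by (rule hb_weaken) (use gamma_ge1 in simp)
  have "l1 (\<lambda>k. cmod (of_real (q k) * w k)) (B * (9 * kap^3 * 1 * B^3))"
  proof (rule l1_mono[OF l1_mult_l2[OF hb_l2_one[OF hb_gamma_one[OF yh]] hb_l2_zero[OF c0]]])
    show "cmod (of_real (q k) * w k) \<le> \<bar>jb k * cmod (y k)\<bar> * \<bar>cmod (cub (\<lambda>_ _ _. 1) y k)\<bar>" for k
      using qj[of k] by (simp add: w_def norm_mult abs_mult mult.assoc mult_right_mono)
  qed simp
  then have s: "(\<lambda>k. of_real (q k) * w k) summable_on UNIV" by (rule l1_imp_abs_summable)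
  have "(\<Sum>\<^sub>\<infinity>k. Im (of_real (q k) * w k)) = Im (\<Sum>\<^sub>\<infinity>k. of_real (q k) * w k)"
    using infsum_Im[OF s] by simp
  also have "\<dots> = 0" using q quartic_real[OF yh] by (auto simp: w_def)
  finally show ?thesis using eq by simp
qed

lemma g_hb: "0 \<le> t \<Longrightarrow> t \<le> T \<Longrightarrow> hb \<gamma> (\<lambda>k. - \<i> * cub (twm t (\<lambda>_ _ _. 1)) (v t) k) (9 * kap^3 * B^3)"
  using yb_scale[where c = "- \<i>", OF cub_yb[OF one_mb[of t] _ yb_one[OF v_hb[of t]]]] by (simp add: yb_def)

lemma mass_t: assumes t: "0 \<le> t" "t \<le> T" shows "(\<Sum>\<^sub>\<infinity>k. (cmod (v t k))^2) = \<mu>^2"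
proof -
  have "(\<Sum>\<^sub>\<infinity>k. 1 * (cmod (v t k))^2) = (\<Sum>\<^sub>\<infinity>k. 1 * (cmod (v 0 k))^2)"
  proof (rule conserved_quadratic[OF v_der _ _ _ _ t, where q = "\<lambda>_. 1"])
    fix s assume s: "0 \<le> s" "s \<le> T"
    show "hb 1 (v s) B" by (rule hb_gamma_one[OF v_hb[OF s]])
    show "hb 1 (\<lambda>k. - \<i> * cub (twm s (\<lambda>_ _ _. 1)) (v s) k) (9 * kap^3 * B^3)" by (rule hb_gamma_one[OF g_hb[OF s]])
    show "(\<Sum>\<^sub>\<infinity>k. 1 * Re (cnj (v s k) * (- \<i> * cub (twm s (\<lambda>_ _ _. 1)) (v s) k))) = 0"
      using vg_real[OF s, of "\<lambda>_. 1"] by (simp only: simp_thms)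
  qed (auto simp: jb_ge1 abs_le_jb)
  then show ?thesis using mass0 by simp
qed

lemma mom_t: assumes t: "0 \<le> t" "t \<le> T" shows "(\<Sum>\<^sub>\<infinity>k. of_int k * (cmod (v t k))^2) = p0"
proof -
  have "(\<Sum>\<^sub>\<infinity>k. of_int k * (cmod (v t k))^2) = (\<Sum>\<^sub>\<infinity>k. of_int k * (cmod (v 0 k))^2)"
  proof (rule conserved_quadratic[OF v_der _ _ _ _ t, where q = "real_of_int"])
    fix s assume s: "0 \<le> s" "s \<le> T"
    show "hb 1 (v s) B" by (rule hb_gamma_one[OF v_hb[OF s]])
    show "hb 1 (\<lambda>k. - \<i> * cub (twm s (\<lambda>_ _ _. 1)) (v s) k) (9 * kap^3 * B^3)" by (rule hb_gamma_one[OF g_hb[OF s]])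
    show "(\<Sum>\<^sub>\<infinity>k. of_int k * Re (cnj (v s k) * (- \<i> * cub (twm s (\<lambda>_ _ _. 1)) (v s) k))) = 0"
      using vg_real[OF s, of "real_of_int"] by (simp only: simp_thms)
  qed (auto simp: jb_ge1 abs_le_jb)
  then show ?thesis using mom0 by simp
qed

lemma sq_summable: "hb \<gamma> x C \<Longrightarrow> (\<lambda>k. (cmod (x k))^2) summable_on UNIV"
proof -
  assume "hb \<gamma> x C"
  then have "hb 0 x C" by (rule hb_weaken) (use gamma_ge1 in simp)
  then have "l1 (\<lambda>k. (cmod (x k))^2) (C^2)" by (intro l2_imp_l1_sq hb_l2_zero)
  then show ?thesis by (intro l1_real_summable) simp
qed

lemma v_l2: assumes t: "0 \<le> t" "t \<le> T" shows "hb 0 (v t) \<mu>"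
proof -
  have "(\<Sum>k\<in>F. (cmod (v t k))^2) \<le> \<mu>^2" if "finite F" for F
    unfolding mass_t[OF t, symmetric] using that sq_summable[OF v_hb[OF t]] by (intro finite_sum_le_infsum) auto
  then show ?thesis using mu by (simp add: hb_def l2_def)
qed

lemma v_yb: assumes t: "0 \<le> t" "t \<le> T" shows "yb \<mu> (v t) B"
  unfolding yb_def using v_hb[OF t] hb_mono[OF v_l2[OF t], of "B * \<mu>"] B mu by simp

lemma mu_le: "\<mu> \<le> B"
proof -
  have "hb 0 (v 0) B" using v_hb[of 0] T gamma_ge1 by (intro hb_weaken[of \<gamma> "v 0" B 0]) auto
  then have l: "l2 (\<lambda>k. cmod (v 0 k)) B" by (rule hb_l2_zero)
  have "\<mu>^2 \<le> B^2" unfolding mass0[symmetric] using l2D[OF l] sq_summable[of "v 0" B] v_hb[of 0] T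
    by (intro infsum_le_finite_sums) auto
  then show ?thesis by (rule power2_le_imp_le) (use B in simp)
qed

lemma p0_le: "\<bar>p0\<bar> \<le> B^2"
proof -
  have v1: "hb 1 (v 0) B" using v_hb[of 0] T by (intro hb_gamma_one) auto
  have l: "l1 (\<lambda>k. cmod (complex_of_real (of_int k * (cmod (v 0 k))^2))) (B * B)"
  proof (rule l1_mono[OF l1_mult_l2[OF hb_l2_one[OF v1] hb_l2_one[OF v1]]])
    fix k
    have "\<bar>real_of_int k\<bar> \<le> jb k * jb k" 
      using mult_left_mono[OF jb_ge1[of k] jb_nonneg[of k]] abs_le_jb[of k] by linarith
    then have "\<bar>real_of_int k\<bar> * (cmod (v 0 k))^2 \<le> jb k * jb k * (cmod (v 0 k))^2" by (intro mult_right_mono) auto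
    then show "cmod (complex_of_real (of_int k * (cmod (v 0 k))^2)) \<le> \<bar>jb k * cmod (v 0 k)\<bar> * \<bar>jb k * cmod (v 0 k)\<bar>"
      by (simp add: norm_mult power2_eq_square abs_mult mult_ac)
  qed simp
  have s: "(\<lambda>k. real_of_int k * (cmod (v 0 k))^2) summable_on UNIV"
    using l unfolding norm_of_real by (rule l1_real_summable)
  from l1_imp_abs_summable(3)[OF l] have "cmod (\<Sum>\<^sub>\<infinity>k. complex_of_real (of_int k * (cmod (v 0 k))^2)) \<le> B * B" .
  moreover have "(\<Sum>\<^sub>\<infinity>k. complex_of_real (of_int k * (cmod (v 0 k))^2)) = complex_of_real p0"
    using has_sum_of_real[OF has_sum_infsum[OF s]] unfolding mom0 by (rule infsumI)
  ultimately show ?thesis by (simp add: power2_eq_square)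
qed

lemma xk_bound: "\<bar>xk k\<bar> \<le> 4 * \<tau> * B^2"
proof -
  have m: "\<mu>^2 \<le> B^2" using mu_le mu by (simp add: power_mono)
  have "\<bar>if k = 0 then 0 else - p0 / of_int k\<bar> \<le> B^2"
  proof (cases "k = 0")
    case False
    then have "1 \<le> \<bar>real_of_int k\<bar>" by linarith
    then have "\<bar>p0\<bar> / \<bar>real_of_int k\<bar> \<le> \<bar>p0\<bar> / 1" by (intro divide_left_mono) auto
    then show ?thesis using False p0_le by simp
  qed simp
  then have "\<bar>\<mu>^2 + (if k = 0 then 0 else - p0 / of_int k)\<bar> \<le> 2 * B^2" using m zero_le_power2[of \<mu>] unfolding abs_le_iff by linarith
  then have "2 * \<tau> * \<bar>\<mu>^2 + (if k = 0 then 0 else - p0 / of_int k)\<bar> \<le> 2 * \<tau> * (2 * B^2)" using tau by (intro mult_left_mono) auto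
  then show ?thesis unfolding xk_def abs_mult using tau by simp
qed

definition LL :: real where "LL = 9 * kap^3 * B^3"

lemma LL_nonneg: "0 \<le> LL" unfolding LL_def using kap_pos B by simp

lemma g_yb: "0 \<le> t \<Longrightarrow> t \<le> T \<Longrightarrow> yb \<mu> (\<lambda>k. - \<i> * cub (twm t (\<lambda>_ _ _. 1)) (v t) k) LL"
  using yb_scale[where c = "- \<i>", OF cub_yb[OF one_mb[of t] _ v_yb[of t]]] mu by (simp add: LL_def)

lemma v_lip:
  assumes "0 \<le> s" "s \<le> t" "t \<le> T"
  shows "yb \<mu> (\<lambda>k. v t k - v s k) ((t - s) * LL)"
proof (rule yb_mvt[OF assms(2)])
  show "((\<lambda>s. v s k) has_vector_derivative (- \<i> * cub (twm r (\<lambda>_ _ _. 1)) (v r) k)) (at r within {s..t})" if "s \<le> r" "r \<le> t" for k r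
    by (rule has_vector_derivative_within_subset[OF v_der]) (use that assms in auto)
  show "yb \<mu> (\<lambda>k. - \<i> * cub (twm r (\<lambda>_ _ _. 1)) (v r) k) LL" if "s \<le> r" "r \<le> t" for r
    using that assms by (intro g_yb) auto
qed

lemma cub_phf_deriv:
  assumes x: "hb \<gamma> x P" and s: "s \<in> {a..b}" and a: "0 \<le> a"
  shows "((\<lambda>s. cub (\<lambda>k k1 k2. phf (phi k k1 k2) s) x k) has_vector_derivative cub (twm s (\<lambda>_ _ _. 1)) x k) (at s within {a..b})"
  unfolding cub_def tri_def
proof (rule has_vector_derivative_infsum[OF s, where M = "\<lambda>p. cmod (trt (\<lambda>_ _ _. 1) (rv x) x x k p)"])
  have one: "mb (\<lambda>_ _ _. 1) 1" by (intro mb_bounded) auto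
  show "(\<lambda>p. cmod (trt (\<lambda>_ _ _. 1) (rv x) x x k p)) summable_on UNIV"
    using x by (intro mb_abs_summable[OF one] hb_rv)
  show "trt (\<lambda>k k1 k2. phf (phi k k1 k2) r) (rv x) x x k summable_on UNIV" if "r \<in> {a..b}" for r
    using x that a by (intro mb_summable[OF mb_bounded[of r]] hb_rv) (auto simp: phf_bound)
  show "((\<lambda>r. trt (\<lambda>k k1 k2. phf (phi k k1 k2) r) (rv x) x x k i) has_vector_derivative trt (twm r (\<lambda>_ _ _. 1)) (rv x) x x k i) (at r within {a..b})" for i r
    by (cases i) (auto simp: trt_def twm_def mult.assoc intro!: has_vector_derivative_mult_left phf_deriv)
  show "cmod (trt (twm r (\<lambda>_ _ _. 1)) (rv x) x x k i) \<le> cmod (trt (\<lambda>_ _ _. 1) (rv x) x x k i)" for i r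
    by (cases i) (auto simp: trt_def twm_def norm_mult)
qed

lemma phf_shift: "cis (t * of_int f) * phf f s = phf f (t + s) - phf f t"
  by (auto simp: phf_def algebra_simps cis_mult diff_divide_distrib)

lemma freeze:
  assumes t: "0 \<le> t" "t + \<tau> \<le> T"
  shows "yb \<mu> (\<lambda>k. v (t + \<tau>) k - v t k - cub (twm t (\<lambda>k k1 k2. - \<i> * phf (phi k k1 k2) \<tau>)) (v t) k)
     (\<tau> * (27 * kap^3 * B^2 * (\<tau> * LL)))"
proof -
  let ?x = "v t"
  have tT: "t \<le> T" using t tau by linarith
  have x: "hb \<gamma> ?x B" using t tT by (intro v_hb)
  define e where "e s k = v s k + \<i> * cub (\<lambda>k k1 k2. phf (phi k k1 k2) s) ?x k" for s k
  define e' where "e' s k = - \<i> * (cub (twm s (\<lambda>_ _ _. 1)) (v s) k - cub (twm s (\<lambda>_ _ _. 1)) ?x k)" for s k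
  have "yb \<mu> (\<lambda>k. e (t + \<tau>) k - e t k) ((t + \<tau> - t) * (27 * kap^3 * B^2 * (\<tau> * LL)))"
  proof (rule yb_mvt)
    fix k s assume s: "t \<le> s" "s \<le> t + \<tau>"
    have 1: "((\<lambda>s. v s k) has_vector_derivative (- \<i> * cub (twm s (\<lambda>_ _ _. 1)) (v s) k)) (at s within {t..t+\<tau>})"
      by (rule has_vector_derivative_within_subset[OF v_der]) (use s t in auto)
    have 2: "((\<lambda>s. \<i> * cub (\<lambda>k k1 k2. phf (phi k k1 k2) s) ?x k) has_vector_derivative \<i> * cub (twm s (\<lambda>_ _ _. 1)) ?x k) (at s within {t..t+\<tau>})"
      using s t by (intro has_vector_derivative_mult_right cub_phf_deriv[OF x]) auto
    show "((\<lambda>s. e s k) has_vector_derivative e' s k) (at s within {t..t+\<tau>})"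
      unfolding e_def e'_def using has_vector_derivative_add[OF 1 2] by (simp add: algebra_simps)
  next
    fix s assume s: "t \<le> s" "s \<le> t + \<tau>"
    have "yb \<mu> (\<lambda>k. v s k - v t k) ((s - t) * LL)" using s t by (intro v_lip) auto
    then have "yb \<mu> (\<lambda>k. v s k - v t k) (\<tau> * LL)"
      using s LL_nonneg mu by (elim yb_mono) (auto intro: mult_right_mono)
    then have "yb \<mu> (\<lambda>k. cub (twm s (\<lambda>_ _ _. 1)) (v s) k - cub (twm s (\<lambda>_ _ _. 1)) ?x k) (27 * kap^3 * 1 * B^2 * (\<tau> * LL))"
      using s t mu tT by (intro cub_lip[OF one_mb] v_yb) auto
    from yb_scale[OF this, of "- \<i>"] show "yb \<mu> (e' s) (27 * kap^3 * B^2 * (\<tau> * LL))"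
      unfolding e'_def by simp
  qed (use tau in auto)
  moreover have "e (t + \<tau>) k - e t k = v (t + \<tau>) k - v t k - cub (twm t (\<lambda>k k1 k2. - \<i> * phf (phi k k1 k2) \<tau>)) ?x k" for k
  proof -
    have b: "mb (\<lambda>k k1 k2. phf (phi k k1 k2) r) r" if "0 \<le> r" for r using that by (intro mb_bounded) (auto simp: phf_bound)
    have "cub (\<lambda>k k1 k2. phf (phi k k1 k2) t + cis (t * of_int (phi k k1 k2)) * phf (phi k k1 k2) \<tau>) ?x k
      = cub (\<lambda>k k1 k2. phf (phi k k1 k2) t) ?x k + cub (twm t (\<lambda>k k1 k2. phf (phi k k1 k2) \<tau>)) ?x k"
      using cub_add_m[OF b[OF t(1)] mb_twm[OF b[of \<tau>], of t] x, of k] tau by (simp add: twm_def)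
    moreover have "(\<lambda>k k1 k2. phf (phi k k1 k2) t + cis (t * of_int (phi k k1 k2)) * phf (phi k k1 k2) \<tau>) = (\<lambda>k k1 k2. phf (phi k k1 k2) (t + \<tau>))"
      by (simp add: phf_shift)
    moreover have "cub (twm t (\<lambda>k k1 k2. - \<i> * phf (phi k k1 k2) \<tau>)) ?x k = - \<i> * cub (twm t (\<lambda>k k1 k2. phf (phi k k1 k2) \<tau>)) ?x k"
    proof -
      have "twm t (\<lambda>k k1 k2. - \<i> * phf (phi k k1 k2) \<tau>) = (\<lambda>k k1 k2. - \<i> * twm t (\<lambda>k k1 k2. phf (phi k k1 k2) \<tau>) k k1 k2)"
        by (auto simp: fun_eq_iff twm_def)
      then show ?thesis by (simp only: cub_mult_const)
    qed
    ultimately show ?thesis by (simp add: e_def algebra_simps)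
  qed
  ultimately show ?thesis by simp
qed

definition delta :: "real \<Rightarrow> int \<Rightarrow> complex" where
  "delta t k = v (t + \<tau>) k - v t k - Ft t (v t) k"

text \<open>The local error without its oscillating cubic part. It is
  \<open>O(\<tau>\<^sup>2)\<close> in both norms at each step and can be summed without
  cancellation.\<close>

definition rho :: "real \<Rightarrow> int \<Rightarrow> complex" where
  "rho t k = delta t k - cub (twm t bb) (v t) k"

definition Krho :: real where "Krho = 27 * kap^3 * B^2 * LL + 16 * B^5"

lemma Krho_nonneg: "0 \<le> Krho" unfolding Krho_def using LL_nonneg kap_pos B by simp

text \<open>Two sources: freezing \<open>v\<close> during the step, and the second-order remainder
  of \<open>cis (- xk k)\<close>. The first-order term \<open>\<i> * xk k\<close> is supplied by the
  resonant sum in \<open>mm_identity\<close>, for \<open>k = 0\<close> by the added term of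
  \<open>eps\<close>. Conservation of mass and momentum enters here: \<open>xk\<close> is formed
  from the data at time \<open>0\<close>, the resonant sum from \<open>v t\<close>.\<close>

lemma rho_yb:
  assumes t: "0 \<le> t" "t + \<tau> \<le> T"
  shows "yb \<mu> (rho t) (\<tau>^2 * Krho)"
proof -
  have tT: "t \<le> T" using t tau by linarith
  have rho: "rho t k = (v (t + \<tau>) k - v t k - cub (twm t (\<lambda>k k1 k2. - \<i> * phf (phi k k1 k2) \<tau>)) (v t) k)
     - (cis (- xk k) - 1 + \<i> * of_real (xk k)) * v t k" for k
    unfolding rho_def delta_def Ft_def mm_identity[OF v_hb[OF t(1) tT] mass_t[OF t(1) tT] mom_t[OF t(1) tT]]
    by (cases "k = 0") (auto simp: eps_def xk_def algebra_simps)
  have "yb \<mu> (\<lambda>k. (cis (- xk k) - 1 + \<i> * of_real (xk k)) * v t k) ((16 * \<tau>^2 * B^4) * B)"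
  proof (rule yb_dom[OF v_yb[OF t(1) tT]])
    fix k
    have "\<bar>xk k\<bar>^2 \<le> (4 * \<tau> * B^2)^2" using xk_bound[of k] by (intro power_mono) auto
    then have "(xk k)^2 \<le> 16 * \<tau>^2 * B^4" by (simp add: power_mult_distrib)
    then show "cmod ((cis (- xk k) - 1 + \<i> * of_real (xk k)) * v t k) \<le> 16 * \<tau>^2 * B^4 * cmod (v t k)"
      unfolding norm_mult using cis_second_order[of "xk k"] by (intro mult_right_mono) auto
  qed auto
  from yb_diff[OF freeze[OF t] this] show ?thesis
    unfolding rho[abs_def] Krho_def by (simp add: power2_eq_square power4_eq_xxxx algebra_simps numeral_eq_Suc)
qed

lemma bb_gamma: "0 \<le> t \<Longrightarrow> t \<le> T \<Longrightarrow> hb \<gamma> (cub (twm t bb) (v t)) (\<tau> * \<tau> powr \<theta> * (12 * kap^3 * B^3))"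
proof -
  assume t: "0 \<le> t" "t \<le> T"
  have "hb \<gamma> (cub (twm t bb) (v t)) (4 * \<tau> * \<tau> powr \<theta> * (3 * kap^3 * (B * B * B)))"
    unfolding cub_def using v_hb[OF t] bb_hard tau by (intro tri_hard(1) hb_rv) (auto simp: twm_def norm_mult)
  then show ?thesis by (simp add: power3_eq_cube algebra_simps)
qed

lemma bbe_zero: "0 \<le> t \<Longrightarrow> t \<le> T \<Longrightarrow> hb 0 (cub (twm t bbe) (v t)) (\<tau> * \<tau> powr \<theta> * (8 * kap^2 * B^3) * \<mu>)"
proof -
  assume t: "0 \<le> t" "t \<le> T"
  have "hb 0 (cub (twm t bbe) (v t)) (8 * \<tau> * \<tau> powr \<theta> * kap^2 * (B * \<mu> * B * B))"
    unfolding cub_def using v_hb[OF t] yb_zero[OF v_yb[OF t]] bbe_bound tau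
    by (intro tri_easy hb_rv) (auto simp: twm_def norm_mult)
  then show ?thesis by (simp add: power3_eq_cube algebra_simps)
qed

text \<open>By \<open>sum_abel\<close> the sequences are frozen within each inner sum, which then is
  a trilinear form with the geometric multiplier \<open>G i\<close>. The increments of
  \<open>v\<close> over one step are of size \<open>\<tau> * LL\<close>, so the at most
  \<open>T / \<tau>\<close> changes of argument contribute \<open>3 * T * LL\<close>, one third for
  each factor.\<close>

lemma bbh_sum_zero:
  assumes n: "real n * \<tau> \<le> T"
  shows "hb 0 (\<lambda>k. \<Sum>j<n. cub (twm (real j * \<tau>) bbh) (v (real j * \<tau>)) k) (\<tau> powr \<theta> * (sconst T * (B^3 + 3 * T * LL * B^2)) * \<mu>)"
proof -
  define G where "G i = (\<lambda>k k1 k2. (\<Sum>j\<in>{i..<n}. cis (real j * \<tau> * of_int (phi k k1 k2))) * bbh k k1 k2)" for i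
  have jT: "0 \<le> real j * \<tau>" "real j * \<tau> \<le> T" if "j \<le> n" for j
  proof -
    have "real j * \<tau> \<le> real n * \<tau>" using that tau by (intro mult_right_mono) auto
    then show "0 \<le> real j * \<tau>" "real j * \<tau> \<le> T" using tau n by (simp, linarith)
  qed
  have Gmb: "mb (G i) (real n * (4 * \<tau>))" for i
  proof (rule mb_dom[OF bbh_mb])
    fix k k1 k2
    have "cmod (\<Sum>j\<in>{i..<n}. cis (real j * \<tau> * of_int (phi k k1 k2))) \<le> (\<Sum>j\<in>{i..<n}. cmod (cis (real j * \<tau> * of_int (phi k k1 k2))))" by (rule norm_sum)
    also have "\<dots> \<le> real n" by simp
    finally show "cmod (G i k k1 k2) \<le> real n * cmod (bbh k k1 k2)" unfolding G_def norm_mult by (rule mult_right_mono) simp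
  qed simp
  have cubG: "(\<Sum>j\<in>{i..<n}. cub (twm (real j * \<tau>) bbh) x k) = cub (G i) x k" if x: "hb \<gamma> x P" for i x k P
    using cub_sum_m[where m = "\<lambda>j. twm (real j * \<tau>) bbh" and J = "{i..<n}", OF mb_twm[OF bbh_mb] x, of k]
    by (simp add: G_def twm_def sum_distrib_right)
  have hts: "hb 0 (tri (G i) a b c) (sconst T * \<tau> powr \<theta> * (P * Q * R) * \<mu>)"
    if "yb \<mu> a P" "yb \<mu> b Q" "yb \<mu> c R" for a b c P Q R i
    unfolding G_def using mu by (intro hard_time_sum[OF tau n _ _ bbh_bound that]) (auto simp: bbh_def)
  let ?s = "sconst T * \<tau> powr \<theta> * \<mu>"
  have s0: "0 \<le> ?s" using sconst_nonneg T mu by simp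
  have "(\<Sum>j<n. cub (twm (real j * \<tau>) bbh) (v (real j * \<tau>)) k) = cub (G 0) (v 0) k
     + (\<Sum>i\<in>{1..<n}. cub (G i) (v (real i * \<tau>)) k - cub (G i) (v (real (i - 1) * \<tau>)) k)" for k
  proof -
    have "(\<Sum>j<n. cub (twm (real j * \<tau>) bbh) (v (real j * \<tau>)) k) = (\<Sum>j<n. cub (twm (real j * \<tau>) bbh) (v (real 0 * \<tau>)) k)
     + (\<Sum>i\<in>{1..<n}. \<Sum>j\<in>{i..<n}. cub (twm (real j * \<tau>) bbh) (v (real i * \<tau>)) k - cub (twm (real j * \<tau>) bbh) (v (real (i - 1) * \<tau>)) k)"
      by (rule sum_abel[where f = "\<lambda>j x. cub (twm (real j * \<tau>) bbh) x k" and x = "\<lambda>i. v (real i * \<tau>)"])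
    also have "(\<Sum>j<n. cub (twm (real j * \<tau>) bbh) (v (real 0 * \<tau>)) k) = cub (G 0) (v 0) k"
      using cubG[where i = 0 and k = k, OF v_hb[of 0]] T by (simp add: lessThan_atLeast0)
    also have "(\<Sum>i\<in>{1..<n}. \<Sum>j\<in>{i..<n}. cub (twm (real j * \<tau>) bbh) (v (real i * \<tau>)) k - cub (twm (real j * \<tau>) bbh) (v (real (i - 1) * \<tau>)) k)
       = (\<Sum>i\<in>{1..<n}. cub (G i) (v (real i * \<tau>)) k - cub (G i) (v (real (i - 1) * \<tau>)) k)"
    proof (rule sum.cong[OF refl])
      fix i assume i: "i \<in> {1..<n}"
      have "hb \<gamma> (v (real i * \<tau>)) B" "hb \<gamma> (v (real (i - 1) * \<tau>)) B" using jT[of i] jT[of "i - 1"] i by (auto intro!: v_hb)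
      then show "(\<Sum>j\<in>{i..<n}. cub (twm (real j * \<tau>) bbh) (v (real i * \<tau>)) k - cub (twm (real j * \<tau>) bbh) (v (real (i - 1) * \<tau>)) k)
        = cub (G i) (v (real i * \<tau>)) k - cub (G i) (v (real (i - 1) * \<tau>)) k"
        unfolding sum_subtractf by (simp only: cubG)
    qed
    finally show ?thesis .
  qed
  moreover have "hb 0 (cub (G 0) (v 0)) (?s * B^3)"
  proof -
    have "yb \<mu> (v 0) B" using T by (intro v_yb) auto
    from hts[OF yb_rv[OF this] this this, of 0] show ?thesis by (simp add: cub_def power3_eq_cube algebra_simps)
  qed
  moreover have "hb 0 (\<lambda>k. cub (G i) (v (real i * \<tau>)) k - cub (G i) (v (real (i - 1) * \<tau>)) k) (?s * (3 * LL * B^2) * \<tau>)" if i: "i \<in> {1..<n}" for i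
  proof -
    let ?x = "v (real i * \<tau>)" and ?y = "v (real (i - 1) * \<tau>)"
    have x: "yb \<mu> ?x B" and y: "yb \<mu> ?y B" using jT[of i] jT[of "i - 1"] i by (auto intro!: v_yb)
    have ii: "real i = real (i - 1) + 1" using i by auto
    have "real i * \<tau> - real (i - 1) * \<tau> = \<tau>" unfolding ii by (simp add: algebra_simps)
    moreover have "real (i - 1) * \<tau> \<le> real i * \<tau>" using tau by (intro mult_right_mono) auto
    ultimately have d: "yb \<mu> (\<lambda>k. ?x k - ?y k) (\<tau> * LL)"
      using v_lip[of "real (i - 1) * \<tau>" "real i * \<tau>"] jT[of i] jT[of "i - 1"] i by simp
    show ?thesis unfolding cub_diff[OF Gmb yb_gamma[OF x] yb_gamma[OF y]]
      by (rule hb_mono[OF hb_add[OF hb_add[OF hts[OF yb_rv[OF d] x x] hts[OF yb_rv[OF y] d x]] hts[OF yb_rv[OF y] y d]]])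
         (simp add: power2_eq_square algebra_simps)
  qed
  ultimately have "hb 0 (\<lambda>k. \<Sum>j<n. cub (twm (real j * \<tau>) bbh) (v (real j * \<tau>)) k) (?s * B^3 + (\<Sum>i\<in>{1..<n}. ?s * (3 * LL * B^2) * \<tau>))"
    by (simp only:) (intro hb_add hb_sum)
  moreover have "(\<Sum>i\<in>{1..<n}. ?s * (3 * LL * B^2) * \<tau>) \<le> ?s * (3 * LL * B^2) * T"
  proof -
    have "(\<Sum>i\<in>{1..<n}. ?s * (3 * LL * B^2) * \<tau>) = ?s * (3 * LL * B^2) * (real (n - 1) * \<tau>)" by (simp add: algebra_simps)
    also have "\<dots> \<le> ?s * (3 * LL * B^2) * T"
      using s0 LL_nonneg jT[of "n - 1"] by (intro mult_left_mono) auto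
    finally show ?thesis .
  qed
  ultimately show ?thesis by (elim hb_mono) (simp add: algebra_simps)
qed

definition KD :: real where
  "KD = T * Krho + T * (12 * kap^3 * B^3) + T * (8 * kap^2 * B^3) + sconst T * (B^3 + 3 * T * LL * B^2)"

lemma KD_nonneg: "0 \<le> KD"
  unfolding KD_def using T Krho_nonneg kap_pos B sconst_nonneg[of T] LL_nonneg
  by (intro add_nonneg_nonneg mult_nonneg_nonneg) auto

lemma tau_le_powr: "\<tau> \<le> \<tau> powr \<theta>"
  using powr_mono'[of \<theta> 1 \<tau>] theta_le1 tau by simp

text \<open>In \<open>H^\<gamma>\<close> the stepwise bound of the cubic term is enough, because no
  power of \<mu> is demanded. The \<open>L^2\<close> part requires the division into
  \<open>bbe\<close> and \<open>bbh\<close>.\<close>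

lemma D_yb:
  assumes n: "real n * \<tau> \<le> T"
  shows "yb \<mu> (\<lambda>k. \<Sum>j<n. delta (real j * \<tau>) k) (KD * \<tau> powr \<theta>)"
proof -
  have jT: "0 \<le> real j * \<tau>" "real j * \<tau> \<le> T" "real j * \<tau> + \<tau> \<le> T" if "j \<in> {..<n}" for j
  proof -
    have "(real j + 1) * \<tau> \<le> real n * \<tau>" using that tau by (intro mult_right_mono) auto
    then have "real j * \<tau> + \<tau> \<le> T" using n by (simp add: algebra_simps)
    then show "0 \<le> real j * \<tau>" "real j * \<tau> \<le> T" "real j * \<tau> + \<tau> \<le> T" using tau by auto
  qed
  have sc: "real n * (\<tau> * c) \<le> T * c" if "0 \<le> c" for c
    using mult_right_mono[OF n that] by (simp add: mult.assoc)
  have rs: "yb \<mu> (\<lambda>k. \<Sum>j<n. rho (real j * \<tau>) k) (T * Krho * \<tau> powr \<theta>)"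
  proof (rule yb_mono[OF yb_sum[OF rho_yb]])
    have "(\<Sum>j<n. \<tau>^2 * Krho) = real n * (\<tau> * (\<tau> * Krho))" by (simp add: power2_eq_square algebra_simps)
    also have "\<dots> \<le> T * (\<tau> * Krho)" using tau Krho_nonneg by (intro sc) auto
    also have "\<dots> \<le> T * (\<tau> powr \<theta> * Krho)" using T Krho_nonneg tau_le_powr by (intro mult_left_mono mult_right_mono) auto
    finally show "(\<Sum>j<n. \<tau>^2 * Krho) \<le> T * Krho * \<tau> powr \<theta>" by (simp add: algebra_simps)
  qed (use jT mu in auto)
  have "hb \<gamma> (\<lambda>k. \<Sum>j<n. cub (twm (real j * \<tau>) bb) (v (real j * \<tau>)) k) (\<Sum>j<n. \<tau> * \<tau> powr \<theta> * (12 * kap^3 * B^3))"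
    using jT by (intro hb_sum bb_gamma) auto
  moreover have "(\<Sum>j<n. \<tau> * \<tau> powr \<theta> * (12 * kap^3 * B^3)) \<le> T * (12 * kap^3 * B^3) * \<tau> powr \<theta>"
    using sc[of "\<tau> powr \<theta> * (12 * kap^3 * B^3)"] kap_pos B by (simp add: algebra_simps)
  ultimately have bg: "hb \<gamma> (\<lambda>k. \<Sum>j<n. cub (twm (real j * \<tau>) bb) (v (real j * \<tau>)) k) (T * (12 * kap^3 * B^3) * \<tau> powr \<theta>)"
    by (rule hb_mono)
  have split: "cub (twm (real j * \<tau>) bb) (v (real j * \<tau>)) k = cub (twm (real j * \<tau>) bbe) (v (real j * \<tau>)) k + cub (twm (real j * \<tau>) bbh) (v (real j * \<tau>)) k"
    if "j \<in> {..<n}" for j k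
  proof -
    have "twm (real j * \<tau>) bb = (\<lambda>k k1 k2. twm (real j * \<tau>) bbe k k1 k2 + twm (real j * \<tau>) bbh k k1 k2)"
      by (auto simp: fun_eq_iff twm_def bbe_def bbh_def)
    then show ?thesis using cub_add_m[OF mb_twm[OF bbe_mb] mb_twm[OF bbh_mb] v_hb[OF jT(1,2)[OF that]]] by simp
  qed
  have "hb 0 (\<lambda>k. \<Sum>j<n. cub (twm (real j * \<tau>) bbe) (v (real j * \<tau>)) k) (\<Sum>j<n. \<tau> * \<tau> powr \<theta> * (8 * kap^2 * B^3) * \<mu>)"
    using jT by (intro hb_sum bbe_zero) auto
  moreover have "(\<Sum>j<n. \<tau> * \<tau> powr \<theta> * (8 * kap^2 * B^3) * \<mu>) \<le> T * (8 * kap^2 * B^3) * \<tau> powr \<theta> * \<mu>"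
    using sc[of "\<tau> powr \<theta> * (8 * kap^2 * B^3) * \<mu>"] B mu by (simp add: algebra_simps)
  ultimately have "hb 0 (\<lambda>k. \<Sum>j<n. cub (twm (real j * \<tau>) bbe) (v (real j * \<tau>)) k) (T * (8 * kap^2 * B^3) * \<tau> powr \<theta> * \<mu>)"
    by (rule hb_mono)
  from hb_add[OF this bbh_sum_zero[OF n]]
  have bz: "hb 0 (\<lambda>k. \<Sum>j<n. cub (twm (real j * \<tau>) bb) (v (real j * \<tau>)) k)
     (T * (8 * kap^2 * B^3) * \<tau> powr \<theta> * \<mu> + \<tau> powr \<theta> * (sconst T * (B^3 + 3 * T * LL * B^2)) * \<mu>)"
    by (simp add: split sum.distrib)
  have "delta t k = rho t k + cub (twm t bb) (v t) k" for t k by (simp add: rho_def)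
  then have eq: "(\<lambda>k. \<Sum>j<n. delta (real j * \<tau>) k) = (\<lambda>k. (\<Sum>j<n. rho (real j * \<tau>) k) + (\<Sum>j<n. cub (twm (real j * \<tau>) bb) (v (real j * \<tau>)) k))"
    by (simp add: sum.distrib)
  have pos: "0 \<le> T * (12 * kap^3 * B^3) * \<tau> powr \<theta>" "0 \<le> T * (8 * kap^2 * B^3) * \<tau> powr \<theta>"
    "0 \<le> sconst T * (B^3 + 3 * T * LL * B^2) * \<tau> powr \<theta>"
    using T kap_pos B sconst_nonneg[of T] LL_nonneg by auto
  show ?thesis unfolding eq yb_def
  proof
    show "hb \<gamma> (\<lambda>k. (\<Sum>j<n. rho (real j * \<tau>) k) + (\<Sum>j<n. cub (twm (real j * \<tau>) bb) (v (real j * \<tau>)) k)) (KD * \<tau> powr \<theta>)"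
      by (rule hb_mono[OF hb_add[OF yb_gamma[OF rs] bg]]) (use pos in \<open>simp add: KD_def algebra_simps\<close>)
    have "T * Krho * \<tau> powr \<theta> * \<mu> + (T * (8 * kap^2 * B^3) * \<tau> powr \<theta> * \<mu> + \<tau> powr \<theta> * (sconst T * (B^3 + 3 * T * LL * B^2)) * \<mu>)
       \<le> KD * \<tau> powr \<theta> * \<mu>"
      using mult_nonneg_nonneg[OF pos(1), of \<mu>] mu by (simp add: KD_def algebra_simps)
    then show "hb 0 (\<lambda>k. (\<Sum>j<n. rho (real j * \<tau>) k) + (\<Sum>j<n. cub (twm (real j * \<tau>) bb) (v (real j * \<tau>)) k)) (KD * \<tau> powr \<theta> * \<mu>)"
      by (rule hb_mono[OF hb_add[OF yb_zero[OF rs] bz]])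
  qed
qed

end

section \<open>The corrected step, its Lipschitz constants and the global error\<close>

context sch
begin

definition Rt :: "real \<Rightarrow> (int \<Rightarrow> complex) \<Rightarrow> real" where
  "Rt t X = Re (ip (Ft t X) X)"

definition Qt :: "real \<Rightarrow> (int \<Rightarrow> complex) \<Rightarrow> real" where
  "Qt t X = Re (ip (Ft t X) (Ft t X))"

definition Ht :: "real \<Rightarrow> (int \<Rightarrow> complex) \<Rightarrow> real" where
  "Ht t X = - (Rt t X + Qt t X / 2) / \<mu>^2"

text \<open>The total coefficient of the freely evolved argument in \<open>G1 + G2\<close>, both
  corrections being real multiples of it.\<close>

definition At :: "real \<Rightarrow> (int \<Rightarrow> complex) \<Rightarrow> real" where
  "At t X = Ht t X - (Ht t X)^2 / 2 - Ht t X * (Rt t X / \<mu>^2)"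

definition Nt :: "real \<Rightarrow> (int \<Rightarrow> complex) \<Rightarrow> int \<Rightarrow> complex" where
  "Nt t X k = Ft t X k + of_real (At t X) * X k"

end

context sol
begin

text \<open>Radius of the ball in which the Lipschitz bounds hold: the numerical solution stays
  within \<open>1\<close> of the exact one as long as
  \<open>Ke * \<tau> powr \<theta> \<le> 1\<close>.\<close>

definition PP :: real where "PP = B + 1"
definition Kf :: real where "Kf = 6 * B^2 * PP + 162 * kap^3 * PP^3"
definition Kh :: real where "Kh = 2 * Kf * PP + 2 * Kf^2"
definition Ka :: real where "Ka = Kh + 3 * Kh^2"
definition Kn :: real where "Kn = Kf + 2 * Ka * PP"

lemma PP: "1 \<le> PP" "B \<le> PP" using B by (auto simp: PP_def)

lemma Kf_nonneg: "0 \<le> Kf" unfolding Kf_def using PP kap_pos by simp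
lemma Kh_nonneg: "0 \<le> Kh" unfolding Kh_def using PP Kf_nonneg by simp
lemma Ka_nonneg: "0 \<le> Ka" unfolding Ka_def using Kh_nonneg by simp
lemma Kn_nonneg: "0 \<le> Kn" unfolding Kn_def using Kf_nonneg Ka_nonneg PP by simp

lemma eps_bound: "cmod (eps k - 1) \<le> \<tau> * (6 * B^2)"
proof -
  have m: "\<mu>^2 \<le> B^2" using mu_le mu by (simp add: power_mono)
  have "cmod (eps k - 1) \<le> cmod (cis (- xk k) - 1) + cmod (if k = 0 then \<i> * of_real (2 * \<tau> * \<mu>^2) else 0)"
    unfolding eps_def by (rule order_trans[OF _ norm_triangle_ineq]) (simp add: algebra_simps)
  also have "\<dots> \<le> 4 * \<tau> * B^2 + 2 * \<tau> * \<mu>^2"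
    using cmod_cis_minus_one_le[of "- xk k"] xk_bound[of k] tau by (intro add_mono) (auto simp: norm_mult norm_power)
  also have "\<dots> \<le> 4 * \<tau> * B^2 + 2 * \<tau> * B^2" using tau m by (simp add: mult_left_mono)
  finally show ?thesis by simp
qed

lemma Ft_yb: assumes X: "yb \<mu> X PP" shows "yb \<mu> (Ft t X) (\<tau> * Kf)"
proof -
  have "yb \<mu> (\<lambda>k. (eps k - 1) * X k) (\<tau> * (6 * B^2) * PP)"
    using tau by (intro yb_dom[OF X]) (auto simp: norm_mult intro!: mult_right_mono eps_bound)
  from yb_add[OF this cub_yb[OF mb_twm[OF mm_mb] _ X, of t]] mu
  have "yb \<mu> (Ft t X) (\<tau> * (6 * B^2) * PP + 9 * kap^3 * (6 * \<tau>) * PP^3)" unfolding Ft_def[abs_def] by simp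
  then show ?thesis
  proof (rule yb_mono)
    have "\<tau> * (54 * (kap^3 * PP^3)) \<le> \<tau> * (162 * (kap^3 * PP^3))" using tau kap_pos PP by (intro mult_left_mono) auto
    then show "\<tau> * (6 * B^2) * PP + 9 * kap^3 * (6 * \<tau>) * PP^3 \<le> \<tau> * Kf" by (simp add: Kf_def algebra_simps)
  qed (use mu in simp)
qed

lemma Ft_lip:
  assumes X: "yb \<mu> X PP" and Y: "yb \<mu> Y PP" and d: "yb \<mu> (\<lambda>k. X k - Y k) d"
  shows "yb \<mu> (\<lambda>k. Ft t X k - Ft t Y k) (\<tau> * Kf * d)"
proof -
  have d0: "0 \<le> d" by (rule yb_nonneg[OF d])
  have "yb \<mu> (\<lambda>k. (eps k - 1) * (X k - Y k)) (\<tau> * (6 * B^2) * d)"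
    using tau by (intro yb_dom[OF d]) (auto simp: norm_mult intro!: mult_right_mono eps_bound)
  from yb_add[OF this cub_lip[OF mb_twm[OF mm_mb] _ X Y d, of t]] mu
  have "yb \<mu> (\<lambda>k. (eps k - 1) * (X k - Y k) + (cub (twm t mm) X k - cub (twm t mm) Y k))
     (\<tau> * (6 * B^2) * d + 27 * kap^3 * (6 * \<tau>) * PP^2 * d)" by simp
  moreover have "(\<lambda>k. (eps k - 1) * (X k - Y k) + (cub (twm t mm) X k - cub (twm t mm) Y k)) = (\<lambda>k. Ft t X k - Ft t Y k)"
    by (auto simp: Ft_def algebra_simps)
  ultimately have "yb \<mu> (\<lambda>k. Ft t X k - Ft t Y k) (\<tau> * (6 * B^2) * d + 27 * kap^3 * (6 * \<tau>) * PP^2 * d)" by simp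
  then show ?thesis
  proof (rule yb_mono)
    have 1: "6 * B^2 * 1 \<le> 6 * B^2 * PP" using PP by (intro mult_left_mono) auto
    have "PP^2 \<le> PP^3" using PP by (intro power_increasing) auto
    then have 2: "162 * kap^3 * PP^2 \<le> 162 * kap^3 * PP^3" using kap_pos by (intro mult_left_mono) auto
    have "(\<tau> * d) * (6 * B^2 + 162 * kap^3 * PP^2) \<le> (\<tau> * d) * Kf"
      unfolding Kf_def using 1 2 tau d0 by (intro mult_left_mono) auto
    then show "\<tau> * (6 * B^2) * d + 27 * kap^3 * (6 * \<tau>) * PP^2 * d \<le> \<tau> * Kf * d" by (simp add: algebra_simps)
  qed (use mu in simp)
qed

text \<open>Each argument contributes a factor \<open>\<mu>\<close>, exactly what the division by
  \<open>\<mu>\<^sup>2\<close> in \<open>Ht\<close> consumes.\<close>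

lemma ip_yb: "yb \<mu> X P \<Longrightarrow> yb \<mu> Y Q \<Longrightarrow> \<bar>Re (ip X Y)\<bar> \<le> P * Q * \<mu>^2"
  using ip_bound[OF yb_zero yb_zero, of \<mu> X P \<mu> Y Q] abs_Re_le_cmod[of "ip X Y"]
  by (simp add: power2_eq_square mult_ac)

lemma ip_diff_yb:
  assumes "yb \<mu> X P" "yb \<mu> X' P" "yb \<mu> Y Q" "yb \<mu> Y' Q" "yb \<mu> (\<lambda>k. X k - X' k) d" "yb \<mu> (\<lambda>k. Y k - Y' k) e"
  shows "\<bar>Re (ip X Y) - Re (ip X' Y')\<bar> \<le> (d * Q + P * e) * \<mu>^2"
proof -
  have "ip X Y - ip X' Y' = ip (\<lambda>k. X k - X' k) Y + ip X' (\<lambda>k. Y k - Y' k)"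
    using ip_diff_left[OF yb_zero[OF assms(1)] yb_zero[OF assms(2)] yb_zero[OF assms(3)]]
      ip_diff_right[OF yb_zero[OF assms(2)] yb_zero[OF assms(3)] yb_zero[OF assms(4)]] by simp
  then have "Re (ip X Y) - Re (ip X' Y') = Re (ip (\<lambda>k. X k - X' k) Y) + Re (ip X' (\<lambda>k. Y k - Y' k))"
    by (metis minus_complex.sel(1) plus_complex.sel(1))
  moreover have "\<bar>Re (ip (\<lambda>k. X k - X' k) Y)\<bar> \<le> d * Q * \<mu>^2" "\<bar>Re (ip X' (\<lambda>k. Y k - Y' k))\<bar> \<le> P * e * \<mu>^2"
    using ip_yb[OF assms(5,3)] ip_yb[OF assms(2,6)] by auto
  ultimately show ?thesis by (simp add: algebra_simps)
qed

lemma tau_sq: "\<tau>^2 \<le> \<tau>"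
  using tau by (simp add: power2_eq_square mult_left_le)

lemma Q_bound: assumes X: "yb \<mu> X PP" shows "\<bar>Qt t X\<bar> / \<mu>^2 \<le> \<tau>^2 * Kf^2" "0 \<le> Qt t X"
proof -
  show "\<bar>Qt t X\<bar> / \<mu>^2 \<le> \<tau>^2 * Kf^2"
    using ip_yb[OF Ft_yb[OF X, of t] Ft_yb[OF X, of t]] mu by (simp add: Qt_def divide_le_eq power2_eq_square mult_ac)
  have F0: "hb 0 (Ft t X) (\<tau> * Kf * \<mu>)" using Ft_yb[OF X] by (rule yb_zero)
  have "Re (ip (Ft t X) (Ft t X)) = (\<Sum>\<^sub>\<infinity>k. Re (Ft t X k * cnj (Ft t X k)))"
    unfolding ip_def by (rule infsum_Re[symmetric]) (rule has_sum_imp_summable[OF ip_has_sum[OF F0 F0]])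
  also have "\<dots> \<ge> 0" by (intro infsum_nonneg) (simp add: power2_eq_square[symmetric])
  finally show "0 \<le> Qt t X" by (simp add: Qt_def)
qed

lemma R_bound: assumes X: "yb \<mu> X PP" shows "\<bar>Rt t X / \<mu>^2\<bar> \<le> \<tau> * Kh"
proof -
  have "\<bar>Rt t X\<bar> \<le> \<tau> * Kf * PP * \<mu>^2" unfolding Rt_def by (rule ip_yb[OF Ft_yb[OF X] X])
  then have "\<bar>Rt t X / \<mu>^2\<bar> \<le> \<tau> * Kf * PP" using mu by (simp add: divide_le_eq)
  also have "\<dots> \<le> \<tau> * Kh" unfolding Kh_def using tau Kf_nonneg PP
    by (simp add: mult.assoc mult_left_mono)
  finally show ?thesis .
qed

lemma H_bound: assumes X: "yb \<mu> X PP" shows "\<bar>Ht t X\<bar> \<le> \<tau> * Kh"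
proof -
  have R: "\<bar>Rt t X / \<mu>^2\<bar> \<le> \<tau> * (Kf * PP)"
    using ip_yb[OF Ft_yb[OF X, of t] X] mu by (simp add: Rt_def divide_le_eq mult_ac)
  have Q: "\<bar>Qt t X / \<mu>^2\<bar> \<le> \<tau> * Kf^2"
    using Q_bound(1)[OF X, of t] mult_right_mono[OF tau_sq, of "Kf^2"] by simp
  have e: "Ht t X = - (Rt t X / \<mu>^2) - (Qt t X / \<mu>^2) / 2" using mu by (simp add: Ht_def field_simps)
  have r: "\<bar>- a - b / 2\<bar> \<le> \<bar>a\<bar> + \<bar>b\<bar>" for a b :: real by linarith
  have "\<bar>Ht t X\<bar> \<le> \<bar>Rt t X / \<mu>^2\<bar> + \<bar>Qt t X / \<mu>^2\<bar>" unfolding e by (rule r)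
  also have "\<dots> \<le> \<tau> * (Kf * PP + Kf^2)" using R Q by (simp add: distrib_left)
  also have "\<dots> \<le> \<tau> * Kh" unfolding Kh_def using tau Kf_nonneg PP by (intro mult_left_mono) auto
  finally show ?thesis .
qed

lemma R_lip:
  assumes X: "yb \<mu> X PP" and Y: "yb \<mu> Y PP" and d: "yb \<mu> (\<lambda>k. X k - Y k) d"
  shows "\<bar>Rt t X / \<mu>^2 - Rt t Y / \<mu>^2\<bar> \<le> \<tau> * (2 * Kf * PP) * d"
proof -
  have d0: "0 \<le> d" by (rule yb_nonneg[OF d])
  have "\<bar>Rt t X - Rt t Y\<bar> \<le> (\<tau> * Kf * d * PP + \<tau> * Kf * d) * \<mu>^2"
    unfolding Rt_def by (rule ip_diff_yb[OF Ft_yb[OF X] Ft_yb[OF Y] X Y Ft_lip[OF X Y d] d])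
  then have "\<bar>Rt t X / \<mu>^2 - Rt t Y / \<mu>^2\<bar> \<le> \<tau> * Kf * d * PP + \<tau> * Kf * d * 1"
    using mu by (simp add: diff_divide_distrib[symmetric] divide_le_eq)
  also have "\<dots> \<le> \<tau> * Kf * d * PP + \<tau> * Kf * d * PP" using PP tau Kf_nonneg d0 by (intro add_left_mono mult_left_mono) auto
  finally show ?thesis by (simp add: algebra_simps)
qed

lemma H_lip:
  assumes X: "yb \<mu> X PP" and Y: "yb \<mu> Y PP" and d: "yb \<mu> (\<lambda>k. X k - Y k) d"
  shows "\<bar>Ht t X - Ht t Y\<bar> \<le> \<tau> * Kh * d"
proof -
  have d0: "0 \<le> d" by (rule yb_nonneg[OF d])
  have "\<bar>Qt t X - Qt t Y\<bar> \<le> (\<tau> * Kf * d * (\<tau> * Kf) + \<tau> * Kf * (\<tau> * Kf * d)) * \<mu>^2"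
    unfolding Qt_def by (rule ip_diff_yb[OF Ft_yb[OF X] Ft_yb[OF Y] Ft_yb[OF X] Ft_yb[OF Y] Ft_lip[OF X Y d] Ft_lip[OF X Y d]])
  then have "\<bar>Qt t X / \<mu>^2 - Qt t Y / \<mu>^2\<bar> \<le> \<tau>^2 * (2 * Kf^2 * d)"
    using mu by (simp add: diff_divide_distrib[symmetric] divide_le_eq power2_eq_square algebra_simps)
  also have "\<dots> \<le> \<tau> * (2 * Kf^2 * d)" using tau_sq d0 by (intro mult_right_mono) auto
  finally have Q: "\<bar>Qt t X / \<mu>^2 - Qt t Y / \<mu>^2\<bar> \<le> \<tau> * (2 * Kf^2) * d" by (simp add: algebra_simps)
  have eq: "Ht t Z = - (Rt t Z / \<mu>^2) - (Qt t Z / \<mu>^2) / 2" for Z using mu by (simp add: Ht_def field_simps)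
  have "\<bar>(- a - b / 2) - (- a' - b' / 2)\<bar> \<le> \<bar>a - a'\<bar> + \<bar>b - b'\<bar>" for a b a' b' :: real by linarith
  then have "\<bar>Ht t X - Ht t Y\<bar> \<le> \<bar>Rt t X / \<mu>^2 - Rt t Y / \<mu>^2\<bar> + \<bar>Qt t X / \<mu>^2 - Qt t Y / \<mu>^2\<bar>"
    unfolding eq by blast
  also have "\<dots> \<le> \<tau> * (2 * Kf * PP) * d + \<tau> * (2 * Kf^2) * d" by (rule add_mono[OF R_lip[OF X Y d] Q])
  finally show ?thesis by (simp add: Kh_def algebra_simps)
qed

lemma A_H: assumes X: "yb \<mu> X PP" shows "\<bar>At t X - Ht t X\<bar> \<le> \<tau>^2 * (2 * Kh^2)"
proof -
  have "\<bar>Ht t X\<bar>^2 \<le> (\<tau> * Kh)^2" by (intro power_mono H_bound[OF X]) auto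
  then have h2: "(Ht t X)^2 \<le> \<tau>^2 * Kh^2" by (simp add: power_mult_distrib)
  have "\<bar>Ht t X * (Rt t X / \<mu>^2)\<bar> \<le> (\<tau> * Kh) * (\<tau> * Kh)"
    unfolding abs_mult by (intro mult_mono H_bound[OF X] R_bound[OF X, of t]) (use tau Kh_nonneg in auto)
  then have hr: "\<bar>Ht t X * (Rt t X / \<mu>^2)\<bar> \<le> \<tau>^2 * Kh^2" by (simp add: power2_eq_square algebra_simps)
  have "\<bar>At t X - Ht t X\<bar> \<le> (Ht t X)^2 + \<bar>Ht t X * (Rt t X / \<mu>^2)\<bar>"
    unfolding At_def using zero_le_power2[of "Ht t X"] by linarith
  then show ?thesis using h2 hr by simp
qed

lemma A_bound: assumes X: "yb \<mu> X PP" shows "\<bar>At t X\<bar> \<le> \<tau> * Ka"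
proof -
  have "\<tau>^2 * (2 * Kh^2) \<le> \<tau> * (3 * Kh^2)" using tau_sq tau by (intro mult_mono) auto
  then show ?thesis using A_H[OF X, of t] H_bound[OF X, of t] unfolding Ka_def distrib_left by linarith
qed

lemma A_lip:
  assumes X: "yb \<mu> X PP" and Y: "yb \<mu> Y PP" and d: "yb \<mu> (\<lambda>k. X k - Y k) d"
  shows "\<bar>At t X - At t Y\<bar> \<le> \<tau> * Ka * d"
proof -
  have d0: "0 \<le> d" by (rule yb_nonneg[OF d])
  define h h' r r' where "h = Ht t X" and "h' = Ht t Y" and "r = Rt t X / \<mu>^2" and "r' = Rt t Y / \<mu>^2"
  have b: "\<bar>h\<bar> \<le> \<tau> * Kh" "\<bar>h'\<bar> \<le> \<tau> * Kh" "\<bar>r\<bar> \<le> \<tau> * Kh" "\<bar>r'\<bar> \<le> \<tau> * Kh"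
    unfolding h_def h'_def r_def r'_def using H_bound[OF X] H_bound[OF Y] R_bound[OF X] R_bound[OF Y] by auto
  have l: "\<bar>h - h'\<bar> \<le> \<tau> * Kh * d" unfolding h_def h'_def by (rule H_lip[OF X Y d])
  have lr: "\<bar>r - r'\<bar> \<le> \<tau> * Kh * d"
  proof (rule order_trans[OF R_lip[OF X Y d, of t, folded r_def r'_def]])
    show "\<tau> * (2 * Kf * PP) * d \<le> \<tau> * Kh * d" unfolding Kh_def using tau d0 by (intro mult_right_mono mult_left_mono) auto
  qed
  have p0: "0 \<le> \<tau> * Kh" "0 \<le> \<tau> * Kh * d" using tau Kh_nonneg d0 by auto
  have 1: "\<bar>h^2 / 2 - h'^2 / 2\<bar> \<le> (\<tau> * Kh) * (\<tau> * Kh * d)"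
  proof -
    have "h^2 / 2 - h'^2 / 2 = ((h + h') / 2) * (h - h')" by (simp add: power2_eq_square field_simps)
    moreover have "\<bar>(h + h') / 2\<bar> \<le> \<tau> * Kh" using b(1,2) abs_triangle_ineq[of h h'] by simp
    ultimately show ?thesis using l p0 unfolding abs_mult by (metis abs_ge_zero abs_mult mult_mono)
  qed
  have 2: "\<bar>h * r - h' * r'\<bar> \<le> (\<tau> * Kh * d) * (\<tau> * Kh) + (\<tau> * Kh) * (\<tau> * Kh * d)"
  proof -
    have "h * r - h' * r' = (h - h') * r + h' * (r - r')" by (simp add: algebra_simps)
    also have "\<bar>\<dots>\<bar> \<le> \<bar>h - h'\<bar> * \<bar>r\<bar> + \<bar>h'\<bar> * \<bar>r - r'\<bar>" unfolding abs_mult[symmetric] by (rule abs_triangle_ineq)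
    also have "\<dots> \<le> (\<tau> * Kh * d) * (\<tau> * Kh) + (\<tau> * Kh) * (\<tau> * Kh * d)" using b l lr p0 by (intro add_mono mult_mono) auto
    finally show ?thesis .
  qed
  have "At t X - At t Y = (h - h') - (h^2 / 2 - h'^2 / 2) - (h * r - h' * r')"
    by (simp add: At_def h_def h'_def r_def r'_def)
  then have "\<bar>At t X - At t Y\<bar> \<le> \<tau> * Kh * d + \<tau>^2 * (3 * Kh^2 * d)"
    using l 1 2 by (simp add: power2_eq_square algebra_simps)
  also have "\<tau>^2 * (3 * Kh^2 * d) \<le> \<tau> * (3 * Kh^2 * d)" using tau_sq d0 by (intro mult_right_mono) auto
  finally show ?thesis by (simp add: Ka_def algebra_simps)
qed

lemma Nt_lip:
  assumes X: "yb \<mu> X PP" and Y: "yb \<mu> Y PP" and d: "yb \<mu> (\<lambda>k. X k - Y k) d"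
  shows "yb \<mu> (\<lambda>k. Nt t X k - Nt t Y k) (\<tau> * Kn * d)"
proof -
  have d0: "0 \<le> d" by (rule yb_nonneg[OF d])
  have a: "yb \<mu> (\<lambda>k. of_real (At t X - At t Y) * X k) (\<tau> * Ka * d * PP)"
    using A_lip[OF X Y d, of t] PP mu by (intro yb_mono[OF yb_scale[OF X]] mult_right_mono) (auto simp flip: of_real_diff)
  have b: "yb \<mu> (\<lambda>k. of_real (At t Y) * (X k - Y k)) (\<tau> * Ka * d)"
    using A_bound[OF Y, of t] d0 mu by (intro yb_mono[OF yb_scale[OF d]] mult_right_mono) auto
  have "yb \<mu> (\<lambda>k. (Ft t X k - Ft t Y k) + (of_real (At t X - At t Y) * X k) + of_real (At t Y) * (X k - Y k)) (\<tau> * Kf * d + \<tau> * Ka * d * PP + \<tau> * Ka * d)"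
    by (intro yb_add Ft_lip[OF X Y d] a b)
  moreover have "(\<lambda>k. (Ft t X k - Ft t Y k) + (of_real (At t X - At t Y) * X k) + of_real (At t Y) * (X k - Y k)) = (\<lambda>k. Nt t X k - Nt t Y k)"
    by (auto simp: Nt_def algebra_simps)
  ultimately have "yb \<mu> (\<lambda>k. Nt t X k - Nt t Y k) (\<tau> * Kf * d + \<tau> * Ka * d * PP + \<tau> * Ka * d)" by simp
  then show ?thesis
  proof (rule yb_mono)
    have "\<tau> * Ka * d * 1 \<le> \<tau> * Ka * d * PP" using PP tau Ka_nonneg d0 by (intro mult_left_mono) auto
    then show "\<tau> * Kf * d + \<tau> * Ka * d * PP + \<tau> * Ka * d \<le> \<tau> * Kn * d" by (simp add: Kn_def algebra_simps)
  qed (use mu in simp)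
qed

lemma v_PP: "0 \<le> t \<Longrightarrow> t \<le> T \<Longrightarrow> yb \<mu> (v t) PP"
  using yb_mono[OF v_yb PP(2)] mu by simp

lemma delta_yb: assumes t: "0 \<le> t" "t + \<tau> \<le> T" shows "yb \<mu> (delta t) (\<tau> * (LL + Kf))"
proof -
  have "yb \<mu> (\<lambda>k. (v (t + \<tau>) k - v t k) - Ft t (v t) k) ((t + \<tau> - t) * LL + \<tau> * Kf)"
    using t tau by (intro yb_diff v_lip Ft_yb v_PP) auto
  then show ?thesis by (simp add: delta_def[abs_def] algebra_simps)
qed

lemma ip_v: "0 \<le> t \<Longrightarrow> t \<le> T \<Longrightarrow> ip (v t) (v t) = of_real (\<mu>^2)"
proof -
  assume t: "0 \<le> t" "t \<le> T"
  have "ip (v t) (v t) = (\<Sum>\<^sub>\<infinity>k. complex_of_real ((cmod (v t k))^2))"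
    unfolding ip_def by (intro infsum_cong) (simp only: complex_norm_square)
  also have "\<dots> = of_real (\<mu>^2)"
    using has_sum_of_real[OF has_sum_infsum[OF sq_summable[OF v_hb[OF t]]]] unfolding mass_t[OF t] by (rule infsumI)
  finally show ?thesis .
qed

lemma ip_add_expand:
  assumes "hb 0 a C" "hb 0 b D"
  shows "Re (ip (\<lambda>k. a k + b k) (\<lambda>k. a k + b k)) = Re (ip a a) + 2 * Re (ip b a) + Re (ip b b)"
proof -
  have ab: "hb 0 (\<lambda>k. a k + b k) (C + D)" by (rule hb_add[OF assms])
  have l: "ip (\<lambda>k. a k + b k) c = ip a c + ip b c" if "hb 0 c E" for c E by (rule ip_add_left[OF assms that])
  have "ip c (\<lambda>k. a k + b k) = ip c a + ip c b" if "hb 0 c E" for c E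
    using ip_cnj[of c "\<lambda>k. a k + b k"] l[OF that] ip_cnj[of c a] ip_cnj[of c b] by simp
  then have "ip (\<lambda>k. a k + b k) (\<lambda>k. a k + b k) = ip a a + ip a b + (ip b a + ip b b)"
    using l[OF ab] assms by simp
  moreover have "Re (ip a b) = Re (ip b a)" by (subst ip_cnj) simp
  ultimately show ?thesis by simp
qed

text \<open>The exact flow conserves mass, and
  \<open>v t + Ft t (v t) = v (t + \<tau>) - delta t\<close>. Expanding the square of the
  \<open>L^2\<close> norm on both sides expresses the combination of \<open>Rt\<close> and
  \<open>Qt\<close> in \<open>Ht\<close> through the local error.\<close>

lemma H_delta:
  assumes t: "0 \<le> t" "t + \<tau> \<le> T"
  shows "Ht t (v t) = (Re (ip (delta t) (v (t + \<tau>))) - Re (ip (delta t) (delta t)) / 2) / \<mu>^2"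
proof -
  have tT: "t \<le> T" "0 \<le> t + \<tau>" using t tau by auto
  note vt = yb_zero[OF v_PP[OF t(1) tT(1)]] and vs = yb_zero[OF v_PP[OF tT(2) t(2)]] and dt = yb_zero[OF delta_yb[OF t]]
    and ft = yb_zero[OF Ft_yb[OF v_PP[OF t(1) tT(1)], of t]]
  have e1: "Re (ip (\<lambda>k. v t k + Ft t (v t) k) (\<lambda>k. v t k + Ft t (v t) k)) = \<mu>^2 + 2 * Rt t (v t) + Qt t (v t)"
    using ip_add_expand[OF vt ft] ip_v[OF t(1) tT(1)] by (simp add: Rt_def Qt_def)
  have "(\<lambda>k. v t k + Ft t (v t) k) = (\<lambda>k. v (t + \<tau>) k + - delta t k)" by (auto simp: delta_def)
  then have "Re (ip (\<lambda>k. v t k + Ft t (v t) k) (\<lambda>k. v t k + Ft t (v t) k)) = \<mu>^2 + 2 * Re (ip (\<lambda>k. - delta t k) (v (t + \<tau>))) + Re (ip (\<lambda>k. - delta t k) (\<lambda>k. - delta t k))"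
    using ip_add_expand[OF vs hb_minus[OF dt]] ip_v[OF tT(2) t(2)] by simp
  moreover have "ip (\<lambda>k. - delta t k) y = - ip (delta t) y" for y using ip_scale_left[of "-1" "delta t" y] by simp
  moreover have "ip (\<lambda>k. - delta t k) (\<lambda>k. - delta t k) = ip (delta t) (delta t)" by (simp add: ip_def)
  ultimately have "\<mu>^2 + 2 * Rt t (v t) + Qt t (v t) = \<mu>^2 + 2 * Re (- ip (delta t) (v (t + \<tau>))) + Re (ip (delta t) (delta t))"
    unfolding e1 by (simp only:)
  then have "2 * Rt t (v t) + Qt t (v t) = - 2 * Re (ip (delta t) (v (t + \<tau>))) + Re (ip (delta t) (delta t))"
    by simp
  then have "Rt t (v t) + Qt t (v t) / 2 = - (Re (ip (delta t) (v (t + \<tau>))) - Re (ip (delta t) (delta t)) / 2)" by simp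
  then show ?thesis by (simp add: Ht_def)
qed

definition Ks :: real where "Ks = KD * (1 + 2 * T * LL) + T * (LL + Kf)^2"

lemma Ks_nonneg: "0 \<le> Ks" unfolding Ks_def using KD_nonneg T LL_nonneg by simp

lemma grid: assumes "real n * \<tau> \<le> T" "j < n"
  shows "0 \<le> real j * \<tau>" "real j * \<tau> \<le> T" "real j * \<tau> + \<tau> \<le> T" "real (Suc j) * \<tau> = real j * \<tau> + \<tau>"
proof -
  have "(real j + 1) * \<tau> \<le> real n * \<tau>" using assms(2) tau by (intro mult_right_mono) auto
  then show "real j * \<tau> + \<tau> \<le> T" using assms(1) by (simp add: algebra_simps)
  then show "0 \<le> real j * \<tau>" "real j * \<tau> \<le> T" "real (Suc j) * \<tau> = real j * \<tau> + \<tau>" using tau by (auto simp: algebra_simps)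
qed

text \<open>Stepwise, \<open>delta\<close> is bounded by order \<tau> relative to
  \<open>\<mu>\<close>, which would leave a sum of order \<open>1\<close>. Summation by parts
  exploits the accumulated error instead: \<open>D i\<close> is small by \<open>D_yb\<close>, and it
  is paired with increments of the solution. The quadratic term is already
  \<open>O(\<tau>\<^sup>2)\<close> per step.\<close>

lemma H_sum:
  assumes n: "real n * \<tau> \<le> T"
  shows "\<bar>\<Sum>j<n. Ht (real j * \<tau>) (v (real j * \<tau>))\<bar> \<le> Ks * \<tau> powr \<theta>"
proof (cases "n = 0")
  case True then show ?thesis using Ks_nonneg by simp
next
  case False
  define d where "d j = delta (real j * \<tau>)" for j
  define x where "x j = v (real (Suc j) * \<tau>)" for j
  \<comment> \<open>Tails of the error sum. Each is the difference of two accumulated errors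
    starting at \<open>0\<close>, which are the ones that \<open>D_yb\<close> controls; hence the
    factor \<open>2\<close> in \<open>Di\<close>.\<close>
  define D where "D i = (\<lambda>k. \<Sum>j\<in>{i..<n}. d j k)" for i
  have dy: "yb \<mu> (d j) (\<tau> * (LL + Kf))" if "j < n" for j unfolding d_def using grid[OF n that] by (intro delta_yb)
  have xv: "hb 0 (x j) \<mu>" if "j < n" for j unfolding x_def using grid[OF n that] tau by (intro v_l2) auto
  have D0: "hb 0 (D 0) (KD * \<tau> powr \<theta> * \<mu>)"
    using yb_zero[OF D_yb[OF n]] by (simp add: D_def d_def lessThan_atLeast0)
  have Di: "hb 0 (D i) (2 * (KD * \<tau> powr \<theta>) * \<mu>)" if "i < n" for i
  proof -
    have "real i * \<tau> \<le> T" using grid[OF n that] by simp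
    from hb_diff[OF yb_zero[OF D_yb[OF n]] yb_zero[OF D_yb[OF this]]]
    have "hb 0 (\<lambda>k. (\<Sum>j<n. d j k) - (\<Sum>j<i. d j k)) (KD * \<tau> powr \<theta> * \<mu> + KD * \<tau> powr \<theta> * \<mu>)" by (simp add: d_def)
    moreover have "(\<Sum>j<n. d j k) - (\<Sum>j<i. d j k) = D i k" for k
      using sum_diff_nat_ivl[of 0 i n "\<lambda>j. d j k"] that by (simp add: D_def lessThan_atLeast0)
    ultimately show ?thesis by (simp add: algebra_simps)
  qed
  have "(\<Sum>j<n. ip (d j) (x j)) = (\<Sum>j<n. ip (d j) (x 0)) + (\<Sum>i\<in>{1..<n}. \<Sum>j\<in>{i..<n}. ip (d j) (x i) - ip (d j) (x (i - 1)))"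
    by (rule sum_abel[where f = "\<lambda>j y. ip (d j) y"])
  also have "(\<Sum>j<n. ip (d j) (x 0)) = ip (D 0) (x 0)"
    unfolding D_def lessThan_atLeast0
    by (rule ip_sum_left[where C = "\<lambda>_. \<tau> * (LL + Kf) * \<mu>" and D = \<mu>, symmetric]) (use yb_zero[OF dy] xv False in auto)
  also have "(\<Sum>i\<in>{1..<n}. \<Sum>j\<in>{i..<n}. ip (d j) (x i) - ip (d j) (x (i - 1))) = (\<Sum>i\<in>{1..<n}. ip (D i) (\<lambda>k. x i k - x (i - 1) k))"
  proof (rule sum.cong[OF refl])
    fix i assume i: "i \<in> {1..<n}"
    have "ip (D i) (\<lambda>k. x i k - x (i - 1) k) = ip (D i) (x i) - ip (D i) (x (i - 1))"
      using i by (intro ip_diff_right[OF Di xv xv]) auto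
    moreover have ipD: "ip (D i) y = (\<Sum>j\<in>{i..<n}. ip (d j) y)" if "hb 0 y \<mu>" for y
      unfolding D_def
      by (rule ip_sum_left[where C = "\<lambda>_. \<tau> * (LL + Kf) * \<mu>" and D = \<mu>]) (use yb_zero[OF dy] that in auto)
    ultimately show "(\<Sum>j\<in>{i..<n}. ip (d j) (x i) - ip (d j) (x (i - 1))) = ip (D i) (\<lambda>k. x i k - x (i - 1) k)"
      using ipD[OF xv[of i]] ipD[OF xv[of "i - 1"]] i
      by (simp add: sum_subtractf less_imp_diff_less)
  qed
  finally have S: "(\<Sum>j<n. ip (d j) (x j)) = ip (D 0) (x 0) + (\<Sum>i\<in>{1..<n}. ip (D i) (\<lambda>k. x i k - x (i - 1) k))" .
  have "cmod (\<Sum>j<n. ip (d j) (x j)) \<le> cmod (ip (D 0) (x 0)) + (\<Sum>i\<in>{1..<n}. cmod (ip (D i) (\<lambda>k. x i k - x (i - 1) k)))"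
    unfolding S by (rule order_trans[OF norm_triangle_ineq add_left_mono[OF norm_sum]])
  also have "\<dots> \<le> KD * \<tau> powr \<theta> * \<mu> * \<mu> + (\<Sum>i\<in>{1..<n}. 2 * (KD * \<tau> powr \<theta>) * \<mu> * (\<tau> * LL * \<mu>))"
  proof (intro add_mono sum_mono)
    show "cmod (ip (D 0) (x 0)) \<le> KD * \<tau> powr \<theta> * \<mu> * \<mu>" using False by (intro ip_bound[OF D0 xv]) auto
    fix i assume i: "i \<in> {1..<n}"
    then obtain i' where i': "i = Suc i'" by (cases i) auto
    have "yb \<mu> (\<lambda>k. x i k - x (i - 1) k) ((real (Suc i) * \<tau> - real (Suc (i - 1)) * \<tau>) * LL)"
      unfolding x_def using i grid[OF n, of i] tau by (intro v_lip) (auto intro!: mult_right_mono)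
    also have "real (Suc i) * \<tau> - real (Suc (i - 1)) * \<tau> = \<tau>" by (simp add: i' algebra_simps)
    finally show "cmod (ip (D i) (\<lambda>k. x i k - x (i - 1) k)) \<le> 2 * (KD * \<tau> powr \<theta>) * \<mu> * (\<tau> * LL * \<mu>)"
      using i by (intro ip_bound[OF Di yb_zero]) auto
  qed
  also have "\<dots> \<le> KD * \<tau> powr \<theta> * (1 + 2 * T * LL) * \<mu>^2"
  proof -
    have "(\<Sum>i\<in>{1..<n}. 2 * (KD * \<tau> powr \<theta>) * \<mu> * (\<tau> * LL * \<mu>)) = (2 * KD * \<tau> powr \<theta> * LL * \<mu>^2) * (real (n - 1) * \<tau>)"
      by (simp add: power2_eq_square)
    also have "\<dots> \<le> (2 * KD * \<tau> powr \<theta> * LL * \<mu>^2) * T"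
      using KD_nonneg LL_nonneg grid(2)[OF n, of "n - 1"] False by (intro mult_left_mono) auto
    finally show ?thesis by (simp add: power2_eq_square algebra_simps)
  qed
  finally have I1: "cmod (\<Sum>j<n. ip (d j) (x j)) \<le> KD * \<tau> powr \<theta> * (1 + 2 * T * LL) * \<mu>^2" .
  have I2: "\<bar>\<Sum>j<n. Re (ip (d j) (d j))\<bar> \<le> T * (LL + Kf)^2 * \<tau> * \<mu>^2"
  proof -
    have "\<bar>\<Sum>j<n. Re (ip (d j) (d j))\<bar> \<le> (\<Sum>j<n. \<bar>Re (ip (d j) (d j))\<bar>)" by (rule sum_abs)
    also have "\<dots> \<le> (\<Sum>j<n. \<tau> * (LL + Kf) * (\<tau> * (LL + Kf)) * \<mu>^2)" by (intro sum_mono ip_yb dy) auto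
    also have "\<dots> = (real n * \<tau>) * ((LL + Kf)^2 * \<tau> * \<mu>^2)" by (simp add: power2_eq_square)
    also have "\<dots> \<le> T * ((LL + Kf)^2 * \<tau> * \<mu>^2)" using n tau by (intro mult_right_mono) auto
    finally show ?thesis by (simp add: algebra_simps)
  qed
  have "(\<Sum>j<n. Ht (real j * \<tau>) (v (real j * \<tau>))) = (\<Sum>j<n. (Re (ip (d j) (x j)) - Re (ip (d j) (d j)) / 2) / \<mu>^2)"
    using grid[OF n] by (intro sum.cong refl) (simp add: H_delta d_def x_def)
  also have "\<dots> = (Re (\<Sum>j<n. ip (d j) (x j)) - (\<Sum>j<n. Re (ip (d j) (d j))) / 2) / \<mu>^2"
    by (simp add: sum_divide_distrib[symmetric] sum_subtractf)
  also have "\<bar>\<dots>\<bar> \<le> (KD * \<tau> powr \<theta> * (1 + 2 * T * LL) * \<mu>^2 + T * (LL + Kf)^2 * \<tau> * \<mu>^2) / \<mu>^2"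
  proof -
    have "\<bar>Re (\<Sum>j<n. ip (d j) (x j)) - (\<Sum>j<n. Re (ip (d j) (d j))) / 2\<bar> \<le> KD * \<tau> powr \<theta> * (1 + 2 * T * LL) * \<mu>^2 + T * (LL + Kf)^2 * \<tau> * \<mu>^2"
      using I1 I2 abs_Re_le_cmod[of "\<Sum>j<n. ip (d j) (x j)"] by linarith
    then show ?thesis using mu by (simp add: divide_right_mono)
  qed
  also have "\<dots> = KD * (1 + 2 * T * LL) * \<tau> powr \<theta> + T * (LL + Kf)^2 * \<tau>"
    using mu by (simp add: field_simps)
  also have "\<dots> \<le> KD * (1 + 2 * T * LL) * \<tau> powr \<theta> + T * (LL + Kf)^2 * \<tau> powr \<theta>"
    using T tau_le_powr by (intro add_left_mono mult_left_mono) auto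
  finally show ?thesis by (simp add: Ks_def algebra_simps)
qed

definition dPhi :: "nat \<Rightarrow> int \<Rightarrow> complex" where
  "dPhi j k = v (real (Suc j) * \<tau>) k - v (real j * \<tau>) k - Nt (real j * \<tau>) (v (real j * \<tau>)) k"

definition KP :: real where "KP = KD + Ks * (B + 2 * T * LL) + T * (2 * Kh^2 * B)"

lemma KP_nonneg: "0 \<le> KP" unfolding KP_def using KD_nonneg Ks_nonneg T LL_nonneg B by simp

text \<open>The correction adds the terms \<open>h j * vv j k\<close>. As \<open>H_sum\<close>
  controls only the sums of the \<open>h j\<close>, a second summation by parts is made; the
  remaining part \<open>a j - h j\<close> is quadratic and summed directly.\<close>

lemma dPhi_sum:
  assumes n: "real n * \<tau> \<le> T"
  shows "yb \<mu> (\<lambda>k. \<Sum>j<n. dPhi j k) (KP * \<tau> powr \<theta>)"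
proof -
  define vv where "vv j = v (real j * \<tau>)" for j
  define h where "h j = Ht (real j * \<tau>) (vv j)" for j
  define a where "a j = At (real j * \<tau>) (vv j)" for j
  have vy: "yb \<mu> (vv j) B" if "j < n" for j unfolding vv_def using grid[OF n that] by (intro v_yb) auto
  have vP: "yb \<mu> (vv j) PP" if "j < n" for j using yb_mono[OF vy[OF that] PP(2)] mu by simp
  have dP: "dPhi j k = delta (real j * \<tau>) k - of_real (h j) * vv j k - of_real (a j - h j) * vv j k" if "j < n" for j k
    using grid[OF n that] by (simp add: dPhi_def delta_def Nt_def a_def h_def vv_def algebra_simps)
  have 1: "yb \<mu> (\<lambda>k. \<Sum>j<n. of_real (a j - h j) * vv j k) (T * (2 * Kh^2 * B) * \<tau> powr \<theta>)"
  proof (rule yb_mono[OF yb_sum])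
    show "yb \<mu> (\<lambda>k. of_real (a j - h j) * vv j k) (\<tau>^2 * (2 * Kh^2) * B)" if "j \<in> {..<n}" for j
      using A_H[OF vP, of j "real j * \<tau>"] that B mu
      by (intro yb_mono[OF yb_scale[OF vy]] mult_right_mono) (auto simp: a_def h_def simp flip: of_real_diff)
    have "(\<Sum>j<n. \<tau>^2 * (2 * Kh^2) * B) = (real n * \<tau>) * (2 * Kh^2 * B * \<tau>)" by (simp add: power2_eq_square)
    also have "\<dots> \<le> T * (2 * Kh^2 * B * \<tau> powr \<theta>)" using n tau B T tau_le_powr by (intro mult_mono mult_left_mono) auto
    finally show "(\<Sum>j<n. \<tau>^2 * (2 * Kh^2) * B) \<le> T * (2 * Kh^2 * B) * \<tau> powr \<theta>" by (simp add: algebra_simps)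
  qed (use mu in simp)
  have 2: "yb \<mu> (\<lambda>k. \<Sum>j<n. of_real (h j) * vv j k) (Ks * (B + 2 * T * LL) * \<tau> powr \<theta>)"
  proof (cases "n = 0")
    case True then show ?thesis using Ks_nonneg B T LL_nonneg mu by (simp add: yb_zero_seq)
  next
    case False
    have S: "\<bar>\<Sum>j<i. h j\<bar> \<le> Ks * \<tau> powr \<theta>" if "i \<le> n" for i
    proof -
      have "real i * \<tau> \<le> real n * \<tau>" using that tau by (intro mult_right_mono) auto
      then show ?thesis unfolding h_def vv_def using n by (intro H_sum) linarith
    qed
    have S2: "\<bar>\<Sum>j\<in>{i..<n}. h j\<bar> \<le> 2 * (Ks * \<tau> powr \<theta>)" if "i < n" for i
      using S[of n] S[of i] sum_diff_nat_ivl[of 0 i n h] that by (auto simp: lessThan_atLeast0)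
    have eq: "(\<Sum>j<n. of_real (h j) * vv j k) = of_real (\<Sum>j<n. h j) * vv 0 k + (\<Sum>i\<in>{1..<n}. of_real (\<Sum>j\<in>{i..<n}. h j) * (vv i k - vv (i - 1) k))" for k
    proof -
      have "(\<Sum>j<n. of_real (h j) * vv j k) = (\<Sum>j<n. of_real (h j) * vv 0 k) + (\<Sum>i\<in>{1..<n}. \<Sum>j\<in>{i..<n}. of_real (h j) * vv i k - of_real (h j) * vv (i - 1) k)"
        by (rule sum_abel[where f = "\<lambda>j x. of_real (h j) * x k" and x = vv])
      then show ?thesis by (simp add: sum_distrib_right right_diff_distrib sum_subtractf)
    qed
    have "yb \<mu> (\<lambda>k. of_real (\<Sum>j<n. h j) * vv 0 k + (\<Sum>i\<in>{1..<n}. of_real (\<Sum>j\<in>{i..<n}. h j) * (vv i k - vv (i - 1) k)))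
        (Ks * \<tau> powr \<theta> * B + (\<Sum>i\<in>{1..<n}. 2 * (Ks * \<tau> powr \<theta>) * (\<tau> * LL)))"
    proof (intro yb_add yb_sum)
      show "yb \<mu> (\<lambda>k. of_real (\<Sum>j<n. h j) * vv 0 k) (Ks * \<tau> powr \<theta> * B)"
        using S[of n] False B mu by (intro yb_mono[OF yb_scale[OF vy]] mult_right_mono) (auto simp del: of_real_sum)
      fix i assume i: "i \<in> {1..<n}"
      then obtain i' where i': "i = Suc i'" by (cases i) auto
      have "yb \<mu> (\<lambda>k. vv i k - vv (i - 1) k) ((real i * \<tau> - real (i - 1) * \<tau>) * LL)"
        unfolding vv_def using i grid[OF n, of i] tau by (intro v_lip) (auto intro!: mult_right_mono)
      also have "real i * \<tau> - real (i - 1) * \<tau> = \<tau>" by (simp add: i' algebra_simps)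
      finally have d: "yb \<mu> (\<lambda>k. vv i k - vv (i - 1) k) (\<tau> * LL)" .
      have "\<bar>\<Sum>j\<in>{i..<n}. h j\<bar> * (\<tau> * LL) \<le> 2 * (Ks * \<tau> powr \<theta>) * (\<tau> * LL)"
        using S2[of i] i tau LL_nonneg by (intro mult_right_mono) auto
      then show "yb \<mu> (\<lambda>k. of_real (\<Sum>j\<in>{i..<n}. h j) * (vv i k - vv (i - 1) k)) (2 * (Ks * \<tau> powr \<theta>) * (\<tau> * LL))"
        using yb_mono[OF yb_scale[OF d, of "of_real (\<Sum>j\<in>{i..<n}. h j)"]] mu unfolding norm_of_real by simp
    qed
    moreover have "Ks * \<tau> powr \<theta> * B + (\<Sum>i\<in>{1..<n}. 2 * (Ks * \<tau> powr \<theta>) * (\<tau> * LL)) \<le> Ks * (B + 2 * T * LL) * \<tau> powr \<theta>"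
    proof -
      have "(\<Sum>i\<in>{1..<n}. 2 * (Ks * \<tau> powr \<theta>) * (\<tau> * LL)) = (2 * Ks * \<tau> powr \<theta> * LL) * (real (n - 1) * \<tau>)" by simp
      also have "\<dots> \<le> (2 * Ks * \<tau> powr \<theta> * LL) * T"
        using Ks_nonneg LL_nonneg grid(2)[OF n, of "n - 1"] False by (intro mult_left_mono) auto
      finally show ?thesis by (simp add: algebra_simps)
    qed
    ultimately show ?thesis unfolding eq using mu by (elim yb_mono) auto
  qed
  have "(\<Sum>j<n. dPhi j k) = (\<Sum>j<n. delta (real j * \<tau>) k) - (\<Sum>j<n. of_real (h j) * vv j k) - (\<Sum>j<n. of_real (a j - h j) * vv j k)" for k
    unfolding sum_subtractf[symmetric] by (intro sum.cong refl) (simp add: dP)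
  moreover have "KD * \<tau> powr \<theta> + Ks * (B + 2 * T * LL) * \<tau> powr \<theta> + T * (2 * Kh^2 * B) * \<tau> powr \<theta> = KP * \<tau> powr \<theta>"
    by (simp add: KP_def distrib_right)
  ultimately show ?thesis using yb_diff[OF yb_diff[OF D_yb[OF n] 2] 1] by (simp only:)
qed

definition Ke :: real where "Ke = KP * exp (Kn * T)"

lemma Ke_nonneg: "0 \<le> Ke" unfolding Ke_def using KP_nonneg by simp

text \<open>The order \<open>\<tau> powr \<theta>\<close> is available only for accumulated local
  errors, so the error at step \<open>m\<close> is written as their sum from \<open>0\<close> plus
  the sum of all Lipschitz differences. This calls for induction over all earlier steps. The bound
  \<open>?c * (1 + ?x)^m\<close> reproduces itself by the geometric sum, and smallness keeps every
  iterate in the ball of radius \<open>PP\<close>.\<close>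

lemma error_yb:
  assumes V0: "V 0 = v 0" and VS: "\<And>n k. V (Suc n) k = V n k + Nt (real n * \<tau>) (V n) k"
    and small: "Ke * \<tau> powr \<theta> \<le> 1" and n: "real n * \<tau> \<le> T"
  shows "yb \<mu> (\<lambda>k. v (real n * \<tau>) k - V n k) (Ke * \<tau> powr \<theta>)" "yb \<mu> (V n) PP"
proof -
  let ?c = "KP * \<tau> powr \<theta>" and ?x = "\<tau> * Kn"
  have x0: "0 \<le> ?x" using tau Kn_nonneg by simp
  have c0: "0 \<le> ?c" using KP_nonneg by simp
  have pw: "?c * (1 + ?x)^m \<le> Ke * \<tau> powr \<theta>" if "real m * \<tau> \<le> T" for m
  proof -
    have "(1 + ?x)^m \<le> exp ?x ^ m" using x0 by (intro power_mono exp_ge_add_one_self_aux) auto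
    also have "\<dots> = exp (Kn * (real m * \<tau>))" by (simp add: exp_of_nat_mult[symmetric] mult_ac)
    also have "\<dots> \<le> exp (Kn * T)" using that Kn_nonneg by (simp add: mult_left_mono)
    finally have "?c * (1 + ?x)^m \<le> ?c * exp (Kn * T)" using c0 by (rule mult_left_mono)
    then show ?thesis by (simp add: Ke_def mult_ac)
  qed
  have main: "real m * \<tau> \<le> T \<Longrightarrow> yb \<mu> (\<lambda>k. v (real m * \<tau>) k - V m k) (?c * (1 + ?x)^m)" for m
  proof (induction m rule: less_induct)
    case (less m)
    have gr: "real j * \<tau> \<le> T" if "j < m" for j using grid[OF less.prems that] by simp
    have IH: "yb \<mu> (\<lambda>k. v (real j * \<tau>) k - V j k) (?c * (1 + ?x)^j)" if "j < m" for j using less.IH[OF that gr[OF that]] .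
    have VP: "yb \<mu> (V j) PP" if "j < m" for j
    proof -
      have "yb \<mu> (\<lambda>k. v (real j * \<tau>) k - (v (real j * \<tau>) k - V j k)) (B + ?c * (1 + ?x)^j)"
        using grid[OF less.prems that] by (intro yb_diff[OF v_yb IH[OF that]]) auto
      then have "yb \<mu> (V j) (B + ?c * (1 + ?x)^j)" by simp
      then show ?thesis by (rule yb_mono) (use pw[OF gr[OF that]] small mu in \<open>auto simp: PP_def\<close>)
    qed
    have "v (real m * \<tau>) k - V m k = (\<Sum>j<m. dPhi j k) + (\<Sum>j<m. Nt (real j * \<tau>) (v (real j * \<tau>)) k - Nt (real j * \<tau>) (V j) k)" for k
    proof (induction m)
      case 0 then show ?case using V0 by simp
    next
      case (Suc m) then show ?case by (simp add: VS dPhi_def algebra_simps)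
    qed
    moreover have "yb \<mu> (\<lambda>k. (\<Sum>j<m. dPhi j k) + (\<Sum>j<m. Nt (real j * \<tau>) (v (real j * \<tau>)) k - Nt (real j * \<tau>) (V j) k))
       (?c + (\<Sum>j<m. \<tau> * Kn * (?c * (1 + ?x)^j)))"
      using grid[OF less.prems] by (intro yb_add dPhi_sum[OF less.prems] yb_sum Nt_lip v_PP VP IH) auto
    moreover have "?c + (\<Sum>j<m. \<tau> * Kn * (?c * (1 + ?x)^j)) = ?c * (1 + ?x)^m"
    proof (induction m)
      case (Suc m)
      have "?c + (\<Sum>j<Suc m. \<tau> * Kn * (?c * (1 + ?x)^j)) = ?c * (1 + ?x)^m + \<tau> * Kn * (?c * (1 + ?x)^m)" using Suc by simp
      then show ?case by (simp add: algebra_simps)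
    qed simp
    ultimately show ?case by simp
  qed
  show e: "yb \<mu> (\<lambda>k. v (real n * \<tau>) k - V n k) (Ke * \<tau> powr \<theta>)"
    using main[OF n] pw[OF n] mu by (elim yb_mono) auto
  have "yb \<mu> (\<lambda>k. v (real n * \<tau>) k - (v (real n * \<tau>) k - V n k)) (B + Ke * \<tau> powr \<theta>)"
    using n tau by (intro yb_diff[OF v_yb e]) auto
  then have "yb \<mu> (V n) (B + Ke * \<tau> powr \<theta>)" by simp
  then show "yb \<mu> (V n) PP" by (rule yb_mono) (use small mu in \<open>auto simp: PP_def\<close>)
qed

section \<open>Near conservation of mass for \<gamma> > 3/2\<close>

definition hh :: real where "hh = \<mu> powr (2/3)"

text \<open>\<open>2/3\<close> is the exponent with which the \<open>L^2\<close> norm enters the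
  square of the \<open>H^1\<close> norm when \<open>H^1\<close> is interpolated between
  \<open>L^2\<close> and \<open>H^(3/2)\<close>. It is also the one for which
  \<open>hh\<^sup>3\<close> is the mass, so three factors \<open>1 / hh\<close> are balanced by
  \<open>\<mu>\<^sup>2\<close>.\<close>

lemma hh: "0 < hh" "hh^3 = \<mu>^2" "1 \<le> B / hh" "hh / \<mu> \<le> B / hh"
proof -
  show h0: "0 < hh" using mu by (simp add: hh_def)
  show h3: "hh^3 = \<mu>^2" using mu unfolding hh_def by (simp add: powr_powr flip: powr_numeral)
  have BB: "B powr s \<le> B" if "s \<le> 1" for s using powr_mono[OF that B] B by simp
  have "hh \<le> B powr (2/3)" unfolding hh_def using mu mu_le by (intro powr_mono2) auto
  then show "1 \<le> B / hh" using BB[of "2/3"] h0 by simp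
  have "\<mu> powr (1/3) \<le> B powr (1/3)" using mu mu_le by (intro powr_mono2) auto
  then have "\<mu> powr (1/3) \<le> B" using BB[of "1/3"] by simp
  then have "\<mu> * \<mu> powr (1/3) \<le> \<mu> * B" using mu by (intro mult_left_mono) auto
  moreover have "hh * hh = \<mu> * \<mu> powr (1/3)"
  proof -
    have "hh * hh = \<mu> powr (4/3)" unfolding hh_def by (simp flip: powr_add)
    also have "\<dots> = \<mu> powr (1 + 1/3)" by simp
    also have "\<dots> = \<mu> * \<mu> powr (1/3)" using mu by (subst powr_add) simp
    finally show ?thesis .
  qed
  ultimately show "hh / \<mu> \<le> B / hh" using h0 mu by (simp add: field_simps)
qed

text \<open>Interpolation between \<open>L\<^sup>2\<close> and \<open>H\<^bsup>3/2\<^esup>\<close>.\<close>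
lemma v_interpolation:
  assumes g: "\<gamma> > 3/2" and t: "0 \<le> t" "t \<le> T"
  shows "hb 1 (v t) (sqrt hh * B)"
proof -
  have a: "l2 (\<lambda>k. jb k powr (3/2) * cmod (v t k)) B"
    using hb_weaken[OF v_hb[OF t], of "3/2"] g by (simp add: hb_def)
  have b: "l2 (\<lambda>k. cmod (v t k)) \<mu>" by (rule hb_l2_zero[OF v_l2[OF t]])
  have pt: "(jb k)^2 \<le> 2/3 * hh * (jb k powr (3/2))^2 + 1/3 * (1 / hh^2)" for k
  proof -
    define x where "x = hh * jb k"
    have x0: "0 < x" using hh by (simp add: x_def)
    \<comment> \<open>Young's inequality \<open>3 * x\<^sup>2 \<le> 2 * x\<^sup>3 + 1\<close> by
      factorisation; the scaling \<open>x = hh * jb k\<close> balances the two norms.\<close>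
    have "0 \<le> (x - 1)^2 * (2 * x + 1)" using x0 by simp
    also have "\<dots> = 2 * x^3 - 3 * x^2 + 1" by (simp add: power2_eq_square power3_eq_cube algebra_simps)
    finally have "x^2 \<le> 2/3 * x^3 + 1/3" by simp
    then have "x^2 / hh^2 \<le> (2/3 * x^3 + 1/3) / hh^2" by (intro divide_right_mono) auto
    moreover have "x^2 / hh^2 = (jb k)^2" using hh(1) by (simp add: x_def power_mult_distrib)
    moreover have "(2/3 * x^3 + 1/3) / hh^2 = 2/3 * hh * (jb k)^3 + 1/3 * (1 / hh^2)"
      using hh(1) by (simp add: x_def power_mult_distrib add_divide_distrib power2_eq_square power3_eq_cube)
    moreover have "(jb k powr (3/2))^2 = (jb k)^3"
      by (simp add: power2_eq_square powr_numeral flip: powr_add)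
    ultimately show ?thesis by simp
  qed
  have "(\<Sum>k\<in>F. (jb k * cmod (v t k))^2) \<le> (sqrt hh * B)^2" if F: "finite F" for F
  proof -
    have "(\<Sum>k\<in>F. (jb k * cmod (v t k))^2) \<le> (\<Sum>k\<in>F. 2/3 * hh * (jb k powr (3/2) * cmod (v t k))^2 + 1/3 * (1 / hh^2) * (cmod (v t k))^2)"
    proof (rule sum_mono)
      fix k
      show "(jb k * cmod (v t k))^2 \<le> 2/3 * hh * (jb k powr (3/2) * cmod (v t k))^2 + 1/3 * (1 / hh^2) * (cmod (v t k))^2"
        using mult_right_mono[OF pt[of k], of "(cmod (v t k))^2"] by (simp add: power_mult_distrib algebra_simps)
    qed
    also have "\<dots> = 2/3 * hh * (\<Sum>k\<in>F. (jb k powr (3/2) * cmod (v t k))^2) + 1/3 * (1 / hh^2) * (\<Sum>k\<in>F. (cmod (v t k))^2)"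
      by (simp only: sum.distrib sum_distrib_left)
    also have "\<dots> \<le> 2/3 * hh * B^2 + 1/3 * (1 / hh^2) * \<mu>^2"
      using hh(1) l2D[OF a F] l2D[OF b F] by (intro add_mono mult_left_mono) auto
    also have "\<dots> = 2/3 * hh * B^2 + 1/3 * hh"
      unfolding hh(2)[symmetric] using hh(1) by (simp add: power2_eq_square power3_eq_cube)
    also have "\<dots> \<le> 2/3 * hh * B^2 + 1/3 * hh * B^2"
    proof -
      have "1/3 * hh * 1 \<le> 1/3 * hh * B^2" using hh(1) one_le_power[OF B, of 2] by (intro mult_left_mono) auto
      then show ?thesis by simp
    qed
    also have "\<dots> = (sqrt hh * B)^2" using hh(1) by (simp add: power_mult_distrib)
    finally show ?thesis .
  qed
  then show ?thesis using hh(1) B by (simp add: hb_def l2_def)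
qed

definition KH :: real where "KH = Krho + (LL + Kf)^2 + 4 * kap^2 * B^3 + Kh * Ke"

lemma KH_nonneg: "0 \<le> KH"
  unfolding KH_def using Krho_nonneg B Kh_nonneg Ke_nonneg by simp

text \<open>At a single time no bound of the cubic error proportional to \<open>\<mu>\<close> is at
  hand; interpolation gives \<open>hh\<close> in its place. Paired with the solution and divided by
  the mass this leaves \<open>hh / \<mu>\<close>, which is at most \<open>B / hh\<close>.\<close>

lemma H_v_small:
  assumes g: "\<gamma> > 3/2" and t: "0 \<le> t" "t + \<tau> \<le> T"
  shows "\<bar>Ht t (v t)\<bar> \<le> \<tau>^2 * (B / hh) * (Krho + (LL + Kf)^2 + 4 * kap^2 * B^3)"
proof -
  have tT: "t \<le> T" "0 \<le> t + \<tau>" using t tau by auto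
  have th: "\<theta> = 1" using adm g by auto
  have vs: "hb 0 (v (t + \<tau>)) \<mu>" by (rule v_l2[OF tT(2) t(2)])
  have "hb 0 (cub (twm t bb) (v t)) (4 * \<tau> * \<tau> * kap^2 * (sqrt hh * B * (sqrt hh * B) * B))"
    unfolding cub_def using v_interpolation[OF g t(1) tT(1)] v_hb[OF t(1) tT(1)] tau bb_hard
    by (intro tri_hard_zero[OF g] hb_rv) (auto simp: twm_def norm_mult th)
  moreover have "4 * \<tau> * \<tau> * kap^2 * (sqrt hh * B * (sqrt hh * B) * B) = \<tau>^2 * (4 * kap^2 * B^3) * hh"
  proof -
    have "sqrt hh * B * (sqrt hh * B) * B = (sqrt hh * sqrt hh) * B^3" by (simp add: power3_eq_cube)
    then show ?thesis using hh(1) by (simp add: power2_eq_square)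
  qed
  ultimately have c: "hb 0 (cub (twm t bb) (v t)) (\<tau>^2 * (4 * kap^2 * B^3) * hh)" by simp
  have r: "hb 0 (rho t) (\<tau>^2 * Krho * \<mu>)" using yb_zero[OF rho_yb[OF t]] .
  have d: "delta t = (\<lambda>k. rho t k + cub (twm t bb) (v t) k)" by (auto simp: rho_def)
  have "ip (delta t) (v (t + \<tau>)) = ip (rho t) (v (t + \<tau>)) + ip (cub (twm t bb) (v t)) (v (t + \<tau>))"
    unfolding d by (rule ip_add_left[OF r c vs])
  then have "\<bar>Re (ip (delta t) (v (t + \<tau>)))\<bar> \<le> cmod (ip (rho t) (v (t + \<tau>))) + cmod (ip (cub (twm t bb) (v t)) (v (t + \<tau>)))"
    using abs_Re_le_cmod norm_triangle_ineq order_trans by metis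
  also have "\<dots> \<le> \<tau>^2 * Krho * \<mu> * \<mu> + \<tau>^2 * (4 * kap^2 * B^3) * hh * \<mu>" by (intro add_mono ip_bound[OF r vs] ip_bound[OF c vs])
  finally have i1: "\<bar>Re (ip (delta t) (v (t + \<tau>)))\<bar> \<le> (\<tau>^2 * Krho + \<tau>^2 * (4 * kap^2 * B^3) * (hh / \<mu>)) * \<mu>^2"
    using mu by (simp add: power2_eq_square algebra_simps)
  have i2: "\<bar>Re (ip (delta t) (delta t))\<bar> \<le> \<tau>^2 * (LL + Kf)^2 * \<mu>^2"
    using ip_yb[OF delta_yb[OF t] delta_yb[OF t]] by (simp add: power2_eq_square algebra_simps)
  have "\<bar>Re (ip (delta t) (v (t + \<tau>))) - Re (ip (delta t) (delta t)) / 2\<bar> \<le>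
    (\<tau>^2 * Krho + \<tau>^2 * (4 * kap^2 * B^3) * (hh / \<mu>)) * \<mu>^2 + \<tau>^2 * (LL + Kf)^2 * \<mu>^2"
    using i1 i2 by linarith
  also have "\<dots> = (\<tau>^2 * Krho + \<tau>^2 * (4 * kap^2 * B^3) * (hh / \<mu>) + \<tau>^2 * (LL + Kf)^2) * \<mu>^2"
    by (simp add: distrib_right)
  finally have "\<bar>Ht t (v t)\<bar> \<le> \<tau>^2 * Krho + \<tau>^2 * (4 * kap^2 * B^3) * (hh / \<mu>) + \<tau>^2 * (LL + Kf)^2"
    unfolding H_delta[OF t] using mu by (simp add: divide_le_eq)
  also have "\<dots> \<le> \<tau>^2 * Krho * (B / hh) + \<tau>^2 * (4 * kap^2 * B^3) * (B / hh) + \<tau>^2 * (LL + Kf)^2 * (B / hh)"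
  proof (intro add_mono)
    show "\<tau>^2 * Krho \<le> \<tau>^2 * Krho * (B / hh)" using mult_left_mono[OF hh(3), of "\<tau>^2 * Krho"] Krho_nonneg by simp
    show "\<tau>^2 * (LL + Kf)^2 \<le> \<tau>^2 * (LL + Kf)^2 * (B / hh)" using mult_left_mono[OF hh(3), of "\<tau>^2 * (LL + Kf)^2"] by simp
    show "\<tau>^2 * (4 * kap^2 * B^3) * (hh / \<mu>) \<le> \<tau>^2 * (4 * kap^2 * B^3) * (B / hh)"
      using B by (intro mult_left_mono hh(4)) auto
  qed
  finally show ?thesis by (simp add: algebra_simps)
qed

definition K2 :: real where "K2 = 2 * Ka + Ka^2"
definition Km :: real where "Km = B^3 * (KH * (KH + Kf^2)^2 * (1 + Kh))"

text \<open>The new mass is computed exactly. With \<open>q\<close> eliminated through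
  \<open>H = - r - q / 2\<close>, what is not a multiple of the old defect is a product of three
  factors, each at most a constant times \<open>|H| + q\<close>, hence of size
  \<open>\<tau>\<^sup>2 / hh\<close>. Together with \<open>\<mu>\<^sup>2 = hh\<^sup>3\<close> this
  gives order \<open>\<tau>^6\<close>.\<close>

lemma mass_step:
  assumes g: "\<gamma> > 3/2" and V0: "V 0 = v 0" and VS: "\<And>n k. V (Suc n) k = V n k + Nt (real n * \<tau>) (V n) k"
    and small: "Ke * \<tau> powr \<theta> \<le> 1" and n: "real (Suc n) * \<tau> \<le> T"
  defines "M m \<equiv> Re (ip (V m) (V m)) - \<mu>^2"
  shows "\<bar>M (Suc n)\<bar> \<le> (1 + \<tau> * K2) * \<bar>M n\<bar> + \<tau>^6 * Km"
proof -
  have th: "\<theta> = 1" using adm g by auto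
  define t where "t = real n * \<tau>"
  have t: "0 \<le> t" "t \<le> T" "t + \<tau> \<le> T" using grid[OF n, of n] by (auto simp: t_def)
  have e: "yb \<mu> (\<lambda>k. v t k - V n k) (Ke * \<tau>)" and X: "yb \<mu> (V n) PP"
    using error_yb[OF V0 VS small, of n] t(2) tau th by (auto simp: t_def)
  define H R Q A where "H = Ht t (V n)" and "R = Rt t (V n)" and "Q = Qt t (V n)" and "A = At t (V n)"
  define r q where "r = R / \<mu>^2" and "q = Q / \<mu>^2"
  have m2: "0 < \<mu>^2" using mu by simp
  have q0: "0 \<le> q" using Q_bound(2)[OF X, of t] by (simp add: q_def Q_def)
  have Hrq: "H = - r - q / 2" using mu by (simp add: H_def Ht_def r_def q_def R_def Q_def field_simps)
  have AA: "A = H - H^2 / 2 - H * r" by (simp add: A_def At_def H_def r_def R_def)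
  define F where "F = Ft t (V n)"
  have x0: "hb 0 (V n) (PP * \<mu>)" and f0: "hb 0 F (\<tau> * Kf * \<mu>)"
    using yb_zero[OF X] yb_zero[OF Ft_yb[OF X, of t]] by (auto simp: F_def)
  have V': "V (Suc n) = (\<lambda>k. of_real (1 + A) * V n k + F k)"
    by (auto simp: VS Nt_def A_def F_def t_def algebra_simps)
  have "Re (ip (V (Suc n)) (V (Suc n))) = (1 + A)^2 * Re (ip (V n) (V n)) + 2 * (1 + A) * R + Q"
  proof -
    have s: "hb 0 (\<lambda>k. of_real (1 + A) * V n k) (cmod (of_real (1 + A)) * (PP * \<mu>))" by (rule hb_scale[OF x0])
    have "ip F (\<lambda>k. of_real (1 + A) * V n k) = of_real (1 + A) * ip F (V n)"
      using ip_scale_left[of "of_real (1 + A)" "V n" F] ip_cnj[of F "\<lambda>k. of_real (1 + A) * V n k"] ip_cnj[of F "V n"] by simp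
    moreover have "ip (\<lambda>k. of_real (1 + A) * V n k) (\<lambda>k. of_real (1 + A) * V n k) = of_real ((1 + A)^2) * ip (V n) (V n)"
      unfolding ip_def infsum_cmult_right'[symmetric] by (intro infsum_cong) (simp add: power2_eq_square algebra_simps)
    ultimately show ?thesis unfolding V' ip_add_expand[OF s f0]
      by (simp add: R_def Rt_def Q_def Qt_def F_def[symmetric] del: of_real_power of_real_add)
  qed
  then have rec: "M (Suc n) = (1 + A)^2 * M n + \<mu>^2 * ((1 + A)^2 - 1 + 2 * (1 + A) * r + q)"
    unfolding M_def r_def q_def using mu by (simp add: field_simps)
  \<comment> \<open>\<open>G2\<close> is built so that
    \<open>2 * (A - H) = - H\<^sup>2 - 2 * H * r\<close>. Then all terms assemble to
    \<open>(A - H) * (A + H + 2 * r)\<close>, the difference of the values of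
    \<open>y\<^sup>2 + 2 * y * r\<close> at \<open>A\<close> and \<open>H\<close>, and
    \<open>A - H\<close> is itself quadratic.\<close>
  have br: "(1 + A)^2 - 1 + 2 * (1 + A) * r + q = - H * (H / 2 + r) * (A + H + 2 * r)"
  proof -
    have q: "q = - 2 * H - 2 * r" using Hrq by simp
    have AH: "A - H = - H * (H / 2 + r)" by (simp add: AA power2_eq_square algebra_simps)
    have "(1 + A)^2 - 1 + 2 * (1 + A) * r + q = 2 * (A - H) + A^2 + 2 * (A * r)"
      by (simp add: q power2_eq_square algebra_simps)
    also have "2 * (A - H) = - (H^2) - 2 * (H * r)" unfolding AH by (simp add: power2_eq_square algebra_simps)
    also have "- (H^2) - 2 * (H * r) + A^2 + 2 * (A * r) = (A - H) * (A + H + 2 * r)" by (simp add: power2_eq_square algebra_simps)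
    finally show ?thesis unfolding AH .
  qed
  have Hb: "\<bar>H\<bar> \<le> \<tau>^2 * (B / hh) * KH"
  proof -
    have "yb \<mu> (\<lambda>k. V n k - v t k) (Ke * \<tau>)" by (rule yb_cong_norm[OF e]) (simp add: norm_minus_commute)
    from H_lip[OF X v_PP[OF t(1,2)] this, of t] have "\<bar>H - Ht t (v t)\<bar> \<le> \<tau>^2 * (Kh * Ke) * 1"
      by (simp add: H_def power2_eq_square algebra_simps)
    also have "\<dots> \<le> \<tau>^2 * (Kh * Ke) * (B / hh)" using Kh_nonneg Ke_nonneg hh(3) by (intro mult_left_mono) auto
    finally show ?thesis using H_v_small[OF g t(1,3)] unfolding KH_def by (simp add: algebra_simps)
  qed
  have qb: "q \<le> \<tau>^2 * (B / hh) * Kf^2"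
  proof -
    have "q \<le> \<tau>^2 * Kf^2 * 1" using Q_bound(1)[OF X, of t] abs_ge_self[of Q] divide_right_mono[of Q "\<bar>Q\<bar>" "\<mu>^2"] by (simp add: q_def Q_def)
    also have "\<dots> \<le> \<tau>^2 * Kf^2 * (B / hh)" using hh(3) by (intro mult_left_mono) auto
    finally show ?thesis by (simp add: algebra_simps)
  qed
  have Kh1: "\<bar>H\<bar> \<le> Kh"
    using H_bound[OF X, of t] mult_right_mono[OF tau(2) Kh_nonneg] by (simp add: H_def)
  define s where "s = \<tau>^2 * (B / hh)"
  have s0: "0 \<le> s" using B hh(1) by (simp add: s_def)
  have hq: "\<bar>H\<bar> + q \<le> s * (KH + Kf^2)" using Hb qb by (simp add: s_def distrib_left)
  \<comment> \<open>\<open>R_bound\<close> alone would give only order \<tau> here. The relation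
    \<open>r = - H - q / 2\<close> makes this factor and the next one as small as a multiple of
    \<open>|H| + q\<close>.\<close>
  have b1: "\<bar>H / 2 + r\<bar> \<le> \<bar>H\<bar> + q" using Hrq q0 by linarith
  have "A + H + 2 * r = - H * (H / 2 + r) - q" using Hrq by (simp add: AA power2_eq_square algebra_simps)
  then have "\<bar>A + H + 2 * r\<bar> \<le> \<bar>H * (H / 2 + r)\<bar> + q" using q0 by linarith
  also have "\<bar>H * (H / 2 + r)\<bar> \<le> Kh * (\<bar>H\<bar> + q)" unfolding abs_mult using Kh1 b1 q0 Kh_nonneg by (intro mult_mono) auto
  finally have b2: "\<bar>A + H + 2 * r\<bar> \<le> (\<bar>H\<bar> + q) * (1 + Kh)" using q0 by (simp add: algebra_simps)
  have "\<bar>- H * (H / 2 + r) * (A + H + 2 * r)\<bar> = \<bar>H\<bar> * \<bar>H / 2 + r\<bar> * \<bar>A + H + 2 * r\<bar>" by (simp add: abs_mult)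
  also have "\<dots> \<le> (s * KH) * (\<bar>H\<bar> + q) * ((\<bar>H\<bar> + q) * (1 + Kh))"
    using Hb b1 b2 q0 s0 KH_nonneg Kh_nonneg unfolding s_def[symmetric] by (intro mult_mono) auto
  also have "\<dots> \<le> (s * KH) * (s * (KH + Kf^2)) * (s * (KH + Kf^2) * (1 + Kh))"
    using hq q0 s0 KH_nonneg Kh_nonneg by (intro mult_mono) auto
  finally have "\<mu>^2 * \<bar>- H * (H / 2 + r) * (A + H + 2 * r)\<bar> \<le> \<mu>^2 * ((s * KH) * (s * (KH + Kf^2)) * (s * (KH + Kf^2) * (1 + Kh)))"
    by (intro mult_left_mono) auto
  also have "\<dots> = \<mu>^2 * s^3 * (KH * (KH + Kf^2)^2 * (1 + Kh))" by (simp add: power2_eq_square power3_eq_cube)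
  also have "\<mu>^2 * s^3 = \<tau>^6 * B^3"
    unfolding hh(2)[symmetric] s_def using hh(1) by (simp add: power_mult_distrib power_divide flip: power_mult)
  finally have res: "\<mu>^2 * \<bar>- H * (H / 2 + r) * (A + H + 2 * r)\<bar> \<le> \<tau>^6 * Km" by (simp add: Km_def)
  have A2: "(1 + A)^2 \<le> 1 + \<tau> * K2"
  proof -
    have a: "\<bar>A\<bar> \<le> \<tau> * Ka" unfolding A_def by (rule A_bound[OF X])
    have "A^2 \<le> (\<tau> * Ka)^2" using power_mono[OF a, of 2] by simp
    also have "\<dots> \<le> \<tau> * Ka^2" unfolding power_mult_distrib using tau_sq by (intro mult_right_mono) auto
    finally show ?thesis using a by (simp add: K2_def power2_eq_square algebra_simps)
  qed
  have "\<bar>M (Suc n)\<bar> \<le> (1 + A)^2 * \<bar>M n\<bar> + \<mu>^2 * \<bar>- H * (H / 2 + r) * (A + H + 2 * r)\<bar>"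
    unfolding rec br by (rule order_trans[OF abs_triangle_ineq]) (simp add: abs_mult)
  also have "\<dots> \<le> (1 + \<tau> * K2) * \<bar>M n\<bar> + \<tau>^6 * Km"
    by (intro add_mono mult_right_mono A2 res) auto
  finally show ?thesis .
qed

definition KM :: real where "KM = T * Km * exp (K2 * T)"

lemma mass_error:
  assumes g: "\<gamma> > 3/2" and V0: "V 0 = v 0" and VS: "\<And>n k. V (Suc n) k = V n k + Nt (real n * \<tau>) (V n) k"
    and small: "Ke * \<tau> powr \<theta> \<le> 1" and n: "real n * \<tau> \<le> T"
  shows "\<bar>Re (ip (V n) (V n)) - \<mu>^2\<bar> \<le> KM * \<tau>^5"
proof -
  have Km0: "0 \<le> Km" unfolding Km_def using B KH_nonneg Kh_nonneg by simp
  have K20: "0 \<le> K2" unfolding K2_def using Ka_nonneg by simp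
  have main: "\<bar>Re (ip (V m) (V m)) - \<mu>^2\<bar> \<le> real m * (\<tau>^6 * Km) * (1 + \<tau> * K2)^m" if "real m * \<tau> \<le> T" for m
    using that
  proof (induction m)
    case 0
    have "ip (V 0) (V 0) = of_real (\<mu>^2)" unfolding V0 using T by (intro ip_v) auto
    then show ?case by simp
  next
    case (Suc m)
    let ?y = "\<tau>^6 * Km" and ?z = "1 + \<tau> * K2"
    have y0: "0 \<le> ?y" and z1: "1 \<le> ?z" using Km0 K20 tau by auto
    have "real m * \<tau> \<le> T" using Suc.prems tau by (simp add: algebra_simps)
    from Suc.IH[OF this] have IH: "\<bar>Re (ip (V m) (V m)) - \<mu>^2\<bar> \<le> real m * ?y * ?z^m" .
    have "\<bar>Re (ip (V (Suc m)) (V (Suc m))) - \<mu>^2\<bar> \<le> ?z * \<bar>Re (ip (V m) (V m)) - \<mu>^2\<bar> + ?y"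
      by (rule mass_step[OF g V0 VS small Suc.prems])
    also have "\<dots> \<le> ?z * (real m * ?y * ?z^m) + ?y * ?z^Suc m"
    proof (rule add_mono)
      show "?z * \<bar>Re (ip (V m) (V m)) - \<mu>^2\<bar> \<le> ?z * (real m * ?y * ?z^m)" using IH z1 by (intro mult_left_mono) auto
      show "?y \<le> ?y * ?z^Suc m" using mult_left_mono[OF one_le_power[OF z1, of "Suc m"] y0] by simp
    qed
    also have "\<dots> = real (Suc m) * ?y * ?z^Suc m" by (simp add: algebra_simps)
    finally show ?case .
  qed
  have "(1 + \<tau> * K2)^n \<le> exp (\<tau> * K2)^n" using tau K20 by (intro power_mono exp_ge_add_one_self_aux) auto
  also have "\<dots> = exp (K2 * (real n * \<tau>))" by (simp add: exp_of_nat_mult[symmetric] mult_ac)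
  also have "\<dots> \<le> exp (K2 * T)" using n K20 by (simp add: mult_left_mono)
  finally have ex: "(1 + \<tau> * K2)^n \<le> exp (K2 * T)" .
  have "real n * (\<tau>^6 * Km) * (1 + \<tau> * K2)^n = (real n * \<tau>) * (\<tau>^5 * Km * (1 + \<tau> * K2)^n)"
    by (simp add: power_numeral_reduce algebra_simps)
  also have "\<dots> \<le> T * (\<tau>^5 * Km * exp (K2 * T))"
    using n ex T tau Km0 K20 by (intro mult_mono mult_left_mono) auto
  finally show ?thesis using main[OF n] by (simp add: KM_def algebra_simps)
qed

end

section \<open>Fourier series on the torus\<close>

text \<open>The definitions of the statement use the gauge integral over \<open>{0..2*pi}\<close>;
  the restricted Lebesgue measure makes dominated convergence and Fatou's lemma applicable.\<close>

abbreviation torus :: "real measure" where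
  "torus \<equiv> lebesgue_on {0..2*pi}"

lemma emeasure_torus: "emeasure torus (space torus) = ennreal (2 * pi)"
  by (simp add: emeasure_restrict_space)

interpretation torus: finite_measure torus
  by standard (subst emeasure_torus, simp)

lemma measure_torus: "measure torus (space torus) = 2 * pi"
  using emeasure_torus by (simp add: measure_def)

lemma integrable_torus_iff: "f absolutely_integrable_on {0..2*pi} \<longleftrightarrow> integrable torus f"
  for f :: "real \<Rightarrow> complex"
  unfolding set_integrable_def by (simp add: integrable_restrict_space)

lemma L2T_integrable:
  assumes "L2T f"
  shows "integrable torus f" "integrable torus (\<lambda>x. (cmod (f x))^2)" "periodic2pi f"
proof -
  show f: "integrable torus f" using assms by (simp add: L2T_def integrable_torus_iff)
  have "(\<lambda>x. (cmod (f x))^2) absolutely_integrable_on {0..2*pi}"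
    using assms unfolding L2T_def by (intro nonnegative_absolutely_integrable_1) auto
  then show "integrable torus (\<lambda>x. (cmod (f x))^2)"
    unfolding set_integrable_def by (simp add: integrable_restrict_space)
  show "periodic2pi f" using assms by (simp add: L2T_def)
qed

lemma L2T_I:
  assumes "periodic2pi f" "integrable torus f" "integrable torus (\<lambda>x. (cmod (f x))^2)"
  shows "L2T f"
  unfolding L2T_def using assms integrable_on_lebesgue_on[of "{0..2*pi}" "\<lambda>x. (cmod (f x))^2"]
  by (auto simp: integrable_torus_iff)

lemma integrable_torus_bounded_mult:
  fixes f g :: "real \<Rightarrow> complex"
  assumes "integrable torus g" "f \<in> borel_measurable torus" "AE x in torus. cmod (f x) \<le> A"
  shows "integrable torus (\<lambda>x. f x * g x)"
proof (rule Bochner_Integration.integrable_bound)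
  show "integrable torus (\<lambda>x. of_real A * g x)" using assms(1) by simp
  show "(\<lambda>x. f x * g x) \<in> borel_measurable torus" using assms by measurable
  show "AE x in torus. norm (f x * g x) \<le> norm (of_real A * g x)"
    using assms(3)
  proof eventually_elim
    case (elim x)
    then have "cmod (f x) \<le> \<bar>A\<bar>" by linarith
    then show ?case by (simp add: norm_mult mult_right_mono)
  qed
qed

lemma borel_measurable_torus_continuous: "continuous_on UNIV f \<Longrightarrow> f \<in> borel_measurable torus"
  for f :: "real \<Rightarrow> complex"
  by (rule continuous_imp_measurable_on_sets_lebesgue) (auto intro: continuous_on_subset)

lemma continuous_cis: "continuous_on S (\<lambda>x. cis (c * x))"
  unfolding cis_conv_exp by (intro continuous_intros)

lemma cis_measurable [measurable]: "(\<lambda>x. cis (c * x)) \<in> borel_measurable torus"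
  by (rule borel_measurable_torus_continuous[OF continuous_cis])

lemma integrable_cis_mult:
  assumes "integrable torus f"
  shows "integrable torus (\<lambda>x. cis (c * x) * f x)"
  by (rule integrable_torus_bounded_mult[OF assms cis_measurable, where A = 1]) simp

lemma fc_torus: "integrable torus f \<Longrightarrow> fc f k = (LINT x|torus. cis (- of_int k * x) * f x) / of_real (2 * pi)"
proof -
  assume f: "integrable torus f"
  have "(LINT x|torus. cis (- of_int k * x) * f x) = integral {0..2*pi} (\<lambda>x. cis (- of_int k * x) * f x)"
    by (rule lebesgue_integral_eq_integral[OF integrable_cis_mult[OF f]]) simp
  then show ?thesis by (simp add: fc_def)
qed

lemma integral_cis_torus: "(LINT x|torus. cis (of_int m * x)) = (if m = 0 then of_real (2 * pi) else 0)"
proof -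
  have i: "integrable torus (\<lambda>x. cis (of_int m * x) * 1)" by (rule integrable_cis_mult) simp
  have "(LINT x|torus. cis (of_int m * x)) = integral {0..2*pi} (\<lambda>x. cis (of_int m * x))"
    using i by (intro lebesgue_integral_eq_integral) auto
  also have "\<dots> = (if m = 0 then of_real (2 * pi) else 0)"
  proof (cases "m = 0")
    case False
    have "((\<lambda>x. cis (of_int m * x)) has_integral (cis (of_int m * (2 * pi)) / (\<i> * of_int m) - cis (of_int m * 0) / (\<i> * of_int m))) {0..2*pi}"
    proof (rule fundamental_theorem_of_calculus)
      show "((\<lambda>x. cis (of_int m * x) / (\<i> * of_int m)) has_vector_derivative cis (of_int m * x)) (at x within {0..2*pi})" for x
        using has_vector_derivative_divide[OF has_vector_derivative_cis[of "of_int m" x "{0..2*pi}"], of "\<i> * of_int m"] False by simp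
    qed simp
    moreover have "cis (of_int m * (2 * pi)) = 1" using cis_multiple_2pi[of "of_int m"] by (simp add: mult_ac)
    ultimately show ?thesis using False by (simp add: integral_unique)
  qed (simp add: scaleR_conv_of_real)
  finally show ?thesis .
qed

lemma fc_cong_AE:
  assumes "integrable torus f" "integrable torus g" "AE x in torus. f x = g x"
  shows "fc f k = fc g k"
proof -
  have "(LINT x|torus. cis (- of_int k * x) * f x) = (LINT x|torus. cis (- of_int k * x) * g x)"
    using assms by (intro integral_cong_AE borel_measurable_integrable integrable_cis_mult) auto
  then show ?thesis using assms by (simp add: fc_torus)
qed

lemma fc_add: "integrable torus f \<Longrightarrow> integrable torus g \<Longrightarrow> fc (\<lambda>x. f x + g x) k = fc f k + fc g k"
  using integrable_cis_mult[of f "- of_int k"] integrable_cis_mult[of g "- of_int k"]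
  by (simp add: fc_torus distrib_left add_divide_distrib)

lemma fc_cmult: "integrable torus f \<Longrightarrow> fc (\<lambda>x. c * f x) k = c * fc f k"
  using integrable_cis_mult[of f "- of_int k"] by (simp add: fc_torus mult.left_commute)

lemma fc_diff: "integrable torus f \<Longrightarrow> integrable torus g \<Longrightarrow> fc (\<lambda>x. f x - g x) k = fc f k - fc g k"
  using fc_add[of f "\<lambda>x. (-1) * g x" k] fc_cmult[of g "-1" k] by simp

lemma fc_cis: "fc (\<lambda>x. c * cis (of_int j * x)) k = (if j = k then c else 0)"
proof -
  have i: "integrable torus (\<lambda>x. cis (of_int j * x) * 1)" by (rule integrable_cis_mult) simp
  have "fc (\<lambda>x. c * cis (of_int j * x)) k = (LINT x|torus. c * cis (of_int (j - k) * x)) / of_real (2 * pi)"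
    using i by (subst fc_torus) (auto simp: cis_mult algebra_simps intro!: arg_cong2[where f = "(/)"] Bochner_Integration.integral_cong)
  then show ?thesis using integral_cis_torus[of "j - k"] by simp
qed

subsection \<open>Uniqueness\<close>

inductive trigpoly :: "(real \<Rightarrow> complex) \<Rightarrow> bool" where
  mono: "trigpoly (\<lambda>x. c * cis (of_int k * x))"
| add: "trigpoly u \<Longrightarrow> trigpoly w \<Longrightarrow> trigpoly (\<lambda>x. u x + w x)"

lemma trigpoly_mult: "trigpoly u \<Longrightarrow> trigpoly w \<Longrightarrow> trigpoly (\<lambda>x. u x * w x)"
proof (induction u rule: trigpoly.induct)
  case (mono c k)
  from mono show ?case
  proof (induction w rule: trigpoly.induct)
    case (mono d j)
    have "(\<lambda>x. c * cis (of_int k * x) * (d * cis (of_int j * x))) = (\<lambda>x. (c * d) * cis (of_int (k + j) * x))"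
      by (auto simp: algebra_simps cis_mult[symmetric])
    then show ?case using trigpoly.mono[of "c * d" "k + j"] by simp
  next
    case (add u w)
    then show ?case by (simp add: distrib_left trigpoly.add)
  qed
next
  case (add u w')
  then show ?case by (simp add: distrib_right trigpoly.add)
qed

text \<open>\<open>real_polynomial_function\<close> is the class provided by Stone-Weierstrass. A
  real-linear functional of \<open>cis x\<close> is a combination of cosine and sine, hence of
  \<open>cis x\<close> and \<open>cis (- x)\<close>.\<close>

lemma trigpoly_polynomial: "real_polynomial_function p \<Longrightarrow> trigpoly (\<lambda>x. of_real (p (cis x)))"
proof (induction p rule: real_polynomial_function.induct)
  case (linear f)
  interpret f: bounded_linear f by fact
  have e: "of_real (f (cis x)) = of_real (f 1) * ((cis x + cis (- x)) / 2) + of_real (f \<i>) * ((cis x - cis (- x)) / (2 * \<i>))" for x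
  proof -
    have "cis x = cos x *\<^sub>R 1 + sin x *\<^sub>R \<i>" by (simp add: complex_eq_iff)
    then have "f (cis x) = cos x * f 1 + sin x * f \<i>" by (metis f.add f.scaleR real_scaleR_def)
    moreover have "(cis x + cis (- x)) / 2 = of_real (cos x)" "(cis x - cis (- x)) / (2 * \<i>) = of_real (sin x)"
      by (auto simp: complex_eq_iff)
    ultimately show ?thesis by simp
  qed
  have "(\<lambda>x. of_real (f (cis x))) = (\<lambda>x. (of_real (f 1) / 2 + of_real (f \<i>) / (2 * \<i>)) * cis (of_int 1 * x)
      + (of_real (f 1) / 2 - of_real (f \<i>) / (2 * \<i>)) * cis (of_int (-1) * x))"
    unfolding e by (simp add: fun_eq_iff algebra_simps add_divide_distrib diff_divide_distrib)
  then show ?case by (simp only:) (intro trigpoly.add trigpoly.mono)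
next
  case (const c)
  then show ?case using trigpoly.mono[of "of_real c" 0] by simp
qed (auto intro: trigpoly.add trigpoly_mult)

lemma continuous_circle_measurable:
  "continuous_on UNIV h \<Longrightarrow> (\<lambda>x. complex_of_real (h (cis x))) \<in> borel_measurable torus"
proof -
  assume h: "continuous_on UNIV h"
  have "continuous_on UNIV (\<lambda>x. h (cis x))"
    using continuous_on_compose2[OF h continuous_cis[of UNIV 1]] by simp
  then show ?thesis by (rule borel_measurable_torus_continuous[OF continuous_on_of_real])
qed

lemma continuous_circle_bounded:
  assumes "continuous_on UNIV (h :: complex \<Rightarrow> real)"
  obtains A where "\<And>x. \<bar>h (cis x)\<bar> \<le> A"
proof -
  have "compact (h ` sphere 0 1)"
    using assms by (intro compact_continuous_image) (auto intro: continuous_on_subset)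
  then obtain A where "\<And>y. y \<in> h ` sphere 0 1 \<Longrightarrow> \<bar>y\<bar> \<le> A"
    using compact_imp_bounded[of "h ` sphere 0 1"] unfolding bounded_real by blast
  then show ?thesis using that[of A] by auto
qed

text \<open>Test functions are continuous functions of \<open>cis x\<close>, not of
  \<open>x\<close>: periodicity is then automatic, and uniform approximation by polynomials on the
  unit circle is available.\<close>

lemma integral_continuous_zero:
  assumes f: "integrable torus f" and z: "\<And>k. fc f k = 0" and h: "continuous_on UNIV (h :: complex \<Rightarrow> real)"
  shows "(LINT x|torus. of_real (h (cis x)) * f x) = 0"
proof -
  have tp: "integrable torus (\<lambda>x. u x * f x) \<and> (LINT x|torus. u x * f x) = 0" if "trigpoly u" for u
    using that
  proof (induction u rule: trigpoly.induct)
    case (mono c k)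
    have "(LINT x|torus. cis (of_int k * x) * f x) = 0" using z[of "- k"] f by (simp add: fc_torus)
    then show ?case using integrable_cis_mult[OF f, of "of_int k"] by (simp add: mult.assoc)
  qed (simp add: distrib_right)
  obtain A where A: "\<And>x. \<bar>h (cis x)\<bar> \<le> A" using continuous_circle_bounded[OF h] by blast
  have hf: "integrable torus (\<lambda>x. of_real (h (cis x)) * f x)"
    using A by (intro integrable_torus_bounded_mult[OF f continuous_circle_measurable[OF h], where A = A]) auto
  have "cmod (LINT x|torus. of_real (h (cis x)) * f x) \<le> e * (LINT x|torus. cmod (f x))" if e: "e > 0" for e
  proof -
    obtain p where p: "real_polynomial_function p" "\<And>z. z \<in> sphere 0 1 \<Longrightarrow> \<bar>h z - p z\<bar> < e"
      using Stone_Weierstrass_real_polynomial_function[of "sphere 0 1" h e] h e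
      by (metis compact_sphere continuous_on_subset subset_UNIV)
    note pf = tp[OF trigpoly_polynomial[OF p(1)]]
    have "(LINT x|torus. of_real (h (cis x)) * f x) = (LINT x|torus. of_real (h (cis x)) * f x - of_real (p (cis x)) * f x)"
      using hf pf by simp
    also have "cmod \<dots> \<le> (LINT x|torus. cmod (of_real (h (cis x)) * f x - of_real (p (cis x)) * f x))"
      by (rule integral_norm_bound)
    also have "\<dots> \<le> (LINT x|torus. e * cmod (f x))"
    proof (rule integral_mono)
      fix x
      have "cmod (of_real (h (cis x)) * f x - of_real (p (cis x)) * f x) = \<bar>h (cis x) - p (cis x)\<bar> * cmod (f x)"
        by (simp only: left_diff_distrib[symmetric] norm_mult of_real_diff[symmetric] norm_of_real)
      also have "\<dots> \<le> e * cmod (f x)" using p(2)[of "cis x"] by (intro mult_right_mono) auto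
      finally show "cmod (of_real (h (cis x)) * f x - of_real (p (cis x)) * f x) \<le> e * cmod (f x)" .
    qed (use hf pf f in auto)
    finally show ?thesis by simp
  qed
  then have le: "cmod (LINT x|torus. of_real (h (cis x)) * f x) \<le> e * (LINT x|torus. cmod (f x))" if "e > 0" for e using that by blast
  have "cmod (LINT x|torus. of_real (h (cis x)) * f x) \<le> 0"
  proof (rule field_le_epsilon)
    fix e :: real assume e: "e > 0"
    let ?I = "LINT x|torus. cmod (f x)"
    have I0: "0 \<le> ?I" by simp
    have I1: "0 < ?I + 1" using I0 by linarith
    have "cmod (LINT x|torus. of_real (h (cis x)) * f x) \<le> e / (?I + 1) * ?I" by (rule le[OF divide_pos_pos[OF e I1]])
    also have "\<dots> = e * (?I / (?I + 1))" by simp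
    also have "\<dots> \<le> e * 1"
    proof (rule mult_left_mono)
      show "?I / (?I + 1) \<le> 1" by (subst divide_le_eq_1_pos[OF I1]) simp
    qed (use e in simp)
    finally show "cmod (LINT x|torus. of_real (h (cis x)) * f x) \<le> 0 + e" by simp
  qed
  then show ?thesis by simp
qed

lemma cis_inj_open: "inj_on cis {0<..<2*pi}"
proof (rule inj_onI)
  fix x y assume xy: "x \<in> {0<..<2*pi}" "y \<in> {0<..<2*pi}" "cis x = cis y"
  then have "cis (x - y) = 1" by (simp add: cis_divide[symmetric])
  then obtain n :: int where n: "x - y = of_int n * (2 * pi)"
    using cos_one_2pi_int[of "x - y"] by (auto simp: complex_eq_iff)
  moreover have "\<bar>x - y\<bar> < 2 * pi" using xy by auto
  ultimately have "\<bar>real_of_int n\<bar> < 1" by (simp add: abs_mult)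
  then have "n = 0" by linarith
  then show "x = y" using n by simp
qed

lemma AE_torus_open: "AE x in torus. x \<in> {0<..<2*pi}"
proof -
  have "AE x in lebesgue. x \<notin> {0, 2*pi}"
    by (intro AE_not_in) (simp add: negligible_iff_null_sets[symmetric])
  then have "AE x in lebesgue. x \<in> {0..2*pi} \<longrightarrow> x \<in> {0<..<2*pi}" by (rule eventually_mono) auto
  then show ?thesis by (subst AE_restrict_space_iff; (assumption | simp))
qed

text \<open>Inner regularity reduces the claim to closed subsets \<open>T\<close> of the set where
  \<open>g\<close> is positive. Cutoffs depending on the distance of \<open>cis x\<close> to the
  image of \<open>T\<close> on the circle converge to the indicator of \<open>T\<close> almost
  everywhere, so the integral of \<open>g\<close> over \<open>T\<close> vanishes and
  \<open>T\<close> is null.\<close>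

lemma AE_nonpos:
  fixes g :: "real \<Rightarrow> real"
  assumes g: "integrable torus g" and z: "\<And>h. continuous_on UNIV (h :: complex \<Rightarrow> real) \<Longrightarrow> (LINT x|torus. h (cis x) * g x) = 0"
  shows "AE x in torus. g x \<le> 0"
proof -
  \<comment> \<open>The endpoints are left out because \<open>cis\<close> identifies them. On the
    open interval \<open>cis\<close> is injective, so points of it outside \<open>T\<close> are
    mapped outside the closed image of \<open>T\<close>.\<close>
  define S where "S = {x \<in> {0<..<2*pi}. 0 < g x}"
  have "S = {x \<in> space torus. 0 < g x} \<inter> {0<..<2*pi}" by (auto simp: S_def)
  moreover have "{x \<in> space torus. 0 < g x} \<in> sets torus" using borel_measurable_integrable[OF g] by measurable
  moreover have "{0<..<2*pi} \<in> sets torus" by (auto simp: sets_restrict_space_iff)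
  ultimately have "S \<in> sets torus" by auto
  then have S: "S \<in> sets lebesgue" by (simp add: sets_restrict_space_iff)
  have closed_null: "T \<in> null_sets lebesgue" if T: "closed T" "T \<subseteq> S" for T
  proof (cases "T = {}")
    case True then show ?thesis by simp
  next
    case False
    have "T \<subseteq> {0..2*pi}" using T by (auto simp: S_def)
    then have "compact T" using T(1) by (meson bounded_closed_interval bounded_subset compact_eq_bounded_closed)
    then have cT: "closed (cis ` T)"
      using continuous_cis[of T 1] by (intro compact_imp_closed compact_continuous_image) auto
    define \<phi> where "\<phi> n z = max 0 (1 - real n * infdist z (cis ` T))" for n :: nat and z
    have c\<phi>: "continuous_on UNIV (\<phi> n)" for n
      unfolding \<phi>_def by (intro continuous_intros)
    have b\<phi>: "\<bar>\<phi> n z\<bar> \<le> 1" for n z by (auto simp: \<phi>_def infdist_nonneg)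
    have lim: "(\<lambda>n. \<phi> n (cis x) * g x) \<longlonglongrightarrow> indicator T x * g x" if x: "x \<in> {0<..<2*pi}" for x
    proof (cases "x \<in> T")
      case True then show ?thesis by (simp add: \<phi>_def)
    next
      case F: False
      have "cis x \<notin> cis ` T"
      proof
        assume "cis x \<in> cis ` T"
        then obtain y where "y \<in> T" "cis x = cis y" by auto
        then show False using inj_onD[OF cis_inj_open, of x y] x F T(2) by (auto simp: S_def)
      qed
      then have "infdist (cis x) (cis ` T) > 0" using cT False by (meson image_is_empty infdist_pos_not_in_closed)
      then obtain N where N: "1 < real N * infdist (cis x) (cis ` T)"
        using reals_Archimedean3 by blast
      have "\<phi> n (cis x) = 0" if "n \<ge> N" for n
      proof -
        have "real N * infdist (cis x) (cis ` T) \<le> real n * infdist (cis x) (cis ` T)"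
          using that by (intro mult_right_mono infdist_nonneg) auto
        then show ?thesis using N by (simp add: \<phi>_def)
      qed
      then have "\<forall>\<^sub>F n in sequentially. \<phi> n (cis x) * g x = indicator T x * g x"
        using F by (auto simp: eventually_sequentially)
      then show ?thesis by (rule tendsto_eventually)
    qed
    have Tm: "T \<in> sets torus" using T(1) \<open>T \<subseteq> {0..2*pi}\<close> by (auto simp: sets_restrict_space_iff)
    have m: "(\<lambda>x. \<phi> n (cis x) * g x) \<in> borel_measurable torus" for n
    proof -
      have "(\<lambda>x. Re (complex_of_real (\<phi> n (cis x)))) \<in> borel_measurable torus"
        using continuous_circle_measurable[OF c\<phi>] by measurable
      then show ?thesis using g by auto
    qed
    have "(\<lambda>n. LINT x|torus. \<phi> n (cis x) * g x) \<longlonglongrightarrow> (LINT x|torus. indicator T x * g x)"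
    proof (rule integral_dominated_convergence[where w = "\<lambda>x. \<bar>g x\<bar>"])
      show "AE x in torus. (\<lambda>n. \<phi> n (cis x) * g x) \<longlonglongrightarrow> indicator T x * g x"
        using AE_torus_open by eventually_elim (rule lim)
      show "AE x in torus. norm (\<phi> n (cis x) * g x) \<le> \<bar>g x\<bar>" for n
        using mult_right_mono[OF b\<phi>] by (auto simp: abs_mult)
    qed (use g Tm m in auto)
    then have I0: "(LINT x|torus. indicator T x * g x) = 0"
      using z[OF c\<phi>] by (simp add: LIMSEQ_const_iff)
    have "AE x in torus. indicator T x * g x = 0"
    proof (subst integral_nonneg_eq_0_iff_AE[symmetric])
      show "integrable torus (\<lambda>x. indicator T x * g x)"
        using integrable_mult_indicator[OF Tm g] by simp
      show "AE x in torus. 0 \<le> indicator T x * g x"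
        using T(2) by (auto simp: S_def indicator_def intro!: AE_I2)
    qed (rule I0)
    then have "AE x in torus. x \<notin> T"
      by eventually_elim (use T(2) in \<open>auto simp: S_def indicator_def split: if_splits\<close>)
    then have "T \<in> null_sets torus" using Tm by (simp add: AE_iff_null_sets)
    then show ?thesis by (simp add: null_sets_restrict_space)
  qed
  have le: "emeasure lebesgue S \<le> ennreal e" if e: "e > 0" for e
  proof -
    obtain T where T: "closed T" "T \<subseteq> S" "S - T \<in> lmeasurable" "emeasure lebesgue (S - T) < ennreal e"
      using sets_lebesgue_inner_closed[OF S e] .
    have "emeasure lebesgue S = emeasure lebesgue ((S - T) \<union> T)" using T(2) by (simp add: Un_absorb2)
    also have "\<dots> = emeasure lebesgue (S - T)"
      using closed_null[OF T(1,2)] T(3) by (intro emeasure_Un_null_set) auto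
    finally show ?thesis using T(4) by simp
  qed
  have "emeasure lebesgue S \<le> 0"
    by (rule ennreal_le_epsilon) (simp only: add_0 le)
  then have "S \<in> null_sets lebesgue" using S by (simp add: null_sets_def)
  then have "AE x in lebesgue. x \<notin> S" by (rule AE_not_in)
  then have "AE x in torus. x \<notin> S" by (simp add: AE_restrict_space_iff) (auto elim!: eventually_mono)
  with AE_torus_open show ?thesis by eventually_elim (auto simp: S_def)
qed

lemma fc_unique:
  assumes f: "integrable torus f" and z: "\<And>k. fc f k = 0"
  shows "AE x in torus. f x = 0"
proof -
  have hf: "integrable torus (\<lambda>x. of_real (h (cis x)) * f x)" if h: "continuous_on UNIV (h :: complex \<Rightarrow> real)" for h
  proof -
    obtain A where "\<And>x. \<bar>h (cis x)\<bar> \<le> A" using continuous_circle_bounded[OF h] by blast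
    then show ?thesis by (intro integrable_torus_bounded_mult[OF f continuous_circle_measurable[OF h], where A = A]) auto
  qed
  have R: "(LINT x|torus. h (cis x) * (c * Re (f x))) = 0" "(LINT x|torus. h (cis x) * (c * Im (f x))) = 0"
    if "continuous_on UNIV (h :: complex \<Rightarrow> real)" for h and c :: real
  proof -
    have "(LINT x|torus. Re (of_real (h (cis x)) * f x)) = 0" "(LINT x|torus. Im (of_real (h (cis x)) * f x)) = 0"
      using integral_continuous_zero[OF f z that] hf[OF that] by (simp_all del: times_complex.sel)
    then have "c * (LINT x|torus. h (cis x) * Re (f x)) = 0" "c * (LINT x|torus. h (cis x) * Im (f x)) = 0" by auto
    then show "(LINT x|torus. h (cis x) * (c * Re (f x))) = 0" "(LINT x|torus. h (cis x) * (c * Im (f x))) = 0"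
      by (simp_all add: mult.left_commute)
  qed
  have 1: "AE x in torus. c * Re (f x) \<le> 0" for c by (rule AE_nonpos[OF _ R(1)]) (use f in auto)
  have 2: "AE x in torus. c * Im (f x) \<le> 0" for c by (rule AE_nonpos[OF _ R(2)]) (use f in auto)
  from 1[of 1] 1[of "-1"] 2[of 1] 2[of "-1"] show ?thesis
    by eventually_elim (auto simp: complex_eq_iff)
qed

subsection \<open>Absolutely convergent Fourier series\<close>

definition ser :: "(int \<Rightarrow> complex) \<Rightarrow> real \<Rightarrow> complex" where
  "ser a x = (\<Sum>\<^sub>\<infinity>k. a k * cis (of_int k * x))"

definition asum :: "(int \<Rightarrow> complex) \<Rightarrow> bool" where
  "asum a \<longleftrightarrow> (\<lambda>k. cmod (a k)) summable_on UNIV"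

lemma ser_uniform:
  assumes "asum a"
  shows "uniform_limit UNIV (\<lambda>F x. \<Sum>k\<in>F. a k * cis (of_int k * x)) (ser a) (finite_subsets_at_top UNIV)"
  using Weierstrass_m_test_general[of UNIV UNIV "\<lambda>k x. a k * cis (of_int k * x)" "\<lambda>k. cmod (a k)"] assms
  unfolding ser_def[abs_def] asum_def by (simp add: norm_mult)

lemma ser_continuous: "asum a \<Longrightarrow> continuous_on UNIV (ser a)"
  by (rule uniform_limit_theorem[OF _ ser_uniform])
     (auto intro!: always_eventually continuous_intros continuous_cis)

lemma ser_periodic: "periodic2pi (ser a)"
proof -
  have "cis (of_int k * (x + 2 * pi)) = cis (of_int k * x)" for k :: int and x
  proof -
    have "cis (of_int k * (x + 2 * pi)) = cis (of_int k * x) * cis (2 * pi * of_int k)"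
      by (simp add: cis_mult algebra_simps)
    then show ?thesis using cis_multiple_2pi[of "of_int k"] by simp
  qed
  then show ?thesis unfolding periodic2pi_def ser_def by simp
qed

lemma ser_bound: "asum a \<Longrightarrow> cmod (ser a x) \<le> (\<Sum>\<^sub>\<infinity>k. cmod (a k))"
  unfolding ser_def asum_def
  using norm_infsum_bound[of "\<lambda>k. a k * cis (of_int k * x)" UNIV] by (simp add: norm_mult)

lemma bounded_L2T:
  assumes "periodic2pi f" "f \<in> borel_measurable torus" "AE x in torus. cmod (f x) \<le> A"
  shows "L2T f"
proof (rule L2T_I[OF assms(1)])
  show f: "integrable torus f" using integrable_torus_bounded_mult[of "\<lambda>_. 1", OF _ assms(2,3)] by simp
  show "integrable torus (\<lambda>x. (cmod (f x))^2)"
  proof (rule torus.integrable_const_bound[of _ "A^2"])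
    show "AE x in torus. norm ((cmod (f x))^2) \<le> A^2"
      using assms(3) by eventually_elim (auto intro: power_mono)
    show "(\<lambda>x. (cmod (f x))^2) \<in> borel_measurable torus" using assms(2) by measurable
  qed
qed

lemma ser_L2T: "asum a \<Longrightarrow> L2T (ser a)"
  by (rule bounded_L2T[OF ser_periodic borel_measurable_torus_continuous[OF ser_continuous]])
     (auto intro: ser_bound)

text \<open>Partial sums converge uniformly along finite subsets, and integration against
  \<open>g\<close> preserves this. \<open>has_sum\<close> is convergence along the same net, so no
  order of summation is chosen. With \<open>g = 1\<close> the coefficients of \<open>ser a\<close>
  result.\<close>

lemma ser_mult_has_sum:
  assumes a: "asum a" and g: "integrable torus g"
  shows "((\<lambda>j. a j * fc g (k - j)) has_sum fc (\<lambda>x. ser a x * g x) k) UNIV"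
proof -
  let ?F = "finite_subsets_at_top (UNIV :: int set)"
  let ?S = "\<lambda>F x. \<Sum>j\<in>F. a j * cis (of_int j * x)"
  have sm: "ser a \<in> borel_measurable torus" by (rule borel_measurable_torus_continuous[OF ser_continuous[OF a]])
  have sg: "integrable torus (\<lambda>x. ser a x * g x)"
    by (rule integrable_torus_bounded_mult[OF g sm]) (auto intro: ser_bound[OF a])
  have Sg: "integrable torus (\<lambda>x. ?S F x * g x)" for F
    using integrable_cis_mult[OF g] by (auto simp: sum_distrib_right mult.assoc)
  have fS: "fc (\<lambda>x. ?S F x * g x) k = (\<Sum>j\<in>F. a j * fc g (k - j))" for F
  proof -
    have "(LINT x|torus. cis (- of_int k * x) * (?S F x * g x)) = (LINT x|torus. (\<Sum>j\<in>F. a j * (cis (- of_int (k - j) * x) * g x)))"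
      by (intro Bochner_Integration.integral_cong) (auto simp: sum_distrib_left sum_distrib_right cis_mult algebra_simps)
    also have "\<dots> = (\<Sum>j\<in>F. a j * (LINT x|torus. cis (- of_int (k - j) * x) * g x))"
      using integrable_cis_mult[OF g, of "- of_int (k - j)" for j] by (simp del: of_int_diff)
    finally show ?thesis using Sg by (simp add: fc_torus[OF Sg] fc_torus[OF g] sum_divide_distrib del: of_int_diff)
  qed
  have "((\<lambda>F. \<Sum>j\<in>F. a j * fc g (k - j)) \<longlongrightarrow> fc (\<lambda>x. ser a x * g x) k) ?F"
    unfolding fS[symmetric]
  proof (rule tendstoI)
    fix e :: real assume e: "e > 0"
    let ?I = "LINT x|torus. cmod (g x)"
    have I0: "0 \<le> ?I" by simp
    have I1: "0 < ?I + 1" using I0 by linarith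
    define e' where "e' = e * (2 * pi) / (?I + 1)"
    have e': "e' > 0" unfolding e'_def by (intro divide_pos_pos mult_pos_pos e I1) auto
    have "\<forall>\<^sub>F F in ?F. \<forall>x\<in>UNIV. dist (?S F x) (ser a x) < e'" using uniform_limitD[OF ser_uniform[OF a] e'] .
    then show "\<forall>\<^sub>F F in ?F. dist (fc (\<lambda>x. ?S F x * g x) k) (fc (\<lambda>x. ser a x * g x) k) < e"
    proof eventually_elim
      case (elim F)
      have "fc (\<lambda>x. ?S F x * g x) k - fc (\<lambda>x. ser a x * g x) k = fc (\<lambda>x. ?S F x * g x - ser a x * g x) k"
        by (rule fc_diff[OF Sg sg, symmetric])
      also have "\<dots> = (LINT x|torus. cis (- of_int k * x) * (?S F x * g x - ser a x * g x)) / of_real (2 * pi)"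
        using Sg sg by (intro fc_torus) auto
      also have "cmod \<dots> \<le> (e' * ?I) / (2 * pi)"
      proof -
        have "cmod (LINT x|torus. cis (- of_int k * x) * (?S F x * g x - ser a x * g x)) \<le> (LINT x|torus. cmod (cis (- of_int k * x) * (?S F x * g x - ser a x * g x)))"
          by (rule integral_norm_bound)
        also have "\<dots> \<le> (LINT x|torus. e' * cmod (g x))"
        proof (rule integral_mono)
          show "integrable torus (\<lambda>x. cmod (cis (- of_int k * x) * (?S F x * g x - ser a x * g x)))"
            by (intro integrable_norm integrable_cis_mult Bochner_Integration.integrable_diff Sg sg)
          fix x
          have "cmod (cis (- of_int k * x) * (?S F x * g x - ser a x * g x)) = cmod (?S F x - ser a x) * cmod (g x)"
            by (simp add: norm_mult left_diff_distrib[symmetric])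
          also have "\<dots> \<le> e' * cmod (g x)" using elim by (intro mult_right_mono) (auto simp: dist_norm less_imp_le)
          finally show "cmod (cis (- of_int k * x) * (?S F x * g x - ser a x * g x)) \<le> e' * cmod (g x)" .
        qed (use g in auto)
        finally show ?thesis by (simp add: norm_divide norm_mult divide_right_mono)
      qed
      also have "\<dots> = e * (?I / (?I + 1))" by (simp add: e'_def)
      also have "\<dots> < e * 1"
      proof (rule mult_strict_left_mono[OF _ e])
        show "?I / (?I + 1) < 1" by (subst divide_less_eq_1_pos[OF I1]) simp
      qed
      finally show ?case by (simp add: dist_norm)
    qed
  qed
  then show ?thesis by (simp add: has_sum_def)
qed

lemma has_sum_single: "(\<And>j. j \<noteq> k \<Longrightarrow> f j = 0) \<Longrightarrow> (f has_sum f k) UNIV"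
  for f :: "'a \<Rightarrow> 'b::{comm_monoid_add, topological_space}"
  using has_sum_finite[of "{k}" f] has_sum_cong_neutral[of UNIV "{k}" f f "f k"] by auto

lemma fc_ser: "asum a \<Longrightarrow> fc (ser a) k = a k"
proof -
  assume a: "asum a"
  have one: "fc (\<lambda>x. 1) j = (if j = 0 then 1 else 0)" for j using fc_cis[of 1 0 j] by simp
  have "((\<lambda>j. a j * fc (\<lambda>x. 1) (k - j)) has_sum fc (\<lambda>x. ser a x * 1) k) UNIV" by (rule ser_mult_has_sum[OF a]) simp
  moreover have "((\<lambda>j. a j * fc (\<lambda>x. 1) (k - j)) has_sum (a k * fc (\<lambda>x. 1) (k - k))) UNIV"
    by (rule has_sum_single) (simp add: one)
  ultimately have "a k * fc (\<lambda>x. 1) (k - k) = fc (\<lambda>x. ser a x * 1) k" by (rule has_sum_unique[rotated])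
  then show ?thesis by (simp add: one)
qed

text \<open>The Wiener algebra. It is closed under products, conjugation and bounded multipliers,
  contains \<open>H^\<gamma>\<close>, and its members are determined almost everywhere by their
  coefficients; for arguments in \<open>H^\<gamma>\<close> all functions formed in \<Psi>,
  \<open>G1\<close> and \<open>G2\<close> stay in it.\<close>

definition wien :: "(real \<Rightarrow> complex) \<Rightarrow> bool" where
  "wien f \<longleftrightarrow> L2T f \<and> asum (fc f)"

lemma wien_ser: "asum a \<Longrightarrow> wien (ser a)"
  by (simp add: wien_def ser_L2T fc_ser asum_def)

lemma wien_AE:
  assumes "wien f"
  shows "AE x in torus. f x = ser (fc f) x"
proof -
  have a: "asum (fc f)" and f: "integrable torus f" using assms L2T_integrable by (auto simp: wien_def)
  have s: "integrable torus (ser (fc f))" using L2T_integrable(1)[OF ser_L2T[OF a]] .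
  have "AE x in torus. f x - ser (fc f) x = 0"
    using f s by (intro fc_unique) (auto simp: fc_diff fc_ser[OF a])
  then show ?thesis by eventually_elim simp
qed

lemma L2T_mult:
  assumes f: "wien f" and g: "L2T g"
  shows L2T_wien_mult: "L2T (\<lambda>x. f x * g x)"
    and fc_mult_has_sum: "((\<lambda>j. fc f j * fc g (k - j)) has_sum fc (\<lambda>x. f x * g x) k) UNIV"
proof -
  have a: "asum (fc f)" and fi: "integrable torus f" and pf: "periodic2pi f" using f L2T_integrable by (auto simp: wien_def)
  note gi = L2T_integrable[OF g]
  let ?A = "\<Sum>\<^sub>\<infinity>k. cmod (fc f k)"
  have b: "AE x in torus. cmod (f x) \<le> ?A" using wien_AE[OF f] by eventually_elim (simp add: ser_bound[OF a])
  have fg: "integrable torus (\<lambda>x. f x * g x)" by (rule integrable_torus_bounded_mult[OF gi(1) borel_measurable_integrable[OF fi] b])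
  show "L2T (\<lambda>x. f x * g x)"
  proof (rule L2T_I[OF _ fg])
    show "periodic2pi (\<lambda>x. f x * g x)" using pf gi(3) by (simp add: periodic2pi_def)
    show "integrable torus (\<lambda>x. (cmod (f x * g x))^2)"
    proof (rule Bochner_Integration.integrable_bound)
      show "integrable torus (\<lambda>x. ?A^2 * (cmod (g x))^2)" using gi(2) by simp
      show "(\<lambda>x. (cmod (f x * g x))^2) \<in> borel_measurable torus" using fg by measurable
      show "AE x in torus. norm ((cmod (f x * g x))^2) \<le> norm (?A^2 * (cmod (g x))^2)"
        using b by eventually_elim (auto simp: norm_mult power_mult_distrib intro!: mult_right_mono power_mono)
    qed
  qed
  have "fc (\<lambda>x. f x * g x) k = fc (\<lambda>x. ser (fc f) x * g x) k"
  proof (rule fc_cong_AE[OF fg])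
    show "integrable torus (\<lambda>x. ser (fc f) x * g x)"
      by (rule integrable_torus_bounded_mult[OF gi(1) borel_measurable_torus_continuous[OF ser_continuous[OF a]]]) (auto intro: ser_bound[OF a])
    show "AE x in torus. f x * g x = ser (fc f) x * g x" using wien_AE[OF f] by eventually_elim simp
  qed
  then show "((\<lambda>j. fc f j * fc g (k - j)) has_sum fc (\<lambda>x. f x * g x) k) UNIV"
    using ser_mult_has_sum[OF a gi(1), of k] by simp
qed

lemma wien_mult:
  assumes f: "wien f" and g: "wien g"
  shows "wien (\<lambda>x. f x * g x)"
proof -
  have gL: "L2T g" and ag: "asum (fc g)" and af: "asum (fc f)" using f g by (auto simp: wien_def)
  have s: "(\<lambda>(j, k). cmod (fc f j) * cmod (fc g k)) summable_on UNIV \<times> UNIV"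
  proof (rule summable_on_SigmaI)
    show "((\<lambda>k. case (j, k) of (j, k) \<Rightarrow> cmod (fc f j) * cmod (fc g k)) has_sum (cmod (fc f j) * (\<Sum>\<^sub>\<infinity>k. cmod (fc g k)))) UNIV" for j
      using has_sum_cmult_right[OF has_sum_infsum[OF ag[unfolded asum_def]]] by simp
    show "(\<lambda>j. cmod (fc f j) * (\<Sum>\<^sub>\<infinity>k. cmod (fc g k))) summable_on UNIV"
      by (rule summable_on_cmult_left[OF af[unfolded asum_def]])
  qed auto
  have bij: "bij (\<lambda>(k, j). (j, k - j) :: int \<times> int)"
    by (rule o_bij[of "\<lambda>(j, m). (j + m, j)"]) (auto simp: fun_eq_iff)
  have s2: "(\<lambda>(k, j). cmod (fc f j) * cmod (fc g (k - j))) summable_on UNIV \<times> UNIV"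
    using s summable_on_reindex_bij_betw[OF bij, of "\<lambda>(j, k). cmod (fc f j) * cmod (fc g k)"]
    by (simp add: case_prod_unfold)
  have "(\<lambda>k. \<Sum>\<^sub>\<infinity>j. cmod (fc f j) * cmod (fc g (k - j))) summable_on UNIV"
    using summable_on_Sigma_banach[OF s2] by simp
  then have "(\<lambda>k. cmod (fc (\<lambda>x. f x * g x) k)) summable_on UNIV"
  proof (rule summable_on_comparison_test)
    fix k
    have sk: "(\<lambda>j. cmod (fc f j * fc g (k - j))) summable_on UNIV"
      using summable_on_SigmaD1[OF s2, of k] by (simp add: norm_mult)
    show "cmod (fc (\<lambda>x. f x * g x) k) \<le> (\<Sum>\<^sub>\<infinity>j. cmod (fc f j) * cmod (fc g (k - j)))"
      using norm_infsum_bound[OF sk] infsumI[OF fc_mult_has_sum[OF f gL, of k]] by (simp add: norm_mult)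
  qed auto
  then show ?thesis using L2T_wien_mult[OF f gL] by (simp add: wien_def asum_def)
qed

lemma cnjf_L2T: "L2T f \<Longrightarrow> L2T (cnjf f)" and fc_cnjf: "L2T f \<Longrightarrow> fc (cnjf f) = rv (fc f)"
proof -
  assume f: "L2T f"
  note fi = L2T_integrable[OF f]
  have ci: "integrable torus (cnjf f)" unfolding cnjf_def using fi(1) by simp
  show "L2T (cnjf f)" using fi ci by (intro L2T_I) (auto simp: cnjf_def periodic2pi_def)
  show "fc (cnjf f) = rv (fc f)"
  proof
    fix k
    have "cnj (LINT x|torus. cis (- of_int (- k) * x) * f x) = (LINT x|torus. cnj (cis (- of_int (- k) * x) * f x))"
      by (rule Bochner_Integration.integral_cnj[symmetric])
    also have "\<dots> = (LINT x|torus. cis (- of_int k * x) * cnjf f x)"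
      by (intro Bochner_Integration.integral_cong) (auto simp: cnjf_def cis_cnj)
    finally show "fc (cnjf f) k = rv (fc f) k" by (simp add: rv_def fc_torus[OF fi(1)] fc_torus[OF ci])
  qed
qed

lemma asum_rv: "asum a \<Longrightarrow> asum (rv a)"
  unfolding asum_def rv_def
  using summable_on_reindex_bij_betw[of uminus UNIV UNIV "\<lambda>k::int. cmod (a k)"]
  by (simp add: bij_uminus)

lemma wien_cnjf: "wien f \<Longrightarrow> wien (cnjf f)"
  by (simp add: wien_def cnjf_L2T fc_cnjf asum_rv)

text \<open>\<open>fmult\<close> is a choice, so nothing is known of it before some function with
  the prescribed coefficients is exhibited.\<close>

lemma fmult_eq:
  assumes "\<exists>g. L2T g \<and> (\<forall>k. fc g k = m k * fc f k)"
  shows "L2T (fmult m f)" "fc (fmult m f) k = m k * fc f k"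
  using someI_ex[OF assms] unfolding fmult_def by auto

lemma fmult_wien:
  assumes f: "wien f" and m: "\<And>k. cmod (m k) \<le> A"
  shows "wien (fmult m f)" "fc (fmult m f) = (\<lambda>k. m k * fc f k)"
proof -
  have a: "asum (\<lambda>k. m k * fc f k)"
    unfolding asum_def
  proof (rule summable_on_comparison_test)
    show "(\<lambda>k. A * cmod (fc f k)) summable_on UNIV" using f by (intro summable_on_cmult_right) (auto simp: wien_def asum_def)
    show "cmod (m k * fc f k) \<le> A * cmod (fc f k)" for k using m by (simp add: norm_mult mult_right_mono)
  qed auto
  have ex: "\<exists>g. L2T g \<and> (\<forall>k. fc g k = m k * fc f k)"
    using ser_L2T[OF a] fc_ser[OF a] by (intro exI[of _ "ser (\<lambda>k. m k * fc f k)"]) auto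
  show e: "fc (fmult m f) = (\<lambda>k. m k * fc f k)" using fmult_eq(2)[OF ex] by auto
  show "wien (fmult m f)" using fmult_eq(1)[OF ex] a by (simp add: wien_def e)
qed

lemma wien_add: "wien f \<Longrightarrow> wien g \<Longrightarrow> wien (\<lambda>x. f x + g x)"
  and fc_wien_add: "wien f \<Longrightarrow> wien g \<Longrightarrow> fc (\<lambda>x. f x + g x) = (\<lambda>k. fc f k + fc g k)"
proof -
  assume f: "wien f" and g: "wien g"
  then have fi: "integrable torus f" and gi: "integrable torus g" and pf: "periodic2pi f" and pg: "periodic2pi g"
    using L2T_integrable by (auto simp: wien_def)
  show e: "fc (\<lambda>x. f x + g x) = (\<lambda>k. fc f k + fc g k)" using fc_add[OF fi gi] by auto
  have af: "asum (fc f)" and ag: "asum (fc g)" using f g by (auto simp: wien_def)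
  have "L2T (\<lambda>x. f x + g x)"
  proof (rule bounded_L2T)
    show "periodic2pi (\<lambda>x. f x + g x)" using pf pg by (simp add: periodic2pi_def)
    show "AE x in torus. cmod (f x + g x) \<le> (\<Sum>\<^sub>\<infinity>k. cmod (fc f k)) + (\<Sum>\<^sub>\<infinity>k. cmod (fc g k))"
      using wien_AE[OF f] wien_AE[OF g]
    proof eventually_elim
      case (elim x)
      show ?case unfolding elim by (rule norm_triangle_mono[OF ser_bound[OF af] ser_bound[OF ag]])
    qed
  qed (use fi gi in measurable)
  moreover have "asum (\<lambda>k. fc f k + fc g k)"
    unfolding asum_def
  proof (rule summable_on_comparison_test)
    show "(\<lambda>k. cmod (fc f k) + cmod (fc g k)) summable_on UNIV" using f g by (intro summable_on_add) (auto simp: wien_def asum_def)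
  qed (auto intro: norm_triangle_ineq)
  ultimately show "wien (\<lambda>x. f x + g x)" by (simp add: wien_def e)
qed

lemma wien_const: "wien (\<lambda>x. c)" and fc_const: "fc (\<lambda>x. c) = (\<lambda>k. if k = 0 then c else 0)"
proof -
  show e: "fc (\<lambda>x. c) = (\<lambda>k. if k = 0 then c else 0)" using fc_cis[of c 0] by (auto simp: fun_eq_iff)
  have "L2T (\<lambda>x. c)" by (rule bounded_L2T[of _ "cmod c"]) (auto simp: periodic2pi_def)
  moreover have "(\<lambda>k. cmod (if k = 0 then c else 0)) summable_on (UNIV :: int set)"
    by (rule has_sum_imp_summable, rule has_sum_single[of 0]) auto
  ultimately show "wien (\<lambda>x. c)" by (simp add: wien_def asum_def e)
qed

lemma wien_cmult: "wien f \<Longrightarrow> wien (\<lambda>x. c * f x)" and fc_wien_cmult: "wien f \<Longrightarrow> fc (\<lambda>x. c * f x) = (\<lambda>k. c * fc f k)"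
  using wien_mult[OF wien_const] fc_cmult L2T_integrable(1) by (auto simp: wien_def fun_eq_iff)

subsection \<open>Parseval and Riesz--Fischer\<close>

lemma mass_eq_integral:
  assumes "L2T f"
  shows "mass f = (LINT x|torus. (cmod (f x))^2) / (2 * pi)"
proof -
  note fi = L2T_integrable[OF assms]
  have i: "integrable torus (abs2 f)" unfolding abs2_def using fi(2) by (rule integrable_of_real)
  have "fc (abs2 f) 0 = (LINT x|torus. abs2 f x) / of_real (2 * pi)" using fc_torus[OF i, of 0] by simp
  also have "\<dots> = of_real ((LINT x|torus. (cmod (f x))^2) / (2 * pi))" unfolding abs2_def
    using integral_bounded_linear[where T = complex_of_real, OF bounded_linear_of_real fi(2)] by simp
  finally show ?thesis by (simp add: mass_def Pi0_def)
qed

lemma abs2_eq: "abs2 f = (\<lambda>x. f x * cnjf f x)"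
  by (simp add: abs2_def cnjf_def fun_eq_iff complex_norm_square[symmetric] flip: of_real_power)

lemma wien_parseval:
  assumes f: "wien f"
  shows "((\<lambda>k. (cmod (fc f k))^2) has_sum mass f) UNIV"
proof -
  have L: "L2T f" using f by (simp add: wien_def)
  have "((\<lambda>j. fc f j * fc (cnjf f) (0 - j)) has_sum fc (\<lambda>x. f x * cnjf f x) 0) UNIV"
    by (rule fc_mult_has_sum[OF f cnjf_L2T[OF L]])
  moreover have "fc f j * fc (cnjf f) (0 - j) = of_real ((cmod (fc f j))^2)" for j
    by (simp add: fc_cnjf[OF L] rv_def complex_norm_square[symmetric] flip: of_real_power)
  ultimately have "((\<lambda>j. complex_of_real ((cmod (fc f j))^2)) has_sum fc (abs2 f) 0) UNIV"
    by (simp add: abs2_eq)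
  then show ?thesis using has_sum_Re by (fastforce simp: mass_def Pi0_def)
qed

lemma integrable_torus_le_square:
  assumes "f \<in> borel_measurable torus" "integrable torus (\<lambda>x. (cmod (f x))^2)"
  shows "integrable torus f"
proof (rule Bochner_Integration.integrable_bound[of _ "\<lambda>x. 1 + (cmod (f x))^2"])
  have "y \<le> 1 + y^2" if "y \<ge> 0" for y :: real using sum_squares_bound[of y 1] that by simp
  then show "AE x in torus. norm (f x) \<le> norm (1 + (cmod (f x))^2)" by simp
qed (use assms in auto)

text \<open>The pointwise bound \<open>|f| \<le> d / 2 + |f|^2 / (2 * d)\<close> takes the place of
  Cauchy-Schwarz.\<close>

lemma integral_norm_le_mass:
  assumes L: "L2T f" and m: "mass f \<le> d^2" and d: "d > 0"
  shows "(LINT x|torus. cmod (f x)) \<le> 2 * pi * d"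
proof -
  note fi = L2T_integrable[OF L]
  have p: "cmod (f x) \<le> d / 2 + (cmod (f x))^2 / (2 * d)" for x
  proof -
    have "0 \<le> (cmod (f x) - d)^2 / (2 * d)" using d by simp
    also have "\<dots> = d / 2 + (cmod (f x))^2 / (2 * d) - cmod (f x)"
      using d by (simp add: power2_eq_square field_simps)
    finally show ?thesis by simp
  qed
  have "(LINT x|torus. cmod (f x)) \<le> (LINT x|torus. d / 2 + (cmod (f x))^2 / (2 * d))"
    using fi p by (intro integral_mono) auto
  also have "\<dots> = (LINT x|torus. d / 2) + (LINT x|torus. (cmod (f x))^2 / (2 * d))"
    using fi by (intro Bochner_Integration.integral_add) auto
  also have "\<dots> = pi * d + pi * mass f / d"
    using measure_torus by (simp add: mass_eq_integral[OF L] field_simps)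
  also have "pi * mass f / d \<le> pi * d"
    using m d by (simp add: pos_divide_le_eq power2_eq_square mult.assoc)
  finally show ?thesis by (simp add: algebra_simps)
qed

lemma fatou_bound:
  fixes h :: "nat \<Rightarrow> 'a \<Rightarrow> real"
  assumes h: "\<And>n. integrable M (h n)" "\<And>n x. 0 \<le> h n x" "\<And>n. (LINT x|M. h n x) \<le> C"
    and lim: "AE x in M. (\<lambda>n. h n x) \<longlonglongrightarrow> g x" and g: "g \<in> borel_measurable M"
  shows "integrable M g" "(LINT x|M. g x) \<le> C"
proof -
  have C0: "0 \<le> C" using Bochner_Integration.integral_nonneg[of M "h 0"] h(2,3) order_trans by blast
  have g0: "AE x in M. 0 \<le> g x" using lim by eventually_elim (auto intro: LIMSEQ_le_const h(2))
  have "(\<integral>\<^sup>+x. ennreal (g x) \<partial>M) = (\<integral>\<^sup>+x. liminf (\<lambda>n. ennreal (h n x)) \<partial>M)"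
  proof (rule nn_integral_cong_AE)
    show "AE x in M. ennreal (g x) = liminf (\<lambda>n. ennreal (h n x))"
      using lim
    proof eventually_elim
      case (elim x)
      then have "(\<lambda>n. ennreal (h n x)) \<longlonglongrightarrow> ennreal (g x)" by (rule tendsto_ennrealI)
      then show ?case by (simp add: lim_imp_Liminf)
    qed
  qed
  also have "\<dots> \<le> liminf (\<lambda>n. \<integral>\<^sup>+x. ennreal (h n x) \<partial>M)"
    using h(1) by (intro nn_integral_liminf) auto
  also have "\<dots> \<le> liminf (\<lambda>n. ennreal C)"
  proof (intro Liminf_mono always_eventually allI)
    fix n show "(\<integral>\<^sup>+x. ennreal (h n x) \<partial>M) \<le> ennreal C"
      using nn_integral_eq_integral[OF h(1)] h(2,3) by (simp add: ennreal_leI)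
  qed
  also have "\<dots> = ennreal C" by (simp add: Liminf_const)
  finally have le: "(\<integral>\<^sup>+x. ennreal (g x) \<partial>M) \<le> ennreal C" .
  show i: "integrable M g"
    using g g0 le by (intro integrableI_nonneg) (auto simp: le_less_trans[OF le])
  show "(LINT x|M. g x) \<le> C"
    using le nn_integral_eq_integral[OF i g0] C0 by simp
qed

text \<open>Serves \<open>P0\<close>: for \<open>\<gamma> = 1\<close> the coefficients of
  \<open>dx (cnjf u0)\<close> are in general only square summable, so no absolutely convergent
  series provides the function behind \<open>fmult\<close>. Symmetric partial sums are Cauchy in the
  mean, a subsequence converges almost everywhere, and Fatou's lemma gives both square integrability
  and the coefficients of the limit.\<close>

theorem riesz_fischer:
  fixes b :: "int \<Rightarrow> complex"
  assumes b: "(\<lambda>k. (cmod (b k))^2) summable_on UNIV"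
  shows "\<exists>g. L2T g \<and> (\<forall>k. fc g k = b k)"
proof -
  define c where "c n k = (if k \<in> {- int n..int n} then b k else 0)" for n k
  define s where "s n = ser (c n)" for n
  let ?S = "\<Sum>\<^sub>\<infinity>k. (cmod (b k))^2"
  have ac: "asum (c n)" for n
  proof -
    have "(\<lambda>k. cmod (c n k)) summable_on {- int n..int n}" by simp
    then show ?thesis unfolding asum_def
      by (subst (asm) summable_on_cong_neutral[of UNIV _ "\<lambda>k. cmod (c n k)"]) (auto simp: c_def)
  qed
  have ws: "wien (s n)" for n unfolding s_def by (rule wien_ser[OF ac])
  have si: "integrable torus (s n)" for n using ws L2T_integrable by (auto simp: wien_def)
  have fs: "fc (s n) k = c n k" for n k unfolding s_def by (rule fc_ser[OF ac])
  have wd: "wien (\<lambda>x. s i x - s j x)" for i j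
    using wien_add[OF ws[of i] wien_cmult[OF ws[of j], of "-1"]] by simp
  have md: "((\<lambda>k. (cmod (c i k - c j k))^2) has_sum mass (\<lambda>x. s i x - s j x)) UNIV" for i j
    using wien_parseval[OF wd[of i j]] fc_diff[OF si si] by (simp add: fs)
  have small: "\<exists>N. \<forall>i\<ge>N. \<forall>j\<ge>N. mass (\<lambda>x. s i x - s j x) \<le> e" if e: "e > 0" for e
  proof -
    obtain F where F: "finite F" "?S - e < (\<Sum>k\<in>F. (cmod (b k))^2)"
    proof -
      have "((\<lambda>F. \<Sum>k\<in>F. (cmod (b k))^2) \<longlongrightarrow> ?S) (finite_subsets_at_top UNIV)"
        using has_sum_infsum[OF b] by (simp add: has_sum_def)
      then have "\<forall>\<^sub>F F in finite_subsets_at_top UNIV. ?S - e < (\<Sum>k\<in>F. (cmod (b k))^2)"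
        using e by (intro order_tendstoD(1)[of _ ?S]) auto
      then show ?thesis using that unfolding eventually_finite_subsets_at_top by blast
    qed
    define N where "N = nat (\<Sum>k\<in>F. \<bar>k\<bar>)"
    have N: "k \<in> {- int n..int n}" if "k \<in> F" "n \<ge> N" for k n
    proof -
      have "\<bar>k\<bar> \<le> (\<Sum>k\<in>F. \<bar>k\<bar>)" using member_le_sum[OF that(1), of abs] F(1) by simp
      then show ?thesis using that(2) unfolding N_def by auto
    qed
    have bF: "((\<lambda>k. if k \<in> F then 0 else (cmod (b k))^2) has_sum (?S - (\<Sum>k\<in>F. (cmod (b k))^2))) UNIV"
    proof -
      have "((\<lambda>k. (cmod (b k))^2) has_sum (?S - (\<Sum>k\<in>F. (cmod (b k))^2))) (UNIV - F)"
        using has_sum_Diff[OF has_sum_infsum[OF b] has_sum_finite[OF F(1)]] by simp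
      then show ?thesis by (subst has_sum_cong_neutral[of "UNIV - F" UNIV "\<lambda>k. (cmod (b k))^2" _]) auto
    qed
    have "mass (\<lambda>x. s i x - s j x) \<le> e" if "i \<ge> N" "j \<ge> N" for i j
    proof -
      have "mass (\<lambda>x. s i x - s j x) \<le> ?S - (\<Sum>k\<in>F. (cmod (b k))^2)"
        by (rule has_sum_mono[OF md bF]) (use N that in \<open>auto simp: c_def\<close>)
      then show ?thesis using F(2) by simp
    qed
    then show ?thesis by blast
  qed
  have L1: "\<exists>N. \<forall>i\<ge>N. \<forall>j\<ge>N. (LINT x|torus. cmod (s i x - s j x)) < e" if e: "e > 0" for e
  proof -
    define d where "d = e / (4 * pi)"
    have d: "d > 0" using e by (simp add: d_def)
    obtain N where N: "\<And>i j. i \<ge> N \<Longrightarrow> j \<ge> N \<Longrightarrow> mass (\<lambda>x. s i x - s j x) \<le> d^2" using small[of "d^2"] d by auto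
    have "(LINT x|torus. cmod (s i x - s j x)) < e" if "i \<ge> N" "j \<ge> N" for i j
    proof -
      have "(LINT x|torus. cmod (s i x - s j x)) \<le> 2 * pi * d"
        using integral_norm_le_mass[OF _ N[OF that] d] wd by (simp add: wien_def)
      also have "\<dots> < e" using e by (simp add: d_def)
      finally show ?thesis .
    qed
    then show ?thesis by blast
  qed
  obtain r where r: "strict_mono r" "AE x in torus. Cauchy (\<lambda>i. s (r i) x)"
    using cauchy_L1_AE_cauchy_subseq[of torus s, OF si L1] by blast
  define g where "g x = lim (\<lambda>i. s (r i) x)" for x
  have gm: "g \<in> borel_measurable torus"
    unfolding g_def using si by (intro borel_measurable_lim_metric) auto
  have lim: "AE x in torus. (\<lambda>i. s (r i) x) \<longlonglongrightarrow> g x"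
    using r(2) by eventually_elim (simp add: g_def Cauchy_convergent convergent_LIMSEQ_iff[symmetric])
  \<comment> \<open>\<open>lim\<close> depends on nothing but the sequence of values, also where it
    diverges; since all partial sums are periodic, periodicity holds at every point.\<close>
  have per: "periodic2pi g"
    unfolding periodic2pi_def g_def using ser_periodic unfolding periodic2pi_def s_def by simp
  have sq: "integrable torus (\<lambda>x. (cmod (g x))^2)"
  proof (rule fatou_bound(1))
    show "integrable torus (\<lambda>x. (cmod (s (r n) x))^2)" for n using ws L2T_integrable(2) by (auto simp: wien_def)
    show "(LINT x|torus. (cmod (s (r n) x))^2) \<le> 2 * pi * ?S" for n
    proof -
      have "mass (s (r n)) \<le> ?S"
        by (rule has_sum_mono[OF wien_parseval[OF ws] has_sum_infsum[OF b]]) (auto simp: fs c_def)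
      then have "2 * pi * mass (s (r n)) \<le> 2 * pi * ?S" by simp
      moreover have "2 * pi * mass (s (r n)) = (LINT x|torus. (cmod (s (r n) x))^2)"
        using mass_eq_integral[of "s (r n)"] ws[of "r n"] by (simp add: wien_def)
      ultimately show ?thesis by simp
    qed
    show "AE x in torus. (\<lambda>n. (cmod (s (r n) x))^2) \<longlonglongrightarrow> (cmod (g x))^2"
      using lim by eventually_elim (intro tendsto_intros)
  qed (use gm in auto)
  have gi: "integrable torus g" by (rule integrable_torus_le_square[OF gm sq])
  have "fc g k = b k" for k
  proof -
    have "cmod (fc g k - b k) \<le> 0 + e" if e: "e > 0" for e
    proof -
      obtain N where N: "\<And>i j. i \<ge> N \<Longrightarrow> j \<ge> N \<Longrightarrow> (LINT x|torus. cmod (s i x - s j x)) < e" using L1[OF e] by blast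
      define m where "m = r (max N (nat \<bar>k\<bar>))"
      have rn: "n \<le> r n" for n using seq_suble[OF r(1)] .
      have m: "m \<ge> N" "int m \<ge> \<bar>k\<bar>" using rn[of "max N (nat \<bar>k\<bar>)"] by (auto simp: m_def nat_le_iff)
      then have cm: "c m k = b k" by (auto simp: c_def)
      have I: "(LINT x|torus. cmod (g x - s m x)) \<le> e"
      proof (rule fatou_bound(2))
        show "integrable torus (\<lambda>x. cmod (s (r (n + N)) x - s m x))" for n using si by auto
        show "(LINT x|torus. cmod (s (r (n + N)) x - s m x)) \<le> e" for n
          using N[of "r (n + N)" m] m rn[of "n + N"] by simp
        show "AE x in torus. (\<lambda>n. cmod (s (r (n + N)) x - s m x)) \<longlonglongrightarrow> cmod (g x - s m x)"
          using lim
        proof eventually_elim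
          case (elim x)
          show ?case by (intro tendsto_intros LIMSEQ_ignore_initial_segment[OF elim])
        qed
      qed (use gm si[of m] in auto)
      have "fc g k - b k = fc (\<lambda>x. g x - s m x) k" using fc_diff[OF gi si] by (simp add: fs cm)
      also have "\<dots> = (LINT x|torus. cis (- of_int k * x) * (g x - s m x)) / of_real (2 * pi)"
        using gi si by (intro fc_torus) auto
      also have "cmod \<dots> \<le> e / (2 * pi)"
      proof -
        have "cmod (LINT x|torus. cis (- of_int k * x) * (g x - s m x)) \<le> (LINT x|torus. cmod (cis (- of_int k * x) * (g x - s m x)))"
          by (rule integral_norm_bound)
        also have "\<dots> \<le> e" using I by (simp add: norm_mult)
        finally show ?thesis by (simp add: norm_divide norm_mult divide_right_mono)
      qed
      also have "\<dots> \<le> e" using e pi_gt3 by (simp add: field_simps)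
      finally show ?thesis by simp
    qed
    then have "cmod (fc g k - b k) \<le> 0" by (rule field_le_epsilon)
    then show ?thesis by simp
  qed
  then show ?thesis using L2T_I[OF per gi sq] by blast
qed

section \<open>The scheme on the Fourier side\<close>

definition conv :: "(int \<Rightarrow> complex) \<Rightarrow> (int \<Rightarrow> complex) \<Rightarrow> int \<Rightarrow> complex" where
  "conv a b k = (\<Sum>\<^sub>\<infinity>j. a j * b (k - j))"

text \<open>Function and coefficients are carried together, so the formula for \<open>Psi\<close>
  can be translated term by term as it is built.\<close>

definition wc :: "(real \<Rightarrow> complex) \<Rightarrow> (int \<Rightarrow> complex) \<Rightarrow> bool" where
  "wc f a \<longleftrightarrow> wien f \<and> fc f = a"

lemma wcD: "wc f a \<Longrightarrow> fc f = a" "wc f a \<Longrightarrow> wien f" "wc f a \<Longrightarrow> L2T f"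
  by (auto simp: wc_def wien_def)

lemma wc_mult: "wc f a \<Longrightarrow> wc g b \<Longrightarrow> wc (\<lambda>x. f x * g x) (conv a b)"
  using wien_mult[of f g] fc_mult_has_sum[of f g, THEN infsumI]
  by (auto simp: wc_def wien_def conv_def fun_eq_iff)

lemma wc_cnjf: "wc f a \<Longrightarrow> wc (cnjf f) (rv a)"
  using wien_cnjf[of f] fc_cnjf[of f] by (auto simp: wc_def wien_def)

lemma wc_abs2: "wc f a \<Longrightarrow> wc (abs2 f) (conv (rv a) a)"
  using wc_mult[OF wc_cnjf, of f a f a] by (simp add: abs2_eq mult.commute)

lemma wc_fmult: "wc f a \<Longrightarrow> (\<And>k. cmod (m k) \<le> A) \<Longrightarrow> wc (fmult m f) (\<lambda>k. m k * a k)"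
  using fmult_wien[of f m A] by (auto simp: wc_def)

lemma wc_add: "wc f a \<Longrightarrow> wc g b \<Longrightarrow> wc (\<lambda>x. f x + g x) (\<lambda>k. a k + b k)"
  using wien_add[of f g] fc_wien_add[of f g] by (auto simp: wc_def)

lemma wc_cmult: "wc f a \<Longrightarrow> wc (\<lambda>x. c * f x) (\<lambda>k. c * a k)"
  using wien_cmult[of f c] fc_wien_cmult[of f c] by (auto simp: wc_def)

lemma wc_diff: "wc f a \<Longrightarrow> wc g b \<Longrightarrow> wc (\<lambda>x. f x - g x) (\<lambda>k. a k - b k)"
  using wc_add[of f a "\<lambda>x. (-1) * g x" "\<lambda>k. (-1) * b k"] wc_cmult[of g b "-1"] by simp

lemma wc_const: "wc (\<lambda>x. c) (\<lambda>k. if k = 0 then c else 0)"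
  using wien_const fc_const by (auto simp: wc_def)

lemma exp_eq_cis: "exp (- \<i> * of_real t * (of_int k)^2) = cis (- (t * (real_of_int k)^2))"
  by (simp add: cis_conv_exp mult.assoc)

lemma wc_schr: "wc f a \<Longrightarrow> wc (schr t f) (\<lambda>k. cis (- (t * (real_of_int k)^2)) * a k)"
  unfolding schr_def exp_eq_cis by (rule wc_fmult[where A = 1]) auto

lemma norm_dinv_m_le: "cmod (dinv_m k) \<le> 1"
  by (auto simp: dinv_m_def norm_divide norm_mult)

lemma wc_dx_inv: "wc f a \<Longrightarrow> wc (dx_inv f) (\<lambda>k. dinv_m k * a k)"
  unfolding dx_inv_def by (rule wc_fmult[OF _ norm_dinv_m_le])

lemma wc_dx_inv2: "wc f a \<Longrightarrow> wc (dx_inv2 f) (\<lambda>k. dinv_m k * (dinv_m k * a k))"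
  unfolding dx_inv2_def by (intro wc_dx_inv)

text \<open>The double series over the intermediate frequency \<open>l = k1 + k2\<close> and over
  \<open>k1\<close> is reindexed to pairs; this is the shape of \<open>dx_inv (abs2 f)\<close> times
  \<open>f\<close>.\<close>

lemma conv_left_tri:
  assumes s: "trt (\<lambda>k k1 k2. M (k1 + k2)) a b c k summable_on UNIV"
  shows "conv (\<lambda>l. M l * conv a b l) c k = tri (\<lambda>k k1 k2. M (k1 + k2)) a b c k"
proof -
  let ?t = "trt (\<lambda>k k1 k2. M (k1 + k2)) a b c k"
  have bij: "bij_betw (\<lambda>(l, k1). (k1, l - k1) :: int \<times> int) UNIV UNIV"
    by (rule o_bij[of "\<lambda>(k1, k2). (k1 + k2, k1)"]) (auto simp: fun_eq_iff)
  have e: "?t (case p of (l, k1) \<Rightarrow> (k1, l - k1)) = (case p of (l, k1) \<Rightarrow> M l * a k1 * b (l - k1) * c (k - l))" for p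
    by (auto simp: trt_def split: prod.split)
  have s': "(\<lambda>(l, k1). M l * a k1 * b (l - k1) * c (k - l)) summable_on UNIV \<times> UNIV"
    using s summable_on_reindex_bij_betw[OF bij, of ?t] unfolding e by simp
  have "tri (\<lambda>k k1 k2. M (k1 + k2)) a b c k = (\<Sum>\<^sub>\<infinity>(l, k1)\<in>UNIV \<times> UNIV. M l * a k1 * b (l - k1) * c (k - l))"
    using infsum_reindex_bij_betw[OF bij, of ?t] unfolding e tri_def by simp
  also have "\<dots> = (\<Sum>\<^sub>\<infinity>l. \<Sum>\<^sub>\<infinity>k1. M l * a k1 * b (l - k1) * c (k - l))"
    by (rule infsum_Sigma'_banach[OF s', symmetric])
  also have "\<dots> = conv (\<lambda>l. M l * conv a b l) c k"
    unfolding conv_def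
  proof (rule infsum_cong)
    fix l
    have "(\<Sum>\<^sub>\<infinity>k1. M l * a k1 * b (l - k1) * c (k - l)) = (\<Sum>\<^sub>\<infinity>k1. (M l * c (k - l)) * (a k1 * b (l - k1)))"
      by (intro infsum_cong) (simp add: mult_ac)
    also have "\<dots> = (M l * c (k - l)) * (\<Sum>\<^sub>\<infinity>k1. a k1 * b (l - k1))" by (rule infsum_cmult_right')
    finally show "(\<Sum>\<^sub>\<infinity>k1. M l * a k1 * b (l - k1) * c (k - l)) = M l * (\<Sum>\<^sub>\<infinity>j. a j * b (l - j)) * c (k - l)"
      by (simp only: mult_ac)
  qed
  finally show ?thesis ..
qed

text \<open>Here the last two factors are multiplied first, as in the product of
  \<open>cnjf u\<close> with the square of \<open>u\<close>.\<close>

lemma conv_right_tri: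
  assumes s: "trt (\<lambda>k k1 k2. M k1 * N (k - k1)) a b c k summable_on UNIV"
  shows "conv (\<lambda>j. M j * a j) (\<lambda>l. N l * conv b c l) k = tri (\<lambda>k k1 k2. M k1 * N (k - k1)) a b c k"
proof -
  have s': "(\<lambda>(k1, k2). M k1 * N (k - k1) * a k1 * b k2 * c (k - k1 - k2)) summable_on UNIV \<times> UNIV"
    using s by (simp add: trt_def)
  have "tri (\<lambda>k k1 k2. M k1 * N (k - k1)) a b c k = (\<Sum>\<^sub>\<infinity>(k1, k2)\<in>UNIV \<times> UNIV. M k1 * N (k - k1) * a k1 * b k2 * c (k - k1 - k2))"
    by (simp add: tri_def trt_def)
  also have "\<dots> = (\<Sum>\<^sub>\<infinity>k1. \<Sum>\<^sub>\<infinity>k2. M k1 * N (k - k1) * a k1 * b k2 * c (k - k1 - k2))"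
    by (rule infsum_Sigma'_banach[OF s', symmetric])
  also have "\<dots> = conv (\<lambda>j. M j * a j) (\<lambda>l. N l * conv b c l) k"
    unfolding conv_def
  proof (rule infsum_cong)
    fix k1
    have "(\<Sum>\<^sub>\<infinity>k2. M k1 * N (k - k1) * a k1 * b k2 * c (k - k1 - k2)) = (\<Sum>\<^sub>\<infinity>k2. (M k1 * N (k - k1) * a k1) * (b k2 * c (k - k1 - k2)))"
      by (intro infsum_cong) (simp add: mult_ac)
    also have "\<dots> = (M k1 * N (k - k1) * a k1) * (\<Sum>\<^sub>\<infinity>k2. b k2 * c (k - k1 - k2))" by (rule infsum_cmult_right')
    finally show "(\<Sum>\<^sub>\<infinity>k2. M k1 * N (k - k1) * a k1 * b k2 * c (k - k1 - k2)) = M k1 * a k1 * (N (k - k1) * (\<Sum>\<^sub>\<infinity>j. b j * c (k - k1 - j)))"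
      by (simp only: mult_ac)
  qed
  finally show ?thesis ..
qed

text \<open>\<open>hb\<close> leaves out the factor \<open>2 * pi\<close> of \<open>Hnorm\<close>,
  hence the roots.\<close>

lemma hb_Hnorm_le: "hb s (fc f) C \<Longrightarrow> Hnorm s f \<le> sqrt (2 * pi) * C"
  and Hnorm_hb: "Hs s f \<Longrightarrow> hb s (fc f) (Hnorm s f / sqrt (2 * pi))"
proof -
  let ?w = "\<lambda>k::int. (1 + (of_int k)^2) powr s * (cmod (fc f k))^2"
  have w: "(jb k powr s * cmod (fc f k))^2 = ?w k" for k
  proof -
    have "(jb k powr s)^2 = (1 + (of_int k)^2) powr s"
      unfolding jb_def powr_half_sqrt[OF add_nonneg_nonneg[OF zero_le_one zero_le_power2], symmetric] powr_powr
      by (subst power2_eq_square) (simp flip: powr_add)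
    then show ?thesis by (simp add: power_mult_distrib)
  qed
  have I: "infsum ?w UNIV \<le> C^2" if "hb s (fc f) C" for C
  proof -
    have le: "sum ?w F \<le> C^2" if "finite F" for F
      using l2D[OF \<open>hb s (fc f) C\<close>[unfolded hb_def] that] by (simp add: w)
    have "?w summable_on UNIV"
      using le by (intro nonneg_bdd_above_summable_on bdd_aboveI[where M = "C^2"]) auto
    then show "infsum ?w UNIV \<le> C^2" using le by (intro infsum_le_finite_sums) auto
  qed
  have H: "hb s (fc f) (sqrt (infsum ?w UNIV))" if "?w summable_on UNIV"
    unfolding hb_def l2_def w
    using finite_sum_le_infsum[OF that] by (simp add: infsum_nonneg)
  show "Hnorm s f \<le> sqrt (2 * pi) * C" if "hb s (fc f) C"
    using I[OF that] hb_nonneg[OF that] unfolding Hnorm_def real_sqrt_mult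
    by (intro mult_left_mono) (auto intro: real_le_lsqrt)
  show "hb s (fc f) (Hnorm s f / sqrt (2 * pi))" if "Hs s f"
    using H that unfolding Hnorm_def Hs_def by (simp add: real_sqrt_mult)
qed

context adm
begin

lemma conv_ip: "conv a (rv b) 0 = ip a b"
  by (simp add: conv_def ip_def rv_def)

lemma wc_mass: "wc f a \<Longrightarrow> mass f = Re (ip a a)"
  using wcD(1)[OF wc_mult[OF _ wc_cnjf], of f a f a] by (simp add: mass_def Pi0_def abs2_eq conv_ip)

lemma Pi0_mult_cnj: "wc f a \<Longrightarrow> wc g b \<Longrightarrow> Pi0 (\<lambda>x. f x * cnj (g x)) = ip a b"
  using wcD(1)[OF wc_mult[OF _ wc_cnjf], of f a g b] by (simp add: Pi0_def cnjf_def conv_ip)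

lemma hb_wc: "L2T f \<Longrightarrow> hb \<gamma> (fc f) P \<Longrightarrow> wc f (fc f)"
  using l1_imp_abs_summable(1)[OF emb0[of "fc f" P]] by (simp add: wc_def wien_def asum_def)

lemma conv_cub:
  assumes x: "hb \<gamma> x P" and M: "\<And>l. cmod (M l) \<le> A"
  shows "conv (\<lambda>l. M l * conv (rv x) x l) x k = cub (\<lambda>k k1 k2. M (k1 + k2)) x k"
proof -
  have "0 \<le> A" using M norm_ge_zero order_trans by blast
  then have "mb (\<lambda>k k1 k2. M (k1 + k2)) A" using M by (intro mb_bounded) auto
  then show ?thesis unfolding cub_def using mb_summable[OF _ hb_rv[OF x] x x] by (intro conv_left_tri) auto
qed

lemma fc_cubic:
  assumes "L2T f" "hb \<gamma> (fc f) P"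
  shows "wc (\<lambda>x. abs2 f x * f x) (cub (\<lambda>_ _ _. 1) (fc f))"
proof -
  have w: "wc f (fc f)" by (rule hb_wc[OF assms])
  have "conv (conv (rv (fc f)) (fc f)) (fc f) = cub (\<lambda>_ _ _. 1) (fc f)"
    using conv_cub[OF assms(2), of "\<lambda>_. 1" 1] by auto
  then show ?thesis using wc_mult[OF wc_abs2[OF w] w] by simp
qed

text \<open>The derivative falls on the conjugate, whose coefficient at \<open>- j\<close> is the
  conjugate of that of \<open>u0\<close> at \<open>j\<close>; it contributes
  \<open>\<i> * (- j)\<close> and so the minus sign. The product formula admits one factor in the
  Wiener algebra and the other merely in \<open>L2T\<close>.\<close>

lemma P0_eq:
  assumes u: "L2T u0" "hb \<gamma> (fc u0) P"
  shows "P0 u0 = - \<i> * of_real (\<Sum>\<^sub>\<infinity>k. of_int k * (cmod (fc u0 k))^2)"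
proof -
  let ?g = "dx (cnjf u0)" and ?X = "fc u0"
  have w: "wc u0 ?X" by (rule hb_wc[OF u])
  have h1: "hb 1 (rv ?X) P" by (rule hb_rv[OF hb_weaken[OF u(2) gamma_ge1]])
  have "(\<lambda>k. (cmod (\<i> * of_int k * fc (cnjf u0) k))^2) summable_on UNIV"
  proof (rule nonneg_bdd_above_summable_on)
    show "bdd_above (sum (\<lambda>k. (cmod (\<i> * of_int k * fc (cnjf u0) k))^2) ` {F. F \<subseteq> UNIV \<and> finite F})"
    proof (rule bdd_aboveI2)
      fix F :: "int set" assume "F \<in> {F. F \<subseteq> UNIV \<and> finite F}"
      then have F: "finite F" by simp
      have "(\<Sum>k\<in>F. (cmod (\<i> * of_int k * fc (cnjf u0) k))^2) \<le> (\<Sum>k\<in>F. (jb k powr 1 * cmod (rv ?X k))^2)"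
      proof (rule sum_mono)
        fix k
        have "\<bar>real_of_int k\<bar> \<le> jb k" unfolding jb_def by (rule real_le_rsqrt) simp
        then show "(cmod (\<i> * of_int k * fc (cnjf u0) k))^2 \<le> (jb k powr 1 * cmod (rv ?X k))^2"
          using jb_ge1[of k] by (intro power_mono) (auto simp: norm_mult fc_cnjf[OF u(1)] intro!: mult_right_mono)
      qed
      also have "\<dots> \<le> P^2" using l2D[OF h1[unfolded hb_def] F] .
      finally show "(\<Sum>k\<in>F. (cmod (\<i> * of_int k * fc (cnjf u0) k))^2) \<le> P^2" .
    qed
  qed auto
  note ex = riesz_fischer[OF this]
  have g: "L2T ?g" "fc ?g k = \<i> * of_int k * rv ?X k" for k
    unfolding dx_def using fmult_eq[OF ex] by (auto simp: fc_cnjf[OF u(1)])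
  let ?h = "\<lambda>j. of_int j * (cmod (?X j))^2" and ?S = "fc (\<lambda>x. u0 x * ?g x) 0"
  have e: "\<i> * (?X j * fc ?g (0 - j)) = of_real (?h j)" for j
    by (simp add: g(2) rv_def complex_norm_square mult_ac flip: of_real_power)
  have "((\<lambda>j. \<i> * (?X j * fc ?g (0 - j))) has_sum (\<i> * ?S)) UNIV"
    by (rule has_sum_cmult_right[OF fc_mult_has_sum[OF wcD(2)[OF w] g(1)]])
  then have hs: "((\<lambda>j. complex_of_real (?h j)) has_sum (\<i> * ?S)) UNIV" unfolding e .
  then have "(?h has_sum Re (\<i> * ?S)) UNIV" using has_sum_Re[OF hs] by simp
  from has_sum_unique[OF has_sum_of_real[OF this] hs] infsumI[OF this]
  have "\<i> * ?S = of_real (\<Sum>\<^sub>\<infinity>j. ?h j)" by simp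
  then have "- \<i> * (\<i> * ?S) = - \<i> * of_real (\<Sum>\<^sub>\<infinity>j. ?h j)" by (simp only:)
  then show ?thesis by (simp add: P0_def Pi0_def mult.assoc[symmetric])
qed

end

context sch
begin

abbreviation ph :: "int \<Rightarrow> complex" where
  "ph k \<equiv> cis (- (\<tau> * (real_of_int k)^2))"

text \<open>For \<open>k \<noteq> 0\<close>, \<open>mm\<close> gathers the four cubic terms of
  \<Psi> under inverse derivatives; its entries come from
  \<open>dinv_m k * dinv_m k = - 1 / k\<^sup>2\<close> and the analogous product with
  \<open>k1 + k2\<close>. At \<open>k = 0\<close> these vanish and the mean of the cubic term is
  left.\<close>

lemma cub_mm:
  assumes x: "hb \<gamma> x P"
  shows "cub mm x k = (if k = 0 then - \<i> * of_real \<tau> * cub (\<lambda>_ _ _. 1) x k else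
     - 1/2 * (dinv_m k * (dinv_m k * cub (\<lambda>k k1 k2. cis (\<tau> * of_int (2 * k * k1))) x k))
     + 1/2 * (dinv_m k * (dinv_m k * cub (\<lambda>_ _ _. 1) x k))
     + dinv_m k * cub (\<lambda>k k1 k2. cis (\<tau> * real_of_int (phi k k1 k2)) * dinv_m (k1 + k2)) x k
     - dinv_m k * cub (\<lambda>k k1 k2. dinv_m (k1 + k2)) x k)"
proof (cases "k = 0")
  case True
  have "cub mm x 0 = (\<Sum>\<^sub>\<infinity>p. (- \<i> * of_real \<tau>) * trt (\<lambda>_ _ _. 1) (rv x) x x 0 p)"
    unfolding cub_def tri_def by (intro infsum_cong) (auto simp: trt_def mm_def)
  then show ?thesis using True unfolding infsum_cmult_right' by (simp add: cub_def tri_def)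
next
  case False
  let ?t = "\<lambda>m. trt m (rv x) x x k"
  let ?m2 = "\<lambda>k k1 k2. cis (\<tau> * of_int (2 * k * k1))"
    and ?m3 = "\<lambda>k k1 k2. cis (\<tau> * real_of_int (phi k k1 k2)) * dinv_m (k1 + k2)" and ?m4 = "\<lambda>k k1 k2. dinv_m (k1 + k2)"
    and ?m1 = "\<lambda>_ _ _. 1"
  have h: "(?t m has_sum cub m x k) UNIV" if "\<And>k k1 k2. cmod (m k k1 k2) \<le> 1" for m
    by (rule cub_has_sum[OF mb_bounded[of 1 m] x]) (use that in auto)
  have hs: "((\<lambda>p. (- 1/2) * (dinv_m k * (dinv_m k * ?t ?m2 p)) + 1/2 * (dinv_m k * (dinv_m k * ?t ?m1 p))
      + dinv_m k * ?t ?m3 p - dinv_m k * ?t ?m4 p) has_sum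
     ((- 1/2) * (dinv_m k * (dinv_m k * cub ?m2 x k)) + 1/2 * (dinv_m k * (dinv_m k * cub ?m1 x k))
      + dinv_m k * cub ?m3 x k - dinv_m k * cub ?m4 x k)) UNIV"
    by (intro has_sum_diff has_sum_add has_sum_cmult_right h) (auto simp: norm_mult norm_dinv_m_le)
  have eq: "?t mm p = (- 1/2) * (dinv_m k * (dinv_m k * ?t ?m2 p)) + 1/2 * (dinv_m k * (dinv_m k * ?t ?m1 p))
      + dinv_m k * ?t ?m3 p - dinv_m k * ?t ?m4 p" for p
  proof -
    obtain k1 k2 where p: "p = (k1, k2)" by force
    have d2: "dinv_m k * dinv_m k = - (1 / (of_int k)^2)" using False by (simp add: dinv_m_def power2_eq_square field_simps)
    have "mm k k1 k2 = (- 1/2) * (dinv_m k * dinv_m k) * ?m2 k k1 k2 + 1/2 * (dinv_m k * dinv_m k)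
       + dinv_m k * ?m3 k k1 k2 - dinv_m k * ?m4 k k1 k2"
    proof (cases "k1 + k2 = 0")
      case True
      then show ?thesis using False unfolding d2 mm_def by (simp add: dinv_m_def diff_divide_distrib)
    next
      case F: False
      have dd: "dinv_m k * dinv_m (k1 + k2) = - (1 / (of_int k * of_int (k1 + k2)))"
      proof -
        have "\<i> * of_int k * (\<i> * of_int (k1 + k2)) = - (of_int k * of_int (k1 + k2) :: complex)"
          by (simp add: algebra_simps)
        then show ?thesis using False F by (simp add: dinv_m_def del: of_int_add)
      qed
      have "dinv_m k * ?m3 k k1 k2 - dinv_m k * ?m4 k k1 k2 = (dinv_m k * dinv_m (k1 + k2)) * (cis (\<tau> * real_of_int (phi k k1 k2)) - 1)"
        by (simp add: algebra_simps)
      then show ?thesis using False F unfolding d2 dd mm_def by (simp add: diff_divide_distrib)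
    qed
    then show ?thesis unfolding p trt_def by (simp only: split) (simp only: algebra_simps mult_1_left)
  qed
  have "cub mm x k = (- 1/2) * (dinv_m k * (dinv_m k * cub ?m2 x k)) + 1/2 * (dinv_m k * (dinv_m k * cub ?m1 x k))
      + dinv_m k * cub ?m3 x k - dinv_m k * cub ?m4 x k"
    using infsumI[OF hs] unfolding eq[symmetric] by (simp add: cub_def tri_def)
  then show ?thesis using False by simp
qed

lemma wc_Psi:
  assumes u: "L2T u" "hb \<gamma> (fc u) P" and m0: "mass u0 = \<mu>^2" and P0: "P0 u0 = - \<i> * of_real p0"
  shows "wc (Psi u0 \<tau> u) (\<lambda>k. ph k * (eps k * fc u k + cub mm (fc u) k))"
proof -
  let ?X = "fc u"
  define Y where "Y k = ph k * ?X k" for k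
  have Y': "Y = (\<lambda>k. ph k * ?X k)" by (simp add: Y_def fun_eq_iff)
  have hY: "hb \<gamma> Y P" by (rule hb_cong_norm[OF u(2)]) (simp add: Y_def norm_mult)
  have w: "wc u ?X" by (rule hb_wc[OF u])
  have wY: "wc (schr \<tau> u) Y" unfolding Y' by (rule wc_schr[OF w])
  have t1: "wc (Emain u0 \<tau> u) (\<lambda>k. (ph k * cis (- xk k)) * ?X k)"
  proof -
    have "exp (\<i> * of_real \<tau> * (- 2 * of_real (mass u0) - 2 * P0 u0 * dinv_m k - (of_int k)^2)) = ph k * cis (- xk k)" for k
    proof -
      have d: "- \<i> * of_real p0 * dinv_m k = of_real (if k = 0 then 0 else - p0 / of_int k)" by (simp add: dinv_m_def)
      have "2 * P0 u0 * dinv_m k = 2 * (- \<i> * of_real p0 * dinv_m k)" by (simp add: P0)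
      then have "\<i> * of_real \<tau> * (- 2 * of_real (mass u0) - 2 * P0 u0 * dinv_m k - (of_int k)^2)
         = \<i> * of_real (- (\<tau> * (real_of_int k)^2) + - xk k)"
        unfolding d m0 xk_def by (simp add: algebra_simps)
      then show ?thesis by (simp only: cis_mult cis_conv_exp[of "- (\<tau> * (real_of_int k)^2) + - xk k"])
    qed
    then show ?thesis unfolding Emain_def by (simp only:) (rule wc_fmult[OF w, where A = 1], simp add: norm_mult)
  qed
  note wC = fc_cubic[OF u]
  have c0: "Pi0 (\<lambda>y. abs2 u y * u y) = cub (\<lambda>_ _ _. 1) ?X 0" using wcD(1)[OF wC] by (simp add: Pi0_def)
  have t4: "wc (dx_inv2 (\<lambda>y. schr (- \<tau>) (cnjf u) y * schr \<tau> (\<lambda>z. (u z)^2) y))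
     (\<lambda>k. dinv_m k * (dinv_m k * (ph k * cub (\<lambda>k k1 k2. cis (\<tau> * of_int (2 * k * k1))) ?X k)))"
  proof -
    have "wc (\<lambda>z. (u z)^2) (conv ?X ?X)" using wc_mult[OF w w] by (simp add: power2_eq_square)
    note a = wc_dx_inv2[OF wc_mult[OF wc_schr[OF wc_cnjf[OF w], of "- \<tau>"] wc_schr[OF this, of \<tau>]]]
    let ?M = "\<lambda>k1::int. cis (- (- \<tau> * (real_of_int k1)^2))"
    \<comment> \<open>\<open>k1\<^sup>2 - (k - k1)\<^sup>2 = - k\<^sup>2 + 2 * k * k1\<close>: the
      backward flow on the conjugate and the forward flow on the square leave the phase
      \<open>2 * k * k1\<close>, in which \<open>k2\<close> does not occur.\<close>
    have m: "(\<lambda>k k1 k2. ?M k1 * ph (k - k1)) = (\<lambda>k k1 (k2::int). ph k * cis (\<tau> * of_int (2 * k * k1)))"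
      by (auto simp: fun_eq_iff cis_mult power2_eq_square algebra_simps intro!: arg_cong[where f = cis])
    have "conv (\<lambda>k. ?M k * rv ?X k) (\<lambda>k. ph k * conv ?X ?X k) k = ph k * cub (\<lambda>k k1 k2. cis (\<tau> * of_int (2 * k * k1))) ?X k" for k
    proof -
      have "mb (\<lambda>k k1 k2. ?M k1 * ph (k - k1)) 1" by (rule mb_bounded) (auto simp: norm_mult)
      then have "conv (\<lambda>k. ?M k * rv ?X k) (\<lambda>k. ph k * conv ?X ?X k) k = cub (\<lambda>k k1 k2. ?M k1 * ph (k - k1)) ?X k"
        unfolding cub_def by (intro conv_right_tri mb_summable[OF _ hb_rv[OF u(2)] u(2) u(2)])
      then show ?thesis unfolding m cub_cmult_m .
    qed
    then show ?thesis using a by simp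
  qed
  have t5: "wc (schr \<tau> (dx_inv2 (\<lambda>y. abs2 u y * u y))) (\<lambda>k. ph k * (dinv_m k * (dinv_m k * cub (\<lambda>_ _ _. 1) ?X k)))"
    by (intro wc_schr wc_dx_inv2 wC)
  have pr: "wc (\<lambda>y. f y * dx_inv (abs2 f) y) (cub (\<lambda>k k1 k2. dinv_m (k1 + k2)) x)" if f: "wc f x" "hb \<gamma> x P" for f x
  proof -
    have "conv (\<lambda>l. dinv_m l * conv (rv x) x l) x = cub (\<lambda>k k1 k2. dinv_m (k1 + k2)) x"
      using conv_cub[OF f(2) norm_dinv_m_le] by auto
    moreover have "(\<lambda>y. f y * dx_inv (abs2 f) y) = (\<lambda>y. dx_inv (abs2 f) y * f y)" by (simp add: fun_eq_iff)
    ultimately show ?thesis using wc_mult[OF wc_dx_inv[OF wc_abs2[OF f(1)]] f(1)] by simp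
  qed
  have t6: "wc (dx_inv (\<lambda>y. schr \<tau> u y * dx_inv (abs2 (schr \<tau> u)) y))
    (\<lambda>k. dinv_m k * (ph k * cub (\<lambda>k k1 k2. cis (\<tau> * real_of_int (phi k k1 k2)) * dinv_m (k1 + k2)) ?X k))"
  proof -
    have "cub (\<lambda>k k1 k2. dinv_m (k1 + k2)) Y k = ph k * cub (\<lambda>k k1 k2. cis (\<tau> * real_of_int (phi k k1 k2)) * dinv_m (k1 + k2)) ?X k" for k
      unfolding cub_twist[of \<tau> k "\<lambda>k k1 k2. dinv_m (k1 + k2)" ?X, symmetric] Y' mult.assoc[symmetric] cis_mult by simp
    then show ?thesis using wc_dx_inv[OF pr[OF wY hY]] by simp
  qed
  have t7: "wc (schr \<tau> (dx_inv (\<lambda>y. u y * dx_inv (abs2 u) y))) (\<lambda>k. ph k * (dinv_m k * cub (\<lambda>k k1 k2. dinv_m (k1 + k2)) ?X k))"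
    by (intro wc_schr wc_dx_inv pr[OF w u(2)])
  note W = wc_diff[OF wc_add[OF wc_add[OF wc_diff[OF wc_add[OF wc_diff[OF t1
      wc_const[of "\<i> * of_real \<tau> * Pi0 (\<lambda>y. abs2 u y * u y)"]]
      wc_const[of "2 * \<i> * of_real \<tau> * of_real (mass u0) * Pi0 u"]]
      wc_cmult[OF t4, of "1/2"]] wc_cmult[OF t5, of "1/2"]] t6] t7]
  have P: "(ph k * cis (- xk k)) * ?X k - (if k = 0 then \<i> * of_real \<tau> * Pi0 (\<lambda>y. abs2 u y * u y) else 0)
     + (if k = 0 then 2 * \<i> * of_real \<tau> * of_real (mass u0) * Pi0 u else 0)
     - 1/2 * (dinv_m k * (dinv_m k * (ph k * cub (\<lambda>k k1 k2. cis (\<tau> * of_int (2 * k * k1))) ?X k)))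
     + 1/2 * (ph k * (dinv_m k * (dinv_m k * cub (\<lambda>_ _ _. 1) ?X k)))
     + dinv_m k * (ph k * cub (\<lambda>k k1 k2. cis (\<tau> * real_of_int (phi k k1 k2)) * dinv_m (k1 + k2)) ?X k)
     - ph k * (dinv_m k * cub (\<lambda>k k1 k2. dinv_m (k1 + k2)) ?X k) = ph k * (eps k * ?X k + cub mm ?X k)" for k
  proof (cases "k = 0")
    case True
    have d: "dinv_m 0 = 0" by (simp add: dinv_m_def)
    show ?thesis unfolding True cub_mm[OF u(2)] c0 m0 eps_def d by (simp add: Pi0_def algebra_simps)
  next
    case False
    then show ?thesis unfolding cub_mm[OF u(2)] eps_def by (simp add: algebra_simps)
  qed
  show ?thesis using W unfolding P unfolding Psi_def .
qed

lemma Ft_0: "Ft 0 X k = (eps k - 1) * X k + cub mm X k"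
proof -
  have "twm 0 mm = mm" by (simp add: twm_def fun_eq_iff)
  then show ?thesis by (simp add: Ft_def)
qed

lemma wc_Fop:
  assumes "L2T u" "hb \<gamma> (fc u) P" "mass u0 = \<mu>^2" "P0 u0 = - \<i> * of_real p0"
  shows "wc (Fop u0 \<tau> u) (\<lambda>k. ph k * Ft 0 (fc u) k)"
proof -
  have e: "ph k * (eps k * fc u k + cub mm (fc u) k) - ph k * fc u k = ph k * Ft 0 (fc u) k" for k
    unfolding Ft_0 by (simp add: algebra_simps)
  show ?thesis
    using wc_diff[OF wc_Psi[OF assms] wc_schr[OF hb_wc[OF assms(1,2)], of \<tau>]] unfolding e Fop_def .
qed

lemma wc_step:
  assumes a: "L2T u" "hb \<gamma> (fc u) P" "mass u0 = \<mu>^2" "P0 u0 = - \<i> * of_real p0"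
  shows "wc (\<lambda>x. Psi u0 \<tau> u x + G1 u0 \<tau> u x + G2 u0 \<tau> u x) (\<lambda>k. ph k * (fc u k + Nt 0 (fc u) k))"
proof -
  let ?X = "fc u"
  note wS = wc_schr[OF hb_wc[OF a(1,2)], of \<tau>] and wF = wc_Fop[OF a]
  have R: "Re (Pi0 (\<lambda>x. Fop u0 \<tau> u x * cnj (schr \<tau> u x))) = Rt 0 ?X"
    unfolding Pi0_mult_cnj[OF wF wS] Rt_def by (subst ip_unimodular) auto
  have Q: "Re (Pi0 (abs2 (Fop u0 \<tau> u))) = Qt 0 ?X"
    unfolding mass_def[symmetric] wc_mass[OF wF] Qt_def by (subst ip_unimodular) auto
  have H: "Hop u0 \<tau> u = Ht 0 ?X"
    unfolding Hop_def R Q a(3) Ht_def by (simp only: mult_minus_left mult_1_left times_divide_eq_left minus_divide_left times_divide_eq_right)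
  note W = wc_add[OF wc_add[OF wc_Psi[OF a] wc_cmult[OF wS, of "of_real (Hop u0 \<tau> u)"]]
     wc_diff[OF wc_cmult[OF wS, of "- 1/2 * of_real ((Hop u0 \<tau> u)^2)"]
       wc_cmult[OF wS, of "of_real ((1 / mass u0) * Hop u0 \<tau> u * Re (Pi0 (\<lambda>y. Fop u0 \<tau> u y * cnj (schr \<tau> u y))))"]]]
  have e: "ph k * (eps k * ?X k + cub mm ?X k) + of_real (Hop u0 \<tau> u) * (ph k * ?X k)
     + (- 1/2 * of_real ((Hop u0 \<tau> u)^2) * (ph k * ?X k)
       - of_real ((1 / mass u0) * Hop u0 \<tau> u * Re (Pi0 (\<lambda>y. Fop u0 \<tau> u y * cnj (schr \<tau> u y)))) * (ph k * ?X k))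
     = ph k * (?X k + Nt 0 ?X k)" for k
    unfolding R H a(3) Nt_def Ft_0 At_def by (simp add: algebra_simps)
  show ?thesis using W unfolding e unfolding G1_def G2_def .
qed

text \<open>A qualitative bound with a constant that may grow at each step. It keeps every iterate
  in \<open>H^\<gamma>\<close>, where the coefficient formulas are valid; the uniform bound comes
  from \<open>error_yb\<close>.\<close>

lemma hb_step:
  assumes x: "hb \<gamma> X P"
  shows "\<exists>Q. hb \<gamma> (\<lambda>k. ph k * (X k + Nt 0 X k)) Q"
proof -
  have e: "cmod ((eps k - 1) * X k) \<le> (2 + 2 * \<tau> * \<mu>^2) * cmod (X k)" for k
  proof -
    have "cmod (eps k - 1) \<le> cmod (cis (- xk k)) + cmod (if k = 0 then \<i> * of_real (2 * \<tau> * \<mu>^2) else 0) + cmod 1"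
      unfolding eps_def by (intro order_trans[OF norm_triangle_ineq4] add_mono norm_triangle_ineq order_refl)
    also have "\<dots> \<le> 2 + 2 * \<tau> * \<mu>^2" using tau by (auto simp: norm_mult norm_power)
    finally show ?thesis by (simp add: norm_mult mult_right_mono)
  qed
  have 1: "hb \<gamma> (\<lambda>k. (eps k - 1) * X k) ((2 + 2 * \<tau> * \<mu>^2) * P)"
    using hb_dom[OF x e] tau by simp
  have 2: "hb \<gamma> (cub mm X) (9 * kap^3 * (6 * \<tau>) * P^3)"
    using cub_yb[OF mm_mb _ yb_one[OF x]] by (simp add: yb_def)
  have 3: "hb \<gamma> (Ft 0 X) ((2 + 2 * \<tau> * \<mu>^2) * P + 9 * kap^3 * (6 * \<tau>) * P^3)"
    using hb_add[OF 1 2] unfolding Ft_0[abs_def] .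
  have "hb \<gamma> (\<lambda>k. X k + Nt 0 X k) (P + ((2 + 2 * \<tau> * \<mu>^2) * P + 9 * kap^3 * (6 * \<tau>) * P^3 + cmod (of_real (At 0 X)) * P))"
    unfolding Nt_def by (intro hb_add x 3 hb_scale)
  then have "hb \<gamma> (\<lambda>k. ph k * (X k + Nt 0 X k)) (P + ((2 + 2 * \<tau> * \<mu>^2) * P + 9 * kap^3 * (6 * \<tau>) * P^3 + cmod (of_real (At 0 X)) * P))"
    by (rule hb_cong_norm) (simp add: norm_mult)
  then show ?thesis by blast
qed

text \<open>Conjugation with the free flow turns a step of the autonomous scheme into the increment
  at time \<open>t\<close>; inner products, and with them the coefficient \<open>At\<close>, are
  unchanged by the unimodular factors.\<close>

lemma Nt_twist: "cis (t * (real_of_int k)^2) * Nt 0 (\<lambda>j. cis (- (t * (real_of_int j)^2)) * V j) k = Nt t V k"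
proof -
  let ?X = "\<lambda>j. cis (- (t * (real_of_int j)^2)) * V j" and ?c = "\<lambda>k::int. cis (t * (real_of_int k)^2)"
  have X: "?c k * ?X k = V k" for k by (simp add: mult.assoc[symmetric] cis_mult)
  have F: "?c k * Ft 0 ?X k = Ft t V k" for k
  proof -
    have "?c k * Ft 0 ?X k = (eps k - 1) * (?c k * ?X k) + ?c k * cub mm ?X k"
      unfolding Ft_0 by (simp only: algebra_simps)
    also have "\<dots> = Ft t V k" unfolding X cub_twist Ft_def twm_def[abs_def] ..
    finally show ?thesis .
  qed
  have i: "ip (\<lambda>k. ?c k * a k) (\<lambda>k. ?c k * b k) = ip a b" for a b by (rule ip_unimodular) simp
  have R: "Rt 0 ?X = Rt t V" unfolding Rt_def i[of "Ft 0 ?X" ?X, symmetric] X F ..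
  have Q: "Qt 0 ?X = Qt t V" unfolding Qt_def i[of "Ft 0 ?X" "Ft 0 ?X", symmetric] F ..
  have A: "At 0 ?X = At t V" unfolding At_def Ht_def R Q ..
  have "?c k * Nt 0 ?X k = ?c k * Ft 0 ?X k + of_real (At 0 ?X) * (?c k * ?X k)"
    unfolding Nt_def by (simp only: algebra_simps)
  then show ?thesis unfolding A X F Nt_def .
qed

lemma scheme_wc:
  assumes u: "L2T u0" "hb \<gamma> (fc u0) P" "mass u0 = \<mu>^2" "P0 u0 = - \<i> * of_real p0"
  shows "L2T (scheme u0 \<tau> n) \<and> (\<exists>Q. hb \<gamma> (fc (scheme u0 \<tau> n)) Q)" 
    and "fc (scheme u0 \<tau> (Suc n)) = (\<lambda>k. ph k * (fc (scheme u0 \<tau> n) k + Nt 0 (fc (scheme u0 \<tau> n)) k))"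
proof -
  have S: "scheme u0 \<tau> (Suc n) = (\<lambda>x. Psi u0 \<tau> (scheme u0 \<tau> n) x + G1 u0 \<tau> (scheme u0 \<tau> n) x + G2 u0 \<tau> (scheme u0 \<tau> n) x)" for n
    by (simp add: scheme_def)
  have st: "L2T (scheme u0 \<tau> n) \<and> (\<exists>Q. hb \<gamma> (fc (scheme u0 \<tau> n)) Q) \<Longrightarrow>
      wc (scheme u0 \<tau> (Suc n)) (\<lambda>k. ph k * (fc (scheme u0 \<tau> n) k + Nt 0 (fc (scheme u0 \<tau> n)) k))" for n
    using wc_step[OF _ _ u(3,4), of "scheme u0 \<tau> n"] unfolding S by blast
  have I: "L2T (scheme u0 \<tau> n) \<and> (\<exists>Q. hb \<gamma> (fc (scheme u0 \<tau> n)) Q)" for n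
  proof (induction n)
    case 0 show ?case using u(1,2) by (auto simp: scheme_def)
  next
    case (Suc n)
    from Suc obtain Q where Q: "hb \<gamma> (fc (scheme u0 \<tau> n)) Q" by blast
    show ?case using wcD[OF st[OF Suc]] hb_step[OF Q] by auto
  qed
  show "L2T (scheme u0 \<tau> n) \<and> (\<exists>Q. hb \<gamma> (fc (scheme u0 \<tau> n)) Q)" by (rule I)
  show "fc (scheme u0 \<tau> (Suc n)) = (\<lambda>k. ph k * (fc (scheme u0 \<tau> n) k + Nt 0 (fc (scheme u0 \<tau> n)) k))"
    by (rule wcD(1)[OF st[OF I]])
qed

end

text \<open>The exported constants depend on \<open>\<gamma>\<close>, \<open>\<theta>\<close>,
  \<open>T\<close> and \<open>Bh\<close>; data, step size and mass enter through the interpretation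
  of \<open>sol\<close>. \<open>Bh\<close> converts the bound on \<open>Hnorm\<close> to
  coefficients and is kept at least \<open>1\<close>, as the locale demands.\<close>

lemma main_estimate:
  fixes \<gamma> \<theta> T B :: real
  defines "Bh \<equiv> max 1 (B / sqrt (2 * pi))"
  assumes adm: "adm \<gamma> \<theta>" and T: "T > 0"
    and u0: "Hs \<gamma> u0" "fc u0 k0 \<noteq> 0" and sol: "nls_sol \<gamma> T u0 u" and B: "\<forall>t\<in>{0..T}. Hnorm \<gamma> (u t) \<le> B"
    and tau: "0 < \<tau>" "\<tau> \<le> 1" and small: "sol.Ke \<gamma> \<theta> T Bh * \<tau> powr \<theta> \<le> 1" and n: "real n * \<tau> \<le> T"
  shows "Hnorm \<gamma> (\<lambda>x. u (real n * \<tau>) x - scheme u0 \<tau> n x) \<le> sqrt (2 * pi) * (sol.Ke \<gamma> \<theta> T Bh * \<tau> powr \<theta>)"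
    and "\<gamma> > 3/2 \<Longrightarrow> \<bar>mass (scheme u0 \<tau> n) - mass u0\<bar> \<le> sol.KM \<gamma> \<theta> T Bh * \<tau>^5"
proof -
  interpret adm \<gamma> \<theta> by (rule adm)
  have us: "Hs \<gamma> (u t)" if "0 \<le> t" "t \<le> T" for t using sol that by (simp add: nls_sol_def)
  have uhb: "hb \<gamma> (fc (u t)) Bh" if "0 \<le> t" "t \<le> T" for t
  proof (rule hb_mono[OF Hnorm_hb[OF us[OF that]]])
    show "Hnorm \<gamma> (u t) / sqrt (2 * pi) \<le> Bh"
      using B that unfolding Bh_def by (intro max.coboundedI2 divide_right_mono) auto
  qed
  have uL: "L2T (u t)" if "0 \<le> t" "t \<le> T" for t using us[OF that] by (simp add: Hs_def)
  have fu0: "fc (u 0) = fc u0" using sol by (auto simp: nls_sol_def)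
  have u0L: "L2T u0" using u0(1) by (simp add: Hs_def)
  have u0h: "hb \<gamma> (fc u0) Bh" using uhb[of 0] T fu0 by simp
  have w0: "wc u0 (fc u0)" by (rule hb_wc[OF u0L u0h])
  have m: "((\<lambda>k. (cmod (fc u0 k))^2) has_sum mass u0) UNIV" by (rule wien_parseval[OF wcD(2)[OF w0]])
  \<comment> \<open>One nonzero coefficient makes the mass positive, which the division by
    \<open>\<mu>\<^sup>2\<close> requires; the size of the mass enters none of the
    constants.\<close>
  have mpos: "mass u0 > 0"
  proof -
    have "(\<Sum>k\<in>{k0}. (cmod (fc u0 k))^2) \<le> mass u0"
      using finite_sum_le_infsum[OF has_sum_imp_summable[OF m], of "{k0}"] infsumI[OF m] by simp
    moreover have "0 < (cmod (fc u0 k0))^2" using u0(2) by simp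
    ultimately show ?thesis by (metis finite.emptyI insert_absorb empty_iff less_le_trans sum.insert sum.empty add_0_right)
  qed
  define \<mu> where "\<mu> = sqrt (mass u0)"
  have mup: "\<mu> > 0" "mass u0 = \<mu>^2" using mpos by (auto simp: \<mu>_def)
  define p0 where "p0 = (\<Sum>\<^sub>\<infinity>k. of_int k * (cmod (fc u0 k))^2)"
  interpret sch \<gamma> \<theta> \<tau> \<mu> p0 by unfold_locales (use tau mup in auto)
  have P0: "P0 u0 = - \<i> * of_real p0" unfolding p0_def by (rule P0_eq[OF u0L u0h])
  define v where "v t k = cis (t * (real_of_int k)^2) * fc (u t) k" for t k
  have uv: "fc (u t) = (\<lambda>j. cis (- (t * (real_of_int j)^2)) * v t j)" for t
    by (simp add: v_def mult.assoc[symmetric] cis_mult fun_eq_iff)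
  have v0: "v 0 = fc u0" by (simp add: v_def fun_eq_iff fu0)
  interpret s: sol \<gamma> \<theta> \<tau> \<mu> p0 T Bh v
  proof
    show "0 < T" by (rule T)
    show "1 \<le> Bh" by (simp add: Bh_def)
    show "hb \<gamma> (v t) Bh" if "0 \<le> t" "t \<le> T" for t
      by (rule hb_cong_norm[OF uhb[OF that]]) (simp add: v_def norm_mult)
    show "(\<Sum>\<^sub>\<infinity>k. (cmod (v 0 k))^2) = \<mu>^2" unfolding v0 by (rule trans[OF infsumI[OF m] mup(2)])
    show "(\<Sum>\<^sub>\<infinity>k. of_int k * (cmod (v 0 k))^2) = p0" unfolding v0 p0_def ..
    fix k t assume t: "0 \<le> t" "t \<le> T"
    obtain D where D: "((\<lambda>s. fc (u s) k) has_vector_derivative D) (at t within {0..T})"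
        "\<i> * D - (of_int k)^2 * fc (u t) k - fc (\<lambda>x. abs2 (u t) x * u t x) k = 0"
      using sol t unfolding nls_sol_def by (meson atLeastAtMost_iff)
    have N: "fc (\<lambda>x. abs2 (u t) x * u t x) k = cub (\<lambda>_ _ _. 1) (fc (u t)) k"
      using wcD(1)[OF fc_cubic[OF uL[OF t] uhb[OF t]]] by simp
    have "D = - \<i> * (\<i> * D)" by (simp add: mult.assoc[symmetric])
    also have "\<i> * D = (of_int k)^2 * fc (u t) k + cub (\<lambda>_ _ _. 1) (fc (u t)) k" using D(2) unfolding N by (simp add: algebra_simps)
    finally have D': "D = - \<i> * ((of_int k)^2 * fc (u t) k + cub (\<lambda>_ _ _. 1) (fc (u t)) k)" .
    have "((\<lambda>s. cis ((real_of_int k)^2 * s) * fc (u s) k) has_vector_derivative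
        (cis ((real_of_int k)^2 * t) * D + \<i> * of_real ((real_of_int k)^2) * cis ((real_of_int k)^2 * t) * fc (u t) k)) (at t within {0..T})"
      by (rule has_vector_derivative_mult[OF has_vector_derivative_cis D(1)])
    moreover have "cis ((real_of_int k)^2 * t) * D + \<i> * of_real ((real_of_int k)^2) * cis ((real_of_int k)^2 * t) * fc (u t) k
       = - \<i> * (cis (t * (real_of_int k)^2) * cub (\<lambda>_ _ _. 1) (fc (u t)) k)"
      unfolding D' by (simp add: algebra_simps)
    moreover have "cis (t * (real_of_int k)^2) * cub (\<lambda>_ _ _. 1) (fc (u t)) k = cub (twm t (\<lambda>_ _ _. 1)) (v t) k"
      by (subst uv, subst cub_twist) (simp add: twm_def[abs_def])
    ultimately show "((\<lambda>s. v s k) has_vector_derivative - \<i> * cub (twm t (\<lambda>_ _ _. 1)) (v t) k) (at t within {0..T})"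
      unfolding v_def by (simp add: mult.commute)
  qed
  define V where "V m k = cis (real m * \<tau> * (real_of_int k)^2) * fc (scheme u0 \<tau> m) k" for m k
  have sc: "L2T (scheme u0 \<tau> m) \<and> (\<exists>Q. hb \<gamma> (fc (scheme u0 \<tau> m)) Q)" for m by (rule scheme_wc(1)[OF u0L u0h mup(2) P0])
  have V0: "V 0 = v 0" unfolding v0 by (simp add: V_def scheme_def fun_eq_iff)
  have UV: "fc (scheme u0 \<tau> m) = (\<lambda>j. cis (- (real m * \<tau> * (real_of_int j)^2)) * V m j)" for m
    by (simp add: V_def mult.assoc[symmetric] cis_mult fun_eq_iff)
  have VS: "V (Suc m) k = V m k + Nt (real m * \<tau>) (V m) k" for m k
  proof -
    let ?U = "fc (scheme u0 \<tau> m)"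
    have c: "cis (real (Suc m) * \<tau> * (real_of_int k)^2) * ph k = cis (real m * \<tau> * (real_of_int k)^2)"
      by (simp add: cis_mult algebra_simps)
    have "V (Suc m) k = (cis (real (Suc m) * \<tau> * (real_of_int k)^2) * ph k) * (?U k + Nt 0 ?U k)"
      unfolding V_def scheme_wc(2)[OF u0L u0h mup(2) P0] by (simp only: mult.assoc)
    also have "\<dots> = V m k + cis (real m * \<tau> * (real_of_int k)^2) * Nt 0 ?U k"
      unfolding c V_def by (simp only: distrib_left)
    also have "cis (real m * \<tau> * (real_of_int k)^2) * Nt 0 ?U k = Nt (real m * \<tau>) (V m) k"
      unfolding UV by (rule Nt_twist)
    finally show ?thesis .
  qed
  let ?t = "real n * \<tau>"
  have t: "0 \<le> ?t" "?t \<le> T" using tau n by auto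
  have "yb \<mu> (\<lambda>k. v ?t k - V n k) (s.Ke * \<tau> powr \<theta>)" by (rule s.error_yb(1)[OF V0 VS small n])
  then have "hb \<gamma> (\<lambda>k. v ?t k - V n k) (s.Ke * \<tau> powr \<theta>)" by (simp add: yb_def)
  then have "hb \<gamma> (fc (\<lambda>x. u ?t x - scheme u0 \<tau> n x)) (s.Ke * \<tau> powr \<theta>)"
  proof (rule hb_cong_norm)
    fix k
    have "fc (\<lambda>x. u ?t x - scheme u0 \<tau> n x) k = fc (u ?t) k - fc (scheme u0 \<tau> n) k"
      using uL[OF t] sc[of n] L2T_integrable(1) by (intro fc_diff) auto
    also have "\<dots> = cis (- (?t * (real_of_int k)^2)) * (v ?t k - V n k)"
      unfolding uv UV by (simp only: right_diff_distrib)
    finally show "cmod (fc (\<lambda>x. u ?t x - scheme u0 \<tau> n x) k) = cmod (v ?t k - V n k)" by (simp add: norm_mult)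
  qed
  then show "Hnorm \<gamma> (\<lambda>x. u ?t x - scheme u0 \<tau> n x) \<le> sqrt (2 * pi) * (s.Ke * \<tau> powr \<theta>)" by (rule hb_Hnorm_le)
  assume g: "\<gamma> > 3/2"
  have "\<bar>Re (ip (V n) (V n)) - \<mu>^2\<bar> \<le> s.KM * \<tau>^5" by (rule s.mass_error[OF g V0 VS small n])
  moreover have "mass (scheme u0 \<tau> n) = Re (ip (V n) (V n))"
  proof -
    obtain Q where "hb \<gamma> (fc (scheme u0 \<tau> n)) Q" using sc by blast
    then have "mass (scheme u0 \<tau> n) = Re (ip (fc (scheme u0 \<tau> n)) (fc (scheme u0 \<tau> n)))"
      using sc by (intro wc_mass hb_wc) auto
    then show ?thesis unfolding UV by (subst (asm) ip_unimodular) auto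
  qed
  ultimately show "\<bar>mass (scheme u0 \<tau> n) - mass u0\<bar> \<le> s.KM * \<tau>^5" using mup(2) by simp
qed

theorem theorem1p3:
  shows "(\<forall>\<gamma> T B. \<gamma> > 3/2 \<longrightarrow> T > 0 \<longrightarrow>
      (\<exists>\<tau>0>0. \<exists>C>0. \<forall>u0 u.
         Hs \<gamma> u0 \<and> (\<exists>k. fc u0 k \<noteq> 0) \<and> nls_sol \<gamma> T u0 u
         \<and> (\<forall>t\<in>{0..T}. Hnorm \<gamma> (u t) \<le> B) \<longrightarrow>
         (\<forall>\<tau> n. 0 < \<tau> \<and> \<tau> \<le> \<tau>0 \<and> real n * \<tau> \<le> T \<longrightarrow>
            Hnorm \<gamma> (\<lambda>x. u (real n * \<tau>) x - scheme u0 \<tau> n x) \<le> C * \<tau>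
          \<and> \<bar>mass (scheme u0 \<tau> n) - mass u0\<bar> \<le> C * \<tau> ^ 5)))
   \<and> (\<forall>\<epsilon> T B. \<epsilon> > 0 \<longrightarrow> T > 0 \<longrightarrow>
      (\<exists>\<tau>0>0. \<exists>C>0. \<forall>u0 u.
         Hs 1 u0 \<and> (\<exists>k. fc u0 k \<noteq> 0) \<and> nls_sol 1 T u0 u
         \<and> (\<forall>t\<in>{0..T}. Hnorm 1 (u t) \<le> B) \<longrightarrow>
         (\<forall>\<tau> n. 0 < \<tau> \<and> \<tau> \<le> \<tau>0 \<and> real n * \<tau> \<le> T \<longrightarrow>
            Hnorm 1 (\<lambda>x. u (real n * \<tau>) x - scheme u0 \<tau> n x) \<le> C * \<tau> powr (1/2 - \<epsilon>))))"
proof (intro conjI allI impI)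
  have small: "\<exists>\<tau>0>0. \<forall>\<tau>. 0 < \<tau> \<longrightarrow> \<tau> \<le> \<tau>0 \<longrightarrow> \<tau> \<le> 1 \<and> K * \<tau> powr \<theta> \<le> 1" if "\<theta> > 0" for K \<theta> :: real
  proof (intro exI conjI allI impI)
    \<comment> \<open>Nothing is known here about the sign of \<open>K\<close>, hence
      \<open>|K| + 1\<close>, which is also never zero.\<close>
    let ?t = "min 1 ((1 / (\<bar>K\<bar> + 1)) powr (1 / \<theta>))"
    have K: "0 < 1 / (\<bar>K\<bar> + 1)" by (rule divide_pos_pos) auto
    show "0 < ?t" using K by (simp add: less_imp_neq[symmetric])
    fix \<tau> :: real assume \<tau>: "0 < \<tau>" "\<tau> \<le> ?t"
    then show "\<tau> \<le> 1" by simp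
    have "\<tau> powr \<theta> \<le> ((1 / (\<bar>K\<bar> + 1)) powr (1 / \<theta>)) powr \<theta>" using \<tau> that by (intro powr_mono2) auto
    also have "\<dots> = 1 / (\<bar>K\<bar> + 1)" using that K by (simp add: powr_powr)
    finally have "(\<bar>K\<bar> + 1) * \<tau> powr \<theta> \<le> 1" by (simp add: pos_le_divide_eq mult.commute)
    moreover have "K * \<tau> powr \<theta> \<le> (\<bar>K\<bar> + 1) * \<tau> powr \<theta>" by (intro mult_right_mono) auto
    ultimately show "K * \<tau> powr \<theta> \<le> 1" by linarith
  qed
  fix T B :: real
  let ?Bh = "max 1 (B / sqrt (2 * pi))"
  {
    fix \<gamma> :: real assume g: "\<gamma> > 3/2" and T: "T > 0"
    have adm: "adm \<gamma> 1" using g by unfold_locales auto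
    let ?K = "sol.Ke \<gamma> 1 T ?Bh" and ?M = "sol.KM \<gamma> 1 T ?Bh"
    obtain \<tau>0 where \<tau>0: "\<tau>0 > 0" "\<And>\<tau>. 0 < \<tau> \<Longrightarrow> \<tau> \<le> \<tau>0 \<Longrightarrow> \<tau> \<le> 1 \<and> ?K * \<tau> powr 1 \<le> 1"
      using small[of 1 ?K] by auto
    define C where "C = sqrt (2 * pi) * \<bar>?K\<bar> + \<bar>?M\<bar> + 1"
    have C: "sqrt (2 * pi) * ?K \<le> C" "?M \<le> C" "C > 0"
    proof -
      have s: "0 \<le> sqrt (2 * pi)" by simp
      have "sqrt (2 * pi) * ?K \<le> sqrt (2 * pi) * \<bar>?K\<bar>" using s by (intro mult_left_mono) auto
      moreover have "0 \<le> sqrt (2 * pi) * \<bar>?K\<bar>" using s by simp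
      ultimately show "sqrt (2 * pi) * ?K \<le> C" "?M \<le> C" "C > 0" unfolding C_def by linarith+
    qed
    have main: "Hnorm \<gamma> (\<lambda>x. u (real n * \<tau>) x - scheme u0 \<tau> n x) \<le> C * \<tau>" "\<bar>mass (scheme u0 \<tau> n) - mass u0\<bar> \<le> C * \<tau>^5"
      if a: "Hs \<gamma> u0" "fc u0 k \<noteq> 0" "nls_sol \<gamma> T u0 u" "\<forall>t\<in>{0..T}. Hnorm \<gamma> (u t) \<le> B"
        "0 < \<tau>" "\<tau> \<le> \<tau>0" "real n * \<tau> \<le> T" for u0 u k \<tau> n
    proof -
      note e = main_estimate[OF adm T a(1-5) _ _ a(7)]
      have t: "\<tau> \<le> 1" "?K * \<tau> powr 1 \<le> 1" using \<tau>0(2)[OF a(5,6)] by auto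
      have "Hnorm \<gamma> (\<lambda>x. u (real n * \<tau>) x - scheme u0 \<tau> n x) \<le> sqrt (2 * pi) * (?K * \<tau> powr 1)" by (rule e(1)[OF t])
      also have "\<dots> = (sqrt (2 * pi) * ?K) * \<tau>" using a(5) by simp
      also have "\<dots> \<le> C * \<tau>" using C a(5) by (intro mult_right_mono) auto
      finally show "Hnorm \<gamma> (\<lambda>x. u (real n * \<tau>) x - scheme u0 \<tau> n x) \<le> C * \<tau>" .
      have "\<bar>mass (scheme u0 \<tau> n) - mass u0\<bar> \<le> ?M * \<tau>^5" by (rule e(2)[OF t g])
      also have "\<dots> \<le> C * \<tau>^5" using C a(5) by (intro mult_right_mono) auto
      finally show "\<bar>mass (scheme u0 \<tau> n) - mass u0\<bar> \<le> C * \<tau>^5" .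
    qed
    show "\<exists>\<tau>0>0. \<exists>C>0. \<forall>u0 u.
         Hs \<gamma> u0 \<and> (\<exists>k. fc u0 k \<noteq> 0) \<and> nls_sol \<gamma> T u0 u
         \<and> (\<forall>t\<in>{0..T}. Hnorm \<gamma> (u t) \<le> B) \<longrightarrow>
         (\<forall>\<tau> n. 0 < \<tau> \<and> \<tau> \<le> \<tau>0 \<and> real n * \<tau> \<le> T \<longrightarrow>
            Hnorm \<gamma> (\<lambda>x. u (real n * \<tau>) x - scheme u0 \<tau> n x) \<le> C * \<tau>
          \<and> \<bar>mass (scheme u0 \<tau> n) - mass u0\<bar> \<le> C * \<tau> ^ 5)"
      using \<tau>0(1) C(3) main by blast
  next
    fix \<epsilon> :: real assume e: "\<epsilon> > 0" and T: "T > 0"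
    \<comment> \<open>\<open>adm\<close> requires \<open>0 < \<theta>\<close> and
      \<open>\<theta> < 1/2\<close>; the maximum with \<open>1/4\<close> covers large \<epsilon>,
      and since \<open>\<tau> \<le> 1\<close> a larger exponent is a stronger bound.\<close>
    define \<theta> where "\<theta> = max (1/2 - \<epsilon>) (1/4)"
    have th: "0 < \<theta>" "\<theta> < 1/2" "1/2 - \<epsilon> \<le> \<theta>" using e by (auto simp: \<theta>_def max_def)
    have adm: "adm 1 \<theta>" using th by unfold_locales auto
    let ?K = "sol.Ke 1 \<theta> T ?Bh"
    obtain \<tau>0 where \<tau>0: "\<tau>0 > 0" "\<And>\<tau>. 0 < \<tau> \<Longrightarrow> \<tau> \<le> \<tau>0 \<Longrightarrow> \<tau> \<le> 1 \<and> ?K * \<tau> powr \<theta> \<le> 1"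
      using small[OF th(1), of ?K] by auto
    define C where "C = sqrt (2 * pi) * \<bar>?K\<bar> + 1"
    have C: "sqrt (2 * pi) * ?K \<le> C" "C > 0"
    proof -
      have s: "0 \<le> sqrt (2 * pi)" by simp
      have "sqrt (2 * pi) * ?K \<le> sqrt (2 * pi) * \<bar>?K\<bar>" using s by (intro mult_left_mono) auto
      moreover have "0 \<le> sqrt (2 * pi) * \<bar>?K\<bar>" using s by simp
      ultimately show "sqrt (2 * pi) * ?K \<le> C" "C > 0" unfolding C_def by linarith+
    qed
    have main: "Hnorm 1 (\<lambda>x. u (real n * \<tau>) x - scheme u0 \<tau> n x) \<le> C * \<tau> powr (1/2 - \<epsilon>)"
      if a: "Hs 1 u0" "fc u0 k \<noteq> 0" "nls_sol 1 T u0 u" "\<forall>t\<in>{0..T}. Hnorm 1 (u t) \<le> B"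
        "0 < \<tau>" "\<tau> \<le> \<tau>0" "real n * \<tau> \<le> T" for u0 u k \<tau> n
    proof -
      have t: "\<tau> \<le> 1" "?K * \<tau> powr \<theta> \<le> 1" using \<tau>0(2)[OF a(5,6)] by auto
      have "Hnorm 1 (\<lambda>x. u (real n * \<tau>) x - scheme u0 \<tau> n x) \<le> sqrt (2 * pi) * (?K * \<tau> powr \<theta>)"
        by (rule main_estimate(1)[OF adm T a(1-5) t a(7)])
      also have "\<dots> = (sqrt (2 * pi) * ?K) * \<tau> powr \<theta>" by simp
      also have "\<dots> \<le> C * \<tau> powr \<theta>" using C by (intro mult_right_mono) auto
      also have "\<dots> \<le> C * \<tau> powr (1/2 - \<epsilon>)" using C t th a(5) by (intro mult_left_mono powr_mono') auto
      finally show ?thesis .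
    qed
    show "\<exists>\<tau>0>0. \<exists>C>0. \<forall>u0 u.
         Hs 1 u0 \<and> (\<exists>k. fc u0 k \<noteq> 0) \<and> nls_sol 1 T u0 u
         \<and> (\<forall>t\<in>{0..T}. Hnorm 1 (u t) \<le> B) \<longrightarrow>
         (\<forall>\<tau> n. 0 < \<tau> \<and> \<tau> \<le> \<tau>0 \<and> real n * \<tau> \<le> T \<longrightarrow>
            Hnorm 1 (\<lambda>x. u (real n * \<tau>) x - scheme u0 \<tau> n x) \<le> C * \<tau> powr (1/2 - \<epsilon>))"
      using \<tau>0(1) C(2) main by blast
  }
qed

end
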